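(* Let $\mathrm X$ be a locally compact Hausdorff space, $\kappa$ a consistent (in particular positive definite) kernel on $\mathrm X$, $\mathbf A=(A_i)_{i\in I}$ an $(I^+,I^-)$-condenser in $\mathrm X$, $\mathbf g=(g_i)_{i\in I}$ a family of continuous functions $g_i:\mathrm X\to(0,\infty)$, and $\mathbf a=(a_i)_{i\in I}$ with all $a_i>0$. Assume $\mathrm{cap}(\mathbf A,\mathbf a,\mathbf g)>0$ and that either $I^-=\varnothing$, or both $\sum_{i\in I}a_i\,g_{i,\inf}^{-1}<\infty$ and $\sup_{x\in A^+,\,y\in A^-}\kappa(x,y)<\infty$. Assume further that for every $i\in I$: (1) either $g_{i,\sup}<\infty$, or there exist $r_i\in(1,\infty)$ and $\omega_i\in\mathcal E$ with $g_i^{r_i}(x)\leqslant\kappa(x,\omega_i)$ nearly everywhere in $A_i$; and (2) $A_i$ either is compact or satisfies $C(A_i)<\infty$. Let $\{\mathbf K\}_{\mathbf A}$ be the family, directed upwards by $\prec$, of all compact $(I^+,I^-)$-condensers $\mathbf K\prec\mathbf A$ with $\mathrm{cap}(\mathbf K,\mathbf a,\mathbf g)>0$, and for every $\mathbf K\in\{\mathbf K\}_{\mathbf A}$ choose an arbitrary $\lambda_{\mathbf K}\in\mathfrak S(\mathbf K,\mathbf a,\mathbf g)$ (which exists). Then the net $(\lambda_{\mathbf K})_{\mathbf K\in\{\mathbf K\}_{\mathbf A}}$ has an $\mathbf A$-vague cluster point, and every $\mathbf A$-vague cluster point of it belongs to $\mathfrak S(\mathbf A,\mathbf a,\mathbf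 g)$. Furthermore, for every $\lambda_{\mathbf A}\in\mathfrak S(\mathbf A,\mathbf a,\mathbf g)$, $$\lim_{\mathbf K\uparrow\mathbf A}\|\lambda_{\mathbf K}-\lambda_{\mathbf A}\|^2=0.$$
   Context: $\mathfrak M$ is the linear space of all real-valued (signed) Radon measures on the locally compact Hausdorff space $\mathrm X$, with the vague topology (pointwise convergence on the space $\mathrm C_0(\mathrm X)$ of continuous real functions with compact support). For closed $E\subset\mathrm X$, $\mathfrak M^+(E)$ is the set of nonnegative $\nu\in\mathfrak M$ supported by $E$; $\mathfrak M^+:=\mathfrak M^+(\mathrm X)$. $\Phi(\mathrm Y)$ is the set of lower semicontinuous $\psi:\mathrm Y\to(-\infty,\infty]$ with $\psi\geqslant0$ unless $\mathrm Y$ is compact. A kernel is an element $\kappa\in\Phi(\mathrm X\times\mathrm X)$; the mutual energy is $\kappa(\nu,\nu_1)=\int\kappa\,d(\nu\otimes\nu_1)$, the energy of $\nu$ is $\kappa(\nu,\nu)$, and the potential is $\kappa(x,\nu)=\int\kappa(x,y)\,d\nu(y)$, whenever well defined (integral against a signed measure: difference of the integrals against the positive and negative parts, not both infinite). $\kappa$ is positive definite if it is symmetric and $\kappa(\nu,\nu)\geqslant0$ whenever defined. $\mathcal E$ is the set of $\nu\in\mathfrak M$ of finite energy, a pre-Hilbert space with seminorm $\|\nu\|=\sqrt{\kappa(\nu,\nu)}$ (strong topology); $\mathcal E^+:=\mathcal E\cap\mathfrak M^+$. A positive definite kernel is consistent if every strong Cauchy net in $\mathcal E^+$ converges strongly to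 each of its vague cluster points; equivalently, every strongly bounded, vaguely convergent net $(\nu_s)$ in $\mathcal E^+$ with vague limit $\nu$ satisfies $\kappa(\nu_s,\mu)\to\kappa(\nu,\mu)$ for all $\mu\in\mathcal E$. Interior capacity of a set $E\subset \mathrm X$: $C(E)=1/\inf\kappa(\nu,\nu)$, the infimum over $\nu\in\mathcal E^+$ with compact support contained in $E$ and $\nu(\mathrm X)=1$ (with $1/0=+\infty$, $1/(+\infty)=0$, $\inf\varnothing=+\infty$). A property holds nearly everywhere in $E$ if the set of $x\in E$ where it fails has interior capacity zero. Condensers: $I^+\neq\varnothing$ and $I^-$ (possibly empty) are disjoint countable (finite or infinite) subsets of $\mathbb N$, $I=I^+\cup I^-$. An $(I^+,I^-)$-condenser is a family $\mathbf A=(A_i)_{i\in I}$ of nonempty closed subsets of $\mathrm X$ such that every compact set meets at most finitely many $A_i$ and $A_i\cap A_j=\varnothing$ for $i\in I^+$, $j\in I^-$. It is compact if all $A_i$ are compact. $\mathbf A'\prec\mathbf A$ means $A_i'\subset A_i$ for all $i\in I$. $A^\pm:=\bigcup_{i\in I^\pm}A_i$; $\alpha_i=\pm1$ for $i\in I^\pm$. $\mathfrak M(\mathbf A)$ is the set of formal combinations $\mu=\sum_{i\in I}\alpha_i\mu^i$ with $\mu^i\in\mathfrak M^+(A_i)$, identified with $\prod_{i\in I}\mathfrak M^+(A_i)$; the $\mathbf A$-vague topology is the product of the vague topologies. If $\mathbf K\prec\mathbf A$, then $\mathfrak M(\mathbf K)\subset\mathfrak M(\mathbf A)$. $R\mu\in\mathfrak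 M$ is the Radon measure with $R\mu(\varphi)=\sum_i\alpha_i\mu^i(\varphi)$, $\varphi\in\mathrm C_0(\mathrm X)$. The energy of $\mu$ is $\kappa(\mu,\mu):=\kappa(R\mu,R\mu)$; $\mathcal E(\mathbf A)$ is the set of $\mu\in\mathfrak M(\mathbf A)$ of finite energy, $\|\mu\|:=\|R\mu\|$ and $\|\mu_1-\mu_2\|:=\|R\mu_1-R\mu_2\|$ for $\mu_1,\mu_2\in\mathcal E(\mathbf A)$. Let $g_{i,\inf}$, $g_{i,\sup}$ be the infimum and supremum of $g_i$ over $A_i$ (with $1/0=+\infty$). $\mathcal E(\mathbf A,\mathbf a,\mathbf g)$ is the set of $\mu\in\mathcal E(\mathbf A)$ with $\int g_i\,d\mu^i=a_i$ for all $i\in I$; $\|\mathcal E(\mathbf A,\mathbf a,\mathbf g)\|^2:=\inf\{\|\mu\|^2:\mu\in\mathcal E(\mathbf A,\mathbf a,\mathbf g)\}$ ($+\infty$ if the set is empty), and $\mathrm{cap}(\mathbf A,\mathbf a,\mathbf g):=1/\|\mathcal E(\mathbf A,\mathbf a,\mathbf g)\|^2$. $\mathfrak S(\mathbf A,\mathbf a,\mathbf g)$ is the set of $\lambda\in\mathcal E(\mathbf A,\mathbf a,\mathbf g)$ with $\|\lambda\|^2=\|\mathcal E(\mathbf A,\mathbf a,\mathbf g)\|^2$; likewise for $\mathbf K$ in place of $\mathbf A$. *)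

theory Defs
  imports "HOL-Analysis.Analysis"
begin

section \<open>Radon measures on a locally compact Hausdorff space\<close>

text \<open>
  A (signed) Radon measure is a linear functional on the continuous functions with compact
  support that is continuous for the inductive limit topology (Bourbaki).  Such a measure is in
  general not a set function, since its positive and negative parts may both have infinite mass.
  Functionals are kept \<^const>\<open>extensional\<close>, so that equality of measures is
  equality of terms and the vague topology is a subspace of a product topology.
\<close>

definition cc_functions :: "('b::topological_space \<Rightarrow> real) set" where
  "cc_functions = {\<phi>. continuous_on UNIV \<phi> \<and> compact (closure {x. \<phi> x \<noteq> 0})}"

type_synonym 'b functional = "('b \<Rightarrow> real) \<Rightarrow> real"

definition radon_measures :: "'b::topological_space functional set" where
  "radon_measures = {\<nu>. \<nu> \<in> extensional cc_functions
     \<and> (\<forall>\<phi>\<in>cc_functions. \<forall>\<psi>\<in>cc_functions. \<forall>s t.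
           \<nu> (\<lambda>x. s * \<phi> x + t * \<psi> x) = s * \<nu> \<phi> + t * \<nu> \<psi>)
     \<and> (\<forall>K. compact K \<longrightarrow> (\<exists>M. \<forall>\<phi>\<in>cc_functions. \<forall>B.
           closure {x. \<phi> x \<noteq> 0} \<subseteq> K \<and> (\<forall>x. \<bar>\<phi> x\<bar> \<le> B) \<longrightarrow> \<bar>\<nu> \<phi>\<bar> \<le> M * B))}"

definition vague_topology :: "'b::topological_space functional topology" where
  "vague_topology =
     subtopology (product_topology (\<lambda>_. euclideanreal) cc_functions) radon_measures"

definition radon_diff ::
    "'b::topological_space functional \<Rightarrow> 'b functional \<Rightarrow> 'b functional" where
  "radon_diff \<nu> \<mu> = (\<lambda>\<phi>\<in>cc_functions. \<nu> \<phi> - \<mu> \<phi>)"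

definition positive_measures :: "'b::topological_space functional set" where
  "positive_measures =
     {\<nu> \<in> radon_measures. \<forall>\<phi>\<in>cc_functions. (\<forall>x. 0 \<le> \<phi> x) \<longrightarrow> 0 \<le> \<nu> \<phi>}"

definition measure_support :: "'b::topological_space functional \<Rightarrow> 'b set" where
  "measure_support \<nu> =
     - \<Union>{U. open U \<and> (\<forall>\<phi>\<in>cc_functions. closure {x. \<phi> x \<noteq> 0} \<subseteq> U \<longrightarrow> \<nu> \<phi> = 0)}"

definition positive_measures_on :: "'b::topological_space set \<Rightarrow> 'b functional set" where
  "positive_measures_on E = {\<nu> \<in> positive_measures. measure_support \<nu> \<subseteq> E}"

text \<open>
  Jordan decomposition: for \<open>\<phi> \<ge> 0\<close>, the positive part of \<open>\<nu>\<close> takes at \<open>\<phi>\<close> the value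
  \<open>sup {\<nu> \<psi> | 0 \<le> \<psi> \<le> \<phi>}\<close>; it is extended linearly via \<open>\<phi> = max \<phi> 0 - max (- \<phi>) 0\<close>.
\<close>

definition positive_part :: "'b::topological_space functional \<Rightarrow> 'b functional" where
  "positive_part \<nu> = (\<lambda>\<phi>\<in>cc_functions.
       (SUP \<psi>\<in>{\<psi>\<in>cc_functions. \<forall>x. 0 \<le> \<psi> x \<and> \<psi> x \<le> max (\<phi> x) 0}. \<nu> \<psi>)
     - (SUP \<psi>\<in>{\<psi>\<in>cc_functions. \<forall>x. 0 \<le> \<psi> x \<and> \<psi> x \<le> max (- \<phi> x) 0}. \<nu> \<psi>))"

definition negative_part :: "'b::topological_space functional \<Rightarrow> 'b functional" where
  "negative_part \<nu> = radon_diff (positive_part \<nu>) \<nu>"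


section \<open>Integration of lower semicontinuous functions\<close>

text \<open>The class \<open>\<Phi>(Y)\<close>, where \<open>Y\<close> is the whole type.\<close>

definition lsc_class :: "('b::topological_space \<Rightarrow> ereal) set" where
  "lsc_class = {\<psi>. (\<forall>t. open {y. t < \<psi> y}) \<and> (\<forall>y. \<psi> y \<noteq> - \<infinity>)
     \<and> (compact (UNIV :: 'b set) \<or> (\<forall>y. 0 \<le> \<psi> y))}"

text \<open>
  For positive \<open>\<nu>\<close> and \<open>\<psi>\<close> in \<^const>\<open>lsc_class\<close>, the integral is
  Bourbaki's upper integral.
\<close>

definition positive_integral ::
    "'b::topological_space functional \<Rightarrow> ('b \<Rightarrow> ereal) \<Rightarrow> ereal" where
  "positive_integral \<nu> \<psi> =
     (SUP \<phi>\<in>{\<phi>\<in>cc_functions. \<forall>x. ereal (\<phi> x) \<le> \<psi> x}. ereal (\<nu> \<phi>))"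

definition integral_defined ::
    "'b::topological_space functional \<Rightarrow> ('b \<Rightarrow> ereal) \<Rightarrow> bool" where
  "integral_defined \<nu> \<psi> \<longleftrightarrow>
     \<not> (positive_integral (positive_part \<nu>) \<psi> = \<infinity> \<and> positive_integral (negative_part \<nu>) \<psi> = \<infinity>)"

definition signed_integral ::
    "'b::topological_space functional \<Rightarrow> ('b \<Rightarrow> ereal) \<Rightarrow> ereal" where
  "signed_integral \<nu> \<psi> =
     positive_integral (positive_part \<nu>) \<psi> - positive_integral (negative_part \<nu>) \<psi>"

definition tensor_measure ::
    "'b::topological_space functional \<Rightarrow> 'c::topological_space functional \<Rightarrow> ('b \<times> 'c) functional"
  where "tensor_measure \<nu> \<mu> = (\<lambda>\<phi>\<in>cc_functions. \<nu> (\<lambda>x. \<mu> (\<lambda>y. \<phi> (x, y))))"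


section \<open>Kernels, energies and capacity\<close>

type_synonym 'a kernel = "'a \<times> 'a \<Rightarrow> ereal"

definition energy_defined :: "'a::topological_space kernel \<Rightarrow> 'a functional \<Rightarrow> bool" where
  "energy_defined \<kappa> \<nu> \<longleftrightarrow> integral_defined (tensor_measure \<nu> \<nu>) \<kappa>"

definition energy :: "'a::topological_space kernel \<Rightarrow> 'a functional \<Rightarrow> ereal" where
  "energy \<kappa> \<nu> = signed_integral (tensor_measure \<nu> \<nu>) \<kappa>"

definition potential_defined ::
    "'a::topological_space kernel \<Rightarrow> 'a \<Rightarrow> 'a functional \<Rightarrow> bool" where
  "potential_defined \<kappa> x \<nu> \<longleftrightarrow> integral_defined \<nu> (\<lambda>y. \<kappa> (x, y))"

definition potential :: "'a::topological_space kernel \<Rightarrow> 'a \<Rightarrow> 'a functional \<Rightarrow> ereal" where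
  "potential \<kappa> x \<nu> = signed_integral \<nu> (\<lambda>y. \<kappa> (x, y))"

definition positive_definite_kernel :: "'a::topological_space kernel \<Rightarrow> bool" where
  "positive_definite_kernel \<kappa> \<longleftrightarrow> \<kappa> \<in> lsc_class \<and> (\<forall>x y. \<kappa> (x, y) = \<kappa> (y, x))
     \<and> (\<forall>\<nu>\<in>radon_measures. energy_defined \<kappa> \<nu> \<longrightarrow> 0 \<le> energy \<kappa> \<nu>)"

definition finite_energy :: "'a::topological_space kernel \<Rightarrow> 'a functional set" where
  "finite_energy \<kappa> = {\<nu> \<in> radon_measures. energy_defined \<kappa> \<nu> \<and> \<bar>energy \<kappa> \<nu>\<bar> \<noteq> \<infinity>}"

definition positive_finite_energy :: "'a::topological_space kernel \<Rightarrow> 'a functional set" where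
  "positive_finite_energy \<kappa> = finite_energy \<kappa> \<inter> positive_measures"

definition energy_norm :: "'a::topological_space kernel \<Rightarrow> 'a functional \<Rightarrow> real" where
  "energy_norm \<kappa> \<nu> = sqrt (real_of_ereal (energy \<kappa> \<nu>))"

text \<open>
  Cluster points of the net \<open>f\<close> along the filter \<open>F\<close> in an abstract topology.
\<close>

definition cluster_point :: "'b topology \<Rightarrow> ('i \<Rightarrow> 'b) \<Rightarrow> 'i filter \<Rightarrow> 'b \<Rightarrow> bool" where
  "cluster_point T f F l \<longleftrightarrow>
     l \<in> topspace T \<and> (\<forall>U. openin T U \<and> l \<in> U \<longrightarrow> frequently (\<lambda>i. f i \<in> U) F)"

text \<open>
  Nets over arbitrary directed sets are represented by filters of measures (a net by the filter of
  its tails): Cauchy property, cluster points and limits of a net only depend on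
  this filter, and every proper filter arises in this way.
\<close>

definition strong_cauchy :: "'a::topological_space kernel \<Rightarrow> 'a functional filter \<Rightarrow> bool" where
  "strong_cauchy \<kappa> F \<longleftrightarrow> (\<forall>\<epsilon>>0. \<exists>P. eventually P F
     \<and> (\<forall>\<nu> \<mu>. P \<nu> \<and> P \<mu> \<longrightarrow> energy_norm \<kappa> (radon_diff \<nu> \<mu>) < \<epsilon>))"

definition consistent_kernel :: "'a::topological_space kernel \<Rightarrow> bool" where
  "consistent_kernel \<kappa> \<longleftrightarrow> positive_definite_kernel \<kappa>
     \<and> (\<forall>F. eventually (\<lambda>\<nu>. \<nu> \<in> positive_finite_energy \<kappa>) F \<and> strong_cauchy \<kappa> F \<longrightarrow>
          (\<forall>\<nu>. cluster_point vague_topology (\<lambda>\<mu>. \<mu>) F \<nu> \<longrightarrow>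
             \<nu> \<in> finite_energy \<kappa> \<and> ((\<lambda>\<mu>. energy_norm \<kappa> (radon_diff \<mu> \<nu>)) \<longlongrightarrow> 0) F))"

text \<open>
  In \<^typ>\<open>ereal\<close> the conventions \<open>1 / 0 = \<infinity>\<close>, \<open>1 / \<infinity> = 0\<close> and
  \<open>Inf {} = \<infinity>\<close> hold, here and below.
\<close>

definition interior_capacity :: "'a::topological_space kernel \<Rightarrow> 'a set \<Rightarrow> ereal" where
  "interior_capacity \<kappa> E = 1 / (INF \<nu>\<in>{\<nu> \<in> positive_finite_energy \<kappa>.
       compact (measure_support \<nu>) \<and> measure_support \<nu> \<subseteq> E
       \<and> positive_integral \<nu> (\<lambda>_. 1) = 1}. energy \<kappa> \<nu>)"

definition nearly_everywhere ::
    "'a::topological_space kernel \<Rightarrow> 'a set \<Rightarrow> ('a \<Rightarrow> bool) \<Rightarrow> bool" where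
  "nearly_everywhere \<kappa> E P \<longleftrightarrow> interior_capacity \<kappa> {x \<in> E. \<not> P x} = 0"


section \<open>Condensers\<close>

text \<open>
  \<open>Ip\<close> and \<open>In\<close> are the index sets of the positive and of the negative plates.
\<close>

definition condenser ::
    "nat set \<Rightarrow> nat set \<Rightarrow> (nat \<Rightarrow> 'a::topological_space set) \<Rightarrow> bool" where
  "condenser Ip In A \<longleftrightarrow> Ip \<noteq> {} \<and> Ip \<inter> In = {}
     \<and> (\<forall>i\<in>Ip \<union> In. closed (A i) \<and> A i \<noteq> {})
     \<and> (\<forall>K. compact K \<longrightarrow> finite {i \<in> Ip \<union> In. A i \<inter> K \<noteq> {}})
     \<and> (\<forall>i\<in>Ip. \<forall>j\<in>In. A i \<inter> A j = {})"

definition compact_condenser ::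
    "nat set \<Rightarrow> nat set \<Rightarrow> (nat \<Rightarrow> 'a::topological_space set) \<Rightarrow> bool" where
  "compact_condenser Ip In K \<longleftrightarrow> condenser Ip In K \<and> (\<forall>i\<in>Ip \<union> In. compact (K i))"

definition subcondenser ::
    "nat set \<Rightarrow> nat set \<Rightarrow> (nat \<Rightarrow> 'a set) \<Rightarrow> (nat \<Rightarrow> 'a set) \<Rightarrow> bool" where
  "subcondenser Ip In A' A \<longleftrightarrow> (\<forall>i\<in>Ip \<union> In. A' i \<subseteq> A i)"

type_synonym 'a vector_measure = "nat \<Rightarrow> 'a functional"

definition condenser_measures ::
    "nat set \<Rightarrow> nat set \<Rightarrow> (nat \<Rightarrow> 'a::topological_space set) \<Rightarrow> 'a vector_measure set" where
  "condenser_measures Ip In A = (\<Pi>\<^sub>E i\<in>Ip \<union> In. positive_measures_on (A i))"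

definition condenser_vague_topology ::
    "nat set \<Rightarrow> nat set \<Rightarrow> (nat \<Rightarrow> 'a::topological_space set) \<Rightarrow> 'a vector_measure topology" where
  "condenser_vague_topology Ip In A = product_topology
     (\<lambda>i. subtopology vague_topology (positive_measures_on (A i))) (Ip \<union> In)"

text \<open>
  The resultant \<open>R \<mu>\<close>.  The sum is finite for every \<open>\<phi>\<close>, since the support of \<open>\<phi>\<close> meets only
  finitely many plates.
\<close>

definition resultant ::
    "nat set \<Rightarrow> nat set \<Rightarrow> 'a::topological_space vector_measure \<Rightarrow> 'a functional" where
  "resultant Ip In \<mu> = (\<lambda>\<phi>\<in>cc_functions.
     \<Sum>\<^sub>\<infinity>i\<in>Ip \<union> In. (if i \<in> Ip then 1 else - 1) * \<mu> i \<phi>)"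

definition condenser_finite_energy ::
    "'a::topological_space kernel \<Rightarrow> nat set \<Rightarrow> nat set \<Rightarrow> (nat \<Rightarrow> 'a set)
      \<Rightarrow> 'a vector_measure set" where
  "condenser_finite_energy \<kappa> Ip In A =
     {\<mu> \<in> condenser_measures Ip In A. resultant Ip In \<mu> \<in> finite_energy \<kappa>}"

definition condenser_norm ::
    "'a::topological_space kernel \<Rightarrow> nat set \<Rightarrow> nat set \<Rightarrow> 'a vector_measure \<Rightarrow> real" where
  "condenser_norm \<kappa> Ip In \<mu> = energy_norm \<kappa> (resultant Ip In \<mu>)"

definition condenser_dist ::
    "'a::topological_space kernel \<Rightarrow> nat set \<Rightarrow> nat set
      \<Rightarrow> 'a vector_measure \<Rightarrow> 'a vector_measure \<Rightarrow> real" where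
  "condenser_dist \<kappa> Ip In \<mu> \<nu> =
     energy_norm \<kappa> (radon_diff (resultant Ip In \<mu>) (resultant Ip In \<nu>))"

definition admissible_measures ::
    "'a::topological_space kernel \<Rightarrow> nat set \<Rightarrow> nat set \<Rightarrow> (nat \<Rightarrow> 'a set)
      \<Rightarrow> (nat \<Rightarrow> real) \<Rightarrow> (nat \<Rightarrow> 'a \<Rightarrow> real) \<Rightarrow> 'a vector_measure set" where
  "admissible_measures \<kappa> Ip In A a g =
     {\<mu> \<in> condenser_finite_energy \<kappa> Ip In A.
        \<forall>i\<in>Ip \<union> In. positive_integral (\<mu> i) (\<lambda>x. ereal (g i x)) = ereal (a i)}"

definition minimal_energy ::
    "'a::topological_space kernel \<Rightarrow> nat set \<Rightarrow> nat set \<Rightarrow> (nat \<Rightarrow> 'a set)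
      \<Rightarrow> (nat \<Rightarrow> real) \<Rightarrow> (nat \<Rightarrow> 'a \<Rightarrow> real) \<Rightarrow> ereal" where
  "minimal_energy \<kappa> Ip In A a g =
     (INF \<mu>\<in>admissible_measures \<kappa> Ip In A a g. ereal ((condenser_norm \<kappa> Ip In \<mu>)\<^sup>2))"

definition condenser_capacity ::
    "'a::topological_space kernel \<Rightarrow> nat set \<Rightarrow> nat set \<Rightarrow> (nat \<Rightarrow> 'a set)
      \<Rightarrow> (nat \<Rightarrow> real) \<Rightarrow> (nat \<Rightarrow> 'a \<Rightarrow> real) \<Rightarrow> ereal" where
  "condenser_capacity \<kappa> Ip In A a g = 1 / minimal_energy \<kappa> Ip In A a g"

definition minimizers ::
    "'a::topological_space kernel \<Rightarrow> nat set \<Rightarrow> nat set \<Rightarrow> (nat \<Rightarrow> 'a set)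
      \<Rightarrow> (nat \<Rightarrow> real) \<Rightarrow> (nat \<Rightarrow> 'a \<Rightarrow> real) \<Rightarrow> 'a vector_measure set" where
  "minimizers \<kappa> Ip In A a g =
     {\<mu> \<in> admissible_measures \<kappa> Ip In A a g.
        ereal ((condenser_norm \<kappa> Ip In \<mu>)\<^sup>2) = minimal_energy \<kappa> Ip In A a g}"

text \<open>
  A family \<open>(K\<^sub>i)\<close> over \<open>Ip \<union> In\<close> is an extensional function, so that each compact condenser
  occurs exactly once as an index of the net.
\<close>

definition compact_subcondensers ::
    "'a::topological_space kernel \<Rightarrow> nat set \<Rightarrow> nat set \<Rightarrow> (nat \<Rightarrow> 'a set)
      \<Rightarrow> (nat \<Rightarrow> real) \<Rightarrow> (nat \<Rightarrow> 'a \<Rightarrow> real) \<Rightarrow> (nat \<Rightarrow> 'a set) set" where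
  "compact_subcondensers \<kappa> Ip In A a g =
     {K \<in> extensional (Ip \<union> In). compact_condenser Ip In K \<and> subcondenser Ip In K A
        \<and> 0 < condenser_capacity \<kappa> Ip In K a g}"

text \<open>The filter of the tails of a set \<open>S\<close> directed upwards by \<open>R\<close>.\<close>

definition tails_filter :: "'i set \<Rightarrow> ('i \<Rightarrow> 'i \<Rightarrow> bool) \<Rightarrow> 'i filter" where
  "tails_filter S R = (INF s0\<in>S. principal {s \<in> S. R s0 s})"

definition directed_upwards :: "'i set \<Rightarrow> ('i \<Rightarrow> 'i \<Rightarrow> bool) \<Rightarrow> bool" where
  "directed_upwards S R \<longleftrightarrow> S \<noteq> {} \<and> (\<forall>s\<in>S. \<forall>t\<in>S. \<exists>u\<in>S. R s u \<and> R t u)"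

end

theory Submission
  imports Defs
begin

text \<open>
  The set of admissible measures is convex, so by the parallelogram identity every minimizing net is
  strongly Cauchy, and its strong limit is a minimizer as soon as some vague cluster point is
  admissible.  The two parts of \<open>R \<mu>\<close> have disjoint closed supports, hence they form its Jordan
  decomposition, and the hypotheses on the negative plates bound their mutual energy; so both parts
  stay strongly bounded, and by consistency they converge weakly along a vaguely convergent subnet.
  This gives semicontinuity of the energy.  No mass \<open>a i\<close> is lost in the limit: if \<open>C (A i) < \<infinity>\<close>, then
  again by consistency the capacity of \<open>A i\<close> outside large compact sets tends to \<open>0\<close>, which bounds
  the tails of \<open>\<mu> i\<close> in terms of its energy.  Finally the nets \<open>\<lambda>\<^bsub>K\<^esub>\<close> are minimizing, because any
  admissible measure can be cut off to compact plates at small cost of energy.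
\<close>

section \<open>Continuous functions with compact support\<close>

text \<open>Measures are functionals without values on sets, and integrals are suprema over
  continuous minorants. So Dini's theorem for directed families stands in for monotone convergence,
  and splittings of test functions stand in for Hahn sets. The energy of a signed measure is read
  off the Jordan decomposition of its tensor square on the product space; finite energy of
  \<open>\<sigma> - \<tau>\<close> reaches \<open>\<sigma>\<close> and \<open>\<tau>\<close> only
  once \<open>\<sigma> \<otimes> \<sigma> + \<tau> \<otimes> \<tau>\<close> is recognized as the
  positive part there. Afterwards everything stays in the cone of positive measures of finite
  energy: a signed quantity is rewritten as a distance between two elements of the cone. The kernel
  may take negative values only if the space is compact; then all plates are compact, no mass
  escapes, and the given condenser itself belongs to the family. Otherwise
  \<open>\<kappa> \<ge> 0\<close>, so that a smaller measure has smaller energy, and the estimates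
  of tails and cutoffs rest on this. The minimizers for compact condensers come from the same
  existence argument, because all hypotheses pass to compact sub-condensers.\<close>

lemma cc_functionsI:
  fixes \<phi> :: "'b::t2_space \<Rightarrow> real"
  assumes "continuous_on UNIV \<phi>" "compact C" "\<And>x. x \<notin> C \<Longrightarrow> \<phi> x = 0"
  shows "\<phi> \<in> cc_functions"
proof -
  have "closed C" using assms(2) by (rule compact_imp_closed)
  then have "closure {x. \<phi> x \<noteq> 0} \<subseteq> C"
    using assms(3) by (intro closure_minimal) auto
  then have "compact (closure {x. \<phi> x \<noteq> 0})"
    using assms(2) by (metis closed_Int_compact closed_closure inf.absorb1)
  then show ?thesis using assms(1) by (simp add: cc_functions_def)
qed

lemma cc_cont: "\<phi> \<in> cc_functions \<Longrightarrow> continuous_on UNIV \<phi>"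
  by (simp add: cc_functions_def)

lemma cc_compact: "\<phi> \<in> cc_functions \<Longrightarrow> compact (closure {x. \<phi> x \<noteq> 0})"
  by (simp add: cc_functions_def)

lemma cc_outside: "x \<notin> closure {x. \<phi> x \<noteq> 0} \<Longrightarrow> \<phi> x = 0"
  using closure_subset[of "{x. \<phi> x \<noteq> 0}"] by auto

lemma cc_inside: "\<phi> x \<noteq> 0 \<Longrightarrow> x \<in> closure {x. \<phi> x \<noteq> 0}"
  by (rule subsetD[OF closure_subset]) simp

lemma cc_support_subset:
  assumes "closed C" "\<And>x. x \<notin> C \<Longrightarrow> \<phi> x = 0"
  shows "closure {x. \<phi> x \<noteq> 0} \<subseteq> C"
  using assms by (intro closure_minimal) auto

lemma cc_zero [simp]: "(\<lambda>x::'b::t2_space. 0) \<in> cc_functions"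
  by (rule cc_functionsI[where C = "{}"]) auto

lemma cc_comp2:
  fixes \<phi> \<psi> :: "'b::t2_space \<Rightarrow> real"
  assumes "\<phi> \<in> cc_functions" "\<psi> \<in> cc_functions" "continuous_on UNIV h"
    "\<And>x. \<phi> x = 0 \<Longrightarrow> \<psi> x = 0 \<Longrightarrow> h x = 0"
  shows "h \<in> cc_functions"
proof (rule cc_functionsI[OF assms(3) compact_Un[OF cc_compact[OF assms(1)] cc_compact[OF assms(2)]]])
  fix x assume "x \<notin> closure {x. \<phi> x \<noteq> 0} \<union> closure {x. \<psi> x \<noteq> 0}"
  then show "h x = 0" using assms(4) cc_outside by (metis UnCI)
qed

lemma cc_lin:
  fixes \<phi> \<psi> :: "'b::t2_space \<Rightarrow> real"
  assumes "\<phi> \<in> cc_functions" "\<psi> \<in> cc_functions"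
  shows "(\<lambda>x. s * \<phi> x + t * \<psi> x) \<in> cc_functions"
  by (rule cc_comp2[OF assms]) (auto intro!: continuous_on_add continuous_on_mult continuous_on_const cc_cont[OF assms(1)] cc_cont[OF assms(2)])

lemma cc_add:
  fixes \<phi> \<psi> :: "'b::t2_space \<Rightarrow> real"
  assumes "\<phi> \<in> cc_functions" "\<psi> \<in> cc_functions"
  shows "(\<lambda>x. \<phi> x + \<psi> x) \<in> cc_functions"
  using cc_lin[OF assms, of 1 1] by simp

lemma cc_diff:
  fixes \<phi> \<psi> :: "'b::t2_space \<Rightarrow> real"
  assumes "\<phi> \<in> cc_functions" "\<psi> \<in> cc_functions"
  shows "(\<lambda>x. \<phi> x - \<psi> x) \<in> cc_functions"
  using cc_lin[OF assms, of 1 "-1"] by simp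

lemma cc_scale:
  fixes \<phi> :: "'b::t2_space \<Rightarrow> real"
  assumes "\<phi> \<in> cc_functions"
  shows "(\<lambda>x. s * \<phi> x) \<in> cc_functions"
  using cc_lin[OF assms cc_zero, of s 0] by simp

lemma cc_uminus:
  fixes \<phi> :: "'b::t2_space \<Rightarrow> real"
  assumes "\<phi> \<in> cc_functions"
  shows "(\<lambda>x. - \<phi> x) \<in> cc_functions"
  using cc_scale[OF assms, of "-1"] by simp

lemma cc_max:
  fixes \<phi> \<psi> :: "'b::t2_space \<Rightarrow> real"
  assumes "\<phi> \<in> cc_functions" "\<psi> \<in> cc_functions"
  shows "(\<lambda>x. max (\<phi> x) (\<psi> x)) \<in> cc_functions"
  by (rule cc_comp2[OF assms]) (auto intro!: continuous_on_max cc_cont[OF assms(1)] cc_cont[OF assms(2)])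

lemma cc_min:
  fixes \<phi> \<psi> :: "'b::t2_space \<Rightarrow> real"
  assumes "\<phi> \<in> cc_functions" "\<psi> \<in> cc_functions"
  shows "(\<lambda>x. min (\<phi> x) (\<psi> x)) \<in> cc_functions"
  by (rule cc_comp2[OF assms]) (auto intro!: continuous_on_min cc_cont[OF assms(1)] cc_cont[OF assms(2)])

lemma cc_mult:
  fixes \<phi> :: "'b::t2_space \<Rightarrow> real"
  assumes "continuous_on UNIV f" "\<phi> \<in> cc_functions"
  shows "(\<lambda>x. f x * \<phi> x) \<in> cc_functions"
  by (rule cc_comp2[OF assms(2) assms(2)]) (auto intro!: continuous_on_mult assms(1) cc_cont[OF assms(2)])

lemma cc_bounded:
  fixes \<phi> :: "'b::t2_space \<Rightarrow> real"
  assumes "\<phi> \<in> cc_functions"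
  obtains B where "0 \<le> B" "\<And>x. \<bar>\<phi> x\<bar> \<le> B"
proof -
  let ?S = "closure {x. \<phi> x \<noteq> 0}"
  have "compact (\<phi> ` ?S)"
    using assms by (intro compact_continuous_image continuous_on_subset[OF cc_cont] cc_compact) auto
  then obtain B where B: "\<And>y. y \<in> \<phi> ` ?S \<Longrightarrow> \<bar>y\<bar> \<le> B"
    by (metis bounded_iff compact_imp_bounded real_norm_def)
  have "\<bar>\<phi> x\<bar> \<le> max B 0" for x
    using B[of "\<phi> x"] cc_outside[of x \<phi>] by (cases "x \<in> ?S") auto
  then show ?thesis by (intro that[of "max B 0"]) auto
qed

lemma Hausdorff_euclidean: "Hausdorff_space (euclidean :: 'b::t2_space topology)"
  unfolding Hausdorff_space_def using hausdorff by (simp add: disjnt_def) blast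

lemma cc_bump_aux:
  fixes K :: "'b::t2_space set"
  assumes lc: "locally_compact_space (euclidean :: 'b topology)"
    and "compact K" "open U" "K \<subseteq> U"
  shows "\<exists>V C. open V \<and> compact C \<and> K \<subseteq> V \<and> V \<subseteq> C \<and> C \<subseteq> U"
proof -
  note haus = Hausdorff_euclidean[where 'b = 'b]
  have nb: "neighbourhood_base_of (compactin euclidean) (euclidean :: 'b topology)"
    using lc haus locally_compact_space_neighbourhood_base by blast
  have "\<forall>x\<in>K. \<exists>V C. open V \<and> compact C \<and> x \<in> V \<and> V \<subseteq> C \<and> C \<subseteq> U"
    using nb assms(3,4) unfolding neighbourhood_base_of by (simp add: subset_iff)
  then obtain V C where VC: "\<And>x. x \<in> K \<Longrightarrow> open (V x) \<and> compact (C x) \<and> x \<in> V x \<and> V x \<subseteq> C x \<and> C x \<subseteq> U"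
    by metis
  obtain D where D: "D \<subseteq> K" "finite D" "K \<subseteq> (\<Union>x\<in>D. V x)"
    by (rule compactE_image[OF \<open>compact K\<close>, of K V]) (use VC in auto)
  have "open (\<Union>x\<in>D. V x)" "compact (\<Union>x\<in>D. C x)" "(\<Union>x\<in>D. V x) \<subseteq> (\<Union>x\<in>D. C x)" "(\<Union>x\<in>D. C x) \<subseteq> U"
    using D VC by (fastforce intro!: compact_UN)+
  then show ?thesis using D(3) by blast
qed

text \<open>Urysohn's lemma separates \<open>K\<close> from the complement of \<open>V\<close>. The
  nonzero set then lies inside the compact \<open>C\<close>, so even the closed support stays in
  \<open>U\<close>.\<close>

lemma cc_bump:
  fixes K :: "'b::t2_space set"
  assumes lc: "locally_compact_space (euclidean :: 'b topology)"
    and "compact K" "open U" "K \<subseteq> U"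
  shows "\<exists>\<xi>\<in>cc_functions. (\<forall>x. 0 \<le> \<xi> x) \<and> (\<forall>x. \<xi> x \<le> 1) \<and> (\<forall>x\<in>K. \<xi> x = 1)
    \<and> closure {x. \<xi> x \<noteq> 0} \<subseteq> U"
proof -
  note haus = Hausdorff_euclidean[where 'b = 'b]
  have cr: "completely_regular_space (euclidean :: 'b topology)"
    using lc haus locally_compact_regular_imp_completely_regular_space by blast
  obtain V C where VC: "open V" "compact C" "K \<subseteq> V" "V \<subseteq> C" "C \<subseteq> U"
    using cc_bump_aux[OF assms] by blast
  have dis: "disjnt (- V) K" using VC(3) by (auto simp: disjnt_def)
  obtain f :: "'b \<Rightarrow> real" where f: "continuous_map euclidean (subtopology euclidean {0..1}) f" "f ` (-V) \<subseteq> {0}" "f ` K \<subseteq> {1}"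
    by (rule Urysohn_completely_regular_compact_closed[of 0 1 euclidean K "-V"]) (use cr assms(2) dis VC(1) in \<open>auto simp: disjnt_sym\<close>)
  have fr: "f x \<in> {0..1}" for x using f(1) by (auto simp: continuous_map_in_subtopology Pi_iff)
  have "continuous_on UNIV f" using f(1) by (simp add: continuous_map_in_subtopology)
  moreover have out: "x \<notin> C \<Longrightarrow> f x = 0" for x using f(2) VC(4) by auto
  ultimately have "f \<in> cc_functions" using VC(2) by (intro cc_functionsI)
  moreover have "closure {x. f x \<noteq> 0} \<subseteq> U"
    using cc_support_subset[of C f] out VC(2,5) compact_imp_closed by blast
  ultimately show ?thesis using fr f(3) by (intro bexI[of _ f]) auto
qed

lemma cc_cutoff:
  fixes K :: "'b::t2_space set"
  assumes lc: "locally_compact_space (euclidean :: 'b topology)" and "compact K"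
  shows "\<exists>\<xi>\<in>cc_functions. (\<forall>x. 0 \<le> \<xi> x) \<and> (\<forall>x. \<xi> x \<le> 1) \<and> (\<forall>x\<in>K. \<xi> x = 1)"
  using cc_bump[OF assms open_UNIV subset_UNIV] by blast


section \<open>Radon measures\<close>

lemma rm_lin:
  assumes "\<nu> \<in> radon_measures" "\<phi> \<in> cc_functions" "\<psi> \<in> cc_functions"
  shows "\<nu> (\<lambda>x. s * \<phi> x + t * \<psi> x) = s * \<nu> \<phi> + t * \<nu> \<psi>"
  using assms by (simp add: radon_measures_def)

lemma rm_add:
  assumes "\<nu> \<in> radon_measures" "\<phi> \<in> cc_functions" "\<psi> \<in> cc_functions"
  shows "\<nu> (\<lambda>x. \<phi> x + \<psi> x) = \<nu> \<phi> + \<nu> \<psi>"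
  using rm_lin[OF assms, of 1 1] by simp

lemma rm_diff:
  assumes "\<nu> \<in> radon_measures" "\<phi> \<in> cc_functions" "\<psi> \<in> cc_functions"
  shows "\<nu> (\<lambda>x. \<phi> x - \<psi> x) = \<nu> \<phi> - \<nu> \<psi>"
  using rm_lin[OF assms, of 1 "-1"] by simp

lemma rm_scale:
  assumes "\<nu> \<in> radon_measures" "\<phi> \<in> cc_functions"
  shows "\<nu> (\<lambda>x. s * \<phi> x) = s * \<nu> \<phi>"
  using rm_lin[OF assms assms(2), of s 0] by simp

lemma rm_zero:
  assumes "\<nu> \<in> radon_measures"
  shows "\<nu> (\<lambda>x::'b::t2_space. 0) = 0"
  using rm_scale[OF assms cc_zero, of 0] by simp

lemma rm_ext: "\<nu> \<in> radon_measures \<Longrightarrow> \<nu> \<in> extensional cc_functions"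
  by (simp add: radon_measures_def)

lemma pm_rm: "\<nu> \<in> positive_measures \<Longrightarrow> \<nu> \<in> radon_measures"
  by (simp add: positive_measures_def)

lemma pm_nonneg:
  assumes "\<nu> \<in> positive_measures" "\<phi> \<in> cc_functions" "\<And>x. 0 \<le> \<phi> x"
  shows "0 \<le> \<nu> \<phi>"
  using assms by (simp add: positive_measures_def)

lemma pm_mono:
  fixes \<phi> \<psi> :: "'b::t2_space \<Rightarrow> real"
  assumes "\<nu> \<in> positive_measures" "\<phi> \<in> cc_functions" "\<psi> \<in> cc_functions" "\<And>x. \<phi> x \<le> \<psi> x"
  shows "\<nu> \<phi> \<le> \<nu> \<psi>"
  using pm_nonneg[OF assms(1) cc_diff[OF assms(3,2)]] rm_diff[OF pm_rm[OF assms(1)] assms(3,2)] assms(4)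
  by simp

lemma functional_eqI:
  assumes "\<nu> \<in> extensional cc_functions" "\<mu> \<in> extensional cc_functions"
    "\<And>\<phi>. \<phi> \<in> cc_functions \<Longrightarrow> \<nu> \<phi> = \<mu> \<phi>"
  shows "\<nu> = \<mu>"
  using assms extensionalityI by blast

text \<open>Positive functionals are automatically continuous: compare with a cutoff function.\<close>

lemma positive_measuresI:
  fixes \<nu> :: "'b::t2_space functional"
  assumes lc: "locally_compact_space (euclidean :: 'b topology)"
    and ext: "\<nu> \<in> extensional cc_functions"
    and lin: "\<And>\<phi> \<psi> s t. \<phi> \<in> cc_functions \<Longrightarrow> \<psi> \<in> cc_functions \<Longrightarrow>
      \<nu> (\<lambda>x. s * \<phi> x + t * \<psi> x) = s * \<nu> \<phi> + t * \<nu> \<psi>"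
    and pos: "\<And>\<phi>. \<phi> \<in> cc_functions \<Longrightarrow> (\<And>x. 0 \<le> \<phi> x) \<Longrightarrow> 0 \<le> \<nu> \<phi>"
  shows "\<nu> \<in> positive_measures"
proof -
  have "\<exists>M. \<forall>\<phi>\<in>cc_functions. \<forall>B. closure {x. \<phi> x \<noteq> 0} \<subseteq> K \<and> (\<forall>x. \<bar>\<phi> x\<bar> \<le> B) \<longrightarrow> \<bar>\<nu> \<phi>\<bar> \<le> M * B"
    if K: "compact K" for K
  proof -
    obtain \<xi> where chi: "\<xi> \<in> cc_functions" "\<And>x. 0 \<le> \<xi> x" "\<And>x. \<xi> x \<le> 1" "\<And>x. x \<in> K \<Longrightarrow> \<xi> x = 1"
      using cc_cutoff[OF lc K] by metis
    have "\<bar>\<nu> \<phi>\<bar> \<le> \<nu> \<xi> * B"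
      if phi: "\<phi> \<in> cc_functions" "closure {x. \<phi> x \<noteq> 0} \<subseteq> K" "\<forall>x. \<bar>\<phi> x\<bar> \<le> B" for \<phi> B
    proof -
      have le: "\<bar>\<phi> x\<bar> \<le> B * \<xi> x" for x
      proof (cases "x \<in> K")
        case True then show ?thesis using phi(3) chi(4)[OF True] by simp
      next
        case False
        then have "\<phi> x = 0" using cc_outside[of x \<phi>] phi(2) by auto
        moreover have "0 \<le> B" using phi(3) abs_ge_zero order_trans by blast
        ultimately show ?thesis using chi(2)[of x] by simp
      qed
      have "0 \<le> B * \<xi> x + 1 * \<phi> x" "0 \<le> B * \<xi> x + (-1) * \<phi> x" for x using le[of x] by auto
      from this[THEN pos[OF cc_lin[OF chi(1) phi(1)]]]
      have "0 \<le> B * \<nu> \<xi> + 1 * \<nu> \<phi>" "0 \<le> B * \<nu> \<xi> + (-1) * \<nu> \<phi>"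
        using lin[OF chi(1) phi(1)] by metis+
      then show ?thesis by (simp add: mult.commute abs_le_iff)
    qed
    then show ?thesis by blast
  qed
  then show ?thesis
    using ext lin pos by (simp add: positive_measures_def radon_measures_def)
qed

text \<open>The support is the complement of the union of all open null sets; that this union is
  itself null needs compactness. Finitely many bumps of integral 0, each above 1/2 near a point of
  the support of \<open>\<phi>\<close>, together dominate a multiple of
  \<open>\<phi>\<close>.\<close>

lemma null_outside_support:
  fixes \<nu> :: "'b::t2_space functional"
  assumes lc: "locally_compact_space (euclidean :: 'b topology)"
    and nu: "\<nu> \<in> positive_measures" and phi: "\<phi> \<in> cc_functions"
    and dis: "closure {x. \<phi> x \<noteq> 0} \<inter> measure_support \<nu> = {}"
  shows "\<nu> \<phi> = 0"
proof -
  let ?S = "closure {x. \<phi> x \<noteq> 0}"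
  have nbhd: "\<exists>U. open U \<and> x \<in> U \<and> (\<forall>\<phi>\<in>cc_functions. closure {x. \<phi> x \<noteq> 0} \<subseteq> U \<longrightarrow> \<nu> \<phi> = 0)"
    if "x \<in> ?S" for x
  proof -
    have "x \<notin> measure_support \<nu>" using that dis by blast
    then show ?thesis unfolding measure_support_def by simp blast
  qed
  have "\<exists>\<xi>. \<xi> \<in> cc_functions \<and> (\<forall>y. 0 \<le> \<xi> y) \<and> \<xi> x = 1 \<and> \<nu> \<xi> = 0" if x: "x \<in> ?S" for x
  proof -
    obtain U where U: "open U" "x \<in> U" "\<forall>\<phi>\<in>cc_functions. closure {x. \<phi> x \<noteq> 0} \<subseteq> U \<longrightarrow> \<nu> \<phi> = 0"
      using nbhd[OF x] by blast
    have "\<exists>f\<in>cc_functions. (\<forall>y. 0 \<le> f y) \<and> (\<forall>y. f y \<le> 1) \<and> (\<forall>y\<in>{x}. f y = 1) \<and> closure {y. f y \<noteq> 0} \<subseteq> U"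
      by (rule cc_bump[OF lc _ U(1)]) (use U(2) in auto)
    then show ?thesis using U(3) by auto
  qed
  then obtain \<xi> where chi: "\<And>x. x \<in> ?S \<Longrightarrow> \<xi> x \<in> cc_functions \<and> (\<forall>y. 0 \<le> \<xi> x y) \<and> \<xi> x x = 1 \<and> \<nu> (\<xi> x) = 0"
    by metis
  have op: "open {y. 1/2 < \<xi> x y}" if "x \<in> ?S" for x
    by (rule open_Collect_less) (use chi[OF that] in \<open>auto intro: cc_cont\<close>)
  obtain D where D: "D \<subseteq> ?S" "finite D" "?S \<subseteq> (\<Union>x\<in>D. {y. 1/2 < \<xi> x y})"
    by (rule compactE_image[OF cc_compact[OF phi], of ?S "\<lambda>x. {y. 1/2 < \<xi> x y}"])
       (use op chi in auto)
  obtain B where B: "0 \<le> B" "\<And>x. \<bar>\<phi> x\<bar> \<le> B" using cc_bounded[OF phi] by blast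
  have sum: "(\<lambda>y. \<Sum>x\<in>D. \<xi> x y) \<in> cc_functions \<and> \<nu> (\<lambda>y. \<Sum>x\<in>D. \<xi> x y) = 0"
    using D(2,1)
  proof (induction D)
    case empty then show ?case using rm_zero[OF pm_rm[OF nu]] by simp
  next
    case (insert x D)
    then show ?case using chi[of x] cc_add[of "\<xi> x"] rm_add[OF pm_rm[OF nu], of "\<xi> x"] by simp
  qed
  let ?\<sigma> = "\<lambda>y. \<Sum>x\<in>D. \<xi> x y"
  have D0: "0 \<le> \<xi> x y" if "x \<in> D" for x y using chi D(1) that by blast
  have le: "\<bar>\<phi> y\<bar> \<le> (2 * B) * ?\<sigma> y" for y
  proof (cases "y \<in> ?S")
    case True
    then obtain x where x: "x \<in> D" "1/2 < \<xi> x y" using D(3) by auto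
    have "\<xi> x y \<le> ?\<sigma> y" using x D(2) D0 by (intro member_le_sum) auto
    then have "1 \<le> 2 * ?\<sigma> y" using x by simp
    then have "B * 1 \<le> B * (2 * ?\<sigma> y)" using B(1) by (rule mult_left_mono)
    then show ?thesis using B(2)[of y] by (simp add: mult_ac)
  next
    case False
    then show ?thesis using B(1) D0 by (auto dest!: cc_outside intro!: mult_nonneg_nonneg sum_nonneg)
  qed
  have s2: "(\<lambda>y. (2*B) * ?\<sigma> y) \<in> cc_functions" "\<nu> (\<lambda>y. (2*B) * ?\<sigma> y) = 0"
    using sum cc_scale[of ?\<sigma>] rm_scale[OF pm_rm[OF nu], of ?\<sigma>] by auto
  have "\<nu> \<phi> \<le> 0" "\<nu> (\<lambda>x. - \<phi> x) \<le> 0"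
    using pm_mono[OF nu phi s2(1)] pm_mono[OF nu cc_uminus[OF phi] s2(1)] s2(2) le by (auto simp: abs_le_iff)
  then show ?thesis using rm_scale[OF pm_rm[OF nu] phi, of "-1"] by simp
qed

lemma measure_support_subset_iff:
  fixes \<nu> :: "'b::t2_space functional"
  assumes lc: "locally_compact_space (euclidean :: 'b topology)"
    and nu: "\<nu> \<in> positive_measures" and "closed A"
  shows "measure_support \<nu> \<subseteq> A \<longleftrightarrow> (\<forall>\<phi>\<in>cc_functions. closure {x. \<phi> x \<noteq> 0} \<inter> A = {} \<longrightarrow> \<nu> \<phi> = 0)"
proof
  assume "measure_support \<nu> \<subseteq> A"
  then show "\<forall>\<phi>\<in>cc_functions. closure {x. \<phi> x \<noteq> 0} \<inter> A = {} \<longrightarrow> \<nu> \<phi> = 0"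
    using null_outside_support[OF lc nu] by blast
next
  assume "\<forall>\<phi>\<in>cc_functions. closure {x. \<phi> x \<noteq> 0} \<inter> A = {} \<longrightarrow> \<nu> \<phi> = 0"
  then have "open (- A) \<and> (\<forall>\<phi>\<in>cc_functions. closure {x. \<phi> x \<noteq> 0} \<subseteq> - A \<longrightarrow> \<nu> \<phi> = 0)"
    using assms(3) by (auto simp: disjoint_eq_subset_Compl)
  then show "measure_support \<nu> \<subseteq> A" unfolding measure_support_def by blast
qed

text \<open>In this form the support condition is a family of equations
  \<open>\<nu> \<phi> = 0\<close>, hence stable under vague limits.\<close>

lemma positive_measures_on_iff:
  fixes \<nu> :: "'b::t2_space functional"
  assumes lc: "locally_compact_space (euclidean :: 'b topology)" and "closed A"
  shows "\<nu> \<in> positive_measures_on A \<longleftrightarrow> \<nu> \<in> positive_measures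
    \<and> (\<forall>\<phi>\<in>cc_functions. closure {x. \<phi> x \<noteq> 0} \<inter> A = {} \<longrightarrow> \<nu> \<phi> = 0)"
  using measure_support_subset_iff[OF lc _ assms(2)] by (auto simp: positive_measures_on_def)

lemma lsc_above_open:
  fixes v :: "'b::topological_space \<Rightarrow> ereal"
  assumes v: "\<And>t. open {x. t < v x}" and f: "continuous_on UNIV (f :: 'b \<Rightarrow> real)"
  shows "open {x. ereal (f x) < v x}"
proof -
  have "{x. ereal (f x) < v x} = (\<Union>t. {x. ereal t < v x} \<inter> {x. f x < t})"
  proof (auto, goal_cases)
    case (1 x)
    then show ?case using ereal_dense2[OF 1] by (auto intro: exI)
  next
    case (2 x t) then show ?case by (meson ereal_less(2) less_ereal.simps(1) less_trans)
  qed
  moreover have "open {x. f x < t}" for t using f by (intro open_Collect_less) auto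
  ultimately show ?thesis using v by (auto intro!: open_Int)
qed

text \<open>Only the compact sets \<open>{x \<in> A. v x + \<epsilon> \<le> \<phi> x}\<close> matter in the hypothesis, so no measurability is
  involved.\<close>

lemma le_positive_integral_of_null:
  fixes \<nu> :: "'b::t2_space functional"
  assumes lc: "locally_compact_space (euclidean :: 'b topology)"
    and nu: "\<nu> \<in> positive_measures_on A" and cl: "closed A" and phi: "\<phi> \<in> cc_functions"
    and v: "\<And>t. open {x. t < v x}" and th: "\<theta> \<in> cc_functions" "\<And>x. ereal (\<theta> x) \<le> v x"
    and null: "\<And>K \<delta>. compact K \<Longrightarrow> K \<subseteq> A \<Longrightarrow> (\<And>x. x \<in> K \<Longrightarrow> v x < ereal (\<phi> x)) \<Longrightarrow> 0 < \<delta> \<Longrightarrow>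
        \<exists>\<xi>\<in>cc_functions. (\<forall>x. 0 \<le> \<xi> x) \<and> (\<forall>x\<in>K. 1 \<le> \<xi> x) \<and> \<nu> \<xi> < \<delta>"
  shows "ereal (\<nu> \<phi>) \<le> positive_integral \<nu> v"
proof -
  have nup: "\<nu> \<in> positive_measures" and nul: "\<forall>\<phi>\<in>cc_functions. closure {x. \<phi> x \<noteq> 0} \<inter> A = {} \<longrightarrow> \<nu> \<phi> = 0"
    using iffD1[OF positive_measures_on_iff[OF lc cl] nu] by blast+
  define S where "S = closure {x. \<phi> x \<noteq> 0} \<union> closure {x. \<theta> x \<noteq> 0}"
  have S: "compact S" unfolding S_def using phi th by (intro compact_Un cc_compact)
  have So1: "\<phi> x = 0" if "x \<notin> S" for x
    by (rule cc_outside[of x \<phi>]) (use that S_def in \<open>meson UnI1 UnI2\<close>)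
  have So2: "\<theta> x = 0" if "x \<notin> S" for x
    by (rule cc_outside[of x \<theta>]) (use that S_def in \<open>meson UnI1 UnI2\<close>)
  note So = So1 So2
  obtain \<eta> where eta: "\<eta> \<in> cc_functions" "\<And>x. 0 \<le> \<eta> x" "\<And>x. \<eta> x \<le> 1" "\<And>x. x \<in> S \<Longrightarrow> \<eta> x = 1"
    using cc_cutoff[OF lc S] by metis
  obtain B where B: "0 \<le> B" "\<And>x. \<bar>\<phi> x\<bar> \<le> B" using cc_bounded[OF phi] by blast
  obtain B' where B': "0 \<le> B'" "\<And>x. \<bar>\<theta> x\<bar> \<le> B'" using cc_bounded[OF th(1)] by blast
  \<comment> \<open>\<open>M\<close> bounds \<open>\<phi> - \<theta>\<close>: lowering
    \<open>\<phi>\<close> by \<open>M\<close> puts it below \<open>\<theta>\<close>, hence below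
    \<open>v\<close>, wherever \<open>v\<close> is too small.\<close>
  define M where "M = B + B'"
  have M: "0 \<le> M" "\<And>x. \<phi> x - M \<le> \<theta> x"
  proof -
    show "0 \<le> M" using B B' M_def by simp
    show "\<phi> x - M \<le> \<theta> x" for x using B(2)[of x] B'(2)[of x] M_def by linarith
  qed
  have main: "ereal (\<nu> \<phi>) \<le> positive_integral \<nu> v + ereal (\<epsilon> * (\<nu> \<eta> + 2 * M))" if e: "0 < \<epsilon>" for \<epsilon>
  proof -
    \<comment> \<open>\<open>F\<close> lies in \<open>S\<close>, since off \<open>S\<close> both
      \<open>\<phi>\<close> and \<open>\<theta>\<close> vanish while
      \<open>\<theta> \<le> v\<close>; this makes it compact.\<close>
    define F where "F = {x. v x \<le> ereal (\<phi> x - \<epsilon>)}"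
    have "open {x. ereal (\<phi> x - \<epsilon>) < v x}"
      using v phi by (intro lsc_above_open continuous_intros cc_cont) auto
    moreover have "F = - {x. ereal (\<phi> x - \<epsilon>) < v x}" unfolding F_def by auto
    ultimately have "closed F" by auto
    have FS: "F \<subseteq> S"
    proof
      fix x assume "x \<in> F"
      then have "v x \<le> ereal (\<phi> x - \<epsilon>)" by (simp add: F_def)
      with th(2)[of x] have "ereal (\<theta> x) \<le> ereal (\<phi> x - \<epsilon>)" by (rule order_trans)
      then show "x \<in> S" using So[of x] e by (cases "x \<in> S") auto
    qed
    then have F: "compact F" using \<open>closed F\<close> S by (metis closed_Int_compact inf.absorb1)
    have "compact (F \<inter> A)" using F cl by (rule compact_Int_closed)
    moreover have "v x < ereal (\<phi> x)" if "x \<in> F \<inter> A" for x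
      using that e unfolding F_def by (auto intro: le_less_trans)
    ultimately obtain \<xi> where chi: "\<xi> \<in> cc_functions" "\<forall>x. 0 \<le> \<xi> x" "\<forall>x\<in>F \<inter> A. 1 \<le> \<xi> x" "\<nu> \<xi> < \<epsilon>"
      using null[of "F \<inter> A" \<epsilon>] e by auto
    define D where "D = F \<inter> {x. \<xi> x \<le> 1/2}"
    have "closed {x. \<xi> x \<le> 1/2}" by (intro closed_Collect_le cc_cont[OF chi(1)] continuous_on_const)
    then have D: "compact D" unfolding D_def using F by (intro compact_Int_closed)
    have DA: "D \<subseteq> - A" unfolding D_def using chi(3) by force
    from cc_bump[OF lc D open_Compl[OF cl] DA]
    obtain \<xi>' where chi'[rule_format]: "\<xi>' \<in> cc_functions" "\<forall>x. 0 \<le> \<xi>' x" "\<forall>x\<in>D. \<xi>' x = 1"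
      "closure {x. \<xi>' x \<noteq> 0} \<subseteq> - A"
      by meson
    have n0: "\<nu> \<xi>' = 0" using nul chi'(1,4) by blast
    \<comment> \<open>\<open>\<phi>\<close> is lowered by \<open>\<epsilon>\<close> on
      \<open>S\<close> and by at least \<open>M\<close> on \<open>F\<close>: the term with
      \<open>\<xi>\<close> achieves the latter where \<open>\<xi> > 1/2\<close>, the term with
      \<open>\<xi>'\<close> on the rest \<open>D\<close> of \<open>F\<close>. Since \<open>D\<close>
      misses \<open>A\<close>, the second term costs nothing, and the first costs at most
      \<open>2 * M * \<epsilon>\<close>.\<close>
    define \<omega> where "\<omega> = (\<lambda>x. 1 * (1 * \<phi> x + (-\<epsilon>) * \<eta> x) + 1 * ((-2*M) * \<xi> x + (-M) * \<xi>' x))"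
    have om: "\<omega> \<in> cc_functions" unfolding \<omega>_def using phi eta(1) chi(1) chi'(1) by (intro cc_lin)
    have nom: "\<nu> \<omega> = \<nu> \<phi> - \<epsilon> * \<nu> \<eta> - 2 * M * \<nu> \<xi>"
      unfolding \<omega>_def using phi eta(1) chi(1) chi'(1) n0
      by (simp only: rm_lin[OF pm_rm[OF nup]] cc_lin) (simp add: algebra_simps)
    have pos: "0 \<le> M * \<xi> x" "0 \<le> M * \<xi>' x" "0 \<le> \<epsilon> * \<eta> x" for x
      using M(1) chi(2) chi'(2) eta(2) e by simp_all
    have "ereal (\<omega> x) \<le> v x" for x
    proof (cases "x \<in> F")
      case False
      then have lt: "ereal (\<phi> x - \<epsilon>) < v x" by (auto simp: F_def)
      show ?thesis
      proof (cases "x \<in> S")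
        case True
        have "\<omega> x \<le> \<phi> x - \<epsilon>" using eta(4)[OF True] pos[of x] by (simp add: \<omega>_def)
        then show ?thesis using lt by (meson ereal_less_eq(3) less_imp_le order_trans)
      next
        case False
        have "\<omega> x \<le> 0" using So[OF False] pos[of x] by (simp add: \<omega>_def)
        then have "ereal (\<omega> x) \<le> ereal (\<theta> x)" using So[OF False] by simp
        then show ?thesis using th(2) order_trans by blast
      qed
    next
      case True
      then have xS: "x \<in> S" using FS by auto
      have "M \<le> 2 * M * \<xi> x + M * \<xi>' x"
      proof (cases "\<xi> x \<le> 1/2")
        case le: True
        then show ?thesis using chi'(3)[of x] True chi(2) M(1) by (auto simp: D_def)
      next
        case False
        then have "M * 1 \<le> M * (2 * \<xi> x)" using M(1) by (intro mult_left_mono) auto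
        then show ?thesis using M(1) chi'(2)[of x] mult_nonneg_nonneg[of M "\<xi>' x"] by linarith
      qed
      then have "\<omega> x \<le> \<phi> x - M" using pos(3)[of x] by (simp add: \<omega>_def)
      then have "\<omega> x \<le> \<theta> x" using M(2)[of x] by linarith
      then show ?thesis using th(2)[of x] by (meson ereal_less_eq(3) order_trans)
    qed
    then have le1: "ereal (\<nu> \<omega>) \<le> positive_integral \<nu> v"
      unfolding positive_integral_def using om by (intro SUP_upper) auto
    have "M * \<nu> \<xi> \<le> M * \<epsilon>" using chi(4) M(1) by (intro mult_left_mono) auto
    then have "\<nu> \<phi> \<le> \<nu> \<omega> + \<epsilon> * (\<nu> \<eta> + 2 * M)" unfolding nom by (simp add: algebra_simps)
    then have "ereal (\<nu> \<phi>) \<le> ereal (\<nu> \<omega>) + ereal (\<epsilon> * (\<nu> \<eta> + 2 * M))" by simp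
    then show ?thesis using le1 by (meson add_right_mono order_trans)
  qed
  have C: "0 \<le> \<nu> \<eta> + 2 * M" using pm_nonneg[OF nup eta(1,2)] M(1) by simp
  show ?thesis
  proof (rule ereal_le_epsilon2)
    fix e :: real assume e: "0 < e"
    let ?\<epsilon> = "e / (\<nu> \<eta> + 2 * M + 1)"
    have "?\<epsilon> > 0" using e C by simp
    from main[OF this] have "ereal (\<nu> \<phi>) \<le> positive_integral \<nu> v + ereal (?\<epsilon> * (\<nu> \<eta> + 2 * M))" .
    moreover have "?\<epsilon> * (\<nu> \<eta> + 2 * M) \<le> e" using C e by (simp add: field_simps)
    ultimately show "ereal (\<nu> \<phi>) \<le> positive_integral \<nu> v + ereal e"
      by (meson add_left_mono ereal_less_eq(3) order_trans)
  qed
qed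

text \<open>The case of an empty exceptional set: the inequality \<open>\<phi> \<le> v\<close> is
  only visible to \<open>\<nu>\<close> on its support.\<close>

lemma le_positive_integral_on:
  fixes \<nu> :: "'b::t2_space functional"
  assumes lc: "locally_compact_space (euclidean :: 'b topology)"
    and nu: "\<nu> \<in> positive_measures_on A" and cl: "closed A" and phi: "\<phi> \<in> cc_functions"
    and v: "\<And>t. open {x. t < v x}" and th: "\<theta> \<in> cc_functions" "\<And>x. ereal (\<theta> x) \<le> v x"
    and le: "\<And>x. x \<in> A \<Longrightarrow> ereal (\<phi> x) \<le> v x"
  shows "ereal (\<nu> \<phi>) \<le> positive_integral \<nu> v"
proof (rule le_positive_integral_of_null[OF lc nu cl phi v th])
  fix K and \<delta> :: real assume "K \<subseteq> A" "\<And>x. x \<in> K \<Longrightarrow> v x < ereal (\<phi> x)" "0 < \<delta>"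
  then have "K = {}" using le by (force simp: not_le)
  moreover have "\<nu> (\<lambda>x. 0) = 0" using nu rm_zero pm_rm by (auto simp: positive_measures_on_def)
  ultimately show "\<exists>\<xi>\<in>cc_functions. (\<forall>x. 0 \<le> \<xi> x) \<and> (\<forall>x\<in>K. 1 \<le> \<xi> x) \<and> \<nu> \<xi> < \<delta>"
    using \<open>0 < \<delta>\<close> by (intro bexI[of _ "\<lambda>x. 0"]) auto
qed

lemma pm_on_pm: "\<nu> \<in> positive_measures_on A \<Longrightarrow> \<nu> \<in> positive_measures"
  by (simp add: positive_measures_on_def)

lemma pm_on_null:
  fixes \<nu> :: "'b::t2_space functional"
  assumes "locally_compact_space (euclidean :: 'b topology)" "\<nu> \<in> positive_measures_on A"
    "\<phi> \<in> cc_functions" "closure {x. \<phi> x \<noteq> 0} \<inter> A = {}"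
  shows "\<nu> \<phi> = 0"
  using assms(2,4) by (intro null_outside_support[OF assms(1) _ assms(3)]) (auto simp: positive_measures_on_def)

section \<open>Linear combinations, densities and the order of measures\<close>

definition radon_comb :: "real \<Rightarrow> 'b::topological_space functional \<Rightarrow> real \<Rightarrow> 'b functional \<Rightarrow> 'b functional" where
  "radon_comb s \<nu> t \<mu> = (\<lambda>\<phi>\<in>cc_functions. s * \<nu> \<phi> + t * \<mu> \<phi>)"

definition zero_measure :: "'b::topological_space functional" where
  "zero_measure = (\<lambda>\<phi>\<in>cc_functions. 0)"

definition radon_density :: "('b \<Rightarrow> real) \<Rightarrow> 'b::topological_space functional \<Rightarrow> 'b functional" where
  "radon_density f \<nu> = (\<lambda>\<phi>\<in>cc_functions. \<nu> (\<lambda>x. f x * \<phi> x))"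

definition measure_le :: "'b::topological_space functional \<Rightarrow> 'b functional \<Rightarrow> bool" where
  "measure_le \<nu> \<mu> \<longleftrightarrow> (\<forall>\<phi>\<in>cc_functions. (\<forall>x. 0 \<le> \<phi> x) \<longrightarrow> \<nu> \<phi> \<le> \<mu> \<phi>)"

lemma radon_comb_apply [simp]: "\<phi> \<in> cc_functions \<Longrightarrow> radon_comb s \<nu> t \<mu> \<phi> = s * \<nu> \<phi> + t * \<mu> \<phi>"
  by (simp add: radon_comb_def)

lemma radon_diff_apply [simp]: "\<phi> \<in> cc_functions \<Longrightarrow> radon_diff \<nu> \<mu> \<phi> = \<nu> \<phi> - \<mu> \<phi>"
  by (simp add: radon_diff_def)

lemma zero_measure_apply [simp]: "\<phi> \<in> cc_functions \<Longrightarrow> zero_measure \<phi> = 0"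
  by (simp add: zero_measure_def)

lemma radon_density_apply [simp]: "\<phi> \<in> cc_functions \<Longrightarrow> radon_density f \<nu> \<phi> = \<nu> (\<lambda>x. f x * \<phi> x)"
  by (simp add: radon_density_def)

lemma radon_comb_ext [simp]: "radon_comb s \<nu> t \<mu> \<in> extensional cc_functions"
  by (simp add: radon_comb_def)

lemma radon_diff_ext [simp]: "radon_diff \<nu> \<mu> \<in> extensional cc_functions"
  by (simp add: radon_diff_def)

lemma zero_measure_ext [simp]: "zero_measure \<in> extensional cc_functions"
  by (simp add: zero_measure_def)

lemma radon_density_ext [simp]: "radon_density f \<nu> \<in> extensional cc_functions"
  by (simp add: radon_density_def)

lemma radon_diff_eq_comb: "radon_diff \<nu> \<mu> = radon_comb 1 \<nu> (-1) \<mu>"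
  by (simp add: radon_diff_def radon_comb_def)

lemma radon_comb_rm:
  fixes \<nu> \<mu> :: "'b::t2_space functional"
  assumes "\<nu> \<in> radon_measures" "\<mu> \<in> radon_measures"
  shows "radon_comb s \<nu> t \<mu> \<in> radon_measures"
  unfolding radon_measures_def
proof (intro CollectI conjI ballI allI impI radon_comb_ext)
  fix \<phi> \<psi> :: "'b \<Rightarrow> real" and p q assume "\<phi> \<in> cc_functions" "\<psi> \<in> cc_functions"
  then show "radon_comb s \<nu> t \<mu> (\<lambda>x. p * \<phi> x + q * \<psi> x) = p * radon_comb s \<nu> t \<mu> \<phi> + q * radon_comb s \<nu> t \<mu> \<psi>"
    using assms by (simp add: cc_lin rm_lin algebra_simps)
next
  fix K :: "'b set" assume K: "compact K"
  obtain M1 where M1: "\<forall>\<phi>\<in>cc_functions. \<forall>B. closure {x. \<phi> x \<noteq> 0} \<subseteq> K \<and> (\<forall>x. \<bar>\<phi> x\<bar> \<le> B) \<longrightarrow> \<bar>\<nu> \<phi>\<bar> \<le> M1 * B"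
    using assms(1) K unfolding radon_measures_def by auto
  obtain M2 where M2: "\<forall>\<phi>\<in>cc_functions. \<forall>B. closure {x. \<phi> x \<noteq> 0} \<subseteq> K \<and> (\<forall>x. \<bar>\<phi> x\<bar> \<le> B) \<longrightarrow> \<bar>\<mu> \<phi>\<bar> \<le> M2 * B"
    using assms(2) K unfolding radon_measures_def by auto
  show "\<exists>M. \<forall>\<phi>\<in>cc_functions. \<forall>B. closure {x. \<phi> x \<noteq> 0} \<subseteq> K \<and> (\<forall>x. \<bar>\<phi> x\<bar> \<le> B) \<longrightarrow>
      \<bar>radon_comb s \<nu> t \<mu> \<phi>\<bar> \<le> M * B"
  proof (intro exI[of _ "\<bar>s\<bar> * M1 + \<bar>t\<bar> * M2"] ballI allI impI)
    fix \<phi> :: "'b \<Rightarrow> real" and B assume phi: "\<phi> \<in> cc_functions" and *: "closure {x. \<phi> x \<noteq> 0} \<subseteq> K \<and> (\<forall>x. \<bar>\<phi> x\<bar> \<le> B)"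
    have "\<bar>\<nu> \<phi>\<bar> \<le> M1 * B" "\<bar>\<mu> \<phi>\<bar> \<le> M2 * B" using M1 M2 phi * by auto
    then have "\<bar>s\<bar> * \<bar>\<nu> \<phi>\<bar> \<le> \<bar>s\<bar> * (M1 * B)" "\<bar>t\<bar> * \<bar>\<mu> \<phi>\<bar> \<le> \<bar>t\<bar> * (M2 * B)"
      by (simp_all add: mult_left_mono)
    moreover have "\<bar>s * \<nu> \<phi> + t * \<mu> \<phi>\<bar> \<le> \<bar>s\<bar> * \<bar>\<nu> \<phi>\<bar> + \<bar>t\<bar> * \<bar>\<mu> \<phi>\<bar>"
      by (metis abs_mult abs_triangle_ineq)
    ultimately show "\<bar>radon_comb s \<nu> t \<mu> \<phi>\<bar> \<le> (\<bar>s\<bar> * M1 + \<bar>t\<bar> * M2) * B"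
      using phi by (simp add: algebra_simps)
  qed
qed

lemma radon_comb_pm:
  fixes \<nu> \<mu> :: "'b::t2_space functional"
  assumes "\<nu> \<in> positive_measures" "\<mu> \<in> positive_measures" "0 \<le> s" "0 \<le> t"
  shows "radon_comb s \<nu> t \<mu> \<in> positive_measures"
  using radon_comb_rm[OF pm_rm[OF assms(1)] pm_rm[OF assms(2)]] assms
  by (auto simp: positive_measures_def intro!: add_nonneg_nonneg mult_nonneg_nonneg)

lemma radon_diff_rm:
  fixes \<nu> \<mu> :: "'b::t2_space functional"
  assumes "\<nu> \<in> radon_measures" "\<mu> \<in> radon_measures"
  shows "radon_diff \<nu> \<mu> \<in> radon_measures"
  unfolding radon_diff_eq_comb by (rule radon_comb_rm[OF assms])

lemma radon_diff_pm:
  fixes \<nu> \<mu> :: "'b::t2_space functional"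
  assumes "\<nu> \<in> radon_measures" "\<mu> \<in> radon_measures" "measure_le \<mu> \<nu>"
  shows "radon_diff \<nu> \<mu> \<in> positive_measures"
  using radon_diff_rm[OF assms(1,2)] assms(3) by (auto simp: positive_measures_def measure_le_def)

lemma zero_measure_pm [simp]: "(zero_measure :: 'b::t2_space functional) \<in> positive_measures"
  by (auto simp: positive_measures_def radon_measures_def cc_lin intro!: exI[of _ 0])

lemma radon_comb_on:
  fixes \<nu> \<mu> :: "'b::t2_space functional"
  assumes lc: "locally_compact_space (euclidean :: 'b topology)" and "closed A"
    and "\<nu> \<in> positive_measures_on A" "\<mu> \<in> positive_measures_on A" "0 \<le> s" "0 \<le> t"
  shows "radon_comb s \<nu> t \<mu> \<in> positive_measures_on A"
  using assms(3-6) unfolding positive_measures_on_iff[OF lc assms(2)]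
  by (simp add: radon_comb_pm)

lemma zero_measure_on:
  assumes lc: "locally_compact_space (euclidean :: 'b::t2_space topology)" and "closed A"
  shows "(zero_measure :: 'b functional) \<in> positive_measures_on A"
  unfolding positive_measures_on_iff[OF assms] by simp

lemma radon_density_pm:
  fixes \<nu> :: "'b::t2_space functional"
  assumes lc: "locally_compact_space (euclidean :: 'b topology)"
    and "\<nu> \<in> positive_measures" and f: "continuous_on UNIV f" "\<And>x. 0 \<le> f x"
  shows "radon_density f \<nu> \<in> positive_measures"
proof (rule positive_measuresI[OF lc radon_density_ext])
  fix \<phi> \<psi> :: "'b \<Rightarrow> real" and s t assume *: "\<phi> \<in> cc_functions" "\<psi> \<in> cc_functions"
  have "(\<lambda>x. f x * (s * \<phi> x + t * \<psi> x)) = (\<lambda>x. s * (f x * \<phi> x) + t * (f x * \<psi> x))"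
    by (simp add: algebra_simps)
  then show "radon_density f \<nu> (\<lambda>x. s * \<phi> x + t * \<psi> x) = s * radon_density f \<nu> \<phi> + t * radon_density f \<nu> \<psi>"
    using * rm_lin[OF pm_rm[OF assms(2)] cc_mult[OF f(1) *(1)] cc_mult[OF f(1) *(2)]] by (simp add: cc_lin)
next
  fix \<phi> :: "'b \<Rightarrow> real" assume phi: "\<phi> \<in> cc_functions" "\<And>x. 0 \<le> \<phi> x"
  then have "0 \<le> \<nu> (\<lambda>x. f x * \<phi> x)"
    using f(2) by (intro pm_nonneg[OF assms(2) cc_mult[OF f(1) phi(1)]]) simp
  then show "0 \<le> radon_density f \<nu> \<phi>" using phi(1) by simp
qed

lemma radon_density_on:
  fixes \<nu> :: "'b::t2_space functional"
  assumes lc: "locally_compact_space (euclidean :: 'b topology)"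
    and A: "closed A" "\<nu> \<in> positive_measures_on A" and f: "continuous_on UNIV f" "\<And>x. 0 \<le> f x"
    and C: "closed C" "\<And>x. x \<notin> C \<Longrightarrow> f x = 0"
  shows "radon_density f \<nu> \<in> positive_measures_on (A \<inter> C)"
proof -
  have nu: "\<nu> \<in> positive_measures" by (rule pm_on_pm[OF A(2)])
  have "radon_density f \<nu> \<phi> = 0" if phi: "\<phi> \<in> cc_functions" and dis: "closure {x. \<phi> x \<noteq> 0} \<inter> (A \<inter> C) = {}" for \<phi>
  proof -
    have "closure {x. f x * \<phi> x \<noteq> 0} \<subseteq> closure {x. \<phi> x \<noteq> 0}" by (rule closure_mono) auto
    moreover have "closure {x. f x * \<phi> x \<noteq> 0} \<subseteq> C" by (rule cc_support_subset[OF C(1)]) (simp add: C(2))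
    ultimately have "closure {x. f x * \<phi> x \<noteq> 0} \<inter> A = {}" using dis by blast
    then show ?thesis using pm_on_null[OF lc A(2) cc_mult[OF f(1) phi]] phi by simp
  qed
  then show ?thesis
    using radon_density_pm[OF lc nu f] A(1) C(1) by (simp add: positive_measures_on_iff[OF lc closed_Int])
qed

lemma radon_density_le:
  fixes \<nu> :: "'b::t2_space functional"
  assumes "\<nu> \<in> positive_measures" and f: "continuous_on UNIV f" "\<And>x. f x \<le> 1"
  shows "measure_le (radon_density f \<nu>) \<nu>"
  unfolding measure_le_def
proof (intro ballI impI)
  fix \<phi> :: "'b \<Rightarrow> real" assume phi: "\<phi> \<in> cc_functions" "\<forall>x. 0 \<le> \<phi> x"
  have "f x * \<phi> x \<le> \<phi> x" for x using mult_right_mono[OF f(2)[of x], of "\<phi> x"] phi(2) by simp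
  then show "radon_density f \<nu> \<phi> \<le> \<nu> \<phi>"
    using pm_mono[OF assms(1) cc_mult[OF f(1) phi(1)] phi(1)] phi(1) by simp
qed

lemma measure_le_on:
  fixes \<nu> :: "'b::t2_space functional"
  assumes lc: "locally_compact_space (euclidean :: 'b topology)" and A: "closed A"
    and "\<mu> \<in> positive_measures_on A" "\<nu> \<in> positive_measures" "measure_le \<nu> \<mu>"
  shows "\<nu> \<in> positive_measures_on A"
  unfolding positive_measures_on_iff[OF lc A]
proof (intro conjI ballI impI assms)
  fix \<phi> :: "'b \<Rightarrow> real" assume phi: "\<phi> \<in> cc_functions" and dis: "closure {x. \<phi> x \<noteq> 0} \<inter> A = {}"
  let ?\<psi> = "\<lambda>x. max (\<phi> x) (- \<phi> x)"
  have psi: "?\<psi> \<in> cc_functions" using phi by (intro cc_max cc_uminus)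
  have "closure {x. ?\<psi> x \<noteq> 0} \<subseteq> closure {x. \<phi> x \<noteq> 0}" by (rule closure_mono) auto
  then have "closure {x. ?\<psi> x \<noteq> 0} \<inter> A = {}" using dis by blast
  then have "\<mu> ?\<psi> = 0" by (rule pm_on_null[OF lc assms(3) psi])
  moreover have "\<nu> ?\<psi> \<le> \<mu> ?\<psi>" using assms(5) psi by (auto simp: measure_le_def)
  moreover have "\<nu> \<phi> \<le> \<nu> ?\<psi>" "\<nu> (\<lambda>x. - \<phi> x) \<le> \<nu> ?\<psi>"
    by (rule pm_mono[OF assms(4) phi psi], simp) (rule pm_mono[OF assms(4) cc_uminus[OF phi] psi], simp)
  ultimately show "\<nu> \<phi> = 0" using rm_scale[OF pm_rm[OF assms(4)] phi, of "-1"] by simp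
qed


section \<open>Upper integrals as functions of the measure\<close>

lemma positive_integral_gt:
  assumes "\<theta> \<in> cc_functions" "\<And>x. ereal (\<theta> x) \<le> \<psi> x"
  shows "ereal (\<nu> \<theta>) \<le> positive_integral \<nu> \<psi>" "positive_integral \<nu> \<psi> \<noteq> - \<infinity>"
proof -
  show *: "ereal (\<nu> \<theta>) \<le> positive_integral \<nu> \<psi>"
    unfolding positive_integral_def using assms by (intro SUP_upper) auto
  then show "positive_integral \<nu> \<psi> \<noteq> - \<infinity>" by auto
qed

lemma positive_integral_le:
  assumes "\<And>\<phi>. \<phi> \<in> cc_functions \<Longrightarrow> (\<And>x. ereal (\<phi> x) \<le> \<psi> x) \<Longrightarrow> ereal (\<nu> \<phi>) \<le> c"
  shows "positive_integral \<nu> \<psi> \<le> c"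
  unfolding positive_integral_def using assms by (intro SUP_least) auto

lemma positive_integral_less:
  assumes "c < positive_integral \<nu> \<psi>"
  obtains \<phi> where "\<phi> \<in> cc_functions" "\<And>x. ereal (\<phi> x) \<le> \<psi> x" "c < ereal (\<nu> \<phi>)"
  using assms unfolding positive_integral_def less_SUP_iff by auto

lemma positive_integral_nonneg:
  fixes \<nu> :: "'b::t2_space functional"
  assumes "\<nu> \<in> positive_measures" "\<And>x. 0 \<le> \<psi> x"
  shows "0 \<le> positive_integral \<nu> \<psi>"
  using positive_integral_gt(1)[OF cc_zero, of \<psi> \<nu>] assms rm_zero[OF pm_rm[OF assms(1)]]
  by (simp add: zero_ereal_def)

lemma positive_integral_cc:
  fixes \<nu> :: "'b::t2_space functional"
  assumes "\<nu> \<in> positive_measures" "\<phi> \<in> cc_functions"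
  shows "positive_integral \<nu> (\<lambda>x. ereal (\<phi> x)) = ereal (\<nu> \<phi>)"
  by (intro antisym positive_integral_le positive_integral_gt) (simp_all add: assms pm_mono)

text \<open>The minorants of \<open>\<psi>\<close> are directed upwards by maxima, so both suprema
  may be taken along the same function. The minorant \<open>\<theta>\<close> makes the index set
  nonempty and keeps the sum away from \<open>\<infinity> - \<infinity>\<close>.\<close>

lemma positive_integral_comb:
  fixes \<nu> \<mu> :: "'b::t2_space functional"
  assumes nu: "\<nu> \<in> positive_measures" and mu: "\<mu> \<in> positive_measures" and st: "0 \<le> s" "0 \<le> t"
    and th: "\<theta> \<in> cc_functions" "\<And>x. ereal (\<theta> x) \<le> \<psi> x"
  shows "positive_integral (radon_comb s \<nu> t \<mu>) \<psi> =
    ereal s * positive_integral \<nu> \<psi> + ereal t * positive_integral \<mu> \<psi>"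
proof -
  define D where "D = {\<phi>\<in>cc_functions. \<forall>x. ereal (\<phi> x) \<le> \<psi> x}"
  have D: "D \<noteq> {}" using th by (auto simp: D_def)
  have Dcc: "\<phi> \<in> cc_functions" if "\<phi> \<in> D" for \<phi> using that by (simp add: D_def)
  have e1: "ereal s * positive_integral \<nu> \<psi> = (SUP \<phi>\<in>D. ereal (s * \<nu> \<phi>))"
    unfolding positive_integral_def D_def[symmetric] using Sup_ereal_mult_left'[OF D st(1), of "\<lambda>\<phi>. ereal (\<nu> \<phi>)"] by simp
  have e2: "ereal t * positive_integral \<mu> \<psi> = (SUP \<phi>\<in>D. ereal (t * \<mu> \<phi>))"
    unfolding positive_integral_def D_def[symmetric] using Sup_ereal_mult_left'[OF D st(2), of "\<lambda>\<phi>. ereal (\<mu> \<phi>)"] by simp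
  have e3: "positive_integral (radon_comb s \<nu> t \<mu>) \<psi> = (SUP \<phi>\<in>D. ereal (s * \<nu> \<phi>) + ereal (t * \<mu> \<phi>))"
    unfolding positive_integral_def D_def[symmetric] using Dcc by (intro SUP_cong) auto
  let ?S = "SUP \<phi>\<in>D. ereal (s * \<nu> \<phi>) + ereal (t * \<mu> \<phi>)"
  have "?S \<le> (SUP \<phi>\<in>D. ereal (s * \<nu> \<phi>)) + (SUP \<phi>\<in>D. ereal (t * \<mu> \<phi>))"
    by (intro SUP_least add_mono SUP_upper)
  moreover have "(SUP \<phi>\<in>D. ereal (s * \<nu> \<phi>)) + (SUP \<phi>\<in>D. ereal (t * \<mu> \<phi>)) \<le> ?S"
  proof -
    have ne: "(SUP \<phi>\<in>D. ereal (t * \<mu> \<phi>)) \<noteq> -\<infinity>" using D by (auto simp: Sup_eq_MInfty)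
    have "(SUP \<phi>\<in>D. ereal (s * \<nu> \<phi>)) + (SUP \<phi>\<in>D. ereal (t * \<mu> \<phi>))
        = (SUP \<phi>\<in>D. ereal (s * \<nu> \<phi>) + (SUP \<phi>'\<in>D. ereal (t * \<mu> \<phi>')))"
      using SUP_ereal_add_left[OF D ne, of "\<lambda>\<phi>. ereal (s * \<nu> \<phi>)"] by simp
    also have "\<dots> = (SUP \<phi>\<in>D. SUP \<phi>'\<in>D. ereal (s * \<nu> \<phi>) + ereal (t * \<mu> \<phi>'))"
      by (intro SUP_cong refl SUP_ereal_add_right[symmetric] D) simp
    also have "\<dots> \<le> ?S"
    proof (intro SUP_least)
      fix \<phi> \<phi>' assume *: "\<phi> \<in> D" "\<phi>' \<in> D"
      let ?m = "\<lambda>x. max (\<phi> x) (\<phi>' x)"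
      have m: "?m \<in> D" using * cc_max[of \<phi> \<phi>'] by (simp add: D_def max_def)
      have "\<nu> \<phi> \<le> \<nu> ?m" "\<mu> \<phi>' \<le> \<mu> ?m"
        by (rule pm_mono[OF nu Dcc[OF *(1)] Dcc[OF m]], simp) (rule pm_mono[OF mu Dcc[OF *(2)] Dcc[OF m]], simp)
      then have "s * \<nu> \<phi> + t * \<mu> \<phi>' \<le> s * \<nu> ?m + t * \<mu> ?m" using st by (intro add_mono mult_left_mono)
      then have "ereal (s * \<nu> \<phi>) + ereal (t * \<mu> \<phi>') \<le> ereal (s * \<nu> ?m) + ereal (t * \<mu> ?m)" by simp
      also have "\<dots> \<le> ?S" using m by (rule SUP_upper)
      finally show "ereal (s * \<nu> \<phi>) + ereal (t * \<mu> \<phi>') \<le> ?S" .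
    qed
    finally show ?thesis .
  qed
  ultimately show ?thesis using e1 e2 e3 by simp
qed

lemma radon_comb_add_diff:
  assumes "\<nu> \<in> radon_measures"
  shows "radon_comb 1 \<mu> 1 (radon_diff \<nu> \<mu>) = \<nu>"
  using assms by (intro functional_eqI) (auto simp: rm_ext)

lemma positive_integral_add_diff:
  fixes \<nu> \<mu> :: "'b::t2_space functional"
  assumes "\<nu> \<in> positive_measures" "\<mu> \<in> positive_measures" "measure_le \<mu> \<nu>"
    and "\<theta> \<in> cc_functions" "\<And>x. ereal (\<theta> x) \<le> \<psi> x"
  shows "positive_integral \<nu> \<psi> = positive_integral \<mu> \<psi> + positive_integral (radon_diff \<nu> \<mu>) \<psi>"
  using positive_integral_comb[OF assms(2) radon_diff_pm[OF pm_rm[OF assms(1)] pm_rm[OF assms(2)] assms(3)], of 1 1 \<theta> \<psi>]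
    radon_comb_add_diff[OF pm_rm[OF assms(1)], of \<mu>] assms(4,5) by (simp add: one_ereal_def[symmetric])

text \<open>For \<open>\<psi>\<close> of both signs the integral need not be monotone in the
  measure. But \<open>\<nu>\<close> is \<open>\<mu>\<close> plus a positive measure whose integral
  is not \<open>- \<infinity>\<close>, so an infinite integral of \<open>\<mu>\<close> could not be
  compensated.\<close>

lemma positive_integral_finite_le:
  fixes \<nu> \<mu> :: "'b::t2_space functional"
  assumes "\<nu> \<in> positive_measures" "\<mu> \<in> positive_measures" "measure_le \<mu> \<nu>"
    and th: "\<theta> \<in> cc_functions" "\<And>x. ereal (\<theta> x) \<le> \<psi> x"
    and "positive_integral \<nu> \<psi> < \<infinity>"
  shows "positive_integral \<mu> \<psi> < \<infinity>"
  using positive_integral_add_diff[OF assms(1-5)] assms(6) positive_integral_gt(2)[OF th, of "radon_diff \<nu> \<mu>"]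
  by auto

lemma positive_integral_mono:
  fixes \<nu> \<mu> :: "'b::t2_space functional"
  assumes "\<nu> \<in> positive_measures" "\<mu> \<in> positive_measures" "measure_le \<mu> \<nu>" "\<And>x. 0 \<le> \<psi> x"
  shows "positive_integral \<mu> \<psi> \<le> positive_integral \<nu> \<psi>"
proof -
  have "0 \<le> positive_integral (radon_diff \<nu> \<mu>) \<psi>"
    using radon_diff_pm[OF pm_rm[OF assms(1)] pm_rm[OF assms(2)] assms(3)] assms(4) by (rule positive_integral_nonneg)
  then show ?thesis
    using positive_integral_add_diff[OF assms(1-3) cc_zero, of \<psi>] assms(4) by (simp add: zero_ereal_def[symmetric] ereal_le_add_self)
qed

text \<open>On a compact space a lower semicontinuous function is bounded below and constants are
  test functions; otherwise the class itself demands \<open>\<psi> \<ge> 0\<close>.\<close>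

lemma lsc_class_minorant:
  fixes \<psi> :: "'b::t2_space \<Rightarrow> ereal"
  assumes "\<psi> \<in> lsc_class"
  obtains \<theta> where "\<theta> \<in> cc_functions" "\<And>x. ereal (\<theta> x) \<le> \<psi> x"
proof (cases "compact (UNIV :: 'b set)")
  case True
  have op: "open {y. ereal (- real n) < \<psi> y}" for n using assms by (simp add: lsc_class_def)
  have cov: "UNIV \<subseteq> (\<Union>n\<in>UNIV. {y. ereal (- real n) < \<psi> y})"
  proof
    fix y :: 'b
    have "\<psi> y \<noteq> - \<infinity>" using assms by (simp add: lsc_class_def)
    then obtain n where "- \<psi> y < ereal (real n)" using less_PInf_Ex_of_nat[of "- \<psi> y"]
      by (auto simp: ereal_uminus_eq_reorder)
    then have "ereal (- real n) < \<psi> y" by (cases "\<psi> y") auto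
    then show "y \<in> (\<Union>n\<in>UNIV. {y. ereal (- real n) < \<psi> y})" by blast
  qed
  obtain N where N: "finite N" "UNIV \<subseteq> (\<Union>n\<in>N. {y. ereal (- real n) < \<psi> y})"
    using compactE_image[OF True, of UNIV "\<lambda>n. {y. ereal (- real n) < \<psi> y}"] op cov by metis
  define m where "m = (\<Sum>n\<in>N. real n)"
  have "ereal (- m) \<le> \<psi> y" for y
  proof -
    obtain n where n: "n \<in> N" "ereal (- real n) < \<psi> y" using N(2) by blast
    have "real n \<le> m" unfolding m_def using n N(1) by (intro member_le_sum) auto
    then have "ereal (- m) \<le> ereal (- real n)" by simp
    then show ?thesis using n(2) by (meson less_imp_le order_trans)
  qed
  moreover have "(\<lambda>_::'b. - m) \<in> cc_functions" using True by (intro cc_functionsI[of _ UNIV]) auto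
  ultimately show ?thesis by (rule that[rotated])
next
  case False
  then have "\<And>x. ereal 0 \<le> \<psi> x" using assms by (simp add: lsc_class_def zero_ereal_def)
  then show ?thesis using that[OF cc_zero] by blast
qed


section \<open>Vague compactness and cluster points\<close>

text \<open>\<open>G\<close> joins \<open>F\<close> with the neighbourhood filter of
  \<open>l\<close> pulled back along \<open>f\<close>; it plays the role of a convergent
  subnet.\<close>

lemma cluster_pointE:
  assumes "cluster_point T f F l"
  obtains G where "G \<noteq> bot" "G \<le> F"
    "\<And>U. openin T U \<Longrightarrow> l \<in> U \<Longrightarrow> eventually (\<lambda>i. f i \<in> U) G"
    "\<And>L. continuous_map T euclideanreal L \<Longrightarrow> ((\<lambda>i. L (f i)) \<longlongrightarrow> L l) G"
proof -
  define G where "G = inf F (filtercomap f (nhdsin T l))"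
  have lT: "l \<in> topspace T" using assms by (simp add: cluster_point_def)
  have *: "eventually (\<lambda>i. f i \<in> U) G" if "openin T U" "l \<in> U" for U
  proof -
    have "eventually (\<lambda>x. x \<in> U) (nhdsin T l)" using that by (auto simp: eventually_nhdsin)
    then have "eventually (\<lambda>i. f i \<in> U) (filtercomap f (nhdsin T l))" by (auto simp: eventually_filtercomap)
    then show ?thesis unfolding G_def by (rule filter_leD[OF inf_le2])
  qed
  have "G \<noteq> bot"
  proof
    assume "G = bot"
    then have "eventually (\<lambda>_. False) G" by simp
    then obtain Q R where Q: "eventually Q F" and R: "eventually R (filtercomap f (nhdsin T l))"
      and QR: "\<And>x. Q x \<Longrightarrow> R x \<Longrightarrow> False" unfolding G_def eventually_inf by blast
    obtain S where S: "eventually S (nhdsin T l)" "\<And>x. S (f x) \<Longrightarrow> R x" using R by (auto simp: eventually_filtercomap)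
    obtain U where U: "openin T U" "l \<in> U" "\<And>x. x \<in> U \<Longrightarrow> S x" using S(1) lT by (auto simp: eventually_nhdsin)
    have "frequently (\<lambda>i. f i \<in> U) F" using assms U by (simp add: cluster_point_def)
    moreover have "eventually (\<lambda>i. f i \<notin> U) F" using Q by eventually_elim (use QR S U in blast)
    ultimately show False by (simp add: frequently_def)
  qed
  moreover have "((\<lambda>i. L (f i)) \<longlongrightarrow> L l) G" if L: "continuous_map T euclideanreal L" for L
  proof (rule topological_tendstoI)
    fix V :: "real set" assume "open V" "L l \<in> V"
    then have "openin T {x \<in> topspace T. L x \<in> V}" "l \<in> {x \<in> topspace T. L x \<in> V}"
      using L lT by (auto simp: continuous_map_def)
    from *[OF this] show "eventually (\<lambda>i. L (f i) \<in> V) G" by eventually_elim simp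
  qed
  ultimately show ?thesis using * by (intro that[of G]) (auto simp: G_def)
qed

lemma compactin_cluster_point:
  assumes C: "compactin T C" and F: "F \<noteq> bot" "eventually (\<lambda>i. f i \<in> C) F"
  obtains l where "l \<in> C" "cluster_point T f F l"
proof (rule ccontr)
  assume no: "\<not> thesis"
  have "\<exists>U. openin T U \<and> l \<in> U \<and> eventually (\<lambda>i. f i \<notin> U) F" if "l \<in> C" for l
  proof -
    have "\<not> cluster_point T f F l" using no that \<open>l \<in> C\<close> by (metis \<open>\<And>l. \<lbrakk>l \<in> C; cluster_point T f F l\<rbrakk> \<Longrightarrow> thesis\<close>)
    moreover have "l \<in> topspace T" using C \<open>l \<in> C\<close> by (auto simp: compactin_def)
    ultimately show ?thesis by (auto simp: cluster_point_def frequently_def)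
  qed
  then obtain U where U: "\<And>l. l \<in> C \<Longrightarrow> openin T (U l) \<and> l \<in> U l \<and> eventually (\<lambda>i. f i \<notin> U l) F" by metis
  have "(\<forall>V\<in>U ` C. openin T V) \<and> C \<subseteq> \<Union> (U ` C)" using U by blast
  then obtain \<F> where Fi: "finite \<F>" "\<F> \<subseteq> U ` C" "C \<subseteq> \<Union>\<F>"
    using C unfolding compactin_def by meson
  have "eventually (\<lambda>i. \<forall>V\<in>\<F>. f i \<notin> V) F"
    using Fi(1,2) U by (intro eventually_ball_finite) auto
  then have "eventually (\<lambda>i. False) F" using F(2) by eventually_elim (use Fi(3) in blast)
  then show False using F(1) by simp
qed

lemma continuous_map_vague_eval:
  assumes "\<phi> \<in> cc_functions"
  shows "continuous_map vague_topology euclideanreal (\<lambda>\<nu>. \<nu> \<phi>)"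
  unfolding vague_topology_def
  by (rule continuous_map_from_subtopology) (rule continuous_map_product_projection[OF assms, of "\<lambda>_. euclideanreal"])

lemma cluster_point_vagueI:
  assumes "G \<noteq> bot" "\<nu> \<in> radon_measures" "eventually (\<lambda>\<mu>. \<mu> \<in> radon_measures) G"
    and lim: "\<And>\<phi>. \<phi> \<in> cc_functions \<Longrightarrow> ((\<lambda>\<mu>. \<mu> \<phi>) \<longlongrightarrow> \<nu> \<phi>) G"
  shows "cluster_point vague_topology (\<lambda>\<mu>. \<mu>) G \<nu>"
proof -
  have "limitin vague_topology (\<lambda>\<mu>. \<mu>) \<nu> G"
    unfolding vague_topology_def limitin_subtopology limitin_componentwise
    using assms by (auto simp: rm_ext limitin_canonical_iff PiE_def elim!: eventually_mono dest: rm_ext)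
  then show ?thesis
    unfolding cluster_point_def limitin_def using assms(1)
    by (auto intro: eventually_frequently)
qed

lemma closedin_Collect_ball:
  assumes "\<And>p. p \<in> I \<Longrightarrow> closedin X {\<nu> \<in> topspace X. Q p \<nu>}"
  shows "closedin X {\<nu> \<in> topspace X. \<forall>p\<in>I. Q p \<nu>}"
proof (cases "I = {}")
  case True
  then have "{\<nu> \<in> topspace X. \<forall>p\<in>I. Q p \<nu>} = topspace X" by blast
  then show ?thesis by (simp only: closedin_topspace)
next
  case False
  then have "{\<nu> \<in> topspace X. \<forall>p\<in>I. Q p \<nu>} = (\<Inter>p\<in>I. {\<nu> \<in> topspace X. Q p \<nu>})" by auto
  moreover have "closedin X (\<Inter>p\<in>I. {\<nu> \<in> topspace X. Q p \<nu>})"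
    using assms False by (intro closedin_INT) auto
  ultimately show ?thesis by (simp only:)
qed

text \<open>Tychonoff's theorem for the product of the intervals
  \<open>[- M \<phi>, M \<phi>]\<close>. All conditions are closed in the product, the last one
  because the upper integral is a supremum of evaluations. Only the inequality is closed: the value
  \<open>a\<close> itself is lost in the limit when mass escapes.\<close>

lemma vague_compact:
  fixes A :: "'b::t2_space set"
  assumes lc: "locally_compact_space (euclidean :: 'b topology)" and A: "closed A"
    and g: "continuous_on UNIV g" "\<And>x. 0 < g x"
  shows "compactin vague_topology {\<nu> \<in> positive_measures_on A. positive_integral \<nu> (\<lambda>x. ereal (g x)) \<le> ereal a}"
    (is "compactin _ ?T")
proof -
  let ?X = "product_topology (\<lambda>_. euclideanreal) (cc_functions :: ('b \<Rightarrow> real) set)"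
  have tX: "topspace ?X = extensional cc_functions" by (auto simp: PiE_def)
  have ev: "continuous_map ?X euclideanreal (\<lambda>\<nu>. \<nu> \<phi>)" if "\<phi> \<in> cc_functions" for \<phi>
    using continuous_map_product_projection[OF that, of "\<lambda>_. euclideanreal"] .
  have closed_eq: "closedin ?X {\<nu> \<in> topspace ?X. L \<nu> = 0}" if "continuous_map ?X euclideanreal L" for L
    using closedin_continuous_map_preimage[OF that, of "{0}"] by simp
  have closed_le: "closedin ?X {\<nu> \<in> topspace ?X. L \<nu> \<le> c}" if "continuous_map ?X euclideanreal L" for L c
    using closedin_continuous_map_preimage[OF that, of "{..c}"] by simp
  define T1 where "T1 = {\<nu> \<in> topspace ?X. \<forall>p\<in>{(\<phi>,\<psi>,s,t). \<phi> \<in> cc_functions \<and> \<psi> \<in> cc_functions}.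
      (case p of (\<phi>,\<psi>,s,t) \<Rightarrow> \<nu> (\<lambda>x. s * \<phi> x + t * \<psi> x) - (s * \<nu> \<phi> + t * \<nu> \<psi>)) = 0}"
  define T2 where "T2 = {\<nu> \<in> topspace ?X. \<forall>\<phi>\<in>{\<phi>\<in>cc_functions. \<forall>x. 0 \<le> \<phi> x}. 0 - \<nu> \<phi> \<le> 0}"
  define T3 where "T3 = {\<nu> \<in> topspace ?X. \<forall>\<phi>\<in>{\<phi>\<in>cc_functions. closure {x. \<phi> x \<noteq> 0} \<inter> A = {}}. \<nu> \<phi> = 0}"
  define T4 where "T4 = {\<nu> \<in> topspace ?X. \<forall>\<phi>\<in>{\<phi>\<in>cc_functions. \<forall>x. ereal (\<phi> x) \<le> ereal (g x)}. \<nu> \<phi> \<le> a}"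
  have c1: "closedin ?X T1" unfolding T1_def
    by (rule closedin_Collect_ball, rule closed_eq)
      (clarsimp simp: case_prod_beta, intro continuous_map_diff continuous_map_add continuous_map_real_mult ev cc_lin continuous_map_const[THEN iffD2], auto)
  have c2: "closedin ?X T2" unfolding T2_def
    by (rule closedin_Collect_ball, rule closed_le) (auto intro!: continuous_map_diff ev continuous_map_const[THEN iffD2])
  have c3: "closedin ?X T3" unfolding T3_def by (rule closedin_Collect_ball, rule closed_eq) (auto intro!: ev)
  have c4: "closedin ?X T4" unfolding T4_def by (rule closedin_Collect_ball, rule closed_le) (auto intro!: ev)
  have cl: "closedin ?X (T1 \<inter> T2 \<inter> T3 \<inter> T4)" using c1 c2 c3 c4 by (intro closedin_Int)
  have "\<nu> \<in> ?T \<longleftrightarrow> \<nu> \<in> T1 \<inter> T2 \<inter> T3 \<inter> T4" for \<nu>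
  proof
    assume "\<nu> \<in> ?T"
    then have pm: "\<nu> \<in> positive_measures" and nul: "\<forall>\<phi>\<in>cc_functions. closure {x. \<phi> x \<noteq> 0} \<inter> A = {} \<longrightarrow> \<nu> \<phi> = 0"
      and le: "positive_integral \<nu> (\<lambda>x. ereal (g x)) \<le> ereal a"
      using iffD1[OF positive_measures_on_iff[OF lc A]] by auto
    have "\<nu> \<phi> \<le> a" if "\<phi> \<in> cc_functions" "\<forall>x. ereal (\<phi> x) \<le> ereal (g x)" for \<phi>
      using order_trans[OF positive_integral_gt(1)[of \<phi> "\<lambda>x. ereal (g x)" \<nu>] le] that by auto
    then show "\<nu> \<in> T1 \<inter> T2 \<inter> T3 \<inter> T4"
      unfolding T1_def T2_def T3_def T4_def tX
      using rm_lin[OF pm_rm[OF pm]] pm_nonneg[OF pm] rm_ext[OF pm_rm[OF pm]] nul by auto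
  next
    assume nu: "\<nu> \<in> T1 \<inter> T2 \<inter> T3 \<inter> T4"
    have "\<nu> \<in> positive_measures"
      by (rule positive_measuresI[OF lc]) (use nu in \<open>auto simp: T1_def T2_def PiE_def\<close>)
    then have "\<nu> \<in> positive_measures_on A"
      using nu unfolding positive_measures_on_iff[OF lc A] T3_def by blast
    moreover have "positive_integral \<nu> (\<lambda>x. ereal (g x)) \<le> ereal a"
      by (rule positive_integral_le) (use nu in \<open>auto simp: T4_def\<close>)
    ultimately show "\<nu> \<in> ?T" by simp
  qed
  then have Teq: "?T = T1 \<inter> T2 \<inter> T3 \<inter> T4" by blast
  have "\<exists>M. \<forall>\<nu>\<in>?T. \<bar>\<nu> \<phi>\<bar> \<le> M" if phi: "\<phi> \<in> cc_functions" for \<phi>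
  proof -
    \<comment> \<open>On the support of \<open>\<phi>\<close> the weight stays away from 0, so
      \<open>\<phi>\<close> is dominated by a multiple of \<open>g\<close> and the bound on the
      \<open>g\<close>-mass controls \<open>\<nu> \<phi>\<close>. The factor is \<open>B + 1\<close>
      rather than \<open>B\<close> so that it can be inverted.\<close>
    have "(\<lambda>x. inverse (g x) * \<phi> x) \<in> cc_functions"
      using g(2) phi by (intro cc_mult continuous_on_inverse g) (auto simp: less_imp_neq[symmetric])
    then obtain B where B: "0 \<le> B" "\<And>x. \<bar>inverse (g x) * \<phi> x\<bar> \<le> B" using cc_bounded by blast
    have phig: "\<bar>\<phi> x\<bar> \<le> (B + 1) * g x" for x
    proof -
      have "\<bar>\<phi> x\<bar> = g x * \<bar>inverse (g x) * \<phi> x\<bar>" using g(2)[of x] by (simp add: abs_mult)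
      also have "\<dots> \<le> g x * (B + 1)" using B(2)[of x] g(2)[of x] by (intro mult_left_mono) auto
      finally show ?thesis by (simp add: mult.commute)
    qed
    have "\<bar>\<nu> \<phi>\<bar> \<le> (B + 1) * a" if "\<nu> \<in> ?T" for \<nu>
    proof -
      have pm: "\<nu> \<in> positive_measures" and le: "positive_integral \<nu> (\<lambda>x. ereal (g x)) \<le> ereal a"
        using that by (auto simp: positive_measures_on_def)
      have "ereal (\<nu> (\<lambda>x. s * inverse (B + 1) * \<phi> x)) \<le> ereal a" if "\<bar>s\<bar> = 1" for s
      proof (rule order_trans[OF positive_integral_gt(1) le])
        show "(\<lambda>x. s * inverse (B + 1) * \<phi> x) \<in> cc_functions" using phi by (rule cc_scale)
        have "s * \<phi> x \<le> (B + 1) * g x" for x using phig[of x] abs_ge_self[of "s * \<phi> x"] that by (simp add: abs_mult)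
        then show "ereal (s * inverse (B + 1) * \<phi> x) \<le> ereal (g x)" for x using B(1) by (simp add: field_simps)
      qed
      from this[of 1] this[of "-1"]
      have "inverse (B + 1) * \<nu> \<phi> \<le> a" "- (inverse (B + 1) * \<nu> \<phi>) \<le> a"
        using rm_scale[OF pm_rm[OF pm] phi, of "inverse (B + 1)"] rm_scale[OF pm_rm[OF pm] phi, of "- inverse (B + 1)"] by auto
      then show ?thesis using B(1) by (simp add: field_simps abs_le_iff)
    qed
    then show ?thesis by blast
  qed
  then have "\<forall>\<phi>\<in>cc_functions. \<exists>M. \<forall>\<nu>\<in>?T. \<bar>\<nu> \<phi>\<bar> \<le> M" by blast
  from bchoice[OF this] obtain M where M0: "\<forall>\<phi>\<in>cc_functions. \<forall>\<nu>\<in>?T. \<bar>\<nu> \<phi>\<bar> \<le> M \<phi>" ..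
  have M: "\<bar>\<nu> \<phi>\<bar> \<le> M \<phi>" if "\<phi> \<in> cc_functions" "\<nu> \<in> ?T" for \<phi> \<nu> using bspec[OF bspec[OF M0 that(1)] that(2)] .
  have "compactin ?X (PiE cc_functions (\<lambda>\<phi>. {- M \<phi>..M \<phi>}))" by (simp add: compactin_PiE)
  moreover have "?T \<subseteq> PiE cc_functions (\<lambda>\<phi>. {- M \<phi>..M \<phi>})"
  proof
    fix \<nu> assume nu: "\<nu> \<in> ?T"
    then have "\<nu> \<in> extensional cc_functions" by (auto simp: positive_measures_on_def dest!: pm_rm rm_ext)
    moreover have "\<nu> \<phi> \<in> {- M \<phi>..M \<phi>}" if "\<phi> \<in> cc_functions" for \<phi>
      using M[OF that nu] by (simp add: abs_le_iff)
    ultimately show "\<nu> \<in> PiE cc_functions (\<lambda>\<phi>. {- M \<phi>..M \<phi>})" unfolding PiE_def by (intro IntI Pi_I)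
  qed
  ultimately have "compactin ?X ?T" using cl Teq by (metis (no_types, lifting) closed_compactin)
  moreover have "?T \<subseteq> radon_measures" by (auto simp: positive_measures_on_def dest: pm_rm)
  ultimately show ?thesis unfolding vague_topology_def compactin_subtopology by blast
qed

section \<open>Filters of tails, and restriction of a measure to a compact set\<close>

lemma eventually_tails_filter:
  assumes dir: "directed_upwards S R" and tr: "transp R"
  shows "eventually P (tails_filter S R) \<longleftrightarrow> (\<exists>s0\<in>S. \<forall>s\<in>S. R s0 s \<longrightarrow> P s)"
proof -
  have "eventually P (tails_filter S R) \<longleftrightarrow> (\<exists>s0\<in>S. eventually P (principal {s \<in> S. R s0 s}))"
    unfolding tails_filter_def
  proof (rule eventually_INF_base)
    show "S \<noteq> {}" using dir by (simp add: directed_upwards_def)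
    fix s t assume "s \<in> S" "t \<in> S"
    then obtain u where u: "u \<in> S" "R s u" "R t u" using dir by (auto simp: directed_upwards_def)
    then have "{v \<in> S. R u v} \<subseteq> {v \<in> S. R s v} \<inter> {v \<in> S. R t v}" using transpD[OF tr] by blast
    then show "\<exists>x\<in>S. principal {s \<in> S. R x s} \<le> inf (principal {u \<in> S. R s u}) (principal {s \<in> S. R t s})"
      using u(1) by (auto simp: inf_principal)
  qed
  then show ?thesis by (auto simp: eventually_principal)
qed

lemma tails_filter_nonbot:
  assumes dir: "directed_upwards S R" and tr: "transp R"
  shows "tails_filter S R \<noteq> bot"
proof
  assume "tails_filter S R = bot"
  then have "eventually (\<lambda>_. False) (tails_filter S R)" by simp
  then have "\<exists>s\<in>S. \<forall>t\<in>S. R s t \<longrightarrow> False" unfolding eventually_tails_filter[OF assms] .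
  then obtain s where s: "s \<in> S" "\<forall>t\<in>S. \<not> R s t" by auto
  then show False using dir by (auto simp: directed_upwards_def)
qed

text \<open>The restriction of \<open>\<nu>\<close> to \<open>K\<close> arises as a vague cluster point of \<open>\<xi> \<nu>\<close>, where
  the cutoff functions \<open>\<xi>\<close> decrease to the indicator of \<open>K\<close>.\<close>

lemma restrict_to_compact:
  fixes \<nu> :: "'b::t2_space functional"
  assumes lc: "locally_compact_space (euclidean :: 'b topology)"
    and nu: "\<nu> \<in> positive_measures" and K: "compact K" and d: "0 < \<delta>"
    and low: "\<And>\<xi>. \<xi> \<in> cc_functions \<Longrightarrow> (\<And>x. 0 \<le> \<xi> x) \<Longrightarrow> (\<And>x. x \<in> K \<Longrightarrow> 1 \<le> \<xi> x) \<Longrightarrow> \<delta> \<le> \<nu> \<xi>"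
  obtains \<nu>' where "\<nu>' \<in> positive_measures_on K" "measure_le \<nu>' \<nu>"
    "0 < positive_integral \<nu>' (\<lambda>_. 1)" "positive_integral \<nu>' (\<lambda>_. 1) < \<infinity>"
proof -
  obtain \<xi>0 where x0: "\<xi>0 \<in> cc_functions" "\<forall>x. 0 \<le> \<xi>0 x" "\<forall>x. \<xi>0 x \<le> 1" "\<forall>x\<in>K. \<xi>0 x = 1"
    using cc_cutoff[OF lc K] by auto
  \<comment> \<open>The common bound \<open>\<xi>0\<close> keeps all masses below
    \<open>\<nu> \<xi>0\<close>, which places the net in a vaguely compact set.\<close>
  define S where "S = {\<xi> \<in> cc_functions. (\<forall>x. 0 \<le> \<xi> x) \<and> (\<forall>x. \<xi> x \<le> \<xi>0 x) \<and> (\<forall>x\<in>K. \<xi> x = 1)}"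
  define R where "R = (\<lambda>\<xi>1 \<xi>2 :: 'b \<Rightarrow> real. \<forall>x. \<xi>2 x \<le> \<xi>1 x)"
  have x0S: "\<xi>0 \<in> S" using x0 by (simp add: S_def)
  have tr: "transp R" unfolding R_def by (rule transpI) (meson order_trans)
  have dir: "directed_upwards S R"
    unfolding directed_upwards_def
  proof (intro conjI ballI)
    show "S \<noteq> {}" using x0S by blast
    fix s t assume "s \<in> S" "t \<in> S"
    then show "\<exists>u\<in>S. R s u \<and> R t u"
      by (intro bexI[of _ "\<lambda>x. min (s x) (t x)"]) (auto simp: S_def R_def cc_min min_le_iff_disj)
  qed
  let ?F = "tails_filter S R"
  let ?T = "{\<mu> \<in> positive_measures_on (UNIV :: 'b set). positive_integral \<mu> (\<lambda>x. ereal 1) \<le> ereal (\<nu> \<xi>0)}"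
  have comp: "compactin vague_topology ?T"
    by (rule vague_compact[OF lc closed_UNIV, of "\<lambda>_. 1"]) auto
  have inT: "radon_density \<xi> \<nu> \<in> ?T" if "\<xi> \<in> S" for \<xi>
  proof -
    have xi: "\<xi> \<in> cc_functions" "\<And>x. 0 \<le> \<xi> x" "\<And>x. \<xi> x \<le> \<xi>0 x" using that by (auto simp: S_def)
    have "radon_density \<xi> \<nu> \<in> positive_measures" by (rule radon_density_pm[OF lc nu cc_cont[OF xi(1)] xi(2)])
    moreover have "positive_integral (radon_density \<xi> \<nu>) (\<lambda>x. ereal 1) \<le> ereal (\<nu> \<xi>0)"
    proof (rule positive_integral_le)
      fix \<phi> :: "'b \<Rightarrow> real" assume phi: "\<phi> \<in> cc_functions" "\<And>x. ereal (\<phi> x) \<le> ereal 1"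
      have "\<xi> x * \<phi> x \<le> \<xi>0 x" for x
        using mult_left_mono[of "\<phi> x" 1 "\<xi> x"] phi(2)[of x] xi(2,3)[of x] by simp
      then have "\<nu> (\<lambda>x. \<xi> x * \<phi> x) \<le> \<nu> \<xi>0"
        by (rule pm_mono[OF nu cc_mult[OF cc_cont[OF xi(1)] phi(1)] x0(1)])
      then show "ereal (radon_density \<xi> \<nu> \<phi>) \<le> ereal (\<nu> \<xi>0)" using phi(1) by simp
    qed
    ultimately show ?thesis by (simp add: positive_measures_on_def)
  qed
  have evS: "eventually (\<lambda>\<xi>. \<xi> \<in> S \<and> R \<xi>1 \<xi>) ?F" if "\<xi>1 \<in> S" for \<xi>1
    unfolding eventually_tails_filter[OF dir tr] using that by blast
  have "eventually (\<lambda>\<xi>. radon_density \<xi> \<nu> \<in> ?T) ?F"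
    using evS[OF x0S] by eventually_elim (use inT in blast)
  from compactin_cluster_point[OF comp tails_filter_nonbot[OF dir tr] this]
  obtain l where l: "l \<in> ?T" "cluster_point vague_topology (\<lambda>\<xi>. radon_density \<xi> \<nu>) ?F l" by blast
  obtain G where G: "G \<noteq> bot" "G \<le> ?F"
    "\<And>L. continuous_map vague_topology euclideanreal L \<Longrightarrow> ((\<lambda>\<xi>. L (radon_density \<xi> \<nu>)) \<longlongrightarrow> L l) G"
    using cluster_pointE[OF l(2)] by metis
  have evG: "eventually (\<lambda>\<xi>. \<xi> \<in> S \<and> R \<xi>1 \<xi>) G" if "\<xi>1 \<in> S" for \<xi>1
    using evS[OF that] G(2) by (rule filter_leD[rotated])
  have lim: "((\<lambda>\<xi>. \<nu> (\<lambda>x. \<xi> x * \<phi> x)) \<longlongrightarrow> l \<phi>) G" if "\<phi> \<in> cc_functions" for \<phi>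
    using G(3)[OF continuous_map_vague_eval[OF that]] that by simp
  have lpm: "l \<in> positive_measures" using l(1) by (simp add: positive_measures_on_def)
  have le: "measure_le l \<nu>"
    unfolding measure_le_def
  proof (intro ballI impI)
    fix \<phi> :: "'b \<Rightarrow> real" assume phi: "\<phi> \<in> cc_functions" "\<forall>x. 0 \<le> \<phi> x"
    have "eventually (\<lambda>\<xi>. \<nu> (\<lambda>x. \<xi> x * \<phi> x) \<le> \<nu> \<phi>) G"
      using evG[OF x0S]
    proof eventually_elim
      case (elim \<xi>)
      have "\<xi> x \<le> 1" for x using elim x0(3) order_trans by (fastforce simp: S_def)
      then have "\<xi> x * \<phi> x \<le> \<phi> x" for x using mult_right_mono[of "\<xi> x" 1 "\<phi> x"] phi(2) by simp
      moreover have "continuous_on UNIV \<xi>" using elim by (auto simp: S_def cc_functions_def)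
      ultimately show ?case using pm_mono[OF nu cc_mult phi(1)] phi(1) by blast
    qed
    then show "l \<phi> \<le> \<nu> \<phi>" by (rule tendsto_upperbound[OF lim[OF phi(1)] _ G(1)])
  qed
  have sup: "l \<in> positive_measures_on K"
    unfolding positive_measures_on_iff[OF lc compact_imp_closed[OF K]]
  proof (intro conjI ballI impI lpm)
    fix \<phi> :: "'b \<Rightarrow> real" assume phi: "\<phi> \<in> cc_functions" and dis: "closure {x. \<phi> x \<noteq> 0} \<inter> K = {}"
    have sub: "K \<subseteq> - closure {x. \<phi> x \<noteq> 0}" using dis by blast
    from cc_bump[OF lc K open_Compl[OF closed_closure] sub]
    obtain \<xi>2 where x2[rule_format]: "\<xi>2 \<in> cc_functions" "\<forall>x. 0 \<le> \<xi>2 x" "\<forall>x. \<xi>2 x \<le> 1" "\<forall>x\<in>K. \<xi>2 x = 1"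
      "closure {x. \<xi>2 x \<noteq> 0} \<subseteq> - closure {x. \<phi> x \<noteq> 0}" by meson
    \<comment> \<open>The factor \<open>\<xi>0\<close> makes the product an index of the net. Every
      later \<open>\<xi>\<close> lies below it and so vanishes on the support of
      \<open>\<phi>\<close>.\<close>
    let ?\<xi>1 = "\<lambda>x. \<xi>2 x * \<xi>0 x"
    have "?\<xi>1 \<in> cc_functions" by (rule cc_mult[OF cc_cont[OF x2(1)] x0(1)])
    moreover have "\<xi>2 x * \<xi>0 x \<le> \<xi>0 x" for x using mult_right_mono[OF x2(3)[of x], of "\<xi>0 x"] x0(2) by simp
    ultimately have x1S: "?\<xi>1 \<in> S" using x2 x0 by (simp add: S_def)
    have "eventually (\<lambda>\<xi>. \<nu> (\<lambda>x. \<xi> x * \<phi> x) = 0) G"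
      using evG[OF x1S]
    proof eventually_elim
      case (elim \<xi>)
      have "\<xi> x * \<phi> x = 0" for x
      proof (cases "\<phi> x = 0")
        case False
        then have "x \<in> closure {x. \<phi> x \<noteq> 0}" by (rule cc_inside)
        then have "x \<notin> closure {x. \<xi>2 x \<noteq> 0}" using subsetD[OF x2(5), of x] by auto
        then have "\<xi>2 x = 0" by (rule cc_outside)
        then have "\<xi> x \<le> 0" using elim by (auto simp: R_def dest!: spec[of _ x])
        moreover have "0 \<le> \<xi> x" using elim by (simp add: S_def)
        ultimately show ?thesis by simp
      qed simp
      then have "(\<lambda>x. \<xi> x * \<phi> x) = (\<lambda>x. 0)" by (rule ext)
      then show ?case using rm_zero[OF pm_rm[OF nu]] by metis
    qed
    then have "((\<lambda>\<xi>. \<nu> (\<lambda>x. \<xi> x * \<phi> x)) \<longlongrightarrow> 0) G" by (rule tendsto_eventually)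
    then show "l \<phi> = 0" using lim[OF phi] G(1) tendsto_unique by blast
  qed
  \<comment> \<open>Total mass is not vaguely continuous, but evaluation at \<open>\<xi>0\<close>
    is; \<open>\<xi> * \<xi>0\<close> still equals 1 on \<open>K\<close>, so \<open>low\<close>
    applies to it and the bound survives in the limit.\<close>
  have "eventually (\<lambda>\<xi>. \<delta> \<le> \<nu> (\<lambda>x. \<xi> x * \<xi>0 x)) G"
    using evG[OF x0S]
  proof eventually_elim
    case (elim \<xi>)
    then have xi: "\<xi> \<in> cc_functions" "\<forall>x. 0 \<le> \<xi> x" "\<forall>x\<in>K. \<xi> x = 1" by (auto simp: S_def)
    show ?case by (rule low[OF cc_mult[OF cc_cont[OF xi(1)] x0(1)]]) (use xi x0 in auto)
  qed
  then have "\<delta> \<le> l \<xi>0" by (rule tendsto_lowerbound[OF lim[OF x0(1)] _ G(1)])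
  moreover have "ereal (l \<xi>0) \<le> positive_integral l (\<lambda>_. 1)"
    using x0 by (intro positive_integral_gt(1)) (auto simp: one_ereal_def)
  moreover have "ereal 0 < ereal \<delta>" using d by simp
  ultimately have "0 < positive_integral l (\<lambda>_. 1)" by (metis ereal_less_eq(3) less_le_trans zero_ereal_def)
  moreover have "positive_integral l (\<lambda>_. 1) < \<infinity>" using l(1) by (auto simp: one_ereal_def[symmetric] intro: le_less_trans)
  ultimately show ?thesis using that sup le by blast
qed

lemma pm_on_mono:
  fixes \<nu> :: "'b::t2_space functional"
  assumes lc: "locally_compact_space (euclidean :: 'b topology)"
    and nu: "\<nu> \<in> positive_measures_on A" and cl: "closed A" and "\<phi> \<in> cc_functions" "\<psi> \<in> cc_functions"
    and "\<And>x. x \<in> A \<Longrightarrow> \<phi> x \<le> \<psi> x"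
  shows "\<nu> \<phi> \<le> \<nu> \<psi>"
proof -
  have "open {x. t < ereal (\<psi> x)}" for t
  proof (cases t)
    case (real r)
    then show ?thesis using cc_cont[OF assms(5)] by (simp add: open_Collect_less)
  qed auto
  then have "ereal (\<nu> \<phi>) \<le> positive_integral \<nu> (\<lambda>x. ereal (\<psi> x))"
    using assms(5,6) by (intro le_positive_integral_on[OF lc nu cl assms(4) _ assms(5)]) auto
  then show ?thesis using positive_integral_cc[OF pm_on_pm[OF nu] assms(5)] by simp
qed


section \<open>Jordan decomposition\<close>

text \<open>The value does not depend on how \<open>\<phi>\<close> is written as a difference of
  nonnegative functions (\<open>Ldiff\<close>). Linearity follows by splitting the scalars as well
  as the functions into positive and negative parts.\<close>

lemma cone_functional_extend:
  fixes u :: "('b::t2_space \<Rightarrow> real) \<Rightarrow> real"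
  assumes lc: "locally_compact_space (euclidean :: 'b topology)"
    and add: "\<And>\<phi> \<psi>. \<phi> \<in> cc_functions \<Longrightarrow> \<psi> \<in> cc_functions \<Longrightarrow> (\<And>x. 0 \<le> \<phi> x) \<Longrightarrow> (\<And>x. 0 \<le> \<psi> x) \<Longrightarrow>
      u (\<lambda>x. \<phi> x + \<psi> x) = u \<phi> + u \<psi>"
    and scale: "\<And>\<phi> s. \<phi> \<in> cc_functions \<Longrightarrow> (\<And>x. 0 \<le> \<phi> x) \<Longrightarrow> 0 \<le> s \<Longrightarrow> u (\<lambda>x. s * \<phi> x) = s * u \<phi>"
    and pos: "\<And>\<phi>. \<phi> \<in> cc_functions \<Longrightarrow> (\<And>x. 0 \<le> \<phi> x) \<Longrightarrow> 0 \<le> u \<phi>"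
  defines "L \<equiv> (\<lambda>\<phi>\<in>cc_functions. u (\<lambda>x. max (\<phi> x) 0) - u (\<lambda>x. max (- \<phi> x) 0))"
  shows "L \<in> positive_measures" "\<And>\<phi>. \<phi> \<in> cc_functions \<Longrightarrow> (\<And>x. 0 \<le> \<phi> x) \<Longrightarrow> L \<phi> = u \<phi>"
proof -
  have u0: "u (\<lambda>x. 0) = 0" using scale[OF cc_zero, of 0] by simp
  have pc: "(\<lambda>x. max (\<phi> x) 0) \<in> cc_functions" "(\<lambda>x. max (- \<phi> x) 0) \<in> cc_functions" if "\<phi> \<in> cc_functions" for \<phi> :: "'b \<Rightarrow> real"
    using cc_max[OF that cc_zero] cc_max[OF cc_uminus[OF that] cc_zero] by auto
  show Lpos: "L \<phi> = u \<phi>" if "\<phi> \<in> cc_functions" "\<And>x. 0 \<le> \<phi> x" for \<phi>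
  proof -
    have "(\<lambda>x. max (\<phi> x) 0) = \<phi>" "(\<lambda>x. max (- \<phi> x) 0) = (\<lambda>x. 0)" using that(2) by (simp_all add: max_absorb1 max_absorb2)
    then show ?thesis using that(1) u0 by (simp add: L_def)
  qed
  have Ldiff: "L \<phi> = u p - u n"
    if "\<phi> \<in> cc_functions" "p \<in> cc_functions" "n \<in> cc_functions" "\<And>x. 0 \<le> p x" "\<And>x. 0 \<le> n x" "\<And>x. \<phi> x = p x - n x" for \<phi> p n
  proof -
    have "(\<lambda>x. max (\<phi> x) 0 + n x) = (\<lambda>x. max (- \<phi> x) 0 + p x)" using that(6) by (auto simp: max_def fun_eq_iff)
    then have "u (\<lambda>x. max (\<phi> x) 0 + n x) = u (\<lambda>x. max (- \<phi> x) 0 + p x)" by simp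
    then have "u (\<lambda>x. max (\<phi> x) 0) + u n = u (\<lambda>x. max (- \<phi> x) 0) + u p"
      using add[OF pc(1)[OF that(1)] that(3)] add[OF pc(2)[OF that(1)] that(2)] that(4,5) by simp
    then show ?thesis using that(1) by (simp add: L_def)
  qed
  show "L \<in> positive_measures"
  proof (rule positive_measuresI[OF lc])
    show "L \<in> extensional cc_functions" by (simp add: L_def)
    show "0 \<le> L \<phi>" if "\<phi> \<in> cc_functions" "\<And>x. 0 \<le> \<phi> x" for \<phi> using Lpos[OF that] pos[OF that] by simp
    fix \<phi> \<psi> :: "'b \<Rightarrow> real" and s t :: real assume phi: "\<phi> \<in> cc_functions" and psi: "\<psi> \<in> cc_functions"
    let ?a = "\<lambda>x. max (\<phi> x) 0" and ?b = "\<lambda>x. max (- \<phi> x) 0" and ?c = "\<lambda>x. max (\<psi> x) 0" and ?d = "\<lambda>x. max (- \<psi> x) 0"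
    let ?s = "max s 0" and ?s' = "max (-s) 0" and ?t = "max t 0" and ?t' = "max (-t) 0"
    let ?p = "\<lambda>x. (?s * ?a x + ?s' * ?b x) + (?t * ?c x + ?t' * ?d x)"
    let ?n = "\<lambda>x. (?s * ?b x + ?s' * ?a x) + (?t * ?d x + ?t' * ?c x)"
    note cc = pc[OF phi] pc[OF psi]
    have lin: "u (\<lambda>x. p * f x + q * h x) = p * u f + q * u h"
      if "f \<in> cc_functions" "h \<in> cc_functions" "\<And>x. 0 \<le> f x" "\<And>x. 0 \<le> h x" "0 \<le> p" "0 \<le> q" for f h p q
      using add[of "\<lambda>x. p * f x" "\<lambda>x. q * h x"] scale[of f p] scale[of h q] that by (simp add: cc_scale)
    have up: "u ?p = (?s * u ?a + ?s' * u ?b) + (?t * u ?c + ?t' * u ?d)"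
      by (subst add) (auto simp only: cc_lin[OF cc(1,2)] cc_lin[OF cc(3,4)] lin[OF cc(1,2)] lin[OF cc(3,4)] max.cobounded2
         intro!: add_nonneg_nonneg mult_nonneg_nonneg)
    have un: "u ?n = (?s * u ?b + ?s' * u ?a) + (?t * u ?d + ?t' * u ?c)"
      by (subst add) (auto simp only: cc_lin[OF cc(2,1)] cc_lin[OF cc(4,3)] lin[OF cc(2,1)] lin[OF cc(4,3)] max.cobounded2
         intro!: add_nonneg_nonneg mult_nonneg_nonneg)
    have "L (\<lambda>x. s * \<phi> x + t * \<psi> x) = u ?p - u ?n"
    proof (rule Ldiff)
      show "(\<lambda>x. s * \<phi> x + t * \<psi> x) \<in> cc_functions" by (rule cc_lin[OF phi psi])
      show "?p \<in> cc_functions" "?n \<in> cc_functions" by (intro cc_add cc_lin cc)+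
      show "0 \<le> ?p x" "0 \<le> ?n x" for x by simp_all
      have spl: "r * y = (max r 0 * max y 0 + max (-r) 0 * max (-y) 0) - (max r 0 * max (-y) 0 + max (-r) 0 * max y 0)" for r y :: real
        by (auto simp: max_def)
      show "s * \<phi> x + t * \<psi> x = ?p x - ?n x" for x using spl[of s "\<phi> x"] spl[of t "\<psi> x"] by linarith
    qed
    also have "\<dots> = (?s - ?s') * (u ?a - u ?b) + (?t - ?t') * (u ?c - u ?d)"
      unfolding up un by (simp add: algebra_simps)
    also have "?s - ?s' = s" by (auto simp: max_def)
    also have "?t - ?t' = t" by (auto simp: max_def)
    finally show "L (\<lambda>x. s * \<phi> x + t * \<psi> x) = s * L \<phi> + t * L \<psi>" using phi psi by (simp add: L_def)
  qed
qed

definition pos_sup :: "'b::topological_space functional \<Rightarrow> ('b \<Rightarrow> real) \<Rightarrow> real" where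
  "pos_sup \<nu> \<phi> = (SUP \<psi>\<in>{\<psi>\<in>cc_functions. \<forall>x. 0 \<le> \<psi> x \<and> \<psi> x \<le> \<phi> x}. \<nu> \<psi>)"

text \<open>All competitors have their support inside that of \<open>\<phi>\<close>, so the
  continuity bound of a Radon measure on this one compact set applies.\<close>

lemma pos_sup_bdd:
  fixes \<nu> :: "'b::t2_space functional"
  assumes "\<nu> \<in> radon_measures" "\<phi> \<in> cc_functions"
  shows "bdd_above (\<nu> ` {\<psi>\<in>cc_functions. \<forall>x. 0 \<le> \<psi> x \<and> \<psi> x \<le> \<phi> x})"
proof -
  obtain B where B: "\<And>x. \<bar>\<phi> x\<bar> \<le> B" using cc_bounded[OF assms(2)] by blast
  obtain M where M: "\<forall>\<psi>\<in>cc_functions. \<forall>B. closure {x. \<psi> x \<noteq> 0} \<subseteq> closure {x. \<phi> x \<noteq> 0} \<and> (\<forall>x. \<bar>\<psi> x\<bar> \<le> B) \<longrightarrow> \<bar>\<nu> \<psi>\<bar> \<le> M * B"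
    using assms(1) cc_compact[OF assms(2)] unfolding radon_measures_def by blast
  have "\<nu> \<psi> \<le> M * B" if "\<psi> \<in> cc_functions" "\<forall>x. 0 \<le> \<psi> x \<and> \<psi> x \<le> \<phi> x" for \<psi>
  proof -
    have "closure {x. \<psi> x \<noteq> 0} \<subseteq> closure {x. \<phi> x \<noteq> 0}" 
    proof (intro closure_mono subsetI)
      fix x assume "x \<in> {x. \<psi> x \<noteq> 0}"
      then have "0 < \<psi> x" using that(2) by (simp add: less_le)
      then show "x \<in> {x. \<phi> x \<noteq> 0}" using that(2)[rule_format, of x] by simp
    qed
    moreover have "\<bar>\<psi> x\<bar> \<le> B" for x using B[of x] that(2)[rule_format, of x] by simp
    ultimately have "\<bar>\<nu> \<psi>\<bar> \<le> M * B" using M that(1) by blast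
    then show ?thesis by simp
  qed
  then show ?thesis by (intro bdd_aboveI[of _ "M * B"]) auto
qed

lemma pos_sup_upper:
  fixes \<nu> :: "'b::t2_space functional"
  assumes "\<nu> \<in> radon_measures" "\<phi> \<in> cc_functions" "\<psi> \<in> cc_functions" "\<And>x. 0 \<le> \<psi> x" "\<And>x. \<psi> x \<le> \<phi> x"
  shows "\<nu> \<psi> \<le> pos_sup \<nu> \<phi>"
  unfolding pos_sup_def using assms(3-5) by (intro cSUP_upper pos_sup_bdd[OF assms(1,2)]) auto

lemma pos_sup_least:
  fixes \<nu> :: "'b::t2_space functional"
  assumes "\<And>x. 0 \<le> \<phi> x" "\<And>\<psi>. \<psi> \<in> cc_functions \<Longrightarrow> (\<And>x. 0 \<le> \<psi> x) \<Longrightarrow> (\<And>x. \<psi> x \<le> \<phi> x) \<Longrightarrow> \<nu> \<psi> \<le> c"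
  shows "pos_sup \<nu> \<phi> \<le> c"
  unfolding pos_sup_def
proof (rule cSUP_least)
  show "{\<psi> \<in> cc_functions. \<forall>x. 0 \<le> \<psi> x \<and> \<psi> x \<le> \<phi> x} \<noteq> {}" using assms(1) cc_zero by blast
qed (use assms(2) in auto)

text \<open>Riesz decomposition: a function between 0 and \<open>\<phi> + \<psi>\<close> is the sum
  of its minimum with \<open>\<phi>\<close> and a rest between 0 and \<open>\<psi>\<close>.\<close>

lemma pos_sup_add:
  fixes \<nu> :: "'b::t2_space functional"
  assumes nu: "\<nu> \<in> radon_measures" and phi: "\<phi> \<in> cc_functions" "\<And>x. 0 \<le> \<phi> x" and psi: "\<psi> \<in> cc_functions" "\<And>x. 0 \<le> \<psi> x"
  shows "pos_sup \<nu> (\<lambda>x. \<phi> x + \<psi> x) = pos_sup \<nu> \<phi> + pos_sup \<nu> \<psi>"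
proof (rule antisym)
  show "pos_sup \<nu> (\<lambda>x. \<phi> x + \<psi> x) \<le> pos_sup \<nu> \<phi> + pos_sup \<nu> \<psi>"
  proof (rule pos_sup_least)
    show "0 \<le> \<phi> x + \<psi> x" for x using phi(2) psi(2) by simp
    fix \<rho> :: "'b \<Rightarrow> real" assume r: "\<rho> \<in> cc_functions" "\<And>x. 0 \<le> \<rho> x" "\<And>x. \<rho> x \<le> \<phi> x + \<psi> x"
    let ?a = "\<lambda>x. min (\<rho> x) (\<phi> x)"
    have a: "?a \<in> cc_functions" using r phi by (intro cc_min)
    have b: "(\<lambda>x. \<rho> x - ?a x) \<in> cc_functions" by (rule cc_diff[OF r(1) a])
    have "\<nu> ?a \<le> pos_sup \<nu> \<phi>" using r phi by (intro pos_sup_upper[OF nu phi(1) a]) auto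
    moreover have "\<nu> (\<lambda>x. \<rho> x - ?a x) \<le> pos_sup \<nu> \<psi>"
    proof (intro pos_sup_upper[OF nu psi(1) b])
      show "\<rho> x - ?a x \<le> \<psi> x" for x using r(3)[of x] psi(2)[of x] by (auto simp: min_def)
    qed auto
    ultimately show "\<nu> \<rho> \<le> pos_sup \<nu> \<phi> + pos_sup \<nu> \<psi>" using rm_diff[OF nu r(1) a] by simp
  qed
  have "pos_sup \<nu> \<phi> \<le> pos_sup \<nu> (\<lambda>x. \<phi> x + \<psi> x) - pos_sup \<nu> \<psi>"
  proof (rule pos_sup_least[OF phi(2)])
    fix f assume f: "f \<in> cc_functions" "\<And>x. 0 \<le> f x" "\<And>x. f x \<le> \<phi> x"
    have "pos_sup \<nu> \<psi> \<le> pos_sup \<nu> (\<lambda>x. \<phi> x + \<psi> x) - \<nu> f"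
    proof (rule pos_sup_least[OF psi(2)])
      fix h assume h: "h \<in> cc_functions" "\<And>x. 0 \<le> h x" "\<And>x. h x \<le> \<psi> x"
      have "\<nu> (\<lambda>x. f x + h x) \<le> pos_sup \<nu> (\<lambda>x. \<phi> x + \<psi> x)"
        using f h by (intro pos_sup_upper[OF nu cc_add[OF phi(1) psi(1)] cc_add[OF f(1) h(1)]] add_nonneg_nonneg add_mono)
      then show "\<nu> h \<le> pos_sup \<nu> (\<lambda>x. \<phi> x + \<psi> x) - \<nu> f" using rm_add[OF nu f(1) h(1)] by simp
    qed
    then show "\<nu> f \<le> pos_sup \<nu> (\<lambda>x. \<phi> x + \<psi> x) - pos_sup \<nu> \<psi>" by simp
  qed
  then show "pos_sup \<nu> \<phi> + pos_sup \<nu> \<psi> \<le> pos_sup \<nu> (\<lambda>x. \<phi> x + \<psi> x)" by simp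
qed

lemma pos_sup_scale_le:
  fixes \<nu> :: "'b::t2_space functional"
  assumes nu: "\<nu> \<in> radon_measures" and phi: "\<phi> \<in> cc_functions" "\<And>x. 0 \<le> \<phi> x" and s: "0 < s"
  shows "pos_sup \<nu> (\<lambda>x. s * \<phi> x) \<le> s * pos_sup \<nu> \<phi>"
proof (rule pos_sup_least)
  show "0 \<le> s * \<phi> x" for x using phi(2) s by simp
  fix \<rho> :: "'b \<Rightarrow> real" assume r: "\<rho> \<in> cc_functions" "\<And>x. 0 \<le> \<rho> x" "\<And>x. \<rho> x \<le> s * \<phi> x"
  have "\<nu> (\<lambda>x. inverse s * \<rho> x) \<le> pos_sup \<nu> \<phi>"
    using r s by (intro pos_sup_upper[OF nu phi(1) cc_scale[OF r(1)]]) (auto simp: field_simps)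
  then show "\<nu> \<rho> \<le> s * pos_sup \<nu> \<phi>" using mult_left_mono[of "inverse s * \<nu> \<rho>" "pos_sup \<nu> \<phi>" s] rm_scale[OF nu r(1), of "inverse s"] s
    by (simp add: mult.assoc[symmetric])
qed

lemma pos_sup_scale:
  fixes \<nu> :: "'b::t2_space functional"
  assumes nu: "\<nu> \<in> radon_measures" and phi: "\<phi> \<in> cc_functions" "\<And>x. 0 \<le> \<phi> x" and s: "0 \<le> s"
  shows "pos_sup \<nu> (\<lambda>x. s * \<phi> x) = s * pos_sup \<nu> \<phi>"
proof (cases "s = 0")
  case True
  have "pos_sup \<nu> (\<lambda>x. 0) = 0"
    using pos_sup_add[OF nu cc_zero _ cc_zero] by simp
  then show ?thesis using True by simp
next
  case False
  then have s0: "0 < s" using s by simp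
  have "pos_sup \<nu> (\<lambda>x. inverse s * (s * \<phi> x)) \<le> inverse s * pos_sup \<nu> (\<lambda>x. s * \<phi> x)"
    using s0 phi by (intro pos_sup_scale_le[OF nu cc_scale[OF phi(1)]]) auto
  then have "s * pos_sup \<nu> \<phi> \<le> pos_sup \<nu> (\<lambda>x. s * \<phi> x)" using s0 by (simp add: field_simps)
  then show ?thesis using pos_sup_scale_le[OF nu phi s0] by simp
qed

lemma positive_part_pm:
  fixes \<nu> :: "'b::t2_space functional"
  assumes lc: "locally_compact_space (euclidean :: 'b topology)" and nu: "\<nu> \<in> radon_measures"
  shows "positive_part \<nu> \<in> positive_measures"
    and "\<And>\<phi>. \<phi> \<in> cc_functions \<Longrightarrow> (\<And>x. 0 \<le> \<phi> x) \<Longrightarrow> positive_part \<nu> \<phi> = pos_sup \<nu> \<phi>"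
proof -
  have eq: "positive_part \<nu> = (\<lambda>\<phi>\<in>cc_functions. pos_sup \<nu> (\<lambda>x. max (\<phi> x) 0) - pos_sup \<nu> (\<lambda>x. max (- \<phi> x) 0))"
    by (simp add: positive_part_def pos_sup_def)
  have pos: "0 \<le> pos_sup \<nu> \<phi>" if "\<phi> \<in> cc_functions" "\<And>x. 0 \<le> \<phi> x" for \<phi>
    using pos_sup_upper[OF nu that(1) cc_zero] that(2) rm_zero[OF nu] by simp
  show "positive_part \<nu> \<in> positive_measures"
    unfolding eq by (rule cone_functional_extend(1)[OF lc]) (simp_all add: pos_sup_add[OF nu] pos_sup_scale[OF nu] pos)
  show "positive_part \<nu> \<phi> = pos_sup \<nu> \<phi>" if "\<phi> \<in> cc_functions" "\<And>x. 0 \<le> \<phi> x" for \<phi>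
    unfolding eq using that
    by (intro cone_functional_extend(2)[OF lc]) (simp_all add: pos_sup_add[OF nu] pos_sup_scale[OF nu] pos)
qed

text \<open>Minimality of the Jordan decomposition: for \<open>0 \<le> \<psi> \<le> \<phi>\<close>
  the value of \<open>P - N\<close> at \<open>\<psi>\<close> is at most
  \<open>P \<psi> \<le> P \<phi>\<close>.\<close>

lemma positive_part_le:
  fixes P :: "'b::t2_space functional"
  assumes lc: "locally_compact_space (euclidean :: 'b topology)"
    and P: "P \<in> positive_measures" and N: "N \<in> positive_measures"
  shows "measure_le (positive_part (radon_diff P N)) P"
  unfolding measure_le_def
proof (intro ballI impI)
  fix \<phi> :: "'b \<Rightarrow> real" assume phi: "\<phi> \<in> cc_functions" "\<forall>x. 0 \<le> \<phi> x"
  have nu: "radon_diff P N \<in> radon_measures" using P N by (intro radon_diff_rm pm_rm)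
  have "pos_sup (radon_diff P N) \<phi> \<le> P \<phi>"
  proof (rule pos_sup_least)
    fix \<psi> :: "'b \<Rightarrow> real" assume psi: "\<psi> \<in> cc_functions" "\<And>x. 0 \<le> \<psi> x" "\<And>x. \<psi> x \<le> \<phi> x"
    show "radon_diff P N \<psi> \<le> P \<phi>" using psi(1) pm_nonneg[OF N psi(1,2)] pm_mono[OF P psi(1) phi(1) psi(3)] by simp
  qed (use phi in simp)
  then show "positive_part (radon_diff P N) \<phi> \<le> P \<phi>" using positive_part_pm(2)[OF lc nu phi(1)] phi(2) by simp
qed

lemma negative_part_pm:
  fixes \<nu> :: "'b::t2_space functional"
  assumes lc: "locally_compact_space (euclidean :: 'b topology)" and nu: "\<nu> \<in> radon_measures"
  shows "negative_part \<nu> \<in> positive_measures"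
  unfolding negative_part_def
proof (rule radon_diff_pm[OF pm_rm[OF positive_part_pm(1)[OF lc nu]] nu])
  show "measure_le \<nu> (positive_part \<nu>)"
    unfolding measure_le_def using positive_part_pm(2)[OF lc nu] pos_sup_upper[OF nu] by simp
qed

lemma radon_diff_jordan:
  fixes \<nu> :: "'b::t2_space functional"
  assumes "\<nu> \<in> radon_measures"
  shows "radon_diff (positive_part \<nu>) (negative_part \<nu>) = \<nu>"
  by (rule functional_eqI) (use rm_ext[OF assms] in \<open>simp_all add: negative_part_def\<close>)

text \<open>The lattice form of mutual singularity for positive measures,
  \<open>inf \<sigma> \<tau> = 0\<close>: the infimum takes at \<open>\<eta>\<close> the least value
  of \<open>\<sigma> (\<eta> - \<theta>) + \<tau> \<theta>\<close> over all
  \<open>0 \<le> \<theta> \<le> \<eta>\<close>.\<close>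

definition singular_measures :: "'b::topological_space functional \<Rightarrow> 'b functional \<Rightarrow> bool" where
  "singular_measures \<sigma> \<tau> \<longleftrightarrow> (\<forall>\<eta>\<in>cc_functions. (\<forall>x. 0 \<le> \<eta> x) \<longrightarrow> (\<forall>\<epsilon>>0. \<exists>\<theta>\<in>cc_functions.
     (\<forall>x. 0 \<le> \<theta> x \<and> \<theta> x \<le> \<eta> x) \<and> \<sigma> (\<lambda>x. \<eta> x - \<theta> x) < \<epsilon> \<and> \<tau> \<theta> < \<epsilon>))"

text \<open>A function \<open>\<theta>\<close> that nearly attains the supremum defining the
  positive part at \<open>\<eta>\<close> separates the two parts up to
  \<open>\<epsilon>\<close>.\<close>

lemma singular_jordan:
  fixes \<nu> :: "'b::t2_space functional"
  assumes lc: "locally_compact_space (euclidean :: 'b topology)" and nu: "\<nu> \<in> radon_measures"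
  shows "singular_measures (positive_part \<nu>) (negative_part \<nu>)"
  unfolding singular_measures_def
proof (intro ballI impI allI)
  fix \<eta> :: "'b \<Rightarrow> real" and \<epsilon> :: real assume eta: "\<eta> \<in> cc_functions" "\<forall>x. 0 \<le> \<eta> x" and e: "0 < \<epsilon>"
  let ?p = "positive_part \<nu>"
  note p = positive_part_pm[OF lc nu]
  have "pos_sup \<nu> \<eta> - \<epsilon> < pos_sup \<nu> \<eta>" using e by simp
  then have "\<exists>\<theta>\<in>{\<psi>\<in>cc_functions. \<forall>x. 0 \<le> \<psi> x \<and> \<psi> x \<le> \<eta> x}. pos_sup \<nu> \<eta> - \<epsilon> < \<nu> \<theta>"
    unfolding pos_sup_def
  proof (subst (asm) less_cSUP_iff)
    show "{\<psi>\<in>cc_functions. \<forall>x. 0 \<le> \<psi> x \<and> \<psi> x \<le> \<eta> x} \<noteq> {}" using eta(2) cc_zero by blast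
  qed (use pos_sup_bdd[OF nu eta(1)] in auto)
  then obtain \<theta> where th: "\<theta> \<in> cc_functions" "\<And>x. 0 \<le> \<theta> x" "\<And>x. \<theta> x \<le> \<eta> x" "pos_sup \<nu> \<eta> - \<epsilon> < \<nu> \<theta>" by auto
  have 1: "?p \<eta> = pos_sup \<nu> \<eta>" using p(2)[OF eta(1)] eta(2) by simp
  have 2: "\<nu> \<theta> \<le> ?p \<theta>" using p(2)[OF th(1,2)] pos_sup_upper[OF nu th(1) th(1)] th(2) by simp
  have 3: "?p \<theta> \<le> ?p \<eta>" by (rule pm_mono[OF p(1) th(1) eta(1) th(3)])
  have "?p (\<lambda>x. \<eta> x - \<theta> x) < \<epsilon>" using rm_diff[OF pm_rm[OF p(1)] eta(1) th(1)] 1 2 th(4) by linarith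
  moreover have "negative_part \<nu> \<theta> < \<epsilon>" using th(1,4) 1 3 by (simp add: negative_part_def)
  ultimately show "\<exists>\<theta>\<in>cc_functions. (\<forall>x. 0 \<le> \<theta> x \<and> \<theta> x \<le> \<eta> x) \<and> ?p (\<lambda>x. \<eta> x - \<theta> x) < \<epsilon> \<and> negative_part \<nu> \<theta> < \<epsilon>"
    using th by (intro bexI[of _ \<theta>]) auto
qed

text \<open>Take for \<open>\<theta>\<close> the product of \<open>\<eta>\<close> with a bump that
  is 1 on the part of \<open>A\<close> inside the support of \<open>\<eta>\<close> and supported off
  \<open>B\<close>; both error terms are then 0.\<close>

lemma singular_disjoint_supports:
  fixes \<sigma> \<tau> :: "'b::t2_space functional"
  assumes lc: "locally_compact_space (euclidean :: 'b topology)"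
    and s: "\<sigma> \<in> positive_measures_on A" "closed A" and t: "\<tau> \<in> positive_measures_on B" "closed B"
    and dis: "A \<inter> B = {}"
  shows "singular_measures \<sigma> \<tau>"
  unfolding singular_measures_def
proof (intro ballI impI allI)
  fix \<eta> :: "'b \<Rightarrow> real" and \<epsilon> :: real assume eta: "\<eta> \<in> cc_functions" "\<forall>x. 0 \<le> \<eta> x" and e: "0 < \<epsilon>"
  let ?S = "closure {x. \<eta> x \<noteq> 0}"
  have cS: "compact (?S \<inter> A)" using cc_compact[OF eta(1)] s(2) by (rule compact_Int_closed)
  have sub: "?S \<inter> A \<subseteq> - B" using dis by auto
  from cc_bump[OF lc cS open_Compl[OF t(2)] sub]
  obtain \<xi> where xi[rule_format]: "\<xi> \<in> cc_functions" "\<forall>x. 0 \<le> \<xi> x" "\<forall>x. \<xi> x \<le> 1"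
    "\<forall>x\<in>?S \<inter> A. \<xi> x = 1" "closure {x. \<xi> x \<noteq> 0} \<subseteq> - B"
    by meson
  let ?\<theta> = "\<lambda>x. \<xi> x * \<eta> x"
  have th: "?\<theta> \<in> cc_functions" by (rule cc_mult[OF cc_cont[OF xi(1)] eta(1)])
  have le: "\<xi> x * \<eta> x \<le> \<eta> x" for x using mult_right_mono[OF xi(3)[of x], of "\<eta> x"] eta(2) by simp
  have "closure {x. ?\<theta> x \<noteq> 0} \<subseteq> closure {x. \<xi> x \<noteq> 0}" by (rule closure_mono) auto
  then have "closure {x. ?\<theta> x \<noteq> 0} \<inter> B = {}" using xi(5) by blast
  then have "\<tau> ?\<theta> = 0" by (rule pm_on_null[OF lc t(1) th])
  moreover have "\<sigma> (\<lambda>x. \<eta> x - ?\<theta> x) \<le> \<sigma> (\<lambda>x. 0)"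
  proof (rule pm_on_mono[OF lc s cc_diff[OF eta(1) th] cc_zero])
    fix x assume "x \<in> A"
    then show "\<eta> x - ?\<theta> x \<le> 0" using xi(4)[of x] cc_outside[of x \<eta>] by (cases "x \<in> ?S") simp_all
  qed
  ultimately show "\<exists>\<theta>\<in>cc_functions. (\<forall>x. 0 \<le> \<theta> x \<and> \<theta> x \<le> \<eta> x) \<and> \<sigma> (\<lambda>x. \<eta> x - \<theta> x) < \<epsilon> \<and> \<tau> \<theta> < \<epsilon>"
    using th le xi(2) eta(2) e rm_zero[OF pm_rm[OF pm_on_pm[OF s(1)]]] by (intro bexI[of _ ?\<theta>]) auto
qed

text \<open>\<open>P\<close> and \<open>N\<close> exceed the Jordan parts of \<open>P - N\<close> by
  one and the same positive measure \<open>?H\<close>. Its integral is finite because that of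
  \<open>P\<close> is, so it cancels.\<close>

lemma signed_integral_diff:
  fixes P N :: "'b::t2_space functional"
  assumes lc: "locally_compact_space (euclidean :: 'b topology)"
    and P: "P \<in> positive_measures" and N: "N \<in> positive_measures"
    and th: "\<theta> \<in> cc_functions" "\<And>x. ereal (\<theta> x) \<le> \<psi> x"
    and fin: "positive_integral P \<psi> < \<infinity>"
  shows "integral_defined (radon_diff P N) \<psi>"
    and "- \<infinity> < signed_integral (radon_diff P N) \<psi> \<Longrightarrow> positive_integral N \<psi> < \<infinity>"
    and "positive_integral N \<psi> < \<infinity> \<Longrightarrow>
      signed_integral (radon_diff P N) \<psi> = positive_integral P \<psi> - positive_integral N \<psi>"
proof -
  let ?D = "radon_diff P N"
  let ?p = "positive_part ?D" and ?n = "negative_part ?D"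
  have D: "?D \<in> radon_measures" using P N by (intro radon_diff_rm pm_rm)
  have p: "?p \<in> positive_measures" and n: "?n \<in> positive_measures"
    using positive_part_pm(1)[OF lc D] negative_part_pm[OF lc D] by auto
  have pP: "measure_le ?p P" by (rule positive_part_le[OF lc P N])
  have H: "radon_diff P ?p = radon_diff N ?n"
    by (rule functional_eqI) (simp_all add: negative_part_def)
  have nN: "measure_le ?n N" unfolding measure_le_def
  proof (intro ballI impI)
    fix \<phi> :: "'b \<Rightarrow> real" assume "\<phi> \<in> cc_functions" "\<forall>x. 0 \<le> \<phi> x"
    then show "?n \<phi> \<le> N \<phi>" using pP by (simp add: negative_part_def measure_le_def)
  qed
  let ?H = "radon_diff P ?p"
  have eP: "positive_integral P \<psi> = positive_integral ?p \<psi> + positive_integral ?H \<psi>"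
    by (rule positive_integral_add_diff[OF P p pP th])
  have eN: "positive_integral N \<psi> = positive_integral ?n \<psi> + positive_integral ?H \<psi>"
    unfolding H by (rule positive_integral_add_diff[OF N n nN th])
  have ni: "positive_integral ?p \<psi> \<noteq> -\<infinity>" "positive_integral ?n \<psi> \<noteq> -\<infinity>" "positive_integral ?H \<psi> \<noteq> -\<infinity>"
    by (rule positive_integral_gt(2)[OF th])+
  have fp: "positive_integral ?p \<psi> \<noteq> \<infinity>" "positive_integral ?H \<psi> \<noteq> \<infinity>" using eP fin ni by auto
  show "integral_defined ?D \<psi>" using fp by (simp add: integral_defined_def)
  show "positive_integral N \<psi> < \<infinity>" if "- \<infinity> < signed_integral ?D \<psi>"
    using that fp ni eN unfolding signed_integral_def
    by (cases "positive_integral ?p \<psi>"; cases "positive_integral ?n \<psi>"; cases "positive_integral ?H \<psi>") auto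
  show "signed_integral ?D \<psi> = positive_integral P \<psi> - positive_integral N \<psi>" if "positive_integral N \<psi> < \<infinity>"
    using that fp ni eN eP unfolding signed_integral_def
    by (cases "positive_integral ?p \<psi>"; cases "positive_integral ?n \<psi>"; cases "positive_integral ?H \<psi>") auto
qed

lemma positive_integral_zero_measure:
  fixes \<psi> :: "'b::t2_space \<Rightarrow> ereal"
  assumes "\<theta> \<in> cc_functions" "\<And>x. ereal (\<theta> x) \<le> \<psi> x"
  shows "positive_integral zero_measure \<psi> = 0"
proof (rule antisym)
  show "positive_integral zero_measure \<psi> \<le> 0" by (rule positive_integral_le) (simp add: zero_ereal_def)
  show "0 \<le> positive_integral zero_measure \<psi>"
    using positive_integral_gt(1)[OF assms, of zero_measure] assms(1) by (simp add: zero_ereal_def)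
qed

lemma positive_part_of_pm:
  fixes P :: "'b::t2_space functional"
  assumes lc: "locally_compact_space (euclidean :: 'b topology)" and P: "P \<in> positive_measures"
  shows "positive_part P = P" "negative_part P = zero_measure"
proof -
  have rm: "P \<in> radon_measures" using P by (rule pm_rm)
  note p = positive_part_pm[OF lc rm]
  have pos: "positive_part P \<phi> = P \<phi>" if phi: "\<phi> \<in> cc_functions" "\<And>x. 0 \<le> \<phi> x" for \<phi>
  proof -
    have "pos_sup P \<phi> \<le> P \<phi>" by (rule pos_sup_least[OF phi(2)]) (rule pm_mono[OF P _ phi(1)])
    moreover have "P \<phi> \<le> pos_sup P \<phi>" using phi by (intro pos_sup_upper[OF rm]) auto
    ultimately show ?thesis using p(2)[OF phi] by simp
  qed
  show 1: "positive_part P = P"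
  proof (rule functional_eqI[OF rm_ext[OF pm_rm[OF p(1)]] rm_ext[OF rm]])
    fix \<phi> :: "'b \<Rightarrow> real" assume phi: "\<phi> \<in> cc_functions"
    let ?a = "\<lambda>x. max (\<phi> x) 0" and ?b = "\<lambda>x. max (- \<phi> x) 0"
    have ab: "?a \<in> cc_functions" "?b \<in> cc_functions"
      using cc_max[OF phi cc_zero] cc_max[OF cc_uminus[OF phi] cc_zero] by auto
    have eq: "(\<lambda>x. ?a x - ?b x) = \<phi>" by (auto simp: max_def fun_eq_iff)
    show "positive_part P \<phi> = P \<phi>"
      using rm_diff[OF pm_rm[OF p(1)] ab] rm_diff[OF rm ab] pos[OF ab(1)] pos[OF ab(2)] unfolding eq by simp
  qed
  show "negative_part P = zero_measure"
    by (rule functional_eqI) (simp_all add: negative_part_def 1)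
qed

section \<open>Tensor products\<close>

lemma locally_compact_prod:
  assumes "locally_compact_space (euclidean :: 'b::t2_space topology)"
    "locally_compact_space (euclidean :: 'c::t2_space topology)"
  shows "locally_compact_space (euclidean :: ('b \<times> 'c) topology)"
proof -
  have "(euclidean :: ('b \<times> 'c) topology) = prod_topology euclidean euclidean" by simp
  then show ?thesis using assms locally_compact_space_prod_topology by metis
qed

lemma continuous_Pair_left:
  assumes "continuous_on UNIV (\<phi> :: 'b::topological_space \<times> 'c::topological_space \<Rightarrow> real)"
  shows "continuous_on UNIV (\<lambda>y. \<phi> (x, y))"
  by (rule continuous_on_compose2[OF assms]) (auto intro!: continuous_on_Pair continuous_on_const continuous_on_id)

lemma tensor_slice_cc:
  fixes \<phi> :: "'b::t2_space \<times> 'c::t2_space \<Rightarrow> real"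
  assumes "\<phi> \<in> cc_functions"
  shows "(\<lambda>y. \<phi> (x, y)) \<in> cc_functions"
proof (rule cc_functionsI)
  show "continuous_on UNIV (\<lambda>y. \<phi> (x, y))" by (rule continuous_Pair_left[OF cc_cont[OF assms]])
  show "compact (snd ` closure {z. \<phi> z \<noteq> 0})"
    by (rule compact_continuous_image[OF continuous_on_snd[OF continuous_on_id] cc_compact[OF assms]])
  show "\<phi> (x, y) = 0" if "y \<notin> snd ` closure {z. \<phi> z \<noteq> 0}" for y
    using cc_inside[of \<phi> "(x, y)"] that by force
qed

text \<open>Continuity in \<open>x\<close> must be uniform in \<open>y\<close>; this is the tube
  lemma over the compact second projection of the support.\<close>

lemma tensor_inner_cc:
  fixes \<phi> :: "'b::t2_space \<times> 'c::t2_space \<Rightarrow> real"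
  assumes lc: "locally_compact_space (euclidean :: 'c topology)"
    and phi: "\<phi> \<in> cc_functions" and mu: "\<mu> \<in> positive_measures"
  shows "(\<lambda>x. \<mu> (\<lambda>y. \<phi> (x, y))) \<in> cc_functions"
proof (rule cc_functionsI)
  let ?S = "closure {z. \<phi> z \<noteq> 0}"
  show "compact (fst ` ?S)"
    by (rule compact_continuous_image[OF continuous_on_fst[OF continuous_on_id] cc_compact[OF phi]])
  show "\<mu> (\<lambda>y. \<phi> (x, y)) = 0" if "x \<notin> fst ` ?S" for x
  proof -
    have "(\<lambda>y. \<phi> (x, y)) = (\<lambda>y. 0)"
    proof
      fix y show "\<phi> (x, y) = 0" using cc_inside[of \<phi> "(x, y)"] that by force
    qed
    then show ?thesis using rm_zero[OF pm_rm[OF mu]] by simp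
  qed
  have S2: "compact (snd ` ?S)"
    by (rule compact_continuous_image[OF continuous_on_snd[OF continuous_on_id] cc_compact[OF phi]])
  from cc_cutoff[OF lc S2]
  obtain \<eta> where eta[rule_format]: "\<eta> \<in> cc_functions" "\<forall>y. 0 \<le> \<eta> y" "\<forall>y\<in>snd ` ?S. \<eta> y = 1" by meson
  have "((\<lambda>x. \<mu> (\<lambda>y. \<phi> (x, y))) \<longlongrightarrow> \<mu> (\<lambda>y. \<phi> (x0, y))) (nhds x0)" for x0
  proof (rule tendstoI)
    fix e :: real assume e: "0 < e"
    \<comment> \<open>The summand 1 covers the case \<open>\<mu> \<eta> = 0\<close> and makes
      \<open>d * \<mu> \<eta>\<close> strictly less than \<open>e\<close>.\<close>
    define d where "d = e / (\<mu> \<eta> + 1)"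
    have m0: "0 \<le> \<mu> \<eta>" by (rule pm_nonneg[OF mu eta(1,2)])
    then have d: "0 < d" using e by (simp add: d_def)
    have "d * (\<mu> \<eta> + 1) = e" using m0 by (simp add: d_def)
    then have dm: "d * \<mu> \<eta> < e" using d by (simp add: algebra_simps)
    let ?W = "{z. \<bar>\<phi> z - \<phi> (x0, snd z)\<bar> < d}"
    have c1: "continuous_on UNIV (\<lambda>z::'b \<times> 'c. \<phi> (x0, snd z))"
      by (rule continuous_on_compose2[OF continuous_Pair_left[OF cc_cont[OF phi]]])
        (auto intro: continuous_on_snd continuous_on_id)
    have "open ?W"
      by (intro open_Collect_less continuous_on_rabs continuous_on_diff cc_cont[OF phi] c1 continuous_on_const)
    moreover have "{x0} \<times> snd ` ?S \<subseteq> ?W" using d by auto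
    ultimately have "\<exists>U. x0 \<in> U \<and> open U \<and> U \<times> snd ` ?S \<subseteq> ?W"
      by (rule Elementary_Topology.tube_lemma[OF S2])
    then obtain U where U: "x0 \<in> U" "open U" "U \<times> snd ` ?S \<subseteq> ?W" by (elim exE conjE)
    have "\<bar>\<mu> (\<lambda>y. \<phi> (x, y)) - \<mu> (\<lambda>y. \<phi> (x0, y))\<bar> < e" if x: "x \<in> U" for x
    proof -
      have le: "\<bar>\<phi> (x, y) - \<phi> (x0, y)\<bar> \<le> d * \<eta> y" for y
      proof (cases "y \<in> snd ` ?S")
        case True
        then have "(x, y) \<in> ?W" using U(3) x by blast
        then show ?thesis using eta(3)[OF True] by simp
      next
        case False
        then have "\<phi> (x, y) = 0" "\<phi> (x0, y) = 0" using cc_inside[of \<phi> "(x, y)"] cc_inside[of \<phi> "(x0, y)"] by force+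
        then show ?thesis using d eta(2)[of y] by simp
      qed
      note cc = tensor_slice_cc[OF phi, of x] tensor_slice_cc[OF phi, of x0]
      have "\<mu> (\<lambda>y. \<phi> (x, y) - \<phi> (x0, y)) \<le> \<mu> (\<lambda>y. d * \<eta> y)"
        by (rule pm_mono[OF mu cc_diff[OF cc] cc_scale[OF eta(1)]]) (use le in \<open>simp add: abs_le_iff\<close>)
      moreover have "\<mu> (\<lambda>y. \<phi> (x0, y) - \<phi> (x, y)) \<le> \<mu> (\<lambda>y. d * \<eta> y)"
        by (rule pm_mono[OF mu cc_diff[OF cc(2,1)] cc_scale[OF eta(1)]]) (use le in \<open>simp add: abs_le_iff\<close>)
      ultimately show ?thesis
        using rm_diff[OF pm_rm[OF mu] cc] rm_diff[OF pm_rm[OF mu] cc(2,1)] rm_scale[OF pm_rm[OF mu] eta(1), of d] dm by linarith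
    qed
    then show "\<forall>\<^sub>F x in nhds x0. dist (\<mu> (\<lambda>y. \<phi> (x, y))) (\<mu> (\<lambda>y. \<phi> (x0, y))) < e"
      using U(1,2) by (auto simp: eventually_nhds dist_real_def)
  qed
  then show "continuous_on UNIV (\<lambda>x. \<mu> (\<lambda>y. \<phi> (x, y)))"
    unfolding continuous_on_def by (blast intro: tendsto_mono[OF at_within_le_nhds])
qed

lemma tensor_apply: "\<phi> \<in> cc_functions \<Longrightarrow> tensor_measure \<nu> \<mu> \<phi> = \<nu> (\<lambda>x. \<mu> (\<lambda>y. \<phi> (x, y)))"
  by (simp add: tensor_measure_def)

lemma tensor_ext: "tensor_measure \<nu> \<mu> \<in> extensional cc_functions"
  by (simp add: tensor_measure_def)

lemma tensor_pm:
  fixes \<nu> :: "'b::t2_space functional" and \<mu> :: "'c::t2_space functional"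
  assumes lcb: "locally_compact_space (euclidean :: 'b topology)"
    and lc: "locally_compact_space (euclidean :: 'c topology)"
    and nu: "\<nu> \<in> positive_measures" and mu: "\<mu> \<in> positive_measures"
  shows "tensor_measure \<nu> \<mu> \<in> positive_measures"
proof (rule positive_measuresI[OF locally_compact_prod[OF lcb lc] tensor_ext])
  fix \<phi> \<psi> :: "'b \<times> 'c \<Rightarrow> real" and s t assume phi: "\<phi> \<in> cc_functions" and psi: "\<psi> \<in> cc_functions"
  have "(\<lambda>x. \<mu> (\<lambda>y. s * \<phi> (x, y) + t * \<psi> (x, y))) = (\<lambda>x. s * \<mu> (\<lambda>y. \<phi> (x, y)) + t * \<mu> (\<lambda>y. \<psi> (x, y)))"
    using rm_lin[OF pm_rm[OF mu] tensor_slice_cc[OF phi] tensor_slice_cc[OF psi]] by (intro ext) simp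
  then show "tensor_measure \<nu> \<mu> (\<lambda>x. s * \<phi> x + t * \<psi> x) = s * tensor_measure \<nu> \<mu> \<phi> + t * tensor_measure \<nu> \<mu> \<psi>"
    using rm_lin[OF pm_rm[OF nu] tensor_inner_cc[OF lc phi mu] tensor_inner_cc[OF lc psi mu]]
    by (simp add: tensor_apply phi psi cc_lin)
next
  fix \<phi> :: "'b \<times> 'c \<Rightarrow> real" assume phi: "\<phi> \<in> cc_functions" "\<And>z. 0 \<le> \<phi> z"
  have "0 \<le> \<mu> (\<lambda>y. \<phi> (x, y))" for x by (rule pm_nonneg[OF mu tensor_slice_cc[OF phi(1)]]) (rule phi(2))
  then have "0 \<le> \<nu> (\<lambda>x. \<mu> (\<lambda>y. \<phi> (x, y)))" by (rule pm_nonneg[OF nu tensor_inner_cc[OF lc phi(1) mu]])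
  then show "0 \<le> tensor_measure \<nu> \<mu> \<phi>" by (simp add: tensor_apply phi(1))
qed

lemma tensor_comb_left:
  fixes \<nu> :: "'b::t2_space functional" and \<mu> :: "'c::t2_space functional"
  assumes lc: "locally_compact_space (euclidean :: 'c topology)" and mu: "\<mu> \<in> positive_measures"
  shows "tensor_measure (radon_comb s \<nu> t \<nu>') \<mu> = radon_comb s (tensor_measure \<nu> \<mu>) t (tensor_measure \<nu>' \<mu>)"
  by (rule functional_eqI) (simp_all add: tensor_ext tensor_apply tensor_inner_cc[OF lc _ mu])

lemma tensor_comb_right:
  fixes \<nu> :: "'b::t2_space functional" and \<mu> \<mu>' :: "'c::t2_space functional"
  assumes lc: "locally_compact_space (euclidean :: 'c topology)" and nu: "\<nu> \<in> radon_measures"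
    and mu: "\<mu> \<in> positive_measures" "\<mu>' \<in> positive_measures"
  shows "tensor_measure \<nu> (radon_comb s \<mu> t \<mu>') = radon_comb s (tensor_measure \<nu> \<mu>) t (tensor_measure \<nu> \<mu>')"
  by (rule functional_eqI)
    (simp_all add: tensor_ext tensor_apply tensor_slice_cc rm_lin[OF nu] tensor_inner_cc[OF lc _ mu(1)] tensor_inner_cc[OF lc _ mu(2)])

text \<open>The four terms of the expansion are grouped by sign. In general this is not the Jordan
  decomposition of the tensor square; for singular \<open>\<sigma>\<close> and \<open>\<tau>\<close>
  the missing inequality is \<open>tensor_square_le_positive_part\<close>.\<close>

lemma tensor_square_diff:
  fixes \<sigma> \<tau> :: "'b::t2_space functional"
  assumes lc: "locally_compact_space (euclidean :: 'b topology)"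
    and s: "\<sigma> \<in> positive_measures" and t: "\<tau> \<in> positive_measures"
  shows "tensor_measure (radon_diff \<sigma> \<tau>) (radon_diff \<sigma> \<tau>) =
    radon_diff (radon_comb 1 (tensor_measure \<sigma> \<sigma>) 1 (tensor_measure \<tau> \<tau>))
      (radon_comb 1 (tensor_measure \<sigma> \<tau>) 1 (tensor_measure \<tau> \<sigma>))"
proof -
  have rm: "radon_diff \<sigma> \<tau> \<in> radon_measures" by (intro radon_diff_rm pm_rm s t)
  have "tensor_measure (radon_diff \<sigma> \<tau>) (radon_comb 1 \<sigma> (-1) \<tau>) =
    radon_comb 1 (tensor_measure (radon_diff \<sigma> \<tau>) \<sigma>) (-1) (tensor_measure (radon_diff \<sigma> \<tau>) \<tau>)"
    by (rule tensor_comb_right[OF lc rm s t])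
  moreover have "tensor_measure (radon_diff \<sigma> \<tau>) \<sigma> = radon_comb 1 (tensor_measure \<sigma> \<sigma>) (-1) (tensor_measure \<tau> \<sigma>)"
    unfolding radon_diff_eq_comb by (rule tensor_comb_left[OF lc s])
  moreover have "tensor_measure (radon_diff \<sigma> \<tau>) \<tau> = radon_comb 1 (tensor_measure \<sigma> \<tau>) (-1) (tensor_measure \<tau> \<tau>)"
    unfolding radon_diff_eq_comb by (rule tensor_comb_left[OF lc t])
  ultimately have "tensor_measure (radon_diff \<sigma> \<tau>) (radon_comb 1 \<sigma> (-1) \<tau>) =
    radon_comb 1 (radon_comb 1 (tensor_measure \<sigma> \<sigma>) (-1) (tensor_measure \<tau> \<sigma>)) (-1)
      (radon_comb 1 (tensor_measure \<sigma> \<tau>) (-1) (tensor_measure \<tau> \<tau>))" by simp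
  also have "\<dots> = radon_diff (radon_comb 1 (tensor_measure \<sigma> \<sigma>) 1 (tensor_measure \<tau> \<tau>))
      (radon_comb 1 (tensor_measure \<sigma> \<tau>) 1 (tensor_measure \<tau> \<sigma>))"
    by (rule functional_eqI) simp_all
  finally show ?thesis by (simp only: radon_diff_eq_comb)
qed

lemma cc_product:
  fixes f :: "'b::t2_space \<Rightarrow> real" and h :: "'c::t2_space \<Rightarrow> real"
  assumes f: "f \<in> cc_functions" and h: "h \<in> cc_functions"
  shows "(\<lambda>z. f (fst z) * h (snd z)) \<in> cc_functions"
proof (rule cc_functionsI)
  show "continuous_on UNIV (\<lambda>z. f (fst z) * h (snd z))"
    by (intro continuous_on_mult continuous_on_compose2[OF cc_cont[OF f]] continuous_on_compose2[OF cc_cont[OF h]]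
        continuous_on_fst continuous_on_snd continuous_on_id subset_UNIV)
  show "compact (closure {x. f x \<noteq> 0} \<times> closure {x. h x \<noteq> 0})"
    by (rule compact_Times[OF cc_compact[OF f] cc_compact[OF h]])
  show "f (fst z) * h (snd z) = 0" if "z \<notin> closure {x. f x \<noteq> 0} \<times> closure {x. h x \<noteq> 0}" for z
    using that cc_inside[of f "fst z"] cc_inside[of h "snd z"] by (cases z) auto
qed

lemma tensor_product:
  fixes f :: "'b::t2_space \<Rightarrow> real" and h :: "'c::t2_space \<Rightarrow> real"
  assumes f: "f \<in> cc_functions" and h: "h \<in> cc_functions" and "\<nu> \<in> radon_measures" "\<mu> \<in> radon_measures"
  shows "tensor_measure \<nu> \<mu> (\<lambda>z. f (fst z) * h (snd z)) = \<nu> f * \<mu> h"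
  using rm_scale[OF assms(4) h] rm_scale[OF assms(3) f, of "\<mu> h"]
  by (simp add: tensor_apply cc_product[OF f h] mult.commute)

lemma tensor_le_product:
  fixes f1 f2 :: "'b::t2_space \<Rightarrow> real" and h1 h2 :: "'c::t2_space \<Rightarrow> real"
  assumes lcb: "locally_compact_space (euclidean :: 'b topology)"
    and lc: "locally_compact_space (euclidean :: 'c topology)"
    and nu: "\<nu> \<in> positive_measures" and mu: "\<mu> \<in> positive_measures"
    and psi: "\<psi> \<in> cc_functions" and f: "f1 \<in> cc_functions" "f2 \<in> cc_functions" and h: "h1 \<in> cc_functions" "h2 \<in> cc_functions"
    and le: "\<And>x y. \<psi> (x, y) \<le> B * (f1 x * h1 y + f2 x * h2 y)"
  shows "tensor_measure \<nu> \<mu> \<psi> \<le> B * (\<nu> f1 * \<mu> h1 + \<nu> f2 * \<mu> h2)"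
proof -
  let ?a = "\<lambda>z. f1 (fst z) * h1 (snd z)" and ?b = "\<lambda>z. f2 (fst z) * h2 (snd z)"
  have ab: "?a \<in> cc_functions" "?b \<in> cc_functions" by (intro cc_product f h)+
  have T: "tensor_measure \<nu> \<mu> \<in> positive_measures" by (rule tensor_pm[OF lcb lc nu mu])
  have "tensor_measure \<nu> \<mu> \<psi> \<le> tensor_measure \<nu> \<mu> (\<lambda>z. B * ?a z + B * ?b z)"
  proof (rule pm_mono[OF T psi cc_lin[OF ab]])
    show "\<psi> z \<le> B * ?a z + B * ?b z" for z using le[of "fst z" "snd z"] by (simp add: distrib_left)
  qed
  also have "\<dots> = B * (\<nu> f1 * \<mu> h1) + B * (\<nu> f2 * \<mu> h2)"
    using rm_lin[OF pm_rm[OF T] ab, of B B] tensor_product[OF f(1) h(1) pm_rm[OF nu] pm_rm[OF mu]]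
      tensor_product[OF f(2) h(2) pm_rm[OF nu] pm_rm[OF mu]] by simp
  finally show ?thesis by (simp add: distrib_left)
qed

text \<open>A function \<open>\<theta>\<close> separating \<open>\<sigma>\<close> from \<open>\<tau>\<close> yields the weight
  \<open>\<theta> x * \<theta> y + (1 - \<theta> x) * (1 - \<theta> y)\<close> separating \<open>\<sigma> \<otimes> \<sigma> + \<tau> \<otimes> \<tau>\<close> from
  \<open>\<sigma> \<otimes> \<tau> + \<tau> \<otimes> \<sigma>\<close>.\<close>

lemma tensor_square_le_positive_part:
  fixes \<sigma> \<tau> :: "'b::t2_space functional"
  assumes lc: "locally_compact_space (euclidean :: 'b topology)"
    and s: "\<sigma> \<in> positive_measures" and t: "\<tau> \<in> positive_measures" and sing: "singular_measures \<sigma> \<tau>"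
  shows "measure_le (radon_comb 1 (tensor_measure \<sigma> \<sigma>) 1 (tensor_measure \<tau> \<tau>))
    (positive_part (tensor_measure (radon_diff \<sigma> \<tau>) (radon_diff \<sigma> \<tau>)))"
  unfolding measure_le_def
proof (intro ballI impI)
  fix \<phi> :: "'b \<times> 'b \<Rightarrow> real" assume phi: "\<phi> \<in> cc_functions" "\<forall>x. 0 \<le> \<phi> x"
  note lc2 = locally_compact_prod[OF lc lc]
  let ?ss = "tensor_measure \<sigma> \<sigma>" and ?tt = "tensor_measure \<tau> \<tau>" and ?st = "tensor_measure \<sigma> \<tau>" and ?ts = "tensor_measure \<tau> \<sigma>"
  let ?P = "radon_comb 1 ?ss 1 ?tt" and ?N = "radon_comb 1 ?st 1 ?ts"
  let ?D = "tensor_measure (radon_diff \<sigma> \<tau>) (radon_diff \<sigma> \<tau>)"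
  note pms = tensor_pm[OF lc lc s s] tensor_pm[OF lc lc t t] tensor_pm[OF lc lc s t] tensor_pm[OF lc lc t s]
  have D: "?D = radon_diff ?P ?N" by (rule tensor_square_diff[OF lc s t])
  have Drm: "?D \<in> radon_measures" unfolding D by (intro radon_diff_rm radon_comb_rm pm_rm pms)
  let ?S = "closure {z. \<phi> z \<noteq> 0}"
  let ?S1 = "fst ` ?S \<union> snd ` ?S"
  have S1: "compact ?S1"
    by (intro compact_Un compact_continuous_image continuous_on_fst continuous_on_snd continuous_on_id cc_compact phi(1))
  from cc_cutoff[OF lc S1]
  obtain \<eta> where eta[rule_format]: "\<eta> \<in> cc_functions" "\<forall>y. 0 \<le> \<eta> y" "\<forall>y. \<eta> y \<le> 1" "\<forall>y\<in>?S1. \<eta> y = 1" by meson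
  obtain B where B: "0 \<le> B" "\<And>z. \<bar>\<phi> z\<bar> \<le> B" using cc_bounded[OF phi(1)] by blast
  have s0: "0 \<le> \<sigma> \<eta>" and t0: "0 \<le> \<tau> \<eta>" by (rule pm_nonneg[OF _ eta(1,2)], fact)+
  \<comment> \<open>The four product estimates below have two terms each: four are at most
    \<open>B * \<sigma> \<eta> * \<epsilon>\<close> and four at most
    \<open>B * \<tau> \<eta> * \<epsilon>\<close>.\<close>
  define C where "C = 4 * B * (\<sigma> \<eta> + \<tau> \<eta>)"
  have C0: "0 \<le> C" using B(1) s0 t0 by (simp add: C_def)
  have main: "?P \<phi> \<le> pos_sup ?D \<phi> + C * \<epsilon>" if e: "0 < \<epsilon>" for \<epsilon>
  proof -
    have "\<exists>\<theta>\<in>cc_functions. (\<forall>x. 0 \<le> \<theta> x \<and> \<theta> x \<le> \<eta> x) \<and> \<sigma> (\<lambda>x. \<eta> x - \<theta> x) < \<epsilon> \<and> \<tau> \<theta> < \<epsilon>"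
      using bspec[OF sing[unfolded singular_measures_def] eta(1)] eta(2) e by simp
    then obtain \<theta> where th[rule_format]: "\<theta> \<in> cc_functions" "\<forall>x. 0 \<le> \<theta> x" "\<forall>x. \<theta> x \<le> \<eta> x"
      and ths: "\<sigma> (\<lambda>x. \<eta> x - \<theta> x) < \<epsilon>" and tht: "\<tau> \<theta> < \<epsilon>" by meson
    let ?\<zeta> = "\<lambda>x. \<eta> x - \<theta> x"
    have z: "?\<zeta> \<in> cc_functions" "\<And>x. 0 \<le> ?\<zeta> x" using th eta(1) by (simp_all add: cc_diff)
    have th1: "\<theta> x \<le> 1" for x using th(3)[of x] eta(3)[of x] by linarith
    define w where "w = (\<lambda>z. \<theta> (fst z) * \<theta> (snd z) + (1 - \<theta> (fst z)) * (1 - \<theta> (snd z)))"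
    have wcont: "continuous_on UNIV w" unfolding w_def
      by (intro continuous_on_add continuous_on_mult continuous_on_diff continuous_on_const
          continuous_on_compose2[OF cc_cont[OF th(1)]] continuous_on_fst continuous_on_snd continuous_on_id subset_UNIV)
    have w01: "0 \<le> w z" "w z \<le> 1" for z
    proof -
      show "0 \<le> w z" unfolding w_def using th(2) th1 by (intro add_nonneg_nonneg mult_nonneg_nonneg) auto
      have "0 \<le> \<theta> (fst z) * (1 - \<theta> (snd z))" "0 \<le> \<theta> (snd z) * (1 - \<theta> (fst z))"
        using th(2) th1 by (auto intro!: mult_nonneg_nonneg)
      then show "w z \<le> 1" unfolding w_def by (simp add: algebra_simps)
    qed
    let ?\<psi> = "\<lambda>z. w z * \<phi> z" and ?\<psi>' = "\<lambda>z. (1 - w z) * \<phi> z"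
    have psi: "?\<psi> \<in> cc_functions" by (rule cc_mult[OF wcont phi(1)])
    have psi': "?\<psi>' \<in> cc_functions"
      by (rule cc_mult[OF _ phi(1)]) (intro continuous_on_diff continuous_on_const wcont)
    have psi0: "0 \<le> w z * \<phi> z" for z by (rule mult_nonneg_nonneg[OF w01(1) phi(2)[rule_format]])
    have psi1: "w z * \<phi> z \<le> \<phi> z" for z using mult_right_mono[OF w01(2)[of z] phi(2)[rule_format, of z]] by simp
    \<comment> \<open>On the support of \<open>\<phi>\<close> both coordinates satisfy
      \<open>\<eta> = 1\<close>, and elsewhere the left side is 0; so each product estimate need
      only be checked where \<open>\<eta>\<close> is 1.\<close>
    have bnd: "c * \<phi> (x, y) \<le> B * d" if "0 \<le> d" "\<eta> x = 1 \<Longrightarrow> \<eta> y = 1 \<Longrightarrow> c \<le> d" for c d x y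
    proof (cases "(x, y) \<in> ?S")
      case True
      have "\<eta> x = 1" "\<eta> y = 1" using imageI[OF True, of fst] imageI[OF True, of snd] by (simp_all add: eta(4))
      then have "c \<le> d" by (rule that(2))
      then have "c * \<phi> (x, y) \<le> d * \<phi> (x, y)" by (rule mult_right_mono) (rule phi(2)[rule_format])
      also have "\<dots> \<le> d * B" using B(2)[of "(x, y)"] that(1) by (intro mult_left_mono) auto
      finally show ?thesis by (simp add: mult.commute)
    next
      case False
      then have "\<phi> (x, y) = 0" by (rule cc_outside)
      then show ?thesis using B(1) that(1) by simp
    qed
    have nn: "0 \<le> \<theta> a * \<theta> b" "0 \<le> \<theta> a * (1 - \<theta> b)" "0 \<le> (1 - \<theta> a) * (1 - \<theta> b)"
      "0 \<le> \<theta> a * \<eta> b" "0 \<le> \<eta> a * \<theta> b" "0 \<le> \<eta> a * ?\<zeta> b" "0 \<le> ?\<zeta> a * \<eta> b"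
      "\<theta> a * \<theta> b \<le> \<theta> a" "\<theta> a * \<theta> b \<le> \<theta> b" for a b
    proof -
      have f: "0 \<le> 1 - \<theta> c" for c using th1[of c] by simp
      show "0 \<le> \<theta> a * \<theta> b" "0 \<le> \<theta> a * (1 - \<theta> b)" "0 \<le> (1 - \<theta> a) * (1 - \<theta> b)"
        "0 \<le> \<theta> a * \<eta> b" "0 \<le> \<eta> a * \<theta> b" "0 \<le> \<eta> a * ?\<zeta> b" "0 \<le> ?\<zeta> a * \<eta> b"
        by (rule mult_nonneg_nonneg; rule th(2) f eta(2) z(2))+
      show "\<theta> a * \<theta> b \<le> \<theta> a" "\<theta> a * \<theta> b \<le> \<theta> b"
        using mult_left_mono[OF th1[of b] th(2)[of a]] mult_right_mono[OF th1[of a] th(2)[of b]] by simp_all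
    qed
    have ss: "?ss ?\<psi>' \<le> B * (\<sigma> \<eta> * \<sigma> ?\<zeta> + \<sigma> ?\<zeta> * \<sigma> \<eta>)"
    proof (rule tensor_le_product[OF lc lc s s psi' eta(1) z(1) z(1) eta(1)])
      fix x y
      show "?\<psi>' (x, y) \<le> B * (\<eta> x * ?\<zeta> y + ?\<zeta> x * \<eta> y)"
      proof (rule bnd)
        show "0 \<le> \<eta> x * (\<eta> y - \<theta> y) + (\<eta> x - \<theta> x) * \<eta> y" using nn(6)[of x y] nn(7)[of x y] by linarith
        assume "\<eta> x = 1" "\<eta> y = 1"
        then show "1 - w (x, y) \<le> \<eta> x * (\<eta> y - \<theta> y) + (\<eta> x - \<theta> x) * \<eta> y"
          using nn(3)[of x y] by (simp add: w_def algebra_simps)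
      qed
    qed
    have tt: "?tt ?\<psi>' \<le> B * (\<tau> \<theta> * \<tau> \<eta> + \<tau> \<eta> * \<tau> \<theta>)"
    proof (rule tensor_le_product[OF lc lc t t psi' th(1) eta(1) eta(1) th(1)])
      fix x y
      show "?\<psi>' (x, y) \<le> B * (\<theta> x * \<eta> y + \<eta> x * \<theta> y)"
      proof (rule bnd)
        show "0 \<le> \<theta> x * \<eta> y + \<eta> x * \<theta> y" using nn(4)[of x y] nn(5)[of x y] by linarith
        assume "\<eta> x = 1" "\<eta> y = 1"
        then show "1 - w (x, y) \<le> \<theta> x * \<eta> y + \<eta> x * \<theta> y"
          using nn(1)[of x y] by (simp add: w_def algebra_simps)
      qed
    qed
    have st: "?st ?\<psi> \<le> B * (\<sigma> \<eta> * \<tau> \<theta> + \<sigma> ?\<zeta> * \<tau> \<eta>)"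
    proof (rule tensor_le_product[OF lc lc s t psi eta(1) z(1) th(1) eta(1)])
      fix x y
      show "?\<psi> (x, y) \<le> B * (\<eta> x * \<theta> y + ?\<zeta> x * \<eta> y)"
      proof (rule bnd)
        show "0 \<le> \<eta> x * \<theta> y + (\<eta> x - \<theta> x) * \<eta> y" using nn(5)[of x y] nn(7)[of x y] by linarith
        assume "\<eta> x = 1" "\<eta> y = 1"
        then show "w (x, y) \<le> \<eta> x * \<theta> y + (\<eta> x - \<theta> x) * \<eta> y"
          using nn(2)[of x y] nn(9)[of x y] th(2) by (simp add: w_def algebra_simps)
      qed
    qed
    have ts: "?ts ?\<psi> \<le> B * (\<tau> \<theta> * \<sigma> \<eta> + \<tau> \<eta> * \<sigma> ?\<zeta>)"
    proof (rule tensor_le_product[OF lc lc t s psi th(1) eta(1) eta(1) z(1)])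
      fix x y
      show "?\<psi> (x, y) \<le> B * (\<theta> x * \<eta> y + \<eta> x * ?\<zeta> y)"
      proof (rule bnd)
        show "0 \<le> \<theta> x * \<eta> y + \<eta> x * (\<eta> y - \<theta> y)" using nn(4)[of x y] nn(6)[of x y] by linarith
        assume "\<eta> x = 1" "\<eta> y = 1"
        then show "w (x, y) \<le> \<theta> x * \<eta> y + \<eta> x * (\<eta> y - \<theta> y)"
          using nn(8)[of x y] th(2) by (simp add: w_def algebra_simps)
      qed
    qed
    have "B * \<sigma> \<eta> * \<sigma> ?\<zeta> \<le> B * \<sigma> \<eta> * \<epsilon>" "B * \<sigma> \<eta> * \<tau> \<theta> \<le> B * \<sigma> \<eta> * \<epsilon>"
      "B * \<tau> \<eta> * \<sigma> ?\<zeta> \<le> B * \<tau> \<eta> * \<epsilon>" "B * \<tau> \<eta> * \<tau> \<theta> \<le> B * \<tau> \<eta> * \<epsilon>"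
      using B(1) s0 t0 ths tht by (simp_all add: mult_left_mono)
    \<comment> \<open>The left side is exactly \<open>?P \<phi> - ?D ?\<psi>\<close>, because
      \<open>\<phi>\<close> is the sum of \<open>?\<psi>\<close> and
      \<open>?\<psi>'\<close>.\<close>
    then have sum: "?ss ?\<psi>' + ?tt ?\<psi>' + ?st ?\<psi> + ?ts ?\<psi> \<le> C * \<epsilon>"
      using ss tt st ts unfolding C_def by (simp add: algebra_simps)
    have split: "\<rho> \<phi> = \<rho> ?\<psi> + \<rho> ?\<psi>'" if "\<rho> \<in> positive_measures" for \<rho> :: "('b \<times> 'b) functional"
    proof -
      have "(\<lambda>z. ?\<psi> z + ?\<psi>' z) = \<phi>" by (simp add: fun_eq_iff algebra_simps)
      then show ?thesis using rm_add[OF pm_rm[OF that] psi psi'] by metis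
    qed
    have "?D ?\<psi> \<le> pos_sup ?D \<phi>" by (rule pos_sup_upper[OF Drm phi(1) psi psi0 psi1])
    moreover have "?D ?\<psi> = ?ss ?\<psi> + ?tt ?\<psi> - (?st ?\<psi> + ?ts ?\<psi>)" unfolding D using psi by simp
    ultimately show ?thesis using sum split[OF pms(1)] split[OF pms(2)] phi(1) by simp
  qed
  have "?P \<phi> \<le> pos_sup ?D \<phi>"
  proof (rule field_le_epsilon)
    fix e :: real assume e: "0 < e"
    have "?P \<phi> \<le> pos_sup ?D \<phi> + C * (e / (C + 1))" using e C0 by (intro main) simp
    moreover have "C * (e / (C + 1)) \<le> e" using e C0 by (simp add: field_simps)
    ultimately show "?P \<phi> \<le> pos_sup ?D \<phi> + e" by linarith
  qed
  then show "?P \<phi> \<le> positive_part ?D \<phi>" using positive_part_pm(2)[OF lc2 Drm phi(1)] phi(2) by simp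
qed

lemma tensor_mono:
  fixes \<nu> \<nu>' :: "'b::t2_space functional" and \<mu> \<mu>' :: "'c::t2_space functional"
  assumes lc: "locally_compact_space (euclidean :: 'c topology)"
    and pm: "\<nu> \<in> positive_measures" "\<mu> \<in> positive_measures" "\<mu>' \<in> positive_measures"
    and le: "measure_le \<nu> \<nu>'" "measure_le \<mu> \<mu>'"
  shows "measure_le (tensor_measure \<nu> \<mu>) (tensor_measure \<nu>' \<mu>')"
  unfolding measure_le_def
proof (intro ballI impI)
  fix \<phi> :: "'b \<times> 'c \<Rightarrow> real" assume phi: "\<phi> \<in> cc_functions" "\<forall>z. 0 \<le> \<phi> z"
  note cc = tensor_inner_cc[OF lc phi(1)]
  have "\<mu> (\<lambda>y. \<phi> (x, y)) \<le> \<mu>' (\<lambda>y. \<phi> (x, y))" for x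
    using le(2) tensor_slice_cc[OF phi(1)] phi(2) by (simp add: measure_le_def)
  then have "\<nu> (\<lambda>x. \<mu> (\<lambda>y. \<phi> (x, y))) \<le> \<nu> (\<lambda>x. \<mu>' (\<lambda>y. \<phi> (x, y)))"
    by (rule pm_mono[OF pm(1) cc[OF pm(2)] cc[OF pm(3)]])
  also have "\<dots> \<le> \<nu>' (\<lambda>x. \<mu>' (\<lambda>y. \<phi> (x, y)))"
    using le(1) cc[OF pm(3)] pm_nonneg[OF pm(3) tensor_slice_cc[OF phi(1)]] phi(2) by (simp add: measure_le_def)
  finally show "tensor_measure \<nu> \<mu> \<phi> \<le> tensor_measure \<nu>' \<mu>' \<phi>" using phi(1) by (simp add: tensor_apply)
qed

lemma nonneg_quadratic_discriminant:
  fixes a b c :: real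
  assumes "\<And>t. 0 \<le> a + 2 * t * b + t\<^sup>2 * c"
  shows "b\<^sup>2 \<le> a * c"
proof (cases "c = 0")
  case True
  have "b = 0"
  proof (rule ccontr)
    assume "b \<noteq> 0"
    then have "a + 2 * (- (a + 1) / (2 * b)) * b = -1" by (simp add: field_simps)
    then show False using assms[of "- (a + 1) / (2 * b)"] True by simp
  qed
  then show ?thesis using True by simp
next
  case False
  have "0 \<le> c"
  proof (rule ccontr)
    assume "\<not> 0 \<le> c"
    then have c: "c < 0" by simp
    \<comment> \<open>So large that the negative quadratic term outweighs the constant and the
      linear one, leaving a value of at most \<open>- t\<close>.\<close>
    define t where "t = (\<bar>a\<bar> + 2 * \<bar>b\<bar> + 1) / (- c) + 1"
    have t: "1 \<le> t" "\<bar>a\<bar> + 2 * \<bar>b\<bar> + 1 \<le> t * (- c)" using c by (auto simp: t_def field_simps)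
    have "\<bar>a\<bar> \<le> \<bar>a\<bar> * t" "b * t \<le> \<bar>b\<bar> * t" using t(1) by (auto simp: mult_le_cancel_left1 mult_right_mono)
    moreover have "(\<bar>a\<bar> + 2 * \<bar>b\<bar> + 1) * t \<le> t * (- c) * t" using t by (intro mult_right_mono) auto
    ultimately have "a + 2 * t * b + t\<^sup>2 * c \<le> - t" by (simp add: power2_eq_square algebra_simps)
    then show False using assms[of t] t(1) by linarith
  qed
  with False have c: "0 < c" by simp
  have "0 \<le> (a + 2 * (- b / c) * b + (- b / c)\<^sup>2 * c) * c" using assms[of "- b / c"] c by (intro mult_nonneg_nonneg) auto
  also have "\<dots> = a * c - b\<^sup>2" using c by (simp add: field_simps power2_eq_square)
  finally show ?thesis by simp
qed


section \<open>The cone of positive measures of finite energy\<close>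

locale energy_space =
  fixes \<kappa> :: "('a::t2_space) kernel"
  assumes lc: "locally_compact_space (euclidean :: 'a topology)"
    and pd: "positive_definite_kernel \<kappa>"
begin

abbreviation Ep :: "'a functional set" where
  "Ep \<equiv> positive_finite_energy \<kappa>"

definition mutual :: "'a functional \<Rightarrow> 'a functional \<Rightarrow> ereal" where
  "mutual \<sigma> \<tau> = positive_integral (tensor_measure \<sigma> \<tau>) \<kappa>"

text \<open>Symmetrizing makes Fubini's theorem for \<open>\<sigma> \<otimes> \<tau>\<close> and \<open>\<tau> \<otimes> \<sigma>\<close> unnecessary.\<close>

definition form :: "'a functional \<Rightarrow> 'a functional \<Rightarrow> real" where
  "form \<sigma> \<tau> = (real_of_ereal (mutual \<sigma> \<tau>) + real_of_ereal (mutual \<tau> \<sigma>)) / 2"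

lemma kernel_lsc: "\<kappa> \<in> lsc_class"
  using pd by (simp add: positive_definite_kernel_def)

text \<open>One test function below the kernel, fixed once: it keeps all upper integrals of
  \<open>\<kappa>\<close> away from \<open>- \<infinity>\<close>, also for a kernel of both
  signs.\<close>

definition minorant :: "'a \<times> 'a \<Rightarrow> real" where
  "minorant = (SOME \<theta>. \<theta> \<in> cc_functions \<and> (\<forall>z. ereal (\<theta> z) \<le> \<kappa> z))"

lemma minorant: "minorant \<in> cc_functions" "ereal (minorant z) \<le> \<kappa> z"
proof -
  have "\<exists>\<theta>. \<theta> \<in> cc_functions \<and> (\<forall>z. ereal (\<theta> z) \<le> \<kappa> z)"
    by (rule lsc_class_minorant[OF kernel_lsc]) auto
  note * = someI_ex[OF this, folded minorant_def]
  show "minorant \<in> cc_functions" by (rule *[THEN conjunct1])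
  show "ereal (minorant z) \<le> \<kappa> z" by (rule *[THEN conjunct2, rule_format])
qed

lemma lc2: "locally_compact_space (euclidean :: ('a \<times> 'a) topology)"
  by (rule locally_compact_prod[OF lc lc])

lemma mutual_not_MInf: "mutual \<sigma> \<tau> \<noteq> - \<infinity>"
proof -
  show ?thesis unfolding mutual_def by (rule positive_integral_gt(2)[OF minorant])
qed

lemma tpm: "\<sigma> \<in> positive_measures \<Longrightarrow> \<tau> \<in> positive_measures \<Longrightarrow> tensor_measure \<sigma> \<tau> \<in> positive_measures"
  for \<sigma> \<tau> :: "'a functional"
  by (rule tensor_pm[OF lc lc])

lemma energy_pm:
  assumes "\<sigma> \<in> positive_measures"
  shows "energy_defined \<kappa> \<sigma>" "energy \<kappa> \<sigma> = mutual \<sigma> \<sigma>"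
proof -
  note th = minorant
  have z: "positive_integral (zero_measure :: ('a \<times> 'a) functional) \<kappa> = 0"
    by (rule positive_integral_zero_measure[OF th])
  show "energy_defined \<kappa> \<sigma>" "energy \<kappa> \<sigma> = mutual \<sigma> \<sigma>"
    using positive_part_of_pm[OF lc2 tpm[OF assms assms]] z
    by (simp_all add: energy_defined_def energy_def integral_defined_def signed_integral_def mutual_def)
qed

lemma Ep_iff: "\<sigma> \<in> Ep \<longleftrightarrow> \<sigma> \<in> positive_measures \<and> mutual \<sigma> \<sigma> < \<infinity>"
proof (cases "\<sigma> \<in> positive_measures")
  case True
  then show ?thesis using energy_pm[OF True] mutual_not_MInf[of \<sigma> \<sigma>] pm_rm[OF True]
    by (cases "mutual \<sigma> \<sigma>") (auto simp: positive_finite_energy_def finite_energy_def)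
qed (simp add: positive_finite_energy_def)

lemma Ep_pm: "\<sigma> \<in> Ep \<Longrightarrow> \<sigma> \<in> positive_measures"
  by (simp add: Ep_iff)

lemma mutual_comb_left:
  assumes "\<sigma> \<in> positive_measures" "\<tau> \<in> positive_measures" "\<rho> \<in> positive_measures" "0 \<le> s" "0 \<le> t"
  shows "mutual (radon_comb s \<sigma> t \<tau>) \<rho> = ereal s * mutual \<sigma> \<rho> + ereal t * mutual \<tau> \<rho>"
proof -
  note th = minorant
  show ?thesis unfolding mutual_def tensor_comb_left[OF lc assms(3)]
    by (rule positive_integral_comb[OF tpm[OF assms(1,3)] tpm[OF assms(2,3)] assms(4,5) th])
qed

lemma mutual_comb_right:
  assumes "\<sigma> \<in> positive_measures" "\<tau> \<in> positive_measures" "\<rho> \<in> positive_measures" "0 \<le> s" "0 \<le> t"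
  shows "mutual \<rho> (radon_comb s \<sigma> t \<tau>) = ereal s * mutual \<rho> \<sigma> + ereal t * mutual \<rho> \<tau>"
proof -
  note th = minorant
  show ?thesis unfolding mutual_def tensor_comb_right[OF lc pm_rm[OF assms(3)] assms(1,2)]
    by (rule positive_integral_comb[OF tpm[OF assms(3,1)] tpm[OF assms(3,2)] assms(4,5) th])
qed

text \<open>Finite energies of \<open>\<sigma>\<close> and \<open>\<tau>\<close> make the energy of
  \<open>\<sigma> - \<tau>\<close> well defined but possibly \<open>- \<infinity>\<close>. Positive
  definiteness excludes this value, and thereby forces the mixed energies to be finite.\<close>

lemma mutual_square_diff:
  assumes s: "\<sigma> \<in> positive_measures" and t: "\<tau> \<in> positive_measures"
    and fin: "mutual \<sigma> \<sigma> < \<infinity>" "mutual \<tau> \<tau> < \<infinity>"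
  shows "energy_defined \<kappa> (radon_diff \<sigma> \<tau>)"
    and "mutual \<sigma> \<tau> + mutual \<tau> \<sigma> < \<infinity>"
    and "energy \<kappa> (radon_diff \<sigma> \<tau>) = (mutual \<sigma> \<sigma> + mutual \<tau> \<tau>) - (mutual \<sigma> \<tau> + mutual \<tau> \<sigma>)"
proof -
  note th = minorant
  let ?P = "radon_comb 1 (tensor_measure \<sigma> \<sigma>) 1 (tensor_measure \<tau> \<tau>)"
  let ?N = "radon_comb 1 (tensor_measure \<sigma> \<tau>) 1 (tensor_measure \<tau> \<sigma>)"
  have P: "?P \<in> positive_measures" and N: "?N \<in> positive_measures"
    using s t by (simp_all add: radon_comb_pm tpm)
  have D: "tensor_measure (radon_diff \<sigma> \<tau>) (radon_diff \<sigma> \<tau>) = radon_diff ?P ?N"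
    by (rule tensor_square_diff[OF lc s t])
  have iP: "positive_integral ?P \<kappa> = mutual \<sigma> \<sigma> + mutual \<tau> \<tau>"
    using positive_integral_comb[OF tpm[OF s s] tpm[OF t t], of 1 1 minorant \<kappa>] th by (simp add: mutual_def one_ereal_def[symmetric])
  have iN: "positive_integral ?N \<kappa> = mutual \<sigma> \<tau> + mutual \<tau> \<sigma>"
    using positive_integral_comb[OF tpm[OF s t] tpm[OF t s], of 1 1 minorant \<kappa>] th by (simp add: mutual_def one_ereal_def[symmetric])
  have fP: "positive_integral ?P \<kappa> < \<infinity>" unfolding iP using fin by auto
  note * = signed_integral_diff[OF lc2 P N th fP, folded D]
  show ed: "energy_defined \<kappa> (radon_diff \<sigma> \<tau>)" using *(1) by (simp add: energy_defined_def)
  have "radon_diff \<sigma> \<tau> \<in> radon_measures" by (intro radon_diff_rm pm_rm s t)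
  then have "0 \<le> energy \<kappa> (radon_diff \<sigma> \<tau>)" using ed pd by (simp add: positive_definite_kernel_def)
  then have "- \<infinity> < signed_integral (tensor_measure (radon_diff \<sigma> \<tau>) (radon_diff \<sigma> \<tau>)) \<kappa>"
    by (auto simp: energy_def)
  from *(2)[OF this] show fN: "mutual \<sigma> \<tau> + mutual \<tau> \<sigma> < \<infinity>" unfolding iN .
  show "energy \<kappa> (radon_diff \<sigma> \<tau>) = (mutual \<sigma> \<sigma> + mutual \<tau> \<tau>) - (mutual \<sigma> \<tau> + mutual \<tau> \<sigma>)"
    using *(3) fN unfolding iN iP by (simp add: energy_def)
qed

lemma mutual_finite:
  assumes "\<sigma> \<in> Ep" "\<tau> \<in> Ep"
  shows "\<bar>mutual \<sigma> \<tau>\<bar> \<noteq> \<infinity>"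
  using mutual_square_diff(2)[of \<sigma> \<tau>] assms mutual_not_MInf[of \<sigma> \<tau>] mutual_not_MInf[of \<tau> \<sigma>]
  by (cases "mutual \<sigma> \<tau>"; cases "mutual \<tau> \<sigma>") (auto simp: Ep_iff)

lemma mutual_real:
  assumes "\<sigma> \<in> Ep" "\<tau> \<in> Ep"
  shows "mutual \<sigma> \<tau> = ereal (real_of_ereal (mutual \<sigma> \<tau>))"
  using mutual_finite[OF assms] by (simp add: ereal_real)

lemma mutual_form: "\<sigma> \<in> Ep \<Longrightarrow> mutual \<sigma> \<sigma> = ereal (form \<sigma> \<sigma>)"
  using mutual_real[of \<sigma> \<sigma>] by (simp add: form_def)

lemma mutual_sum_form: "\<sigma> \<in> Ep \<Longrightarrow> \<tau> \<in> Ep \<Longrightarrow> mutual \<sigma> \<tau> + mutual \<tau> \<sigma> = ereal (2 * form \<sigma> \<tau>)"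
  using mutual_finite[of \<sigma> \<tau>] mutual_finite[of \<tau> \<sigma>]
  by (cases "mutual \<sigma> \<tau>"; cases "mutual \<tau> \<sigma>") (auto simp: form_def)

lemma form_sym: "form \<sigma> \<tau> = form \<tau> \<sigma>"
  by (simp add: form_def add.commute)

lemma Ep_comb:
  assumes "\<sigma> \<in> Ep" "\<tau> \<in> Ep" "0 \<le> s" "0 \<le> t"
  shows "radon_comb s \<sigma> t \<tau> \<in> Ep"
proof -
  have pm: "\<sigma> \<in> positive_measures" "\<tau> \<in> positive_measures" using assms Ep_pm by auto
  have c: "radon_comb s \<sigma> t \<tau> \<in> positive_measures" by (rule radon_comb_pm[OF pm assms(3,4)])
  have "mutual (radon_comb s \<sigma> t \<tau>) (radon_comb s \<sigma> t \<tau>)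
    = ereal s * (ereal s * mutual \<sigma> \<sigma> + ereal t * mutual \<sigma> \<tau>) + ereal t * (ereal s * mutual \<tau> \<sigma> + ereal t * mutual \<tau> \<tau>)"
    using mutual_comb_left[OF pm c assms(3,4)] mutual_comb_right[OF pm pm(1) assms(3,4)] mutual_comb_right[OF pm pm(2) assms(3,4)]
    by simp
  also have "\<dots> < \<infinity>"
    using mutual_finite[OF assms(1,1)] mutual_finite[OF assms(1,2)] mutual_finite[OF assms(2,1)] mutual_finite[OF assms(2,2)]
    by (cases "mutual \<sigma> \<sigma>"; cases "mutual \<sigma> \<tau>"; cases "mutual \<tau> \<sigma>"; cases "mutual \<tau> \<tau>") auto
  finally show ?thesis using c by (simp add: Ep_iff)
qed

lemma form_comb_left:
  assumes "\<sigma> \<in> Ep" "\<tau> \<in> Ep" "\<rho> \<in> Ep" "0 \<le> s" "0 \<le> t"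
  shows "form (radon_comb s \<sigma> t \<tau>) \<rho> = s * form \<sigma> \<rho> + t * form \<tau> \<rho>"
proof -
  note pm = assms(1-3)[THEN Ep_pm]
  have "real_of_ereal (mutual (radon_comb s \<sigma> t \<tau>) \<rho>) = s * real_of_ereal (mutual \<sigma> \<rho>) + t * real_of_ereal (mutual \<tau> \<rho>)"
    unfolding mutual_comb_left[OF pm assms(4,5)] using mutual_finite[OF assms(1,3)] mutual_finite[OF assms(2,3)]
    by (cases "mutual \<sigma> \<rho>"; cases "mutual \<tau> \<rho>") auto
  moreover have "real_of_ereal (mutual \<rho> (radon_comb s \<sigma> t \<tau>)) = s * real_of_ereal (mutual \<rho> \<sigma>) + t * real_of_ereal (mutual \<rho> \<tau>)"
    unfolding mutual_comb_right[OF pm assms(4,5)] using mutual_finite[OF assms(3,1)] mutual_finite[OF assms(3,2)]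
    by (cases "mutual \<rho> \<sigma>"; cases "mutual \<rho> \<tau>") auto
  ultimately show ?thesis by (simp add: form_def algebra_simps add_divide_distrib)
qed

lemma form_comb_right:
  assumes "\<sigma> \<in> Ep" "\<tau> \<in> Ep" "\<rho> \<in> Ep" "0 \<le> s" "0 \<le> t"
  shows "form \<rho> (radon_comb s \<sigma> t \<tau>) = s * form \<rho> \<sigma> + t * form \<rho> \<tau>"
  using form_comb_left[OF assms] by (simp add: form_sym)

lemma form_comb_square:
  assumes "\<sigma> \<in> Ep" "\<tau> \<in> Ep" "0 \<le> s" "0 \<le> t"
  shows "form (radon_comb s \<sigma> t \<tau>) (radon_comb s \<sigma> t \<tau>) =
    s\<^sup>2 * form \<sigma> \<sigma> + 2 * s * t * form \<sigma> \<tau> + t\<^sup>2 * form \<tau> \<tau>"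
proof -
  have c: "radon_comb s \<sigma> t \<tau> \<in> Ep" by (rule Ep_comb[OF assms])
  have "form (radon_comb s \<sigma> t \<tau>) (radon_comb s \<sigma> t \<tau>) =
    s * (s * form \<sigma> \<sigma> + t * form \<sigma> \<tau>) + t * (s * form \<sigma> \<tau> + t * form \<tau> \<tau>)"
    unfolding form_comb_left[OF assms(1,2) c assms(3,4)] form_comb_right[OF assms(1,2,1,3,4)]
      form_comb_right[OF assms(1,2,2,3,4)] form_sym[of \<tau> \<sigma>] ..
  then show ?thesis by (simp add: algebra_simps power2_eq_square)
qed

text \<open>The expanded square of the strong distance. It allows distances to be computed without
  leaving the cone, where \<open>form\<close> is additive.\<close>

definition qdist :: "'a functional \<Rightarrow> 'a functional \<Rightarrow> real" where
  "qdist \<sigma> \<tau> = form \<sigma> \<sigma> - 2 * form \<sigma> \<tau> + form \<tau> \<tau>"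

lemma energy_diff:
  assumes "\<sigma> \<in> Ep" "\<tau> \<in> Ep"
  shows "radon_diff \<sigma> \<tau> \<in> finite_energy \<kappa>" "energy \<kappa> (radon_diff \<sigma> \<tau>) = ereal (qdist \<sigma> \<tau>)" "0 \<le> qdist \<sigma> \<tau>"
    "(energy_norm \<kappa> (radon_diff \<sigma> \<tau>))\<^sup>2 = qdist \<sigma> \<tau>"
proof -
  have pm: "\<sigma> \<in> positive_measures" "\<tau> \<in> positive_measures" and fin: "mutual \<sigma> \<sigma> < \<infinity>" "mutual \<tau> \<tau> < \<infinity>"
    using assms by (auto simp: Ep_iff)
  have rm: "radon_diff \<sigma> \<tau> \<in> radon_measures" by (intro radon_diff_rm pm_rm pm)
  note * = mutual_square_diff[OF pm fin]
  show e: "energy \<kappa> (radon_diff \<sigma> \<tau>) = ereal (qdist \<sigma> \<tau>)"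
    unfolding *(3) mutual_sum_form[OF assms] mutual_form[OF assms(1)] mutual_form[OF assms(2)] by (simp add: qdist_def)
  show "radon_diff \<sigma> \<tau> \<in> finite_energy \<kappa>" using rm *(1) e by (simp add: finite_energy_def)
  have "0 \<le> energy \<kappa> (radon_diff \<sigma> \<tau>)" using rm *(1) pd by (simp add: positive_definite_kernel_def)
  then show q: "0 \<le> qdist \<sigma> \<tau>" unfolding e by simp
  show "(energy_norm \<kappa> (radon_diff \<sigma> \<tau>))\<^sup>2 = qdist \<sigma> \<tau>" using q by (simp add: energy_norm_def e)
qed

lemma zero_Ep: "zero_measure \<in> Ep"
proof -
  have eq: "tensor_measure zero_measure zero_measure = (zero_measure :: ('a \<times> 'a) functional)"
    by (rule functional_eqI)
      (simp_all add: tensor_ext tensor_apply tensor_slice_cc tensor_inner_cc[OF lc _ zero_measure_pm])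
  have "mutual zero_measure zero_measure = 0"
    unfolding mutual_def eq by (rule positive_integral_zero_measure[OF minorant])
  then show ?thesis by (simp add: Ep_iff)
qed

lemma radon_comb_zero: "radon_comb 0 \<sigma> 0 \<tau> = zero_measure"
  by (rule functional_eqI) simp_all

lemma form_zero [simp]: "\<rho> \<in> Ep \<Longrightarrow> form zero_measure \<rho> = 0" "\<rho> \<in> Ep \<Longrightarrow> form \<rho> zero_measure = 0"
  using form_comb_left[OF zero_Ep zero_Ep, of \<rho> 0 0] by (simp_all add: radon_comb_zero form_sym[of \<rho>])

lemma form_nonneg: "\<sigma> \<in> Ep \<Longrightarrow> 0 \<le> form \<sigma> \<sigma>"
  using energy_diff(3)[OF _ zero_Ep, of \<sigma>] zero_Ep by (simp add: qdist_def)

text \<open>Cauchy-Schwarz for the signed measure \<open>\<sigma> - \<tau>\<close> against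
  \<open>\<rho>\<close>. Since \<open>form\<close> lives on the cone, the square of
  \<open>\<sigma> - \<tau> + t \<rho>\<close> is realized as a distance: for
  \<open>t \<ge> 0\<close> the multiple of \<open>\<rho>\<close> is added to
  \<open>\<sigma>\<close>, for \<open>t < 0\<close> to \<open>\<tau>\<close>.\<close>

lemma form_diff_Cauchy_Schwarz:
  assumes "\<sigma> \<in> Ep" "\<tau> \<in> Ep" "\<rho> \<in> Ep"
  shows "(form \<sigma> \<rho> - form \<tau> \<rho>)\<^sup>2 \<le> qdist \<sigma> \<tau> * form \<rho> \<rho>"
proof (rule nonneg_quadratic_discriminant)
  fix t :: real
  show "0 \<le> qdist \<sigma> \<tau> + 2 * t * (form \<sigma> \<rho> - form \<tau> \<rho>) + t\<^sup>2 * form \<rho> \<rho>"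
  proof (cases "0 \<le> t")
    case True
    let ?s = "radon_comb 1 \<sigma> t \<rho>"
    have s: "?s \<in> Ep" using True assms by (intro Ep_comb) auto
    have "0 \<le> qdist ?s \<tau>" by (rule energy_diff(3)[OF s assms(2)])
    also have "\<dots> = qdist \<sigma> \<tau> + 2 * t * (form \<sigma> \<rho> - form \<tau> \<rho>) + t\<^sup>2 * form \<rho> \<rho>"
      using True assms unfolding qdist_def
      by (simp add: form_comb_square form_comb_left form_sym[of \<rho> \<tau>] algebra_simps)
    finally show ?thesis .
  next
    case False
    let ?s = "radon_comb 1 \<tau> (- t) \<rho>"
    have s: "?s \<in> Ep" using False assms by (intro Ep_comb) auto
    have "0 \<le> qdist \<sigma> ?s" by (rule energy_diff(3)[OF assms(1) s])
    also have "\<dots> = qdist \<sigma> \<tau> + 2 * t * (form \<sigma> \<rho> - form \<tau> \<rho>) + t\<^sup>2 * form \<rho> \<rho>"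
      using False assms unfolding qdist_def
      by (simp add: form_comb_square form_comb_right form_sym[of \<rho> \<tau>] algebra_simps)
    finally show ?thesis .
  qed
qed

lemma form_Cauchy_Schwarz:
  assumes "\<sigma> \<in> Ep" "\<rho> \<in> Ep"
  shows "(form \<sigma> \<rho>)\<^sup>2 \<le> form \<sigma> \<sigma> * form \<rho> \<rho>"
  using form_diff_Cauchy_Schwarz[OF assms(1) zero_Ep assms(2)] assms zero_Ep by (simp add: qdist_def)

text \<open>For a kernel of both signs a smaller measure may have larger energy, but by
  \<open>positive_integral_finite_le\<close> it still has a finite one.\<close>

lemma Ep_le:
  assumes "\<sigma> \<in> Ep" "\<tau> \<in> positive_measures" "measure_le \<tau> \<sigma>"
  shows "\<tau> \<in> Ep"
proof -
  note th = minorant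
  note s = Ep_pm[OF assms(1)]
  have "mutual \<sigma> \<sigma> < \<infinity>" using assms(1) by (simp add: Ep_iff)
  then have "mutual \<tau> \<tau> < \<infinity>" unfolding mutual_def
    by (rule positive_integral_finite_le[OF tpm[OF s s] tpm[OF assms(2,2)] tensor_mono[OF lc assms(2,2) s assms(3,3)] th])
  then show ?thesis using assms(2) by (simp add: Ep_iff)
qed

text \<open>The converse of \<open>energy_diff\<close>. For arbitrary \<open>\<sigma>\<close> and
  \<open>\<tau>\<close> cancellation could hide infinite energies; singularity passes to the tensor
  square, whose positive part dominates
  \<open>\<sigma> \<otimes> \<sigma> + \<tau> \<otimes> \<tau>\<close> and has a finite integral
  because the energy is finite.\<close>

lemma finite_energy_singular:
  assumes s: "\<sigma> \<in> positive_measures" and t: "\<tau> \<in> positive_measures" and "singular_measures \<sigma> \<tau>"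
    and fin: "radon_diff \<sigma> \<tau> \<in> finite_energy \<kappa>"
  shows "\<sigma> \<in> Ep" "\<tau> \<in> Ep"
proof -
  note th = minorant
  let ?D = "tensor_measure (radon_diff \<sigma> \<tau>) (radon_diff \<sigma> \<tau>)"
  let ?P = "radon_comb 1 (tensor_measure \<sigma> \<sigma>) 1 (tensor_measure \<tau> \<tau>)"
  have P: "?P \<in> positive_measures" using s t by (simp add: radon_comb_pm tpm)
  have D: "?D \<in> radon_measures" unfolding tensor_square_diff[OF lc s t]
    by (intro radon_diff_rm radon_comb_rm pm_rm tpm s t)
  note Dp = positive_part_pm(1)[OF lc2 D]
  have ni: "positive_integral (positive_part ?D) \<kappa> \<noteq> -\<infinity>" "positive_integral (negative_part ?D) \<kappa> \<noteq> -\<infinity>"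
    by (rule positive_integral_gt(2)[OF th])+
  have "positive_integral (positive_part ?D) \<kappa> < \<infinity>"
    using fin ni unfolding finite_energy_def energy_defined_def energy_def integral_defined_def signed_integral_def
    by (cases "positive_integral (positive_part ?D) \<kappa>"; cases "positive_integral (negative_part ?D) \<kappa>") auto
  from positive_integral_finite_le[OF Dp P tensor_square_le_positive_part[OF lc s t assms(3)] th this]
  have "positive_integral ?P \<kappa> < \<infinity>" .
  moreover have "positive_integral ?P \<kappa> = mutual \<sigma> \<sigma> + mutual \<tau> \<tau>"
    using positive_integral_comb[OF tpm[OF s s] tpm[OF t t], of 1 1 minorant \<kappa>] th by (simp add: mutual_def one_ereal_def[symmetric])
  ultimately have "mutual \<sigma> \<sigma> < \<infinity> \<and> mutual \<tau> \<tau> < \<infinity>"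
    using mutual_not_MInf[of \<sigma> \<sigma>] mutual_not_MInf[of \<tau> \<tau>] by (cases "mutual \<sigma> \<sigma>"; cases "mutual \<tau> \<tau>") auto
  then show "\<sigma> \<in> Ep" "\<tau> \<in> Ep" using s t by (simp_all add: Ep_iff)
qed

lemma finite_energy_positive_part: "\<nu> \<in> finite_energy \<kappa> \<Longrightarrow> positive_part \<nu> \<in> Ep"
proof -
  assume fin: "\<nu> \<in> finite_energy \<kappa>"
  then have rm: "\<nu> \<in> radon_measures" by (simp add: finite_energy_def)
  show ?thesis
    by (rule finite_energy_singular(1)[OF positive_part_pm(1)[OF lc rm] negative_part_pm[OF lc rm] singular_jordan[OF lc rm]])
      (simp add: radon_diff_jordan[OF rm] fin)
qed

abbreviation mid :: "'a functional \<Rightarrow> 'a functional \<Rightarrow> 'a functional" where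
  "mid \<sigma> \<tau> \<equiv> radon_comb (1/2) \<sigma> (1/2) \<tau>"

lemma Ep_mid: "\<sigma> \<in> Ep \<Longrightarrow> \<tau> \<in> Ep \<Longrightarrow> mid \<sigma> \<tau> \<in> Ep"
  by (rule Ep_comb) simp_all

lemma parallelogram:
  assumes "\<sigma> \<in> Ep" "\<tau> \<in> Ep"
  shows "qdist \<sigma> \<tau> = 2 * form \<sigma> \<sigma> + 2 * form \<tau> \<tau> - 4 * form (mid \<sigma> \<tau>) (mid \<sigma> \<tau>)"
proof -
  show ?thesis using assms by (simp add: qdist_def form_comb_square power2_eq_square)
qed

text \<open>The filter of nearly minimal elements; it is Cauchy by the parallelogram identity.\<close>

lemma min_filter:
  assumes ne: "\<C> \<noteq> {}" and sub: "\<And>C. C \<in> \<C> \<Longrightarrow> C \<subseteq> Ep"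
    and dir: "\<And>C D. C \<in> \<C> \<Longrightarrow> D \<in> \<C> \<Longrightarrow> \<exists>E\<in>\<C>. E \<subseteq> C \<inter> D"
    and md: "\<And>C \<sigma> \<tau>. C \<in> \<C> \<Longrightarrow> \<sigma> \<in> C \<Longrightarrow> \<tau> \<in> C \<Longrightarrow> mid \<sigma> \<tau> \<in> C"
    and bd: "\<And>C. C \<in> \<C> \<Longrightarrow> \<exists>\<sigma>\<in>C. form \<sigma> \<sigma> \<le> b"
  obtains G where "G \<noteq> bot" "\<And>C. C \<in> \<C> \<Longrightarrow> eventually (\<lambda>\<sigma>. \<sigma> \<in> C) G" "strong_cauchy \<kappa> G"
proof -
  define w where "w C = (INF \<sigma>\<in>C. form \<sigma> \<sigma>)" for C
  \<comment> \<open>The infima \<open>w C\<close> grow as \<open>C\<close> shrinks along the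
    directed family, and \<open>W\<close> is their limit. The basic sets of the filter use the
    common level \<open>W\<close> in place of \<open>w C\<close>, so that they are nested.\<close>
  define W where "W = (SUP C\<in>\<C>. w C)"
  have bb: "bdd_below ((\<lambda>\<sigma>. form \<sigma> \<sigma>) ` C)" if "C \<in> \<C>" for C
    using sub[OF that] form_nonneg by (intro bdd_belowI[of _ 0]) auto
  have wle: "w C \<le> form \<sigma> \<sigma>" if "C \<in> \<C>" "\<sigma> \<in> C" for C \<sigma>
    unfolding w_def by (rule cINF_lower[OF bb[OF that(1)] that(2)])
  have wb: "w C \<le> b" if C: "C \<in> \<C>" for C using bd[OF C] wle[OF C] by (meson order_trans)
  have wW: "w C \<le> W" if "C \<in> \<C>" for C
    unfolding W_def using that wb by (intro cSUP_upper bdd_aboveI[of _ b]) auto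
  let ?I = "\<C> \<times> {0::real<..}"
  let ?S = "\<lambda>p. {\<sigma> \<in> fst p. form \<sigma> \<sigma> < W + snd p}"
  define G where "G = (INF p\<in>?I. principal (?S p))"
  have ev: "eventually P G \<longleftrightarrow> (\<exists>p\<in>?I. \<forall>\<sigma>\<in>?S p. P \<sigma>)" for P
  proof -
    have "eventually P G \<longleftrightarrow> (\<exists>p\<in>?I. eventually P (principal (?S p)))"
      unfolding G_def
    proof (rule eventually_INF_base)
      obtain C where "C \<in> \<C>" using ne by blast
      then have "(C, 1::real) \<in> ?I" by simp
      then show "?I \<noteq> {}" by blast
      fix p q assume "p \<in> ?I" "q \<in> ?I"
      then have pq: "fst p \<in> \<C>" "fst q \<in> \<C>" "0 < snd p" "0 < snd q" by auto
      obtain E where E: "E \<in> \<C>" "E \<subseteq> fst p \<inter> fst q" using dir[OF pq(1,2)] by blast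
      have "?S (E, min (snd p) (snd q)) \<subseteq> ?S p \<inter> ?S q" using E(2) by auto
      then have "principal (?S (E, min (snd p) (snd q))) \<le> inf (principal (?S p)) (principal (?S q))"
        by (simp only: inf_principal principal_le_iff)
      then show "\<exists>x\<in>?I. principal (?S x) \<le> inf (principal (?S p)) (principal (?S q))"
        by (rule bexI[where x = "(E, min (snd p) (snd q))"]) (simp only: mem_Times_iff fst_conv snd_conv greaterThan_iff min_less_iff_conj E(1) pq(3,4) simp_thms)
    qed
    then show ?thesis by (simp only: eventually_principal)
  qed
  have Sne: "?S p \<noteq> {}" if "p \<in> ?I" for p
  proof -
    have C: "fst p \<in> \<C>" and e: "0 < snd p" using that by auto
    have "w (fst p) < W + snd p" using wW[OF C] e by simp
    moreover have "fst p \<noteq> {}" using bd[OF C] by blast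
    ultimately obtain \<sigma> where "\<sigma> \<in> fst p" "form \<sigma> \<sigma> < W + snd p"
      using cINF_less_iff[OF _ bb[OF C]] unfolding w_def by blast
    then show ?thesis by blast
  qed
  show ?thesis
  proof (rule that)
    show "G \<noteq> bot"
    proof
      assume "G = bot"
      then have "eventually (\<lambda>_. False) G" by simp
      then show False using Sne unfolding ev by blast
    qed
    show "eventually (\<lambda>\<sigma>. \<sigma> \<in> C) G" if "C \<in> \<C>" for C
      unfolding ev using that by (intro bexI[of _ "(C, 1)"]) auto
    show "strong_cauchy \<kappa> G"
      unfolding strong_cauchy_def
    proof (intro allI impI)
      fix \<epsilon> :: real assume e: "0 < \<epsilon>"
      \<comment> \<open>By the parallelogram identity the squared distance is below
        \<open>4 * (W + \<delta>) - 4 * (W - \<delta>) = 8 * \<delta>\<close>.\<close>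
      define \<delta> where "\<delta> = \<epsilon>\<^sup>2 / 8"
      have d: "0 < \<delta>" using e by (simp add: \<delta>_def)
      have "W - \<delta> < W" using d by simp
      then obtain C where C: "C \<in> \<C>" "W - \<delta> < w C"
        unfolding W_def using ne wb by (subst (asm) less_cSUP_iff) (auto intro: bdd_aboveI[of _ b])
      let ?P = "\<lambda>\<sigma>. \<sigma> \<in> ?S (C, \<delta>)"
      have "eventually ?P G" unfolding ev using C(1) d by (intro bexI[of _ "(C, \<delta>)"]) auto
      moreover have "energy_norm \<kappa> (radon_diff \<nu> \<mu>) < \<epsilon>" if "?P \<nu> \<and> ?P \<mu>" for \<nu> \<mu>
      proof -
        have numu: "\<nu> \<in> C" "\<mu> \<in> C" "form \<nu> \<nu> < W + \<delta>" "form \<mu> \<mu> < W + \<delta>" using that by auto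
        then have Ep: "\<nu> \<in> Ep" "\<mu> \<in> Ep" using sub C(1) by auto
        have "w C \<le> form (mid \<nu> \<mu>) (mid \<nu> \<mu>)" by (rule wle[OF C(1) md[OF C(1) numu(1,2)]])
        then have "qdist \<nu> \<mu> < 8 * \<delta>" using parallelogram[OF Ep] numu(3,4) C(2) by linarith
        then have "(energy_norm \<kappa> (radon_diff \<nu> \<mu>))\<^sup>2 < \<epsilon>\<^sup>2" unfolding energy_diff(4)[OF Ep] by (simp add: \<delta>_def)
        then show ?thesis using e by (rule power_less_imp_less_base[OF _ less_imp_le])
      qed
      ultimately show "\<exists>P. eventually P G \<and> (\<forall>\<nu> \<mu>. P \<nu> \<and> P \<mu> \<longrightarrow> energy_norm \<kappa> (radon_diff \<nu> \<mu>) < \<epsilon>)" by blast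
    qed
  qed
qed

end


section \<open>Consistent kernels\<close>

locale consistent_space = energy_space +
  assumes cons: "consistent_kernel \<kappa>"
begin

text \<open>Consistency turns the vague limit into a strong one; Cauchy-Schwarz for
  \<open>\<sigma> - \<nu>\<close> then gives convergence of the form against each fixed
  \<open>\<rho>\<close>.\<close>

lemma strong_limit:
  assumes G: "G \<noteq> bot" "eventually (\<lambda>\<sigma>. \<sigma> \<in> Ep) G" "strong_cauchy \<kappa> G" and nu: "\<nu> \<in> positive_measures"
    and lim: "\<And>\<phi>. \<phi> \<in> cc_functions \<Longrightarrow> ((\<lambda>\<sigma>. \<sigma> \<phi>) \<longlongrightarrow> \<nu> \<phi>) G"
  shows "\<nu> \<in> Ep" "((\<lambda>\<sigma>. qdist \<sigma> \<nu>) \<longlongrightarrow> 0) G" "\<rho> \<in> Ep \<Longrightarrow> ((\<lambda>\<sigma>. form \<sigma> \<rho>) \<longlongrightarrow> form \<nu> \<rho>) G"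
proof -
  have "eventually (\<lambda>\<sigma>. \<sigma> \<in> radon_measures) G"
    using G(2) by eventually_elim (simp add: Ep_pm pm_rm)
  then have cl: "cluster_point vague_topology (\<lambda>\<mu>. \<mu>) G \<nu>"
    by (rule cluster_point_vagueI[OF G(1) pm_rm[OF nu] _ lim])
  have *: "\<nu> \<in> finite_energy \<kappa> \<and> ((\<lambda>\<mu>. energy_norm \<kappa> (radon_diff \<mu> \<nu>)) \<longlongrightarrow> 0) G"
    using cons cl G(2,3) unfolding consistent_kernel_def by blast
  then show nuE: "\<nu> \<in> Ep" using nu by (simp add: positive_finite_energy_def)
  have "((\<lambda>\<mu>. (energy_norm \<kappa> (radon_diff \<mu> \<nu>))\<^sup>2) \<longlongrightarrow> 0\<^sup>2) G"
    using * by (intro tendsto_power) simp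
  then have q2: "((\<lambda>\<mu>. (energy_norm \<kappa> (radon_diff \<mu> \<nu>))\<^sup>2) \<longlongrightarrow> 0) G" by simp
  show q: "((\<lambda>\<sigma>. qdist \<sigma> \<nu>) \<longlongrightarrow> 0) G"
    by (rule Lim_transform_eventually[OF q2]) (use G(2) in eventually_elim, simp add: energy_diff(4)[OF _ nuE])
  assume rho: "\<rho> \<in> Ep"
  have "((\<lambda>\<sigma>. sqrt (qdist \<sigma> \<nu> * form \<rho> \<rho>)) \<longlongrightarrow> sqrt (0 * form \<rho> \<rho>)) G"
    by (intro tendsto_intros q)
  then have s: "((\<lambda>\<sigma>. sqrt (qdist \<sigma> \<nu> * form \<rho> \<rho>)) \<longlongrightarrow> 0) G" by simp
  have "((\<lambda>\<sigma>. form \<sigma> \<rho> - form \<nu> \<rho>) \<longlongrightarrow> 0) G"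
  proof (rule Lim_null_comparison[OF _ s])
    show "\<forall>\<^sub>F \<sigma> in G. norm (form \<sigma> \<rho> - form \<nu> \<rho>) \<le> sqrt (qdist \<sigma> \<nu> * form \<rho> \<rho>)"
      using G(2)
    proof eventually_elim
      case (elim \<sigma>)
      show ?case using real_sqrt_le_mono[OF form_diff_Cauchy_Schwarz[OF elim nuE rho]] by simp
    qed
  qed
  then show "((\<lambda>\<sigma>. form \<sigma> \<rho>) \<longlongrightarrow> form \<nu> \<rho>) G" by (simp add: LIM_zero_iff)
qed

text \<open>Fuglede's equivalence of the two notions of consistency, without completing the space: nearly
  minimal elements of the midpoint convex sets that belong to \<open>F\<close> still converge vaguely to \<open>\<nu>\<close>,
  hence strongly by consistency, and they inherit every linear inequality valid along \<open>F\<close>.\<close>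

lemma weak_limit_aux:
  assumes F: "F \<noteq> bot" "eventually (\<lambda>\<sigma>. \<sigma> \<in> Ep \<and> form \<sigma> \<sigma> \<le> b) F" and nu: "\<nu> \<in> positive_measures"
    and lim: "\<And>\<phi>. \<phi> \<in> cc_functions \<Longrightarrow> ((\<lambda>\<sigma>. \<sigma> \<phi>) \<longlongrightarrow> \<nu> \<phi>) F"
  shows "\<nu> \<in> Ep" "\<rho> \<in> Ep \<Longrightarrow> eventually (\<lambda>\<sigma>. c \<le> form \<sigma> \<rho>) F \<Longrightarrow> c \<le> form \<nu> \<rho>"
    "\<rho> \<in> Ep \<Longrightarrow> eventually (\<lambda>\<sigma>. form \<sigma> \<rho> \<le> c) F \<Longrightarrow> form \<nu> \<rho> \<le> c"
proof -
  define \<C> where "\<C> = {C. C \<subseteq> Ep \<and> (\<forall>\<sigma>\<in>C. \<forall>\<tau>\<in>C. mid \<sigma> \<tau> \<in> C) \<and> eventually (\<lambda>\<sigma>. \<sigma> \<in> C) F}"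
  have evE: "eventually (\<lambda>\<sigma>. \<sigma> \<in> Ep) F" using F(2) by eventually_elim simp
  have EpC: "Ep \<in> \<C>" using evE by (simp add: \<C>_def Ep_mid)
  have restr: "{\<sigma> \<in> Ep. Q \<sigma>} \<in> \<C>"
    if "eventually Q F" "\<And>\<sigma> \<tau>. \<sigma> \<in> Ep \<Longrightarrow> \<tau> \<in> Ep \<Longrightarrow> Q \<sigma> \<Longrightarrow> Q \<tau> \<Longrightarrow> Q (mid \<sigma> \<tau>)" for Q
  proof -
    have "eventually (\<lambda>\<sigma>. \<sigma> \<in> {\<sigma> \<in> Ep. Q \<sigma>}) F" using eventually_conj[OF evE that(1)] by simp
    then show ?thesis unfolding \<C>_def using that(2) Ep_mid by simp
  qed
  obtain G where G: "G \<noteq> bot" "\<And>C. C \<in> \<C> \<Longrightarrow> eventually (\<lambda>\<sigma>. \<sigma> \<in> C) G" "strong_cauchy \<kappa> G"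
  proof (rule min_filter[of \<C> b])
    show "\<C> \<noteq> {}" using EpC by blast
    show "C \<subseteq> Ep" if "C \<in> \<C>" for C using that by (simp add: \<C>_def)
    show "\<exists>E\<in>\<C>. E \<subseteq> C \<inter> D" if "C \<in> \<C>" "D \<in> \<C>" for C D
      using that by (intro bexI[of _ "C \<inter> D"]) (auto simp: \<C>_def intro: eventually_conj)
    show "mid \<sigma> \<tau> \<in> C" if "C \<in> \<C>" "\<sigma> \<in> C" "\<tau> \<in> C" for C \<sigma> \<tau> using that by (auto simp: \<C>_def)
    show "\<exists>\<sigma>\<in>C. form \<sigma> \<sigma> \<le> b" if "C \<in> \<C>" for C
    proof -
      have "eventually (\<lambda>\<sigma>. \<sigma> \<in> C) F" using that by (simp add: \<C>_def)
      from eventually_happens'[OF F(1) eventually_conj[OF this F(2)]] show ?thesis by blast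
    qed
  qed blast
  have GE: "eventually (\<lambda>\<sigma>. \<sigma> \<in> Ep) G" by (rule G(2)[OF EpC])
  have Glim: "((\<lambda>\<sigma>. \<sigma> \<phi>) \<longlongrightarrow> \<nu> \<phi>) G" if phi: "\<phi> \<in> cc_functions" for \<phi>
  proof (rule tendstoI)
    fix e :: real assume "0 < e"
    then have "eventually (\<lambda>\<sigma>. \<bar>\<sigma> \<phi> - \<nu> \<phi>\<bar> < e) F" using tendstoD[OF lim[OF phi]] by (simp add: dist_real_def)
    then have "{\<sigma> \<in> Ep. \<bar>\<sigma> \<phi> - \<nu> \<phi>\<bar> < e} \<in> \<C>" by (rule restr) (use phi in auto)
    from G(2)[OF this] show "eventually (\<lambda>\<sigma>. dist (\<sigma> \<phi>) (\<nu> \<phi>) < e) G"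
      by eventually_elim (simp add: dist_real_def)
  qed
  have sl: "((\<lambda>\<sigma>. form \<sigma> \<rho>) \<longlongrightarrow> form \<nu> \<rho>) G" if "\<rho> \<in> Ep" for \<rho>
    by (rule strong_limit(3)[OF G(1) GE G(3) nu _ that]) (rule Glim)
  show "\<nu> \<in> Ep" by (rule strong_limit(1)[OF G(1) GE G(3) nu]) (rule Glim)
  show "c \<le> form \<nu> \<rho>" if rho: "\<rho> \<in> Ep" and evc: "eventually (\<lambda>\<sigma>. c \<le> form \<sigma> \<rho>) F"
  proof -
    have "{\<sigma> \<in> Ep. c \<le> form \<sigma> \<rho>} \<in> \<C>" by (rule restr[OF evc]) (simp add: form_comb_left rho)
    then have "eventually (\<lambda>\<sigma>. c \<le> form \<sigma> \<rho>) G" using eventually_mono[OF G(2)] by fastforce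
    then show ?thesis by (rule tendsto_lowerbound[OF sl[OF rho] _ G(1)])
  qed
  show "form \<nu> \<rho> \<le> c" if rho: "\<rho> \<in> Ep" and evc: "eventually (\<lambda>\<sigma>. form \<sigma> \<rho> \<le> c) F"
  proof -
    have "{\<sigma> \<in> Ep. form \<sigma> \<rho> \<le> c} \<in> \<C>" by (rule restr[OF evc]) (simp add: form_comb_left rho)
    then have "eventually (\<lambda>\<sigma>. form \<sigma> \<rho> \<le> c) G" using eventually_mono[OF G(2)] by fastforce
    then show ?thesis by (rule tendsto_upperbound[OF sl[OF rho] _ G(1)])
  qed
qed

text \<open>If the form stayed frequently on the wrong side of some \<open>c\<close>, the filter
  \<open>F\<close> restricted to that side would be proper and still satisfy all hypotheses of
  \<open>weak_limit_aux\<close>, which excludes it.\<close>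

lemma weak_limit:
  assumes F: "F \<noteq> bot" "eventually (\<lambda>\<sigma>. \<sigma> \<in> Ep \<and> form \<sigma> \<sigma> \<le> b) F" and nu: "\<nu> \<in> positive_measures"
    and lim: "\<And>\<phi>. \<phi> \<in> cc_functions \<Longrightarrow> ((\<lambda>\<sigma>. \<sigma> \<phi>) \<longlongrightarrow> \<nu> \<phi>) F"
    and rho: "\<rho> \<in> Ep"
  shows "((\<lambda>\<sigma>. form \<sigma> \<rho>) \<longlongrightarrow> form \<nu> \<rho>) F"
proof -
  have sub: "F' = bot" if F': "F' \<le> F" and bad: "eventually (\<lambda>\<sigma>. form \<sigma> \<rho> \<le> c) F' \<and> c < form \<nu> \<rho> \<or> eventually (\<lambda>\<sigma>. c \<le> form \<sigma> \<rho>) F' \<and> form \<nu> \<rho> < c" for F' c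
  proof (rule ccontr)
    assume nb: "F' \<noteq> bot"
    have ev: "eventually (\<lambda>\<sigma>. \<sigma> \<in> Ep \<and> form \<sigma> \<sigma> \<le> b) F'" by (rule filter_leD[OF F' F(2)])
    have lim': "((\<lambda>\<sigma>. \<sigma> \<phi>) \<longlongrightarrow> \<nu> \<phi>) F'" if "\<phi> \<in> cc_functions" for \<phi>
      by (rule tendsto_mono[OF F' lim[OF that]])
    have "c \<le> form \<nu> \<rho>" if "eventually (\<lambda>\<sigma>. c \<le> form \<sigma> \<rho>) F'"
      by (rule weak_limit_aux(2)[OF nb ev nu _ rho that]) (rule lim')
    moreover have "form \<nu> \<rho> \<le> c" if "eventually (\<lambda>\<sigma>. form \<sigma> \<rho> \<le> c) F'"
      by (rule weak_limit_aux(3)[OF nb ev nu _ rho that]) (rule lim')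
    ultimately show False using bad by fastforce
  qed
  have inf_bot: "eventually (\<lambda>\<sigma>. \<not> Q \<sigma>) F" if "inf F (principal {\<sigma>. Q \<sigma>}) = bot" for Q
  proof -
    have "eventually (\<lambda>_. False) (inf F (principal {\<sigma>. Q \<sigma>}))" using that by simp
    then show ?thesis by (simp add: eventually_inf_principal)
  qed
  show ?thesis
  proof (rule order_tendstoI)
    fix c assume "c < form \<nu> \<rho>"
    then have "inf F (principal {\<sigma>. form \<sigma> \<rho> \<le> c}) = bot"
      by (intro sub[of _ c]) (auto simp: eventually_inf_principal)
    from inf_bot[OF this] show "eventually (\<lambda>\<sigma>. c < form \<sigma> \<rho>) F" by (simp add: not_le)
  next
    fix c assume "form \<nu> \<rho> < c"
    then have "inf F (principal {\<sigma>. c \<le> form \<sigma> \<rho>}) = bot"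
      by (intro sub[of _ c]) (auto simp: eventually_inf_principal)
    from inf_bot[OF this] show "eventually (\<lambda>\<sigma>. form \<sigma> \<rho> < c) F" by (simp add: not_le)
  qed
qed

end

section \<open>Directed suprema\<close>

lemma directed_finite_upper:
  fixes d :: "'i \<Rightarrow> 'b \<Rightarrow> real"
  assumes "finite N" "N \<subseteq> I" "I \<noteq> {}"
    and dir: "\<And>i j. i \<in> I \<Longrightarrow> j \<in> I \<Longrightarrow> \<exists>k\<in>I. \<forall>x. d i x \<le> d k x \<and> d j x \<le> d k x"
  shows "\<exists>k\<in>I. \<forall>i\<in>N. \<forall>x. d i x \<le> d k x"
  using assms(1,2)
proof (induction N)
  case empty then show ?case using assms(3) by auto
next
  case (insert i N)
  then obtain k where k: "k \<in> I" "\<forall>i\<in>N. \<forall>x. d i x \<le> d k x" by auto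
  obtain l where "l \<in> I" "\<forall>x. d i x \<le> d l x \<and> d k x \<le> d l x" using dir[of i k] insert.prems k(1) by auto
  then show ?case using k(2) by (intro bexI[of _ l]) (auto intro: order_trans)
qed

text \<open>On the compact support of \<open>\<phi>\<close> finitely many \<open>d i\<close>, hence
  by directedness a single one, exceed \<open>\<phi> - \<epsilon>\<close>. This replaces monotone
  convergence along nets.\<close>

lemma Dini_directed:
  fixes \<nu> :: "'b::t2_space functional"
  assumes lc: "locally_compact_space (euclidean :: 'b topology)" and nu: "\<nu> \<in> positive_measures"
    and phi: "\<phi> \<in> cc_functions" and I: "I \<noteq> {}"
    and d: "\<And>i. i \<in> I \<Longrightarrow> d i \<in> cc_functions" "\<And>i x. i \<in> I \<Longrightarrow> 0 \<le> d i x"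
    and dir: "\<And>i j. i \<in> I \<Longrightarrow> j \<in> I \<Longrightarrow> \<exists>k\<in>I. \<forall>x. d i x \<le> d k x \<and> d j x \<le> d k x"
    and le: "\<And>x. ereal (\<phi> x) \<le> (SUP i\<in>I. ereal (d i x))"
  shows "ereal (\<nu> \<phi>) \<le> (SUP i\<in>I. ereal (\<nu> (d i)))"
proof -
  let ?S = "closure {x. \<phi> x \<noteq> 0}"
  note S = cc_compact[OF phi]
  from cc_cutoff[OF lc S]
  obtain \<eta> where eta[rule_format]: "\<eta> \<in> cc_functions" "\<forall>y. 0 \<le> \<eta> y" "\<forall>y\<in>?S. \<eta> y = 1" by meson
  have e0: "0 \<le> \<nu> \<eta>" by (rule pm_nonneg[OF nu eta(1,2)])
  have main: "\<exists>k\<in>I. \<nu> \<phi> \<le> \<nu> (d k) + \<epsilon> * \<nu> \<eta>" if e: "0 < \<epsilon>" for \<epsilon>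
  proof -
    let ?U = "\<lambda>i. {x. \<phi> x - \<epsilon> < d i x}"
    have op: "open (?U i)" if "i \<in> I" for i
      by (intro open_Collect_less continuous_on_diff cc_cont[OF phi] continuous_on_const cc_cont[OF d(1)[OF that]])
    have cov: "\<exists>i\<in>I. x \<in> ?U i" for x
    proof -
      have "ereal (\<phi> x - \<epsilon>) < (SUP i\<in>I. ereal (d i x))" by (rule less_le_trans[OF _ le[of x]]) (use e in simp)
      then show ?thesis by (simp add: less_SUP_iff)
    qed
    obtain N where N: "N \<subseteq> I" "finite N" "?S \<subseteq> (\<Union>i\<in>N. ?U i)"
      by (rule compactE_image[OF S, of I ?U]) (use op cov in blast)+
    from directed_finite_upper[OF N(2,1) I dir] obtain k where k: "k \<in> I" "\<forall>i\<in>N. \<forall>x. d i x \<le> d k x" by blast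
    have "\<phi> x \<le> 1 * d k x + \<epsilon> * \<eta> x" for x
    proof (cases "x \<in> ?S")
      case True
      then obtain i where "i \<in> N" "\<phi> x - \<epsilon> < d i x" using N(3) by blast
      then show ?thesis using k(2) eta(3)[OF True] by (smt (verit) mult_cancel_left2)
    next
      case False
      then have "\<phi> x = 0" by (rule cc_outside)
      then show ?thesis using d(2)[OF k(1), of x] eta(2)[of x] e by simp
    qed
    then have "\<nu> \<phi> \<le> \<nu> (\<lambda>x. 1 * d k x + \<epsilon> * \<eta> x)"
      by (rule pm_mono[OF nu phi cc_lin[OF d(1)[OF k(1)] eta(1)]])
    then show ?thesis using rm_lin[OF pm_rm[OF nu] d(1)[OF k(1)] eta(1), of 1 \<epsilon>] k(1) by auto
  qed
  show ?thesis
  proof (rule ereal_le_epsilon2)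
    fix e :: real assume e: "0 < e"
    have "0 < e / (\<nu> \<eta> + 1)" using e e0 by simp
    then obtain k where k: "k \<in> I" "\<nu> \<phi> \<le> \<nu> (d k) + e / (\<nu> \<eta> + 1) * \<nu> \<eta>" using main by blast
    have "e / (\<nu> \<eta> + 1) * \<nu> \<eta> \<le> e" using e e0 by (simp add: field_simps)
    then have "ereal (\<nu> \<phi>) \<le> ereal (\<nu> (d k)) + ereal e" using k(2) by simp
    also have "\<dots> \<le> (SUP i\<in>I. ereal (\<nu> (d i))) + ereal e" using k(1) by (intro add_right_mono SUP_upper)
    finally show "ereal (\<nu> \<phi>) \<le> (SUP i\<in>I. ereal (\<nu> (d i))) + ereal e" .
  qed
qed


text \<open>For \<open>0 < t < \<psi> z\<close> a bump at \<open>z\<close> of height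
  \<open>t\<close>, supported where \<open>\<psi>\<close> exceeds \<open>t\<close>, is a
  competitor.\<close>

lemma lsc_le_SUP_cc:
  fixes \<psi> :: "'b::t2_space \<Rightarrow> ereal"
  assumes lc: "locally_compact_space (euclidean :: 'b topology)"
    and op: "\<And>t. open {z. t < \<psi> z}" and nn: "\<And>z. 0 \<le> \<psi> z"
  shows "\<psi> z \<le> (SUP \<phi>\<in>{\<phi>\<in>cc_functions. \<forall>x. 0 \<le> \<phi> x \<and> ereal (\<phi> x) \<le> \<psi> x}. ereal (\<phi> z))" (is "_ \<le> ?R")
proof (rule ccontr)
  assume "\<not> \<psi> z \<le> ?R"
  then have "?R < \<psi> z" by simp
  then obtain t where t: "?R < ereal t" "ereal t < \<psi> z" using ereal_dense2 by blast
  have "ereal 0 \<le> ?R" using nn by (intro SUP_upper2[of "\<lambda>x. 0"]) (auto simp: zero_ereal_def[symmetric])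
  from le_less_trans[OF this t(1)] have t0: "0 < t" by simp
  have sub: "{z} \<subseteq> {z. ereal t < \<psi> z}" using t(2) by simp
  from cc_bump[OF lc compact_sing op sub]
  obtain \<xi> where xi[rule_format]: "\<xi> \<in> cc_functions" "\<forall>x. 0 \<le> \<xi> x" "\<forall>x. \<xi> x \<le> 1" "\<forall>x\<in>{z}. \<xi> x = 1"
    "closure {x. \<xi> x \<noteq> 0} \<subseteq> {z. ereal t < \<psi> z}" by meson
  have le: "ereal (t * \<xi> x) \<le> \<psi> x" for x
  proof (cases "\<xi> x = 0")
    case False
    then have "x \<in> {z. ereal t < \<psi> z}" by (rule subsetD[OF xi(5) cc_inside])
    then have "ereal t \<le> \<psi> x" by simp
    moreover have "ereal (t * \<xi> x) \<le> ereal t" using xi(3)[of x] t0 by simp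
    ultimately show ?thesis by (rule order_trans[rotated])
  qed (use nn in \<open>simp add: zero_ereal_def[symmetric]\<close>)
  have "ereal (t * \<xi> z) \<le> ?R"
    using le xi(1,2) t0 cc_scale[OF xi(1), of t] by (intro SUP_upper) simp
  then show False using t(1) xi(4)[of z] by simp
qed


section \<open>Potentials\<close>

context energy_space
begin

lemma kernel_open: "open {z. t < \<kappa> z}"
  using kernel_lsc by (simp add: lsc_class_def)

definition pot :: "'a functional \<Rightarrow> 'a \<Rightarrow> ereal" where
  "pot \<omega> x = positive_integral \<omega> (\<lambda>y. \<kappa> (x, y))"

definition kernel_minorants :: "('a \<times> 'a \<Rightarrow> real) set" where
  "kernel_minorants = {\<Psi>\<in>cc_functions. \<forall>z. 0 \<le> \<Psi> z \<and> ereal (\<Psi> z) \<le> \<kappa> z}"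

lemma kernel_minorants_directed:
  assumes "\<Phi> \<in> kernel_minorants" "\<Psi> \<in> kernel_minorants"
  shows "\<exists>\<Theta>\<in>kernel_minorants. \<forall>z. \<Phi> z \<le> \<Theta> z \<and> \<Psi> z \<le> \<Theta> z"
proof (rule bexI)
  show "(\<lambda>z. max (\<Phi> z) (\<Psi> z)) \<in> kernel_minorants"
    using assms cc_max[of \<Phi> \<Psi>] by (simp add: kernel_minorants_def max_def)
qed simp

lemma kernel_minorants_ne: "(\<And>z. 0 \<le> \<kappa> z) \<Longrightarrow> kernel_minorants \<noteq> {}"
proof -
  assume "\<And>z. 0 \<le> \<kappa> z"
  then have "(\<lambda>z. 0) \<in> kernel_minorants" by (simp add: kernel_minorants_def zero_ereal_def[symmetric])
  then show "kernel_minorants \<noteq> {}" by blast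
qed

text \<open>A minorant of the slice \<open>\<kappa> (x, -)\<close> need not be the slice of a
  minorant of \<open>\<kappa>\<close>. Dini's theorem closes the gap: slices of continuous minorants
  increase to the slice of the kernel.\<close>

lemma pot_le_SUP:
  assumes nn: "\<And>z. 0 \<le> \<kappa> z" and om: "\<omega> \<in> positive_measures"
  shows "pot \<omega> x \<le> (SUP \<Psi>\<in>kernel_minorants. ereal (\<omega> (\<lambda>y. \<Psi> (x, y))))"
  unfolding pot_def
proof (rule positive_integral_le)
  fix f :: "'a \<Rightarrow> real" assume f: "f \<in> cc_functions" "\<And>y. ereal (f y) \<le> \<kappa> (x, y)"
  show "ereal (\<omega> f) \<le> (SUP \<Psi>\<in>kernel_minorants. ereal (\<omega> (\<lambda>y. \<Psi> (x, y))))"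
  proof (rule Dini_directed[OF lc om f(1) kernel_minorants_ne[OF nn]])
    fix \<Psi> assume "\<Psi> \<in> kernel_minorants"
    then show "(\<lambda>y. \<Psi> (x, y)) \<in> cc_functions" "0 \<le> \<Psi> (x, y)" for y
      by (simp_all add: kernel_minorants_def tensor_slice_cc)
  next
    fix \<Phi> \<Psi> assume "\<Phi> \<in> kernel_minorants" "\<Psi> \<in> kernel_minorants"
    from kernel_minorants_directed[OF this]
    show "\<exists>k\<in>kernel_minorants. \<forall>xa. \<Phi> (x, xa) \<le> k (x, xa) \<and> \<Psi> (x, xa) \<le> k (x, xa)" by blast
  next
    fix y show "ereal (f y) \<le> (SUP \<Psi>\<in>kernel_minorants. ereal (\<Psi> (x, y)))"
      unfolding kernel_minorants_def
      by (rule order_trans[OF f(2) lsc_le_SUP_cc[OF lc2 kernel_open nn]])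
  qed
qed

lemma pot_ge:
  assumes "\<Psi> \<in> kernel_minorants"
  shows "ereal (\<omega> (\<lambda>y. \<Psi> (x, y))) \<le> pot \<omega> x"
  unfolding pot_def using assms
  by (intro positive_integral_gt(1)) (auto simp: kernel_minorants_def tensor_slice_cc)

text \<open>Lower semicontinuity of the potential, as a supremum of the continuous functions
  obtained from minorants of the kernel.\<close>

lemma pot_open:
  assumes nn: "\<And>z. 0 \<le> \<kappa> z" and om: "\<omega> \<in> positive_measures"
  shows "open {x. t < pot \<omega> x}"
proof -
  have "{x. t < pot \<omega> x} = (\<Union>\<Psi>\<in>kernel_minorants. {x. t < ereal (\<omega> (\<lambda>y. \<Psi> (x, y)))})"
  proof (intro subset_antisym subsetI)
    fix x assume "x \<in> {x. t < pot \<omega> x}"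
    then have "t < (SUP \<Psi>\<in>kernel_minorants. ereal (\<omega> (\<lambda>y. \<Psi> (x, y))))"
      using pot_le_SUP[OF nn om, of x] by (auto intro: less_le_trans)
    then show "x \<in> (\<Union>\<Psi>\<in>kernel_minorants. {x. t < ereal (\<omega> (\<lambda>y. \<Psi> (x, y)))})"
      by (auto simp: less_SUP_iff)
  next
    fix x assume "x \<in> (\<Union>\<Psi>\<in>kernel_minorants. {x. t < ereal (\<omega> (\<lambda>y. \<Psi> (x, y)))})"
    then show "x \<in> {x. t < pot \<omega> x}" using pot_ge[of _ \<omega> x] by (auto intro: less_le_trans)
  qed
  moreover have "open {x. t < ereal (\<omega> (\<lambda>y. \<Psi> (x, y)))}" if "\<Psi> \<in> kernel_minorants" for \<Psi>
  proof (cases t)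
    case (real r)
    have "(\<lambda>x. \<omega> (\<lambda>y. \<Psi> (x, y))) \<in> cc_functions"
      using that by (intro tensor_inner_cc[OF lc _ om]) (simp add: kernel_minorants_def)
    then have "open {x. r < \<omega> (\<lambda>y. \<Psi> (x, y))}" by (intro open_Collect_less continuous_on_const cc_cont)
    then show ?thesis by (simp add: real)
  qed auto
  ultimately show ?thesis by (simp add: open_UN)
qed

lemma pot_nonneg:
  assumes nn: "\<And>z. 0 \<le> \<kappa> z" and om: "\<omega> \<in> positive_measures"
  shows "0 \<le> pot \<omega> x"
  unfolding pot_def using om nn by (rule positive_integral_nonneg)

text \<open>One half of Tonelli's theorem: by Dini the iterated integral is approached along
  continuous minorants of \<open>\<kappa>\<close>, and each of them contributes at most
  \<open>mutual \<nu> \<omega>\<close>.\<close>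

lemma integral_pot_le:
  assumes nn: "\<And>z. 0 \<le> \<kappa> z" and om: "\<omega> \<in> positive_measures" and nu: "\<nu> \<in> positive_measures"
  shows "positive_integral \<nu> (pot \<omega>) \<le> mutual \<nu> \<omega>"
proof (rule positive_integral_le)
  fix \<phi> :: "'a \<Rightarrow> real" assume phi: "\<phi> \<in> cc_functions" "\<And>x. ereal (\<phi> x) \<le> pot \<omega> x"
  have cc: "\<Psi> \<in> cc_functions" if "\<Psi> \<in> kernel_minorants" for \<Psi> using that by (simp add: kernel_minorants_def)
  have "ereal (\<nu> \<phi>) \<le> (SUP \<Psi>\<in>kernel_minorants. ereal (\<nu> (\<lambda>x. \<omega> (\<lambda>y. \<Psi> (x, y)))))"
  proof (rule Dini_directed[OF lc nu phi(1) kernel_minorants_ne[OF nn]])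
    fix \<Psi> assume P: "\<Psi> \<in> kernel_minorants"
    show "(\<lambda>x. \<omega> (\<lambda>y. \<Psi> (x, y))) \<in> cc_functions" by (rule tensor_inner_cc[OF lc cc[OF P] om])
    show "0 \<le> \<omega> (\<lambda>y. \<Psi> (x, y))" for x
      by (rule pm_nonneg[OF om tensor_slice_cc[OF cc[OF P]]]) (use P in \<open>simp add: kernel_minorants_def\<close>)
  next
    fix \<Phi> \<Psi> assume *: "\<Phi> \<in> kernel_minorants" "\<Psi> \<in> kernel_minorants"
    from kernel_minorants_directed[OF this]
    obtain \<Theta> where T: "\<Theta> \<in> kernel_minorants" "\<forall>z. \<Phi> z \<le> \<Theta> z \<and> \<Psi> z \<le> \<Theta> z" by blast
    have "\<omega> (\<lambda>y. \<Phi> (x, y)) \<le> \<omega> (\<lambda>y. \<Theta> (x, y))" "\<omega> (\<lambda>y. \<Psi> (x, y)) \<le> \<omega> (\<lambda>y. \<Theta> (x, y))" for x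
      using T(2) by (auto intro!: pm_mono[OF om tensor_slice_cc[OF cc] tensor_slice_cc[OF cc[OF T(1)]]] *)
    then show "\<exists>k\<in>kernel_minorants. \<forall>x. \<omega> (\<lambda>y. \<Phi> (x, y)) \<le> \<omega> (\<lambda>y. k (x, y)) \<and> \<omega> (\<lambda>y. \<Psi> (x, y)) \<le> \<omega> (\<lambda>y. k (x, y))"
      using T(1) by blast
  next
    fix x show "ereal (\<phi> x) \<le> (SUP \<Psi>\<in>kernel_minorants. ereal (\<omega> (\<lambda>y. \<Psi> (x, y))))"
      by (rule order_trans[OF phi(2) pot_le_SUP[OF nn om]])
  qed
  also have "\<dots> \<le> mutual \<nu> \<omega>"
  proof (rule SUP_least)
    fix \<Psi> assume P: "\<Psi> \<in> kernel_minorants"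
    have "ereal (tensor_measure \<nu> \<omega> \<Psi>) \<le> mutual \<nu> \<omega>"
      unfolding mutual_def using P by (intro positive_integral_gt(1)) (auto simp: kernel_minorants_def)
    then show "ereal (\<nu> (\<lambda>x. \<omega> (\<lambda>y. \<Psi> (x, y)))) \<le> mutual \<nu> \<omega>" by (simp add: tensor_apply cc[OF P])
  qed
  finally show "ereal (\<nu> \<phi>) \<le> mutual \<nu> \<omega>" .
qed

lemma mutual_nonneg:
  assumes "\<And>z. 0 \<le> \<kappa> z" "\<sigma> \<in> positive_measures" "\<tau> \<in> positive_measures"
  shows "0 \<le> mutual \<sigma> \<tau>"
  unfolding mutual_def by (rule positive_integral_nonneg[OF tpm[OF assms(2,3)] assms(1)])

lemma mutual_le_form:
  assumes nn: "\<And>z. 0 \<le> \<kappa> z" and "\<sigma> \<in> Ep" "\<tau> \<in> Ep"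
  shows "mutual \<sigma> \<tau> \<le> ereal (2 * form \<sigma> \<tau>)"
  using mutual_sum_form[OF assms(2,3)] mutual_nonneg[OF nn Ep_pm[OF assms(3)] Ep_pm[OF assms(2)]]
  by (metis add.right_neutral add_left_mono)

lemma form_mono:
  assumes nn: "\<And>z. 0 \<le> \<kappa> z" and "\<sigma> \<in> Ep" "\<tau> \<in> positive_measures" "measure_le \<tau> \<sigma>"
  shows "form \<tau> \<tau> \<le> form \<sigma> \<sigma>"
proof -
  note s = Ep_pm[OF assms(2)]
  have "mutual \<tau> \<tau> \<le> mutual \<sigma> \<sigma>" unfolding mutual_def
    by (rule positive_integral_mono[OF tpm[OF s s] tpm[OF assms(3,3)] tensor_mono[OF lc assms(3,3) s assms(4,4)] nn])
  then show ?thesis using mutual_form[OF assms(2)] mutual_form[OF Ep_le[OF assms(2-4)]] by simp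
qed


section \<open>Sets of interior capacity zero\<close>

lemma measure_support_closed: "closed (measure_support \<nu>)"
  unfolding measure_support_def by (auto intro!: open_Union)

text \<open>Normalized to unit mass, such a measure would compete in the infimum, make it finite and
  the capacity positive.\<close>

lemma interior_capacity_zeroD:
  assumes cap: "interior_capacity \<kappa> N = 0" and nu: "\<nu> \<in> Ep" "\<nu> \<in> positive_measures_on K" "K \<subseteq> N" "compact K"
  shows "\<not> (0 < positive_integral \<nu> (\<lambda>_. 1) \<and> positive_integral \<nu> (\<lambda>_. 1) < \<infinity>)"
proof
  assume "0 < positive_integral \<nu> (\<lambda>_. 1) \<and> positive_integral \<nu> (\<lambda>_. 1) < \<infinity>"
  then obtain m where m: "positive_integral \<nu> (\<lambda>_. 1) = ereal m" "0 < m"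
    by (cases "positive_integral \<nu> (\<lambda>_. 1)") auto
  let ?\<mu> = "radon_comb (1/m) \<nu> 0 zero_measure"
  have pm: "\<nu> \<in> positive_measures" by (rule Ep_pm[OF nu(1)])
  have mu: "?\<mu> \<in> Ep" using m(2) by (intro Ep_comb nu(1) zero_Ep) auto
  have "?\<mu> \<in> positive_measures_on K"
    using m(2) compact_imp_closed[OF nu(4)] by (intro radon_comb_on[OF lc] zero_measure_on[OF lc] nu(2)) auto
  then have sup: "measure_support ?\<mu> \<subseteq> K" by (simp add: positive_measures_on_def)
  then have csup: "compact (measure_support ?\<mu>)"
    using nu(4) measure_support_closed[of ?\<mu>] by (metis closed_Int_compact inf.absorb1)
  have "positive_integral ?\<mu> (\<lambda>_. 1) = ereal (1/m) * positive_integral \<nu> (\<lambda>_. 1)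
      + ereal 0 * positive_integral (zero_measure :: 'a functional) (\<lambda>_. 1)"
    using m(2) by (intro positive_integral_comb[OF pm zero_measure_pm _ _ cc_zero]) (auto simp: zero_ereal_def[symmetric])
  then have one: "positive_integral ?\<mu> (\<lambda>_. 1) = 1" using m by (simp add: one_ereal_def zero_ereal_def[symmetric])
  let ?X = "{\<nu> \<in> Ep. compact (measure_support \<nu>) \<and> measure_support \<nu> \<subseteq> N \<and> positive_integral \<nu> (\<lambda>_. 1) = 1}"
  let ?w = "INF \<nu>\<in>?X. energy \<kappa> \<nu>"
  have "?w \<le> energy \<kappa> ?\<mu>" using mu sup csup one nu(3) by (intro INF_lower) auto
  also have "\<dots> < \<infinity>" using energy_pm(2)[OF Ep_pm[OF mu]] mu by (simp add: Ep_iff)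
  finally have w: "?w < \<infinity>" .
  have "0 \<le> ?w"
    by (rule INF_greatest) (auto simp: energy_pm(2)[OF Ep_pm] mutual_form form_nonneg)
  then have "1 / ?w \<noteq> 0" using w by (cases ?w) (auto simp: divide_ereal_def)
  then show False using cap by (simp add: interior_capacity_def)
qed

text \<open>A compact subset of the exceptional set on which \<open>\<nu>\<close> has mass would, by
  restriction of \<open>\<nu>\<close>, carry a nonzero measure of finite energy and so have positive
  capacity. Hence such compact sets are null in the sense of
  \<open>le_positive_integral_of_null\<close>.\<close>

lemma integral_le_of_nearly_everywhere:
  assumes nn: "\<And>z. 0 \<le> \<kappa> z" and om: "\<omega> \<in> positive_measures" and A: "closed A"
    and ne: "interior_capacity \<kappa> {x \<in> A. \<not> ereal (h x) \<le> pot \<omega> x} = 0"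
    and nu: "\<nu> \<in> Ep" "\<nu> \<in> positive_measures_on A"
  shows "positive_integral \<nu> (\<lambda>x. ereal (h x)) \<le> mutual \<nu> \<omega>"
proof (rule positive_integral_le)
  fix \<phi> :: "'a \<Rightarrow> real" assume phi: "\<phi> \<in> cc_functions" "\<And>x. ereal (\<phi> x) \<le> ereal (h x)"
  note pm = Ep_pm[OF nu(1)]
  have "ereal (\<nu> \<phi>) \<le> positive_integral \<nu> (pot \<omega>)"
  proof (rule le_positive_integral_of_null[OF lc nu(2) A phi(1) pot_open[OF nn om] cc_zero])
    show "ereal 0 \<le> pot \<omega> x" for x using pot_nonneg[OF nn om] by (simp add: zero_ereal_def[symmetric])
    fix K and \<delta> :: real assume K: "compact K" "K \<subseteq> A" "\<And>x. x \<in> K \<Longrightarrow> pot \<omega> x < ereal (\<phi> x)" and d: "0 < \<delta>"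
    show "\<exists>\<xi>\<in>cc_functions. (\<forall>x. 0 \<le> \<xi> x) \<and> (\<forall>x\<in>K. 1 \<le> \<xi> x) \<and> \<nu> \<xi> < \<delta>"
    proof (rule ccontr)
      assume no: "\<not> ?thesis"
      have low: "\<delta> \<le> \<nu> \<xi>" if "\<xi> \<in> cc_functions" "\<And>x. 0 \<le> \<xi> x" "\<And>x. x \<in> K \<Longrightarrow> 1 \<le> \<xi> x" for \<xi>
        using no that by (meson not_le)
      obtain \<nu>' where n: "\<nu>' \<in> positive_measures_on K" "measure_le \<nu>' \<nu>"
        "0 < positive_integral \<nu>' (\<lambda>_. 1)" "positive_integral \<nu>' (\<lambda>_. 1) < \<infinity>"
        by (rule restrict_to_compact[OF lc pm K(1) d low])
      have "\<nu>' \<in> Ep" by (rule Ep_le[OF nu(1) pm_on_pm[OF n(1)] n(2)])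
      moreover have "K \<subseteq> {x \<in> A. \<not> ereal (h x) \<le> pot \<omega> x}"
        using K(2,3) phi(2) by (force simp: not_le intro: less_le_trans)
      ultimately show False using interior_capacity_zeroD[OF ne _ n(1) _ K(1)] n(3,4) by blast
    qed
  qed
  also have "\<dots> \<le> mutual \<nu> \<omega>" by (rule integral_pot_le[OF nn om pm])
  finally show "ereal (\<nu> \<phi>) \<le> mutual \<nu> \<omega>" .
qed

end

section \<open>Tails of measures of bounded energy\<close>

text \<open>A continuous function that is 0 off \<open>Q\<close> lives in the interior of
  \<open>Q\<close>, so this says that the interior carries no mass. As a family of linear equations
  it is kept under midpoints.\<close>

definition vanishes_on :: "'b set \<Rightarrow> 'b::topological_space functional \<Rightarrow> bool" where
  "vanishes_on Q \<nu> \<longleftrightarrow> (\<forall>\<phi>\<in>cc_functions. (\<forall>x. x \<notin> Q \<longrightarrow> \<phi> x = 0) \<longrightarrow> \<nu> \<phi> = 0)"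

text \<open>The compact support of \<open>\<psi>\<close> makes the supremum attained, by
  \<open>h\<close> times a cutoff that is 1 on this support.\<close>

lemma positive_integral_radon_density:
  fixes \<nu> :: "'b::t2_space functional"
  assumes lc: "locally_compact_space (euclidean :: 'b topology)"
    and nu: "\<nu> \<in> positive_measures" and psi: "\<psi> \<in> cc_functions" "\<And>x. 0 \<le> \<psi> x"
    and h: "continuous_on UNIV h" "\<And>x. 0 \<le> h x"
  shows "positive_integral (radon_density \<psi> \<nu>) (\<lambda>x. ereal (h x)) = ereal (\<nu> (\<lambda>x. h x * \<psi> x))"
proof (rule antisym)
  note hp = cc_mult[OF h(1) psi(1)]
  show "positive_integral (radon_density \<psi> \<nu>) (\<lambda>x. ereal (h x)) \<le> ereal (\<nu> (\<lambda>x. h x * \<psi> x))"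
  proof (rule positive_integral_le)
    fix \<phi> :: "'b \<Rightarrow> real" assume phi: "\<phi> \<in> cc_functions" "\<And>x. ereal (\<phi> x) \<le> ereal (h x)"
    have "\<psi> x * \<phi> x \<le> h x * \<psi> x" for x
      using mult_left_mono[of "\<phi> x" "h x" "\<psi> x"] phi(2)[of x] psi(2)[of x] by (simp add: mult.commute)
    then show "ereal (radon_density \<psi> \<nu> \<phi>) \<le> ereal (\<nu> (\<lambda>x. h x * \<psi> x))"
      using pm_mono[OF nu cc_mult[OF cc_cont[OF psi(1)] phi(1)] hp] phi(1) by simp
  qed
  from cc_cutoff[OF lc cc_compact[OF psi(1)]]
  obtain \<xi> where xi[rule_format]: "\<xi> \<in> cc_functions" "\<forall>x. \<xi> x \<le> 1" "\<forall>x\<in>closure {x. \<psi> x \<noteq> 0}. \<xi> x = 1" by meson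
  note hx = cc_mult[OF h(1) xi(1)]
  have "\<psi> x * (h x * \<xi> x) = h x * \<psi> x" for x
    using xi(3)[of x] cc_outside[of x \<psi>] by (cases "x \<in> closure {x. \<psi> x \<noteq> 0}") simp_all
  then have "(\<lambda>x. \<psi> x * (h x * \<xi> x)) = (\<lambda>x. h x * \<psi> x)" by (rule ext)
  then have "radon_density \<psi> \<nu> (\<lambda>x. h x * \<xi> x) = \<nu> (\<lambda>x. h x * \<psi> x)" using hx by simp
  moreover have "ereal (radon_density \<psi> \<nu> (\<lambda>x. h x * \<xi> x)) \<le> positive_integral (radon_density \<psi> \<nu>) (\<lambda>x. ereal (h x))"
  proof (rule positive_integral_gt(1)[OF hx])
    show "ereal (h x * \<xi> x) \<le> ereal (h x)" for x using mult_left_mono[OF xi(2)[of x] h(2)[of x]] by simp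
  qed
  ultimately show "ereal (\<nu> (\<lambda>x. h x * \<psi> x)) \<le> positive_integral (radon_density \<psi> \<nu>) (\<lambda>x. ereal (h x))" by simp
qed

context energy_space
begin

lemma energies_nonneg: "0 \<le> (INF \<nu>\<in>{\<nu> \<in> Ep. Q \<nu>}. energy \<kappa> \<nu>)"
  by (rule INF_greatest) (auto simp: energy_pm(2)[OF Ep_pm] mutual_form form_nonneg)

lemma interior_capacity_finiteD:
  assumes "interior_capacity \<kappa> A < \<infinity>"
  obtains c where "0 < c" "\<And>\<sigma>. \<sigma> \<in> Ep \<Longrightarrow> compact (measure_support \<sigma>) \<Longrightarrow> measure_support \<sigma> \<subseteq> A \<Longrightarrow>
    positive_integral \<sigma> (\<lambda>_. 1) = 1 \<Longrightarrow> c \<le> form \<sigma> \<sigma>"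
proof -
  let ?w = "INF \<nu>\<in>{\<nu> \<in> Ep. compact (measure_support \<nu>) \<and> measure_support \<nu> \<subseteq> A \<and> positive_integral \<nu> (\<lambda>_. 1) = 1}. energy \<kappa> \<nu>"
  have w0: "0 \<le> ?w" by (rule energies_nonneg)
  have "?w \<noteq> 0" using assms by (auto simp: interior_capacity_def)
  then have "0 < ?w" using w0 by simp
  then obtain c where c: "0 < ereal c" "ereal c < ?w" using ereal_dense2 by blast
  have "c \<le> form \<sigma> \<sigma>" if "\<sigma> \<in> Ep" "compact (measure_support \<sigma>)" "measure_support \<sigma> \<subseteq> A"
    "positive_integral \<sigma> (\<lambda>_. 1) = 1" for \<sigma>
  proof -
    have "?w \<le> energy \<kappa> \<sigma>" using that by (intro INF_lower) auto
    then have "?w \<le> ereal (form \<sigma> \<sigma>)"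
      by (simp only: energy_pm(2)[OF Ep_pm[OF that(1)]] mutual_form[OF that(1)])
    from less_le_trans[OF c(2) this] show ?thesis by simp
  qed
  then show ?thesis using c(1) that by simp
qed

lemma interior_capacity_zero_subset:
  assumes "interior_capacity \<kappa> N = 0" "M \<subseteq> N"
  shows "interior_capacity \<kappa> M = 0"
proof -
  let ?X = "\<lambda>N. {\<nu> \<in> Ep. compact (measure_support \<nu>) \<and> measure_support \<nu> \<subseteq> N \<and> positive_integral \<nu> (\<lambda>_. 1) = 1}"
  have "0 \<le> (INF \<nu>\<in>?X N. energy \<kappa> \<nu>)" by (rule energies_nonneg)
  moreover have "1 / (INF \<nu>\<in>?X N. energy \<kappa> \<nu>) = 0" using assms(1) by (simp add: interior_capacity_def)
  ultimately have "(INF \<nu>\<in>?X N. energy \<kappa> \<nu>) = \<infinity>"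
    by (cases "INF \<nu>\<in>?X N. energy \<kappa> \<nu>") (auto simp: divide_ereal_def split: if_splits)
  moreover have "(INF \<nu>\<in>?X N. energy \<kappa> \<nu>) \<le> (INF \<nu>\<in>?X M. energy \<kappa> \<nu>)"
    using assms(2) by (intro INF_superset_mono) auto
  ultimately have "(INF \<nu>\<in>?X M. energy \<kappa> \<nu>) = \<infinity>" by simp
  then show ?thesis unfolding interior_capacity_def by simp
qed

text \<open>Splitting \<open>g\<close> at height \<open>T\<close>: \<open>g \<le> T + T powr (1 - r) * g powr r\<close>.\<close>

lemma weight_bound:
  assumes nn: "\<And>z. 0 \<le> \<kappa> z" and A: "closed A" and g: "\<And>x. 0 < g x"
    and cond: "(SUP x\<in>A. ereal (g x)) < \<infinity> \<or>
      (\<exists>r>1. \<exists>\<omega>\<in>finite_energy \<kappa>. nearly_everywhere \<kappa> A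
        (\<lambda>x. potential_defined \<kappa> x \<omega> \<and> ereal (g x powr r) \<le> potential \<kappa> x \<omega>))"
    and d: "0 < \<delta>"
  obtains T where "0 < T" "\<And>\<nu>. \<nu> \<in> Ep \<Longrightarrow> \<nu> \<in> positive_measures_on A \<Longrightarrow>
    positive_integral \<nu> (\<lambda>x. ereal (g x)) \<le> ereal T * positive_integral \<nu> (\<lambda>_. 1) + ereal (\<delta> * sqrt (form \<nu> \<nu>))"
  using cond
proof
  assume "(SUP x\<in>A. ereal (g x)) < \<infinity>"
  then obtain M where M: "(SUP x\<in>A. ereal (g x)) \<le> ereal M" by (cases "SUP x\<in>A. ereal (g x)") auto
  define T where "T = max M 1"
  have T: "0 < T" "1 \<le> T" by (auto simp: T_def)
  have gT: "g x \<le> T" if "x \<in> A" for x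
  proof -
    have "ereal (g x) \<le> ereal M" using M that by (simp add: SUP_le_iff)
    then show ?thesis by (simp add: T_def)
  qed
  show ?thesis
  proof (rule that[OF T(1)])
    fix \<nu> assume nu: "\<nu> \<in> Ep" "\<nu> \<in> positive_measures_on A"
    note rm = pm_rm[OF Ep_pm[OF nu(1)]]
    show "positive_integral \<nu> (\<lambda>x. ereal (g x)) \<le> ereal T * positive_integral \<nu> (\<lambda>_. 1) + ereal (\<delta> * sqrt (form \<nu> \<nu>))"
    proof (rule positive_integral_le)
      fix \<phi> :: "'a \<Rightarrow> real" assume phi: "\<phi> \<in> cc_functions" "\<And>x. ereal (\<phi> x) \<le> ereal (g x)"
      have "inverse T * \<phi> x \<le> 1" if "x \<in> A" for x
        using gT[OF that] phi(2)[of x] T(1) by (simp add: field_simps)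
      then have "ereal (\<nu> (\<lambda>x. inverse T * \<phi> x)) \<le> positive_integral \<nu> (\<lambda>_. 1)"
        by (intro le_positive_integral_on[OF lc nu(2) A cc_scale[OF phi(1)] _ cc_zero]) (auto simp: one_ereal_def)
      then have "ereal T * ereal (inverse T * \<nu> \<phi>) \<le> ereal T * positive_integral \<nu> (\<lambda>_. 1)"
        using T(1) rm_scale[OF rm phi(1)] by (intro ereal_mult_left_mono) auto
      moreover have "T * (inverse T * \<nu> \<phi>) = \<nu> \<phi>" using T(1) by simp
      ultimately have "ereal (\<nu> \<phi>) \<le> ereal T * positive_integral \<nu> (\<lambda>_. 1)" by (metis times_ereal.simps(1))
      moreover have "0 \<le> ereal (\<delta> * sqrt (form \<nu> \<nu>))" using d form_nonneg[OF nu(1)] by simp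
      ultimately show "ereal (\<nu> \<phi>) \<le> ereal T * positive_integral \<nu> (\<lambda>_. 1) + ereal (\<delta> * sqrt (form \<nu> \<nu>))"
        by (rule add_increasing2[rotated])
    qed
  qed
next
  assume "\<exists>r>1. \<exists>\<omega>\<in>finite_energy \<kappa>. nearly_everywhere \<kappa> A
        (\<lambda>x. potential_defined \<kappa> x \<omega> \<and> ereal (g x powr r) \<le> potential \<kappa> x \<omega>)"
  then obtain r \<omega>' where r: "1 < r" and om': "\<omega>' \<in> finite_energy \<kappa>"
    and ne: "interior_capacity \<kappa> {x \<in> A. \<not> (potential_defined \<kappa> x \<omega>' \<and> ereal (g x powr r) \<le> potential \<kappa> x \<omega>')} = 0"
    unfolding nearly_everywhere_def by blast
  \<comment> \<open>Since \<open>\<kappa> \<ge> 0\<close>, dropping the negative part of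
    \<open>\<omega>'\<close> only raises the potential, so the growth condition persists for a
    measure of the cone.\<close>
  define \<omega> where "\<omega> = positive_part \<omega>'"
  have om: "\<omega> \<in> Ep" unfolding \<omega>_def by (rule finite_energy_positive_part[OF om'])
  have omr: "\<omega>' \<in> radon_measures" using om' by (simp add: finite_energy_def)
  have "{x \<in> A. \<not> ereal (g x powr r) \<le> pot \<omega> x}
      \<subseteq> {x \<in> A. \<not> (potential_defined \<kappa> x \<omega>' \<and> ereal (g x powr r) \<le> potential \<kappa> x \<omega>')}"
  proof (intro subsetI CollectI conjI notI)
    fix x assume x: "x \<in> {x \<in> A. \<not> ereal (g x powr r) \<le> pot \<omega> x}"
    then show "x \<in> A" by simp
    assume "potential_defined \<kappa> x \<omega>' \<and> ereal (g x powr r) \<le> potential \<kappa> x \<omega>'"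
    then have "ereal (g x powr r) \<le> pot \<omega> x - pot (negative_part \<omega>') x"
      by (simp add: potential_def signed_integral_def pot_def \<omega>_def)
    moreover have "0 \<le> pot (negative_part \<omega>') x" by (rule pot_nonneg[OF nn negative_part_pm[OF lc omr]])
    moreover have "0 \<le> pot \<omega> x" by (rule pot_nonneg[OF nn Ep_pm[OF om]])
    ultimately have "ereal (g x powr r) \<le> pot \<omega> x"
      by (cases "pot \<omega> x"; cases "pot (negative_part \<omega>') x") auto
    then show False using x by simp
  qed
  then have ne': "interior_capacity \<kappa> {x \<in> A. \<not> ereal (g x powr r) \<le> pot \<omega> x} = 0"
    by (rule interior_capacity_zero_subset[OF ne])
  \<comment> \<open>The factor 2 comes from bounding \<open>mutual \<nu> \<omega>\<close> by twice
    the symmetrized form, by \<open>mutual_le_form\<close>.\<close>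
  define C where "C = 2 * sqrt (form \<omega> \<omega>)"
  have C0: "0 \<le> C" using form_nonneg[OF om] by (simp add: C_def)
  \<comment> \<open>Solves \<open>T powr (1 - r) = \<delta> / (C + \<delta>)\<close>, which times
    \<open>C\<close> is at most \<open>\<delta>\<close>; the added \<open>\<delta>\<close> keeps
    \<open>T\<close> positive when \<open>C = 0\<close>.\<close>
  define T where "T = ((C + \<delta>) / \<delta>) powr (1 / (r - 1))"
  have T: "0 < T" using C0 d by (simp add: T_def)
  have "1 / (r - 1) * (1 - r) = - 1" using r by (simp add: field_simps)
  then have "T powr (1 - r) = ((C + \<delta>) / \<delta>) powr (- 1)" unfolding T_def powr_powr by (simp only:)
  also have "\<dots> = \<delta> / (C + \<delta>)" using C0 d by (simp add: powr_minus_divide)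
  finally have Tr: "T powr (1 - r) = \<delta> / (C + \<delta>)" .
  have TC: "T powr (1 - r) * C \<le> \<delta>" unfolding Tr using C0 d by (simp add: field_simps)
  show ?thesis
  proof (rule that[OF T])
    fix \<nu> assume nu: "\<nu> \<in> Ep" "\<nu> \<in> positive_measures_on A"
    note pm = Ep_pm[OF nu(1)]
    note rm = pm_rm[OF pm]
    have "(form \<nu> \<omega>)\<^sup>2 \<le> form \<nu> \<nu> * form \<omega> \<omega>" by (rule form_Cauchy_Schwarz[OF nu(1) om])
    then have "form \<nu> \<omega> \<le> sqrt (form \<nu> \<nu>) * sqrt (form \<omega> \<omega>)"
      by (metis real_le_rsqrt real_sqrt_mult)
    then have fC: "2 * form \<nu> \<omega> \<le> C * sqrt (form \<nu> \<nu>)" by (simp add: C_def mult_ac)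
    have gr: "positive_integral \<nu> (\<lambda>x. ereal (g x powr r)) \<le> ereal (C * sqrt (form \<nu> \<nu>))"
      using integral_le_of_nearly_everywhere[OF nn Ep_pm[OF om] A ne' nu] mutual_le_form[OF nn nu(1) om] fC
      by (meson ereal_less_eq(3) order_trans)
    show "positive_integral \<nu> (\<lambda>x. ereal (g x)) \<le> ereal T * positive_integral \<nu> (\<lambda>_. 1) + ereal (\<delta> * sqrt (form \<nu> \<nu>))"
    proof (rule positive_integral_le)
      fix \<phi> :: "'a \<Rightarrow> real" assume phi: "\<phi> \<in> cc_functions" "\<And>x. ereal (\<phi> x) \<le> ereal (g x)"
      \<comment> \<open>\<open>?b\<close> is at most \<open>T\<close> and is charged to the mass.
        \<open>?a\<close> is nonzero only where \<open>T < \<phi> x \<le> g x\<close>, and there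
        \<open>T powr (r - 1) * ?a x \<le> g x powr r\<close>, so it is charged to the
        energy.\<close>
      let ?a = "\<lambda>x. max (\<phi> x - T) 0" and ?b = "\<lambda>x. min (\<phi> x) T"
      have a: "?a \<in> cc_functions"
        by (rule cc_comp2[OF phi(1) phi(1)])
          (use T in \<open>auto intro!: continuous_on_max continuous_on_diff continuous_on_const cc_cont[OF phi(1)]\<close>)
      have b: "?b \<in> cc_functions"
        by (rule cc_comp2[OF phi(1) phi(1)])
          (use T in \<open>auto intro!: continuous_on_min continuous_on_const cc_cont[OF phi(1)]\<close>)
      have "(\<lambda>x. ?a x + ?b x) = \<phi>" by (auto simp: fun_eq_iff max_def min_def)
      then have split: "\<nu> \<phi> = \<nu> ?a + \<nu> ?b" using rm_add[OF rm a b] by metis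
      have "ereal (\<nu> (\<lambda>x. inverse T * ?b x)) \<le> positive_integral \<nu> (\<lambda>_. 1)"
        by (rule positive_integral_gt(1)[OF cc_scale[OF b]]) (use T in \<open>simp add: one_ereal_def field_simps\<close>)
      then have "ereal T * ereal (inverse T * \<nu> ?b) \<le> ereal T * positive_integral \<nu> (\<lambda>_. 1)"
        using T rm_scale[OF rm b] by (intro ereal_mult_left_mono) auto
      moreover have "T * (inverse T * \<nu> ?b) = \<nu> ?b" using T by simp
      ultimately have bT: "ereal (\<nu> ?b) \<le> ereal T * positive_integral \<nu> (\<lambda>_. 1)" by (metis times_ereal.simps(1))
      have "ereal (\<nu> (\<lambda>x. T powr (r - 1) * ?a x)) \<le> positive_integral \<nu> (\<lambda>x. ereal (g x powr r))"
      proof (rule positive_integral_gt(1)[OF cc_scale[OF a]])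
        fix x
        show "ereal (T powr (r - 1) * ?a x) \<le> ereal (g x powr r)"
        proof (cases "\<phi> x \<le> T")
          case False
          then have Tg: "T \<le> g x" using phi(2)[of x] by simp
          have "T powr (r - 1) * ?a x \<le> g x powr (r - 1) * g x"
            using False phi(2)[of x] T r Tg by (intro mult_mono powr_mono2) auto
          also have "\<dots> = g x powr r" using g[of x] powr_add[of "g x" "r - 1" 1] by simp
          finally show ?thesis by simp
        qed simp
      qed
      from order_trans[OF this gr] have "ereal (T powr (r - 1) * \<nu> ?a) \<le> ereal (C * sqrt (form \<nu> \<nu>))"
        by (simp only: rm_scale[OF rm a])
      then have "T powr (1 - r) * (T powr (r - 1) * \<nu> ?a) \<le> T powr (1 - r) * (C * sqrt (form \<nu> \<nu>))"
        by (intro mult_left_mono) auto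
      moreover have "T powr (1 - r) * T powr (r - 1) = 1" using T by (simp add: powr_add[symmetric])
      then have "T powr (1 - r) * (T powr (r - 1) * \<nu> ?a) = \<nu> ?a" by (simp only: mult.assoc[symmetric] mult_1)
      ultimately have "\<nu> ?a \<le> (T powr (1 - r) * C) * sqrt (form \<nu> \<nu>)" by (simp only: mult.assoc)
      also have "\<dots> \<le> \<delta> * sqrt (form \<nu> \<nu>)" using TC form_nonneg[OF nu(1)] by (intro mult_right_mono) auto
      finally have "ereal (\<nu> ?a) \<le> ereal (\<delta> * sqrt (form \<nu> \<nu>))" by simp
      then have "ereal (\<nu> ?b) + ereal (\<nu> ?a) \<le> ereal T * positive_integral \<nu> (\<lambda>_. 1) + ereal (\<delta> * sqrt (form \<nu> \<nu>))"
        using bT by (rule add_mono[rotated])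
      then show "ereal (\<nu> \<phi>) \<le> ereal T * positive_integral \<nu> (\<lambda>_. 1) + ereal (\<delta> * sqrt (form \<nu> \<nu>))"
        using split by (simp add: add.commute)
    qed
  qed
qed

end

context consistent_space
begin

text \<open>Otherwise there would be unit measures on \<open>A\<close> of bounded energy, living outside any given
  compact set; by consistency nearly minimal ones converge strongly to their vague limit \<open>0\<close>, but
  their energies are at least \<open>1 / C(A)\<close>.\<close>

lemma mass_tail:
  assumes nn: "\<And>z. 0 \<le> \<kappa> z" and A: "closed A" and cap: "interior_capacity \<kappa> A < \<infinity>" and e: "0 < \<epsilon>"
  obtains Q where "compact Q" "\<And>\<nu> \<psi>. \<nu> \<in> Ep \<Longrightarrow> \<nu> \<in> positive_measures_on A \<Longrightarrow> vanishes_on Q \<nu> \<Longrightarrow>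
    \<psi> \<in> cc_functions \<Longrightarrow> (\<And>x. 0 \<le> \<psi> x) \<Longrightarrow> (\<And>x. \<psi> x \<le> 1) \<Longrightarrow> (\<nu> \<psi>)\<^sup>2 \<le> \<epsilon> * form \<nu> \<nu>"
proof (rule ccontr)
  assume no: "\<not> thesis"
  note goal = that
  obtain c where c: "0 < c" "\<And>\<sigma>. \<sigma> \<in> Ep \<Longrightarrow> compact (measure_support \<sigma>) \<Longrightarrow> measure_support \<sigma> \<subseteq> A \<Longrightarrow>
    positive_integral \<sigma> (\<lambda>_. 1) = 1 \<Longrightarrow> c \<le> form \<sigma> \<sigma>"
    using interior_capacity_finiteD[OF cap] by metis
  \<comment> \<open>These sets are kept under midpoints and shrink as \<open>Q\<close> grows, as
    \<open>min_filter\<close> requires.\<close>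
  define S where "S Q = {\<sigma> \<in> Ep. compact (measure_support \<sigma>) \<and> measure_support \<sigma> \<subseteq> A
     \<and> positive_integral \<sigma> (\<lambda>_. 1) = 1 \<and> vanishes_on Q \<sigma>}" for Q
  \<comment> \<open>A counterexample \<open>\<nu>\<close>, \<open>\<psi>\<close> for
    \<open>Q\<close> gives the unit measure \<open>\<psi> \<nu> / m\<close> with
    \<open>m = \<nu> \<psi>\<close>; its energy is at most
    \<open>form \<nu> \<nu> / m\<^sup>2 < 1 / \<epsilon>\<close>.\<close>
  have small: "\<exists>\<sigma>\<in>S Q. form \<sigma> \<sigma> \<le> 1 / \<epsilon>" if Q: "compact Q" for Q
  proof -
    have "\<exists>\<nu> \<psi>. \<nu> \<in> Ep \<and> \<nu> \<in> positive_measures_on A \<and> vanishes_on Q \<nu> \<and> \<psi> \<in> cc_functions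
        \<and> (\<forall>x. 0 \<le> \<psi> x) \<and> (\<forall>x. \<psi> x \<le> 1) \<and> \<not> (\<nu> \<psi>)\<^sup>2 \<le> \<epsilon> * form \<nu> \<nu>"
    proof (rule ccontr)
      assume "\<not> ?thesis"
      then show False using no goal[OF Q] by meson
    qed
    then obtain \<nu> \<psi> where nu: "\<nu> \<in> Ep" "\<nu> \<in> positive_measures_on A" "vanishes_on Q \<nu>"
      and psi: "\<psi> \<in> cc_functions" "\<And>x. 0 \<le> \<psi> x" "\<And>x. \<psi> x \<le> 1" and big: "\<epsilon> * form \<nu> \<nu> < (\<nu> \<psi>)\<^sup>2"
      by (auto simp: not_le)
    note pm = Ep_pm[OF nu(1)]
    note cont = cc_cont[OF psi(1)]
    define m where "m = \<nu> \<psi>"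
    have "0 \<le> \<epsilon> * form \<nu> \<nu>" using e form_nonneg[OF nu(1)] by simp
    then have "m \<noteq> 0" using big by (auto simp: m_def)
    then have m: "0 < m" using pm_nonneg[OF pm psi(1,2)] by (simp add: m_def)
    let ?d = "radon_density \<psi> \<nu>"
    have dpm: "?d \<in> positive_measures" by (rule radon_density_pm[OF lc pm cont psi(2)])
    have dle: "measure_le ?d \<nu>" by (rule radon_density_le[OF pm cont psi(3)])
    have dE: "?d \<in> Ep" by (rule Ep_le[OF nu(1) dpm dle])
    let ?\<sigma> = "radon_comb (1/m) ?d 0 zero_measure"
    have sE: "?\<sigma> \<in> Ep" using m by (intro Ep_comb dE zero_Ep) auto
    let ?C = "A \<inter> closure {x. \<psi> x \<noteq> 0}"
    have cC: "compact ?C" using A cc_compact[OF psi(1)] by (rule closed_Int_compact)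
    have "?d \<in> positive_measures_on ?C"
      by (rule radon_density_on[OF lc A nu(2) cont psi(2) closed_closure]) (rule cc_outside[of _ \<psi>])
    then have "?\<sigma> \<in> positive_measures_on ?C"
      using m compact_imp_closed[OF cC] by (intro radon_comb_on[OF lc] zero_measure_on[OF lc]) auto
    then have sup: "measure_support ?\<sigma> \<subseteq> ?C" by (simp add: positive_measures_on_def)
    then have csup: "compact (measure_support ?\<sigma>)"
      using cC measure_support_closed[of ?\<sigma>] by (metis closed_Int_compact inf.absorb1)
    have "positive_integral ?\<sigma> (\<lambda>_. 1) = ereal (1/m) * positive_integral ?d (\<lambda>_. 1)
      + ereal 0 * positive_integral (zero_measure :: 'a functional) (\<lambda>_. 1)"
      using m by (intro positive_integral_comb[OF dpm zero_measure_pm _ _ cc_zero]) (auto simp: zero_ereal_def[symmetric])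
    then have one: "positive_integral ?\<sigma> (\<lambda>_. 1) = 1"
      using m positive_integral_radon_density[OF lc pm psi(1,2), of "\<lambda>_. 1"] by (simp add: one_ereal_def zero_ereal_def[symmetric] m_def)
    have van: "vanishes_on Q ?\<sigma>"
      unfolding vanishes_on_def
    proof (intro ballI impI)
      fix \<phi> :: "'a \<Rightarrow> real" assume phi: "\<phi> \<in> cc_functions" "\<forall>x. x \<notin> Q \<longrightarrow> \<phi> x = 0"
      have "\<nu> (\<lambda>x. \<psi> x * \<phi> x) = 0"
        using nu(3) cc_mult[OF cont phi(1)] phi(2) unfolding vanishes_on_def by simp
      then show "?\<sigma> \<phi> = 0" using phi(1) by simp
    qed
    have "form ?\<sigma> ?\<sigma> = (1/m)\<^sup>2 * form ?d ?d"
      using form_comb_square[OF dE zero_Ep, of "1/m" 0] m by simp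
    also have "\<dots> \<le> (1/m)\<^sup>2 * form \<nu> \<nu>"
      by (intro mult_left_mono form_mono[OF nn nu(1) dpm dle]) simp
    also have "\<dots> \<le> 1 / \<epsilon>" using big e m by (simp add: m_def[symmetric] field_simps power2_eq_square)
    finally show ?thesis using sE sup csup one van by (intro bexI[of _ ?\<sigma>]) (auto simp: S_def)
  qed
  have mid_S: "mid \<sigma> \<tau> \<in> S Q" if "\<sigma> \<in> S Q" "\<tau> \<in> S Q" for \<sigma> \<tau> Q
  proof -
    have s: "\<sigma> \<in> Ep" "compact (measure_support \<sigma>)" "measure_support \<sigma> \<subseteq> A" "positive_integral \<sigma> (\<lambda>_. 1) = 1" "vanishes_on Q \<sigma>"
      and t: "\<tau> \<in> Ep" "compact (measure_support \<tau>)" "measure_support \<tau> \<subseteq> A" "positive_integral \<tau> (\<lambda>_. 1) = 1" "vanishes_on Q \<tau>"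
      using that by (auto simp: S_def)
    let ?C = "measure_support \<sigma> \<union> measure_support \<tau>"
    have cC: "compact ?C" using s(2) t(2) by (rule compact_Un)
    have "mid \<sigma> \<tau> \<in> positive_measures_on ?C"
      using Ep_pm[OF s(1)] Ep_pm[OF t(1)]
      by (intro radon_comb_on[OF lc compact_imp_closed[OF cC]]) (auto simp: positive_measures_on_def)
    then have sup: "measure_support (mid \<sigma> \<tau>) \<subseteq> ?C" by (simp add: positive_measures_on_def)
    then have csup: "compact (measure_support (mid \<sigma> \<tau>))"
      using cC measure_support_closed[of "mid \<sigma> \<tau>"] by (metis closed_Int_compact inf.absorb1)
    have "positive_integral (mid \<sigma> \<tau>) (\<lambda>_. 1) = ereal (1/2) * positive_integral \<sigma> (\<lambda>_. 1) + ereal (1/2) * positive_integral \<tau> (\<lambda>_. 1)"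
      by (intro positive_integral_comb[OF Ep_pm[OF s(1)] Ep_pm[OF t(1)] _ _ cc_zero]) (auto simp: zero_ereal_def[symmetric])
    then have one: "positive_integral (mid \<sigma> \<tau>) (\<lambda>_. 1) = 1" using s(4) t(4) by (simp add: one_ereal_def)
    have "vanishes_on Q (mid \<sigma> \<tau>)" using s(5) t(5) by (simp add: vanishes_on_def)
    then show ?thesis using Ep_mid[OF s(1) t(1)] sup csup one s(3) t(3) unfolding S_def by blast
  qed
  let ?\<C> = "S ` {Q. compact Q}"
  obtain G where G: "G \<noteq> bot" "\<And>C. C \<in> ?\<C> \<Longrightarrow> eventually (\<lambda>\<sigma>. \<sigma> \<in> C) G" "strong_cauchy \<kappa> G"
  proof (rule min_filter[of ?\<C> "1/\<epsilon>"])
    show "?\<C> \<noteq> {}" using compact_empty by blast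
    show "C \<subseteq> Ep" if "C \<in> ?\<C>" for C using that by (auto simp: S_def)
    show "\<exists>E\<in>?\<C>. E \<subseteq> C \<inter> D" if CD: "C \<in> ?\<C>" "D \<in> ?\<C>" for C D
    proof -
      obtain P Q where PQ: "C = S P" "compact P" "D = S Q" "compact Q" using CD by blast
      have "vanishes_on P \<sigma> \<and> vanishes_on Q \<sigma>" if "vanishes_on (P \<union> Q) \<sigma>" for \<sigma> :: "'a functional"
        using that unfolding vanishes_on_def by simp
      then have "S (P \<union> Q) \<subseteq> C \<inter> D" unfolding PQ S_def by blast
      then show ?thesis using compact_Un[OF PQ(2,4)] by blast
    qed
    show "mid \<sigma> \<tau> \<in> C" if "C \<in> ?\<C>" "\<sigma> \<in> C" "\<tau> \<in> C" for C \<sigma> \<tau> using that mid_S by blast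
    show "\<exists>\<sigma>\<in>C. form \<sigma> \<sigma> \<le> 1 / \<epsilon>" if "C \<in> ?\<C>" for C using that small by blast
  qed blast
  have evS: "eventually (\<lambda>\<sigma>. \<sigma> \<in> S Q) G" if "compact Q" for Q using G(2) that by blast
  have evE: "eventually (\<lambda>\<sigma>. \<sigma> \<in> Ep) G" using evS[OF compact_empty] by eventually_elim (simp add: S_def)
  \<comment> \<open>Taking \<open>Q\<close> to be the support of a test function shows that it is
    eventually annihilated, so the vague limit is 0.\<close>
  have lim: "((\<lambda>\<sigma>. \<sigma> \<phi>) \<longlongrightarrow> zero_measure \<phi>) G" if phi: "\<phi> \<in> cc_functions" for \<phi>
  proof (rule tendsto_eventually)
    show "eventually (\<lambda>\<sigma>. \<sigma> \<phi> = zero_measure \<phi>) G"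
      using evS[OF cc_compact[OF phi]]
    proof eventually_elim
      case (elim \<sigma>)
      then have "vanishes_on (closure {x. \<phi> x \<noteq> 0}) \<sigma>" by (simp add: S_def)
      moreover have "\<forall>x. x \<notin> closure {x. \<phi> x \<noteq> 0} \<longrightarrow> \<phi> x = 0" by (intro allI impI) (rule cc_outside)
      ultimately have "\<sigma> \<phi> = 0" using phi unfolding vanishes_on_def by (metis (no_types))
      then show ?case using phi by simp
    qed
  qed
  have "((\<lambda>\<sigma>. qdist \<sigma> zero_measure) \<longlongrightarrow> 0) G"
    by (rule strong_limit(2)[OF G(1) evE G(3) zero_measure_pm]) (rule lim)
  moreover have "eventually (\<lambda>\<sigma>. c \<le> qdist \<sigma> zero_measure) G"
    using evS[OF compact_empty]
  proof eventually_elim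
    case (elim \<sigma>)
    then have "\<sigma> \<in> Ep" "c \<le> form \<sigma> \<sigma>" using c(2) by (auto simp: S_def)
    then show ?case using zero_Ep by (simp add: qdist_def)
  qed
  ultimately have "c \<le> 0" using G(1) by (rule tendsto_lowerbound)
  then show False using c(1) by simp
qed

text \<open>The order of choices matters: \<open>T\<close> is fixed first, by the energy term of
  \<open>weight_bound\<close>, and only then is \<open>Q\<close> taken so large that
  \<open>T\<close> times the mass left outside is small. Each term receives
  \<open>\<delta> / 2\<close>.\<close>

lemma weighted_tail:
  assumes nn: "\<And>z. 0 \<le> \<kappa> z" and A: "closed A" and g: "\<And>x. 0 < g x"
    and cond: "(SUP x\<in>A. ereal (g x)) < \<infinity> \<or>
      (\<exists>r>1. \<exists>\<omega>\<in>finite_energy \<kappa>. nearly_everywhere \<kappa> A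
        (\<lambda>x. potential_defined \<kappa> x \<omega> \<and> ereal (g x powr r) \<le> potential \<kappa> x \<omega>))"
    and cap: "interior_capacity \<kappa> A < \<infinity>" and d: "0 < \<delta>" and b: "0 \<le> b"
  obtains Q where "compact Q" "\<And>\<nu>. \<nu> \<in> Ep \<Longrightarrow> \<nu> \<in> positive_measures_on A \<Longrightarrow> vanishes_on Q \<nu> \<Longrightarrow>
    form \<nu> \<nu> \<le> b \<Longrightarrow> positive_integral \<nu> (\<lambda>x. ereal (g x)) \<le> ereal \<delta>"
proof -
  \<comment> \<open>Gives \<open>\<delta>' * sqrt b \<le> \<delta> / 2\<close>; the
    \<open>+ 1\<close> avoids division by 0 for \<open>b = 0\<close>.\<close>
  define \<delta>' where "\<delta>' = \<delta> / (2 * (sqrt b + 1))"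
  have sb: "0 < sqrt b + 1" using b by (simp add: add_nonneg_pos)
  have d': "0 < \<delta>'" using d sb by (simp add: \<delta>'_def)
  have d'b: "\<delta>' * sqrt b \<le> \<delta> / 2"
  proof -
    have "\<delta>' * sqrt b \<le> \<delta>' * (sqrt b + 1)" using d' by (intro mult_left_mono) auto
    also have "\<dots> = \<delta> / 2" unfolding \<delta>'_def using sb
      by (metis less_irrefl nonzero_mult_divide_mult_cancel_right times_divide_eq_left)
    finally show ?thesis .
  qed
  obtain T where T: "0 < T" "\<And>\<nu>. \<nu> \<in> Ep \<Longrightarrow> \<nu> \<in> positive_measures_on A \<Longrightarrow>
    positive_integral \<nu> (\<lambda>x. ereal (g x)) \<le> ereal T * positive_integral \<nu> (\<lambda>_. 1) + ereal (\<delta>' * sqrt (form \<nu> \<nu>))"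
    by (rule weight_bound[OF nn A g cond d']) blast
  \<comment> \<open>Gives \<open>\<epsilon> * b \<le> (\<delta> / (2 * T))\<^sup>2\<close>, hence a
    remaining mass of at most \<open>\<delta> / (2 * T)\<close>.\<close>
  define \<epsilon> where "\<epsilon> = (\<delta> / (2 * T))\<^sup>2 / (b + 1)"
  have e: "0 < \<epsilon>" using d T(1) b by (simp add: \<epsilon>_def)
  have eb: "\<epsilon> * b \<le> (\<delta> / (2 * T))\<^sup>2"
  proof -
    have "\<epsilon> * b \<le> \<epsilon> * (b + 1)" using e by simp
    also have "\<dots> = (\<delta> / (2 * T))\<^sup>2" using b by (simp add: \<epsilon>_def)
    finally show ?thesis .
  qed
  obtain Q where Q: "compact Q" "\<And>\<nu> \<psi>. \<nu> \<in> Ep \<Longrightarrow> \<nu> \<in> positive_measures_on A \<Longrightarrow> vanishes_on Q \<nu> \<Longrightarrow>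
    \<psi> \<in> cc_functions \<Longrightarrow> (\<And>x. 0 \<le> \<psi> x) \<Longrightarrow> (\<And>x. \<psi> x \<le> 1) \<Longrightarrow> (\<nu> \<psi>)\<^sup>2 \<le> \<epsilon> * form \<nu> \<nu>"
    by (rule mass_tail[OF nn A cap e]) blast
  show ?thesis
  proof (rule that[OF Q(1)])
    fix \<nu> assume nu: "\<nu> \<in> Ep" "\<nu> \<in> positive_measures_on A" "vanishes_on Q \<nu>" and fb: "form \<nu> \<nu> \<le> b"
    note pm = Ep_pm[OF nu(1)]
    have "positive_integral \<nu> (\<lambda>_. 1) \<le> ereal (\<delta> / (2 * T))"
    proof (rule positive_integral_le)
      fix \<phi> :: "'a \<Rightarrow> real" assume phi: "\<phi> \<in> cc_functions" "\<And>x. ereal (\<phi> x) \<le> 1"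
      let ?\<psi> = "\<lambda>x. max (\<phi> x) 0"
      have psi: "?\<psi> \<in> cc_functions" by (rule cc_max[OF phi(1) cc_zero])
      have "(\<nu> ?\<psi>)\<^sup>2 \<le> \<epsilon> * form \<nu> \<nu>"
        using phi(2) by (intro Q(2)[OF nu psi]) (auto simp: one_ereal_def)
      also have "\<dots> \<le> \<epsilon> * b" using e fb by simp
      also have "\<dots> \<le> (\<delta> / (2 * T))\<^sup>2" by (rule eb)
      finally have "\<nu> ?\<psi> \<le> \<delta> / (2 * T)" by (rule power2_le_imp_le) (use d T(1) in simp)
      moreover have "\<nu> \<phi> \<le> \<nu> ?\<psi>" by (rule pm_mono[OF pm phi(1) psi]) simp
      ultimately show "ereal (\<nu> \<phi>) \<le> ereal (\<delta> / (2 * T))" by simp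
    qed
    then have "ereal T * positive_integral \<nu> (\<lambda>_. 1) \<le> ereal T * ereal (\<delta> / (2 * T))"
      using T(1) by (intro ereal_mult_left_mono) auto
    also have "\<dots> = ereal (\<delta> / 2)" using T(1) by simp
    finally have 1: "ereal T * positive_integral \<nu> (\<lambda>_. 1) \<le> ereal (\<delta> / 2)" .
    have "\<delta>' * sqrt (form \<nu> \<nu>) \<le> \<delta>' * sqrt b" using fb d' by (intro mult_left_mono) auto
    then have 2: "ereal (\<delta>' * sqrt (form \<nu> \<nu>)) \<le> ereal (\<delta> / 2)" using d'b by simp
    have "positive_integral \<nu> (\<lambda>x. ereal (g x)) \<le> ereal (\<delta> / 2) + ereal (\<delta> / 2)"
      by (rule order_trans[OF T(2)[OF nu(1,2)] add_mono[OF 1 2]])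
    then show "positive_integral \<nu> (\<lambda>x. ereal (g x)) \<le> ereal \<delta>" by simp
  qed
qed

end

section \<open>Condensers\<close>

text \<open>For \<open>J = Ip\<close> and \<open>J = In\<close> these are the two Jordan parts of
  the resultant.\<close>

definition plate_sum :: "nat set \<Rightarrow> 'a::topological_space vector_measure \<Rightarrow> 'a functional" where
  "plate_sum J \<mu> = (\<lambda>\<phi>\<in>cc_functions. \<Sum>\<^sub>\<infinity>i\<in>J. \<mu> i \<phi>)"

lemma lsc_ereal:
  assumes "continuous_on UNIV (f :: 'b::topological_space \<Rightarrow> real)"
  shows "open {x. t < ereal (f x)}"
proof (cases t)
  case (real r)
  then show ?thesis using assms by (simp add: open_Collect_less)
qed auto

lemma le_const_mass:
  fixes \<nu> :: "'b::t2_space functional"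
  assumes lc: "locally_compact_space (euclidean :: 'b topology)"
    and nu: "\<nu> \<in> positive_measures_on B" "closed B" and f: "f \<in> cc_functions" "\<And>x. x \<in> B \<Longrightarrow> f x \<le> c"
    and c: "0 < c" and m: "positive_integral \<nu> (\<lambda>_. 1) \<le> ereal m"
  shows "\<nu> f \<le> c * m"
proof -
  have "ereal (\<nu> (\<lambda>x. inverse c * f x)) \<le> positive_integral \<nu> (\<lambda>_. 1)"
    using f c by (intro le_positive_integral_on[OF lc nu cc_scale[OF f(1)] _ cc_zero]) (auto simp: one_ereal_def field_simps)
  from order_trans[OF this m] have "inverse c * \<nu> f \<le> m"
    using rm_scale[OF pm_rm[OF pm_on_pm[OF nu(1)]] f(1)] by simp
  then show ?thesis using c by (simp add: field_simps)
qed

context energy_space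
begin

text \<open>The kernel is bounded on \<open>B \<times> C\<close> only, so both the inner and the
  outer integral are compared with a constant on the support of the measure alone.\<close>

lemma mutual_bounded:
  assumes s: "\<sigma> \<in> positive_measures_on B" "closed B" and t: "\<tau> \<in> positive_measures_on C" "closed C"
    and M: "\<And>x y. x \<in> B \<Longrightarrow> y \<in> C \<Longrightarrow> \<kappa> (x, y) \<le> ereal M" "0 < M"
    and m: "positive_integral \<sigma> (\<lambda>_. 1) \<le> ereal m" "positive_integral \<tau> (\<lambda>_. 1) \<le> ereal m" "0 < m"
  shows "mutual \<sigma> \<tau> \<le> ereal (M * m * m)"
  unfolding mutual_def
proof (rule positive_integral_le)
  fix \<phi> :: "'a \<times> 'a \<Rightarrow> real" assume phi: "\<phi> \<in> cc_functions" "\<And>z. ereal (\<phi> z) \<le> \<kappa> z"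
  have "\<tau> (\<lambda>y. \<phi> (x, y)) \<le> M * m" if x: "x \<in> B" for x
  proof (rule le_const_mass[OF lc t tensor_slice_cc[OF phi(1)] _ M(2) m(2)])
    fix y assume "y \<in> C"
    then show "\<phi> (x, y) \<le> M" using order_trans[OF phi(2) M(1)[OF x]] by simp
  qed
  then have "\<sigma> (\<lambda>x. \<tau> (\<lambda>y. \<phi> (x, y))) \<le> (M * m) * m"
    using M(2) m(3) by (intro le_const_mass[OF lc s tensor_inner_cc[OF lc phi(1) pm_on_pm[OF t(1)]] _ _ m(1)]) auto
  then show "ereal (tensor_measure \<sigma> \<tau> \<phi>) \<le> ereal (M * m * m)" using phi(1) by (simp add: tensor_apply)
qed

text \<open>A compact product would have a compact projection. The case distinction on compactness
  of the space thus decides when \<open>form_mono\<close> is available.\<close>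

lemma kernel_nonneg: "\<not> compact (UNIV :: 'a set) \<Longrightarrow> 0 \<le> \<kappa> z"
proof -
  assume nc: "\<not> compact (UNIV :: 'a set)"
  have "\<not> compact (UNIV :: ('a \<times> 'a) set)"
  proof
    assume "compact (UNIV :: ('a \<times> 'a) set)"
    then have "compact (fst ` (UNIV :: ('a \<times> 'a) set))"
      by (intro compact_continuous_image continuous_on_fst continuous_on_id)
    then show False using nc by simp
  qed
  then show ?thesis using kernel_lsc by (cases z) (simp add: lsc_class_def)
qed

end

text \<open>Positive capacity stays outside the assumptions and appears as
  \<open>adm \<noteq> {}\<close>. So the locale can be interpreted for a compact sub-condenser
  before anything is known about its capacity.\<close>

locale condenser_problem = consistent_space \<kappa> for \<kappa> :: "('a::t2_space) kernel" +
  fixes Ip In :: "nat set" and A :: "nat \<Rightarrow> 'a set" and a :: "nat \<Rightarrow> real" and g :: "nat \<Rightarrow> 'a \<Rightarrow> real"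
  assumes cond: "condenser Ip In A"
    and weight: "\<And>i. i \<in> Ip \<union> In \<Longrightarrow> continuous_on UNIV (g i) \<and> (\<forall>x. 0 < g i x)"
    and mass: "\<And>i. i \<in> Ip \<union> In \<Longrightarrow> 0 < a i"
    and bound: "In = {} \<or>
         ((\<Sum>\<^sub>\<infinity>i\<in>Ip \<union> In. ereal (a i) * (1 / (INF x\<in>A i. ereal (g i x)))) < \<infinity> \<and>
          (SUP p\<in>(\<Union>i\<in>Ip. A i) \<times> (\<Union>j\<in>In. A j). \<kappa> p) < \<infinity>)"
    and growth: "\<And>i. i \<in> Ip \<union> In \<Longrightarrow>
           (SUP x\<in>A i. ereal (g i x)) < \<infinity> \<or>
           (\<exists>r>1. \<exists>\<omega>\<in>finite_energy \<kappa>. nearly_everywhere \<kappa> (A i)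
              (\<lambda>x. potential_defined \<kappa> x \<omega> \<and> ereal (g i x powr r) \<le> potential \<kappa> x \<omega>))"
    and size: "\<And>i. i \<in> Ip \<union> In \<Longrightarrow> compact (A i) \<or> interior_capacity \<kappa> (A i) < \<infinity>"
begin

abbreviation I :: "nat set" where "I \<equiv> Ip \<union> In"

abbreviation cm :: "'a vector_measure set" where "cm \<equiv> condenser_measures Ip In A"

abbreviation adm :: "'a vector_measure set" where "adm \<equiv> admissible_measures \<kappa> Ip In A a g"

section \<open>Plate sums and the resultant\<close>

definition meets :: "('a \<Rightarrow> real) \<Rightarrow> nat set" where
  "meets \<phi> = {i \<in> I. A i \<inter> closure {x. \<phi> x \<noteq> 0} \<noteq> {}}"

lemma finite_meets: "\<phi> \<in> cc_functions \<Longrightarrow> finite (meets \<phi>)"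
  using cond cc_compact[of \<phi>] unfolding condenser_def meets_def by blast

lemma closed_plate: "i \<in> I \<Longrightarrow> closed (A i)"
  using cond by (simp add: condenser_def)

lemma disjoint_index: "Ip \<inter> In = {}"
  using cond by (simp add: condenser_def)

lemma plate_nonempty: "i \<in> I \<Longrightarrow> A i \<noteq> {}"
  using cond by (simp add: condenser_def)

lemma plates_disjoint: "i \<in> Ip \<Longrightarrow> j \<in> In \<Longrightarrow> A i \<inter> A j = {}"
  using cond by (simp add: condenser_def)

lemma cm_on: "\<mu> \<in> cm \<Longrightarrow> i \<in> I \<Longrightarrow> \<mu> i \<in> positive_measures_on (A i)"
  by (auto simp: condenser_measures_def)

lemma cm_pm: "\<mu> \<in> cm \<Longrightarrow> i \<in> I \<Longrightarrow> \<mu> i \<in> positive_measures"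
  by (rule pm_on_pm[OF cm_on])

lemma cm_null: "\<mu> \<in> cm \<Longrightarrow> i \<in> I \<Longrightarrow> \<phi> \<in> cc_functions \<Longrightarrow> i \<notin> meets \<phi> \<Longrightarrow> \<mu> i \<phi> = 0"
  by (rule pm_on_null[OF lc cm_on]) (auto simp: meets_def)

text \<open>Local finiteness of the plates turns the infinite sum into a finite one. The set
  \<open>N\<close> is a parameter so that several test functions can be evaluated over the same
  indices.\<close>

lemma plate_sum_apply:
  assumes mu: "\<mu> \<in> cm" and J: "J \<subseteq> I" and phi: "\<phi> \<in> cc_functions" and N: "finite N" "meets \<phi> \<subseteq> N"
  shows "plate_sum J \<mu> \<phi> = (\<Sum>i\<in>J \<inter> N. \<mu> i \<phi>)"
proof -
  have "(\<Sum>\<^sub>\<infinity>i\<in>J. \<mu> i \<phi>) = (\<Sum>\<^sub>\<infinity>i\<in>J \<inter> N. \<mu> i \<phi>)"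
  proof (rule infsum_cong_neutral)
    fix i assume "i \<in> J - J \<inter> N"
    then show "\<mu> i \<phi> = 0" using J N(2) by (intro cm_null[OF mu _ phi]) auto
  qed auto
  then show ?thesis using phi N(1) by (simp add: plate_sum_def)
qed

lemma plate_sum_ext: "plate_sum J \<mu> \<in> extensional cc_functions"
  by (simp add: plate_sum_def)

lemma plate_sum_pm:
  assumes mu: "\<mu> \<in> cm" and J: "J \<subseteq> I"
  shows "plate_sum J \<mu> \<in> positive_measures"
proof (rule positive_measuresI[OF lc plate_sum_ext])
  fix \<phi> \<psi> :: "'a \<Rightarrow> real" and s t assume phi: "\<phi> \<in> cc_functions" and psi: "\<psi> \<in> cc_functions"
  let ?c = "\<lambda>x. s * \<phi> x + t * \<psi> x"
  have c: "?c \<in> cc_functions" by (rule cc_lin[OF phi psi])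
  define N where "N = meets \<phi> \<union> meets \<psi> \<union> meets ?c"
  have N: "finite N" "meets \<phi> \<subseteq> N" "meets \<psi> \<subseteq> N" "meets ?c \<subseteq> N"
    using finite_meets phi psi c by (auto simp: N_def)
  have "\<mu> i ?c = s * \<mu> i \<phi> + t * \<mu> i \<psi>" if "i \<in> J \<inter> N" for i
    using that J by (intro rm_lin[OF pm_rm[OF cm_pm[OF mu]] phi psi]) auto
  then show "plate_sum J \<mu> ?c = s * plate_sum J \<mu> \<phi> + t * plate_sum J \<mu> \<psi>"
    using plate_sum_apply[OF mu J phi N(1,2)] plate_sum_apply[OF mu J psi N(1,3)] plate_sum_apply[OF mu J c N(1,4)]
    by (simp add: sum.distrib sum_distrib_left)
next
  fix \<phi> :: "'a \<Rightarrow> real" assume phi: "\<phi> \<in> cc_functions" "\<And>x. 0 \<le> \<phi> x"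
  have "0 \<le> (\<Sum>i\<in>J \<inter> meets \<phi>. \<mu> i \<phi>)"
    using J by (intro sum_nonneg pm_nonneg[OF cm_pm[OF mu] phi]) auto
  then show "0 \<le> plate_sum J \<mu> \<phi>" using plate_sum_apply[OF mu J phi(1) finite_meets[OF phi(1)] subset_refl] by simp
qed

lemma plate_sum_ge:
  assumes mu: "\<mu> \<in> cm" and J: "J \<subseteq> I" and i: "i \<in> J"
  shows "measure_le (\<mu> i) (plate_sum J \<mu>)"
  unfolding measure_le_def
proof (intro ballI impI)
  fix \<phi> :: "'a \<Rightarrow> real" assume phi: "\<phi> \<in> cc_functions" "\<forall>x. 0 \<le> \<phi> x"
  have "\<mu> i \<phi> \<le> (\<Sum>j\<in>J \<inter> insert i (meets \<phi>). \<mu> j \<phi>)"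
    using J i finite_meets[OF phi(1)] phi(2) by (intro member_le_sum pm_nonneg[OF cm_pm[OF mu] phi(1)]) auto
  then show "\<mu> i \<phi> \<le> plate_sum J \<mu> \<phi>"
    using plate_sum_apply[OF mu J phi(1) _ subset_insertI, of i] finite_meets[OF phi(1)] by simp
qed

text \<open>A union of infinitely many closed plates is closed by local finiteness: a point has a
  neighbourhood inside a compact set, which meets only finitely many of them.\<close>

lemma closed_plates:
  assumes J: "J \<subseteq> I"
  shows "closed (\<Union>i\<in>J. A i)"
proof -
  have "\<exists>T. open T \<and> x \<in> T \<and> T \<subseteq> - (\<Union>i\<in>J. A i)" if x: "x \<in> - (\<Union>i\<in>J. A i)" for x
  proof -
    obtain V C where V: "open V" "compact C" "{x} \<subseteq> V" "V \<subseteq> C"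
      using cc_bump_aux[OF lc compact_sing open_UNIV subset_UNIV] by meson
    let ?N = "{i \<in> I. A i \<inter> C \<noteq> {}}"
    have "finite ?N" using cond V(2) unfolding condenser_def by blast
    then have "closed (\<Union>i\<in>J \<inter> ?N. A i)" using J by (intro closed_UN ballI closed_plate) auto
    then have "open (V - (\<Union>i\<in>J \<inter> ?N. A i))" using V(1) by (rule open_Diff[rotated])
    moreover have "x \<in> V - (\<Union>i\<in>J \<inter> ?N. A i)" using x V(3) by auto
    moreover have "V - (\<Union>i\<in>J \<inter> ?N. A i) \<subseteq> - (\<Union>i\<in>J. A i)" using J V(4) by auto
    ultimately show ?thesis by blast
  qed
  then have "open (- (\<Union>i\<in>J. A i))" by (rule Topological_Spaces.openI)
  then show ?thesis by (simp add: closed_def)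
qed

lemma plate_sum_on:
  assumes mu: "\<mu> \<in> cm" and J: "J \<subseteq> I"
  shows "plate_sum J \<mu> \<in> positive_measures_on (\<Union>i\<in>J. A i)"
  unfolding positive_measures_on_iff[OF lc closed_plates[OF J]]
proof (intro conjI ballI impI plate_sum_pm[OF mu J])
  fix \<phi> :: "'a \<Rightarrow> real" assume phi: "\<phi> \<in> cc_functions" "closure {x. \<phi> x \<noteq> 0} \<inter> (\<Union>i\<in>J. A i) = {}"
  then have "J \<inter> meets \<phi> = {}" by (auto simp: meets_def)
  then show "plate_sum J \<mu> \<phi> = 0" using plate_sum_apply[OF mu J phi(1) finite_meets[OF phi(1)] subset_refl] by simp
qed

lemma resultant_eq:
  assumes mu: "\<mu> \<in> cm"
  shows "resultant Ip In \<mu> = radon_diff (plate_sum Ip \<mu>) (plate_sum In \<mu>)"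
proof (rule functional_eqI)
  show "resultant Ip In \<mu> \<in> extensional cc_functions" by (simp add: resultant_def)
  fix \<phi> :: "'a \<Rightarrow> real" assume phi: "\<phi> \<in> cc_functions"
  let ?N = "meets \<phi>" and ?f = "\<lambda>i. (if i \<in> Ip then 1 else - 1) * \<mu> i \<phi>"
  note fin = finite_meets[OF phi]
  have "(\<Sum>\<^sub>\<infinity>i\<in>I. ?f i) = (\<Sum>\<^sub>\<infinity>i\<in>I \<inter> ?N. ?f i)"
    by (rule infsum_cong_neutral) (auto simp: cm_null[OF mu _ phi])
  also have "\<dots> = (\<Sum>i\<in>(Ip \<inter> ?N) \<union> (In \<inter> ?N). ?f i)" using fin by (simp add: Int_Un_distrib2)
  also have "\<dots> = (\<Sum>i\<in>Ip \<inter> ?N. ?f i) + (\<Sum>i\<in>In \<inter> ?N. ?f i)"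
    using fin disjoint_index by (intro sum.union_disjoint) auto
  also have "(\<Sum>i\<in>In \<inter> ?N. ?f i) = (\<Sum>i\<in>In \<inter> ?N. - \<mu> i \<phi>)"
    using disjoint_index by (intro sum.cong) auto
  finally show "resultant Ip In \<mu> \<phi> = radon_diff (plate_sum Ip \<mu>) (plate_sum In \<mu>) \<phi>"
    using phi plate_sum_apply[OF mu _ phi fin subset_refl, of Ip] plate_sum_apply[OF mu _ phi fin subset_refl, of In]
    by (simp add: resultant_def sum_negf)
qed simp_all

lemma plate_sum_singular:
  assumes mu: "\<mu> \<in> cm"
  shows "singular_measures (plate_sum Ip \<mu>) (plate_sum In \<mu>)"
proof (rule singular_disjoint_supports[OF lc plate_sum_on[OF mu] closed_plates plate_sum_on[OF mu] closed_plates])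
  show "(\<Union>i\<in>Ip. A i) \<inter> (\<Union>i\<in>In. A i) = {}" using plates_disjoint by blast
qed auto

text \<open>From left to right this rests on the singularity of the two plate sums; the other
  direction is \<open>energy_diff\<close>.\<close>

lemma finite_energy_iff:
  "\<mu> \<in> condenser_finite_energy \<kappa> Ip In A \<longleftrightarrow> \<mu> \<in> cm \<and> plate_sum Ip \<mu> \<in> Ep \<and> plate_sum In \<mu> \<in> Ep"
proof (cases "\<mu> \<in> cm")
  case True
  have pm: "plate_sum Ip \<mu> \<in> positive_measures" "plate_sum In \<mu> \<in> positive_measures" using plate_sum_pm[OF True] by auto
  show ?thesis
    using True finite_energy_singular[OF pm plate_sum_singular[OF True]] energy_diff(1)
    by (auto simp: condenser_finite_energy_def resultant_eq)
qed (simp add: condenser_finite_energy_def)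

lemma adm_iff:
  "\<mu> \<in> adm \<longleftrightarrow> \<mu> \<in> cm \<and> plate_sum Ip \<mu> \<in> Ep \<and> plate_sum In \<mu> \<in> Ep \<and>
    (\<forall>i\<in>I. positive_integral (\<mu> i) (\<lambda>x. ereal (g i x)) = ereal (a i))"
  by (auto simp: admissible_measures_def finite_energy_iff)

lemma adm_cm: "\<mu> \<in> adm \<Longrightarrow> \<mu> \<in> cm" by (simp add: adm_iff)

lemma adm_Ep: "\<mu> \<in> adm \<Longrightarrow> plate_sum Ip \<mu> \<in> Ep" "\<mu> \<in> adm \<Longrightarrow> plate_sum In \<mu> \<in> Ep" by (simp_all add: adm_iff)

abbreviation nrm :: "'a vector_measure \<Rightarrow> real" where
  "nrm \<mu> \<equiv> (condenser_norm \<kappa> Ip In \<mu>)\<^sup>2"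

lemma nrm_eq: "\<mu> \<in> adm \<Longrightarrow> nrm \<mu> = qdist (plate_sum Ip \<mu>) (plate_sum In \<mu>)"
  using energy_diff(4)[OF adm_Ep] by (simp add: condenser_norm_def resultant_eq[OF adm_cm])

section \<open>Convexity of the admissible measures and minimal energy\<close>

definition vmid :: "'a vector_measure \<Rightarrow> 'a vector_measure \<Rightarrow> 'a vector_measure" where
  "vmid \<mu> \<nu> = (\<lambda>i\<in>I. mid (\<mu> i) (\<nu> i))"

lemma vmid_cm: "\<mu> \<in> cm \<Longrightarrow> \<nu> \<in> cm \<Longrightarrow> vmid \<mu> \<nu> \<in> cm"
  unfolding vmid_def condenser_measures_def
  by (rule restrict_PiE_iff[THEN iffD2]) (auto intro!: radon_comb_on[OF lc closed_plate])

lemma plate_sum_vmid: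
  assumes mu: "\<mu> \<in> cm" and nu: "\<nu> \<in> cm" and J: "J \<subseteq> I"
  shows "plate_sum J (vmid \<mu> \<nu>) = mid (plate_sum J \<mu>) (plate_sum J \<nu>)"
proof (rule functional_eqI[OF plate_sum_ext radon_comb_ext])
  fix \<phi> :: "'a \<Rightarrow> real" assume phi: "\<phi> \<in> cc_functions"
  note * = plate_sum_apply[OF _ J phi finite_meets[OF phi] subset_refl]
  have "(\<Sum>i\<in>J \<inter> meets \<phi>. vmid \<mu> \<nu> i \<phi>) = (\<Sum>i\<in>J \<inter> meets \<phi>. 1/2 * \<mu> i \<phi> + 1/2 * \<nu> i \<phi>)"
    using J phi by (intro sum.cong) (auto simp: vmid_def)
  then show "plate_sum J (vmid \<mu> \<nu>) \<phi> = mid (plate_sum J \<mu>) (plate_sum J \<nu>) \<phi>"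
    using *[OF mu] *[OF nu] *[OF vmid_cm[OF mu nu]] phi by (simp only: radon_comb_apply sum.distrib sum_distrib_left)
qed

lemma vmid_adm:
  assumes mu: "\<mu> \<in> adm" and nu: "\<nu> \<in> adm"
  shows "vmid \<mu> \<nu> \<in> adm"
proof -
  note cm = adm_cm[OF mu] adm_cm[OF nu]
  have "positive_integral (vmid \<mu> \<nu> i) (\<lambda>x. ereal (g i x)) = ereal (a i)" if i: "i \<in> I" for i
  proof -
    have "positive_integral (vmid \<mu> \<nu> i) (\<lambda>x. ereal (g i x)) =
      ereal (1/2) * positive_integral (\<mu> i) (\<lambda>x. ereal (g i x)) + ereal (1/2) * positive_integral (\<nu> i) (\<lambda>x. ereal (g i x))"
      using i weight[OF i]
      by (simp only: vmid_def restrict_apply' if_True, intro positive_integral_comb[OF cm_pm[OF cm(1) i] cm_pm[OF cm(2) i] _ _ cc_zero])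
        (auto intro: less_imp_le)
    also have "\<dots> = ereal (a i)" using mu nu i by (simp add: adm_iff)
    finally show ?thesis .
  qed
  then show ?thesis
    using vmid_cm[OF cm] adm_Ep[OF mu] adm_Ep[OF nu] plate_sum_vmid[OF cm, of Ip] plate_sum_vmid[OF cm, of In]
    by (simp add: adm_iff Ep_mid)
qed

lemma condenser_dist_eq:
  assumes mu: "\<mu> \<in> adm" and nu: "\<nu> \<in> adm"
  shows "(condenser_dist \<kappa> Ip In \<mu> \<nu>)\<^sup>2 = 2 * nrm \<mu> + 2 * nrm \<nu> - 4 * nrm (vmid \<mu> \<nu>)"
proof -
  let ?p = "plate_sum Ip \<mu>" and ?n = "plate_sum In \<mu>" and ?q = "plate_sum Ip \<nu>" and ?m = "plate_sum In \<nu>"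
  note E = adm_Ep[OF mu] adm_Ep[OF nu]
  \<comment> \<open>The negative parts change sides, so that the difference of two resultants
    becomes a difference of two elements of the cone.\<close>
  have eq: "radon_diff (radon_diff ?p ?n) (radon_diff ?q ?m) = radon_diff (radon_comb 1 ?p 1 ?m) (radon_comb 1 ?q 1 ?n)"
    by (rule functional_eqI) simp_all
  have c: "radon_comb 1 ?p 1 ?m \<in> Ep" "radon_comb 1 ?q 1 ?n \<in> Ep" using E by (simp_all add: Ep_comb)
  have d: "(condenser_dist \<kappa> Ip In \<mu> \<nu>)\<^sup>2 = qdist (radon_comb 1 ?p 1 ?m) (radon_comb 1 ?q 1 ?n)"
    using energy_diff(4)[OF c] by (simp add: condenser_dist_def resultant_eq[OF adm_cm[OF mu]] resultant_eq[OF adm_cm[OF nu]] eq)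
  have v: "nrm (vmid \<mu> \<nu>) = qdist (mid ?p ?q) (mid ?n ?m)"
    using nrm_eq[OF vmid_adm[OF mu nu]] plate_sum_vmid[OF adm_cm[OF mu] adm_cm[OF nu]] by simp
  have m: "mid ?p ?q \<in> Ep" "mid ?n ?m \<in> Ep" using E by (simp_all add: Ep_mid)
  show ?thesis
    unfolding d v nrm_eq[OF mu] nrm_eq[OF nu] using E m c
    by (simp add: qdist_def form_comb_square form_comb_left form_comb_right
        form_sym[of ?n ?p] form_sym[of ?q ?p] form_sym[of ?m ?p] form_sym[of ?q ?n] form_sym[of ?m ?n] form_sym[of ?m ?q] field_simps power2_eq_square)
qed

text \<open>If \<open>adm\<close> is empty, the minimal energy is \<open>\<infinity>\<close> and
  \<open>w\<close> takes the default value 0.\<close>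

definition w :: real where "w = real_of_ereal (minimal_energy \<kappa> Ip In A a g)"

text \<open>The minimal energy \<open>e\<close> is nonnegative and infinite exactly for empty
  \<open>adm\<close>, and \<open>0 < 1 / e\<close> means \<open>e < \<infinity>\<close>.\<close>

lemma capacity_pos_iff: "0 < condenser_capacity \<kappa> Ip In A a g \<longleftrightarrow> adm \<noteq> {}"
proof -
  let ?e = "minimal_energy \<kappa> Ip In A a g"
  have e0: "0 \<le> ?e" unfolding minimal_energy_def by (rule INF_greatest) simp
  have "adm \<noteq> {} \<longleftrightarrow> ?e < \<infinity>" unfolding minimal_energy_def INF_less_iff by auto
  also have "\<dots> \<longleftrightarrow> 0 < 1 / ?e" using e0 by (cases ?e) (auto simp: divide_ereal_def)
  finally show ?thesis by (simp add: condenser_capacity_def)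
qed

lemma w_eq: "adm \<noteq> {} \<Longrightarrow> minimal_energy \<kappa> Ip In A a g = ereal w"
proof -
  assume ne: "adm \<noteq> {}"
  have "0 \<le> minimal_energy \<kappa> Ip In A a g" unfolding minimal_energy_def by (rule INF_greatest) simp
  moreover have "minimal_energy \<kappa> Ip In A a g < \<infinity>" unfolding minimal_energy_def INF_less_iff using ne by auto
  ultimately show ?thesis by (cases "minimal_energy \<kappa> Ip In A a g") (auto simp: w_def)
qed

lemma w_le: "\<mu> \<in> adm \<Longrightarrow> w \<le> nrm \<mu>"
proof -
  assume mu: "\<mu> \<in> adm"
  then have "minimal_energy \<kappa> Ip In A a g \<le> ereal (nrm \<mu>)" unfolding minimal_energy_def by (rule INF_lower)
  moreover have "adm \<noteq> {}" using mu by blast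
  ultimately show ?thesis using w_eq by simp
qed

lemma near_w:
  assumes "adm \<noteq> {}" "0 < \<epsilon>"
  obtains \<mu> where "\<mu> \<in> adm" "nrm \<mu> < w + \<epsilon>"
proof -
  have "minimal_energy \<kappa> Ip In A a g < ereal (w + \<epsilon>)" using w_eq[OF assms(1)] assms(2) by simp
  then show ?thesis using that unfolding minimal_energy_def INF_less_iff by auto
qed

lemma minimizers_iff: "\<mu> \<in> minimizers \<kappa> Ip In A a g \<longleftrightarrow> \<mu> \<in> adm \<and> nrm \<mu> = w"
proof (cases "\<mu> \<in> adm")
  case True
  then have "adm \<noteq> {}" by blast
  from w_eq[OF this] show ?thesis using True by (simp add: minimizers_def)
qed (simp add: minimizers_def)

text \<open>The midpoint of \<open>\<mu>\<close> and a minimizer is admissible, so its energy is at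
  least \<open>w\<close>; inserting this into the parallelogram identity leaves
  \<open>2 * (nrm \<mu> - w)\<close>.\<close>

lemma dist_le:
  assumes mu: "\<mu> \<in> adm" and nu: "\<nu> \<in> minimizers \<kappa> Ip In A a g"
  shows "(condenser_dist \<kappa> Ip In \<mu> \<nu>)\<^sup>2 \<le> 2 * (nrm \<mu> - w)"
  using condenser_dist_eq[OF mu, of \<nu>] w_le[OF vmid_adm[OF mu, of \<nu>]] nu by (simp add: minimizers_iff)

text \<open>The equalities in the definition of \<open>adm\<close> are relaxed to the inequality
  that is vaguely closed; \<open>cluster_minimizer\<close> later recovers equality.\<close>

lemma compact_admissible:
  "compactin (condenser_vague_topology Ip In A)
    {\<mu> \<in> cm. \<forall>i\<in>I. positive_integral (\<mu> i) (\<lambda>x. ereal (g i x)) \<le> ereal (a i)}"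
proof -
  let ?T = "\<lambda>i. {\<nu> \<in> positive_measures_on (A i). positive_integral \<nu> (\<lambda>x. ereal (g i x)) \<le> ereal (a i)}"
  have "compactin (subtopology vague_topology (positive_measures_on (A i))) (?T i)" if i: "i \<in> I" for i
    unfolding compactin_subtopology using vague_compact[OF lc closed_plate[OF i]] weight[OF i] by auto
  then have "compactin (condenser_vague_topology Ip In A) (PiE I ?T)"
    unfolding condenser_vague_topology_def by (simp add: compactin_PiE)
  moreover have "PiE I ?T = {\<mu> \<in> cm. \<forall>i\<in>I. positive_integral (\<mu> i) (\<lambda>x. ereal (g i x)) \<le> ereal (a i)}"
    unfolding condenser_measures_def by (simp only: set_eq_iff mem_Collect_eq PiE_iff) blast
  ultimately show ?thesis by simp
qed

lemma ex_cluster_point: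
  assumes "F \<noteq> bot" "eventually (\<lambda>x. f x \<in> adm) F"
  obtains \<mu> where "cluster_point (condenser_vague_topology Ip In A) f F \<mu>"
proof -
  have "eventually (\<lambda>x. f x \<in> {\<mu> \<in> cm. \<forall>i\<in>I. positive_integral (\<mu> i) (\<lambda>x. ereal (g i x)) \<le> ereal (a i)}) F"
    using assms(2) by eventually_elim (simp add: adm_iff)
  from compactin_cluster_point[OF compact_admissible assms(1) this] that show ?thesis by blast
qed

lemma topspace_cvt: "\<mu> \<in> topspace (condenser_vague_topology Ip In A) \<Longrightarrow> \<mu> \<in> cm"
  unfolding condenser_vague_topology_def condenser_measures_def topspace_product_topology
  by (rule subsetD[OF PiE_mono]) auto

lemma continuous_map_eval:
  assumes i: "i \<in> I" and phi: "\<phi> \<in> cc_functions"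
  shows "continuous_map (condenser_vague_topology Ip In A) euclideanreal (\<lambda>\<mu>. \<mu> i \<phi>)"
proof -
  have 1: "continuous_map (condenser_vague_topology Ip In A) (subtopology vague_topology (positive_measures_on (A i))) (\<lambda>\<mu>. \<mu> i)"
    unfolding condenser_vague_topology_def
    using continuous_map_product_projection[OF i, of "\<lambda>i. subtopology vague_topology (positive_measures_on (A i))"] .
  have 2: "continuous_map (subtopology vague_topology (positive_measures_on (A i))) euclideanreal (\<lambda>\<nu>. \<nu> \<phi>)"
    by (rule continuous_map_from_subtopology[OF continuous_map_vague_eval[OF phi]])
  show ?thesis using continuous_map_compose[OF 1 2] by (simp add: o_def)
qed

text \<open>On the plate \<open>A i\<close> the weight is at least its infimum, so the mass of
  \<open>\<mu> i\<close> is at most \<open>a i\<close> divided by it; these bounds are the terms of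
  the convergent series in \<open>bound\<close>.\<close>

lemma mass_bound:
  assumes ne: "In \<noteq> {}"
  obtains m where "0 < m" "\<And>\<mu> J. \<mu> \<in> adm \<Longrightarrow> J \<subseteq> I \<Longrightarrow> positive_integral (plate_sum J \<mu>) (\<lambda>_. 1) \<le> ereal m"
proof -
  let ?ginf = "\<lambda>i. INF x\<in>A i. ereal (g i x)"
  let ?f = "\<lambda>i. ereal (a i) * (1 / ?ginf i)"
  let ?s = "\<Sum>\<^sub>\<infinity>i\<in>I. ?f i"
  have fin: "?s < \<infinity>" using bound ne by blast
  have g0: "0 \<le> ?ginf i" if "i \<in> I" for i using weight[OF that] by (intro INF_greatest) (auto intro: less_imp_le)
  have f0: "0 \<le> ?f i" if "i \<in> I" for i using g0[OF that] mass[OF that] by (intro ereal_0_le_mult) (auto simp: zero_le_divide_ereal)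
  have fs: "sum ?f N \<le> ?s" if "finite N" "N \<subseteq> I" for N
  proof -
    have "?s = (SUP N\<in>{N. finite N \<and> N \<subseteq> I}. sum ?f N)" by (rule nonneg_infsum_complete) (rule f0)
    then show ?thesis using that by (simp only:) (intro SUP_upper, simp)
  qed
  have s0: "0 \<le> ?s" using fs[of "{}"] by simp
  obtain m0 where m0: "?s = ereal m0" "0 \<le> m0" using fin s0 by (cases ?s) auto
  show ?thesis
  proof (rule that[of "m0 + 1"])
    show "0 < m0 + 1" using m0(2) by simp
    fix \<mu> J assume mu: "\<mu> \<in> adm" and J: "J \<subseteq> I"
    show "positive_integral (plate_sum J \<mu>) (\<lambda>_. 1) \<le> ereal (m0 + 1)"
    proof (rule positive_integral_le)
      fix \<phi> :: "'a \<Rightarrow> real" assume phi: "\<phi> \<in> cc_functions" "\<And>x. ereal (\<phi> x) \<le> 1"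
      let ?N = "J \<inter> meets \<phi>"
      have N: "finite ?N" "?N \<subseteq> I" using finite_meets[OF phi(1)] J by auto
      have le: "ereal (\<mu> i \<phi>) \<le> ?f i" if "i \<in> ?N" for i
      proof -
        have i: "i \<in> I" using that N by auto
        note on = cm_on[OF adm_cm[OF mu] i]
        have "sum ?f {i} \<le> ?s" by (rule fs) (use i in simp_all)
        then have "?f i \<le> ?s" by (simp only: sum.insert sum.empty finite.emptyI empty_iff not_False_eq_True add_0_right)
        then have fi: "?f i < \<infinity>" using fin by (rule le_less_trans)
        obtain x0 where "x0 \<in> A i" using plate_nonempty[OF i] by blast
        then have "?ginf i \<le> ereal (g i x0)" by (rule INF_lower)
        then obtain r where r: "?ginf i = ereal r" "0 \<le> r" using g0[OF i] by (cases "?ginf i") auto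
        \<comment> \<open>With \<open>1 / 0 = \<infinity>\<close> a vanishing infimum would make
          this term, and hence the series, infinite.\<close>
        have "r \<noteq> 0"
        proof
          assume "r = 0"
          then have "1 / ?ginf i = \<infinity>" using r(1) by (simp add: divide_ereal_def zero_ereal_def[symmetric])
          then have "?f i = \<infinity>" using mass[OF i] by (simp only:) simp
          then show False using fi by (simp only:)
        qed
        then have r0: "0 < r" using r(2) by simp
        have "ereal (r * \<phi> x) \<le> ereal (g i x)" if "x \<in> A i" for x
        proof -
          have "ereal r \<le> ereal (g i x)" unfolding r(1)[symmetric] using that by (rule INF_lower)
          moreover have "r * \<phi> x \<le> r * 1" using r0 phi(2)[of x] by (intro mult_left_mono) (simp_all add: one_ereal_def)
          ultimately show ?thesis by simp
        qed
        then have "ereal (\<mu> i (\<lambda>x. r * \<phi> x)) \<le> positive_integral (\<mu> i) (\<lambda>x. ereal (g i x))"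
          using weight[OF i]
          by (intro le_positive_integral_on[OF lc on closed_plate[OF i] cc_scale[OF phi(1)] _ cc_zero] lsc_ereal)
            (auto intro: less_imp_le)
        then have "r * \<mu> i \<phi> \<le> a i"
          using rm_scale[OF pm_rm[OF pm_on_pm[OF on]] phi(1), of r] mu i by (simp add: adm_iff)
        then have "\<mu> i \<phi> \<le> a i * (1 / r)" using r0 by (simp add: field_simps)
        moreover have "?f i = ereal (a i * (1 / r))" using r(1) r0 by (simp add: one_ereal_def)
        ultimately show ?thesis by simp
      qed
      have "ereal (plate_sum J \<mu> \<phi>) = (\<Sum>i\<in>?N. ereal (\<mu> i \<phi>))"
        using plate_sum_apply[OF adm_cm[OF mu] J phi(1) finite_meets[OF phi(1)] subset_refl] by simp
      also have "\<dots> \<le> sum ?f ?N" by (rule sum_mono[OF le])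
      also have "\<dots> \<le> ?s" by (rule fs[OF N])
      also have "\<dots> \<le> ereal (m0 + 1)" using m0 by simp
      finally show "ereal (plate_sum J \<mu> \<phi>) \<le> ereal (m0 + 1)" .
    qed
  qed
qed

lemma plate_sum_empty: "plate_sum {} \<mu> = zero_measure"
  by (rule functional_eqI) (simp_all add: plate_sum_def)

text \<open>\<open>nrm \<mu>\<close> is the sum of the two energies minus the mixed term. The mixed
  term is bounded by the masses and the supremum of \<open>\<kappa>\<close> between the plates, and
  is 0 if there are no negative plates, so neither energy can be large.\<close>

lemma energy_bound:
  obtains c where "0 \<le> c" "\<And>\<mu>. \<mu> \<in> adm \<Longrightarrow> form (plate_sum Ip \<mu>) (plate_sum Ip \<mu>) \<le> nrm \<mu> + c"
    "\<And>\<mu>. \<mu> \<in> adm \<Longrightarrow> form (plate_sum In \<mu>) (plate_sum In \<mu>) \<le> nrm \<mu> + c"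
proof -
  have "\<exists>c\<ge>0. \<forall>\<mu>\<in>adm. 2 * form (plate_sum Ip \<mu>) (plate_sum In \<mu>) \<le> c"
  proof (cases "In = {}")
    case True
    then show ?thesis using adm_Ep(1) by (intro exI[of _ 0]) (auto simp: plate_sum_empty)
  next
    case False
    obtain m where m: "0 < m" "\<And>\<mu> J. \<mu> \<in> adm \<Longrightarrow> J \<subseteq> I \<Longrightarrow> positive_integral (plate_sum J \<mu>) (\<lambda>_. 1) \<le> ereal m"
      by (rule mass_bound[OF False]) blast
    let ?P = "\<Union>i\<in>Ip. A i" and ?N = "\<Union>j\<in>In. A j"
    have "(SUP p\<in>?P \<times> ?N. \<kappa> p) < \<infinity>" using bound False by blast
    then obtain M0 where M0: "(SUP p\<in>?P \<times> ?N. \<kappa> p) \<le> ereal M0" by (cases "SUP p\<in>?P \<times> ?N. \<kappa> p") auto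
    define M where "M = max M0 1"
    have M: "0 < M" "ereal M0 \<le> ereal M" by (auto simp: M_def)
    have kM: "\<kappa> (x, y) \<le> ereal M" if "x \<in> ?P" "y \<in> ?N" for x y
    proof -
      have "\<kappa> (x, y) \<le> (SUP p\<in>?P \<times> ?N. \<kappa> p)" using that by (intro SUP_upper) auto
      then show ?thesis using M0 M(2) by (meson order_trans)
    qed
    have kM': "\<kappa> (y, x) \<le> ereal M" if "y \<in> ?N" "x \<in> ?P" for x y
      using kM[OF that(2,1)] pd unfolding positive_definite_kernel_def by metis
    have "2 * form (plate_sum Ip \<mu>) (plate_sum In \<mu>) \<le> 2 * (M * m * m)" if mu: "\<mu> \<in> adm" for \<mu>
    proof -
      note on = plate_sum_on[OF adm_cm[OF mu] Un_upper1] plate_sum_on[OF adm_cm[OF mu] Un_upper2]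
      note cl = closed_plates[OF Un_upper1] closed_plates[OF Un_upper2]
      note mm = m(2)[OF mu Un_upper1] m(2)[OF mu Un_upper2]
      have "mutual (plate_sum Ip \<mu>) (plate_sum In \<mu>) \<le> ereal (M * m * m)"
        by (rule mutual_bounded[OF on(1) cl(1) on(2) cl(2) kM M(1) mm m(1)])
      moreover have "mutual (plate_sum In \<mu>) (plate_sum Ip \<mu>) \<le> ereal (M * m * m)"
        by (rule mutual_bounded[OF on(2) cl(2) on(1) cl(1) kM' M(1) mm(2,1) m(1)])
      ultimately have "mutual (plate_sum Ip \<mu>) (plate_sum In \<mu>) + mutual (plate_sum In \<mu>) (plate_sum Ip \<mu>) \<le> ereal (M * m * m) + ereal (M * m * m)"
        by (rule add_mono)
      then show ?thesis unfolding mutual_sum_form[OF adm_Ep[OF mu]] by simp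
    qed
    moreover have "0 \<le> 2 * (M * m * m)" using M(1) m(1) by simp
    ultimately show ?thesis by blast
  qed
  then obtain c where c: "0 \<le> c" "\<And>\<mu>. \<mu> \<in> adm \<Longrightarrow> 2 * form (plate_sum Ip \<mu>) (plate_sum In \<mu>) \<le> c" by blast
  show ?thesis
  proof (rule that[OF c(1)])
    fix \<mu> assume mu: "\<mu> \<in> adm"
    show "form (plate_sum Ip \<mu>) (plate_sum Ip \<mu>) \<le> nrm \<mu> + c" "form (plate_sum In \<mu>) (plate_sum In \<mu>) \<le> nrm \<mu> + c"
      using nrm_eq[OF mu] c(2)[OF mu] form_nonneg[OF adm_Ep(1)[OF mu]] form_nonneg[OF adm_Ep(2)[OF mu]]
      unfolding qdist_def by linarith+
  qed
qed

text \<open>The only place where the growth and size hypotheses enter.\<close>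

lemma no_mass_escapes:
  assumes i: "i \<in> I" and d: "0 < \<delta>" and b: "0 \<le> b"
  obtains \<xi> where "\<xi> \<in> cc_functions" "\<And>x. 0 \<le> \<xi> x" "\<And>x. \<xi> x \<le> 1"
    "\<And>\<nu>. \<nu> \<in> Ep \<Longrightarrow> \<nu> \<in> positive_measures_on (A i) \<Longrightarrow>
      (\<not> compact (UNIV :: 'a set) \<Longrightarrow> form \<nu> \<nu> \<le> b) \<Longrightarrow>
      positive_integral \<nu> (\<lambda>x. ereal (g i x)) \<le> ereal (\<nu> (\<lambda>x. g i x * \<xi> x)) + ereal \<delta>"
proof (cases "compact (A i)")
  case True
  from cc_cutoff[OF lc True]
  obtain \<xi> where xi[rule_format]: "\<xi> \<in> cc_functions" "\<forall>x. 0 \<le> \<xi> x" "\<forall>x. \<xi> x \<le> 1" "\<forall>x\<in>A i. \<xi> x = 1" by meson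
  note gx = cc_mult[OF weight[OF i, THEN conjunct1] xi(1)]
  show ?thesis
  proof (rule that[OF xi(1-3)])
    fix \<nu> assume nu: "\<nu> \<in> Ep" "\<nu> \<in> positive_measures_on (A i)"
    show "positive_integral \<nu> (\<lambda>x. ereal (g i x)) \<le> ereal (\<nu> (\<lambda>x. g i x * \<xi> x)) + ereal \<delta>"
    proof (rule positive_integral_le)
      fix \<phi> :: "'a \<Rightarrow> real" assume phi: "\<phi> \<in> cc_functions" "\<And>x. ereal (\<phi> x) \<le> ereal (g i x)"
      have "\<nu> \<phi> \<le> \<nu> (\<lambda>x. g i x * \<xi> x)"
        by (rule pm_on_mono[OF lc nu(2) closed_plate[OF i] phi(1) gx]) (use phi(2) xi(4) in simp)
      then show "ereal (\<nu> \<phi>) \<le> ereal (\<nu> (\<lambda>x. g i x * \<xi> x)) + ereal \<delta>" using d by simp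
    qed
  qed
next
  case False
  then have cap: "interior_capacity \<kappa> (A i) < \<infinity>" using size[OF i] by blast
  \<comment> \<open>A space with a noncompact closed subset is noncompact, so here the kernel is
    nonnegative.\<close>
  have ncU: "\<not> compact (UNIV :: 'a set)"
  proof
    assume "compact (UNIV :: 'a set)"
    then have "compact (UNIV \<inter> A i)" using closed_plate[OF i] by (rule compact_Int_closed)
    then show False using False by simp
  qed
  note nn = kernel_nonneg[OF ncU]
  have g0: "\<And>x. 0 < g i x" using weight[OF i] by blast
  obtain Q where Q: "compact Q" "\<And>\<nu>. \<nu> \<in> Ep \<Longrightarrow> \<nu> \<in> positive_measures_on (A i) \<Longrightarrow> vanishes_on Q \<nu> \<Longrightarrow>
    form \<nu> \<nu> \<le> b \<Longrightarrow> positive_integral \<nu> (\<lambda>x. ereal (g i x)) \<le> ereal \<delta>"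
    by (rule weighted_tail[OF nn closed_plate[OF i] g0 growth[OF i] cap d b]) blast
  from cc_cutoff[OF lc Q(1)]
  obtain \<xi> where xi[rule_format]: "\<xi> \<in> cc_functions" "\<forall>x. 0 \<le> \<xi> x" "\<forall>x. \<xi> x \<le> 1" "\<forall>x\<in>Q. \<xi> x = 1" by meson
  note gx = cc_mult[OF weight[OF i, THEN conjunct1] xi(1)]
  let ?\<zeta> = "\<lambda>x. 1 - \<xi> x"
  have z: "continuous_on UNIV ?\<zeta>" "\<And>x. 0 \<le> ?\<zeta> x" "\<And>x. ?\<zeta> x \<le> 1"
    using xi(2,3) by (auto intro!: continuous_on_diff continuous_on_const cc_cont[OF xi(1)])
  show ?thesis
  proof (rule that[OF xi(1-3)])
    fix \<nu> assume nu: "\<nu> \<in> Ep" "\<nu> \<in> positive_measures_on (A i)" and fb': "\<not> compact (UNIV :: 'a set) \<Longrightarrow> form \<nu> \<nu> \<le> b"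
    note fb = fb'[OF ncU]
    note pm = Ep_pm[OF nu(1)]
    \<comment> \<open>The part of \<open>\<nu>\<close> removed by the cutoff. It vanishes on
      \<open>Q\<close>, where \<open>\<xi> = 1\<close>, and being smaller than \<open>\<nu>\<close>
      it inherits the energy bound.\<close>
    let ?\<tau> = "radon_density ?\<zeta> \<nu>"
    have t: "?\<tau> \<in> positive_measures" by (rule radon_density_pm[OF lc pm z(1,2)])
    have le: "measure_le ?\<tau> \<nu>" by (rule radon_density_le[OF pm z(1,3)])
    have "vanishes_on Q ?\<tau>"
      unfolding vanishes_on_def
    proof (intro ballI impI)
      fix \<phi> :: "'a \<Rightarrow> real" assume phi: "\<phi> \<in> cc_functions" "\<forall>x. x \<notin> Q \<longrightarrow> \<phi> x = 0"
      have "?\<zeta> x * \<phi> x = 0" for x using phi(2) xi(4)[of x] by (cases "x \<in> Q") simp_all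
      then have "(\<lambda>x. ?\<zeta> x * \<phi> x) = (\<lambda>x. 0)" by (rule ext)
      then have "\<nu> (\<lambda>x. ?\<zeta> x * \<phi> x) = 0" using rm_zero[OF pm_rm[OF pm]] by (simp only:)
      then show "?\<tau> \<phi> = 0" using phi(1) by simp
    qed
    then have tail: "positive_integral ?\<tau> (\<lambda>x. ereal (g i x)) \<le> ereal \<delta>"
      using Ep_le[OF nu(1) t le] measure_le_on[OF lc closed_plate[OF i] nu(2) t le] form_mono[OF nn nu(1) t le] fb
      by (intro Q(2)) auto
    show "positive_integral \<nu> (\<lambda>x. ereal (g i x)) \<le> ereal (\<nu> (\<lambda>x. g i x * \<xi> x)) + ereal \<delta>"
    proof (rule positive_integral_le)
      fix \<phi> :: "'a \<Rightarrow> real" assume phi: "\<phi> \<in> cc_functions" "\<And>x. ereal (\<phi> x) \<le> ereal (g i x)"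
      note cc = cc_mult[OF cc_cont[OF xi(1)] phi(1)] cc_mult[OF z(1) phi(1)]
      have "(\<lambda>x. \<xi> x * \<phi> x + ?\<zeta> x * \<phi> x) = \<phi>" by (simp add: fun_eq_iff algebra_simps)
      then have split: "\<nu> \<phi> = \<nu> (\<lambda>x. \<xi> x * \<phi> x) + ?\<tau> \<phi>"
        using rm_add[OF pm_rm[OF pm] cc] phi(1) by simp
      have "\<xi> x * \<phi> x \<le> g i x * \<xi> x" for x
        using mult_left_mono[OF _ xi(2)[of x], of "\<phi> x" "g i x"] phi(2)[of x] by (simp add: mult.commute)
      then have "\<nu> (\<lambda>x. \<xi> x * \<phi> x) \<le> \<nu> (\<lambda>x. g i x * \<xi> x)" by (rule pm_mono[OF pm cc(1) gx])
      moreover have "?\<tau> \<phi> \<le> \<delta>"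
        using order_trans[OF positive_integral_gt(1)[OF phi] tail] by simp
      ultimately show "ereal (\<nu> \<phi>) \<le> ereal (\<nu> (\<lambda>x. g i x * \<xi> x)) + ereal \<delta>" using split by simp
    qed
  qed
qed

text \<open>Vague convergence passes to the plate sums, as a test function meets only finitely many
  plates. Of the mass condition, the bound from above is inherited through each minorant of
  \<open>g i\<close>; for the bound from below, \<open>g i\<close> is replaced by the test function
  \<open>g i * \<xi>\<close> at a cost \<open>\<delta>\<close> that is uniform along the
  net.\<close>

lemma cluster_minimizer:
  assumes F: "F \<noteq> bot" "eventually (\<lambda>x. f x \<in> adm) F" "\<And>\<epsilon>. 0 < \<epsilon> \<Longrightarrow> eventually (\<lambda>x. nrm (f x) \<le> w + \<epsilon>) F"
    and cl: "cluster_point (condenser_vague_topology Ip In A) f F \<mu>"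
  shows "\<mu> \<in> minimizers \<kappa> Ip In A a g"
proof -
  have mu: "\<mu> \<in> cm" using cl topspace_cvt unfolding cluster_point_def by blast
  obtain G where G: "G \<noteq> bot" "G \<le> F"
    "\<And>L. continuous_map (condenser_vague_topology Ip In A) euclideanreal L \<Longrightarrow> ((\<lambda>x. L (f x)) \<longlongrightarrow> L \<mu>) G"
    using cluster_pointE[OF cl] by metis
  have Gadm: "eventually (\<lambda>x. f x \<in> adm) G" by (rule filter_leD[OF G(2) F(2)])
  have Gw: "eventually (\<lambda>x. nrm (f x) \<le> w + \<epsilon>) G" if "0 < \<epsilon>" for \<epsilon> by (rule filter_leD[OF G(2) F(3)[OF that]])
  have lim: "((\<lambda>x. f x i \<phi>) \<longlongrightarrow> \<mu> i \<phi>) G" if "i \<in> I" "\<phi> \<in> cc_functions" for i \<phi>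
    by (rule G(3)[OF continuous_map_eval[OF that]])
  have plim: "((\<lambda>x. plate_sum J (f x) \<phi>) \<longlongrightarrow> plate_sum J \<mu> \<phi>) G" if J: "J \<subseteq> I" and phi: "\<phi> \<in> cc_functions" for J \<phi>
  proof -
    note pa = plate_sum_apply[OF _ J phi finite_meets[OF phi] subset_refl]
    have "((\<lambda>x. \<Sum>i\<in>J \<inter> meets \<phi>. f x i \<phi>) \<longlongrightarrow> (\<Sum>i\<in>J \<inter> meets \<phi>. \<mu> i \<phi>)) G"
      using J by (intro tendsto_sum lim phi) auto
    then have "((\<lambda>x. \<Sum>i\<in>J \<inter> meets \<phi>. f x i \<phi>) \<longlongrightarrow> plate_sum J \<mu> \<phi>) G" by (simp only: pa[OF mu])
    then show ?thesis
    proof (rule Lim_transform_eventually)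
      show "eventually (\<lambda>x. (\<Sum>i\<in>J \<inter> meets \<phi>. f x i \<phi>) = plate_sum J (f x) \<phi>) G"
        using Gadm by eventually_elim (simp add: pa[OF adm_cm])
    qed
  qed
  obtain c where c: "0 \<le> c" "\<And>\<mu>. \<mu> \<in> adm \<Longrightarrow> form (plate_sum Ip \<mu>) (plate_sum Ip \<mu>) \<le> nrm \<mu> + c"
    "\<And>\<mu>. \<mu> \<in> adm \<Longrightarrow> form (plate_sum In \<mu>) (plate_sum In \<mu>) \<le> nrm \<mu> + c"
    by (rule energy_bound) blast
  \<comment> \<open>Bounds the energies of both parts as soon as
    \<open>nrm (f x) \<le> w + 1\<close>; the absolute value makes \<open>b\<close> visibly
    nonnegative.\<close>
  define b where "b = \<bar>w\<bar> + 1 + c"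
  have b0: "0 \<le> b" using c(1) by (simp add: b_def)
  have plate_sum_b: "eventually (\<lambda>x. plate_sum J (f x) \<in> Ep \<and> form (plate_sum J (f x)) (plate_sum J (f x)) \<le> b) G" if J: "J \<in> {Ip, In}" for J
    using Gadm Gw[of 1, simplified]
  proof eventually_elim
    case (elim x)
    then show ?case using J c(2)[OF elim(1)] c(3)[OF elim(1)] adm_Ep[OF elim(1)] by (auto simp: b_def)
  qed
  have wl: "plate_sum J \<mu> \<in> Ep" "\<rho> \<in> Ep \<Longrightarrow> ((\<lambda>x. form (plate_sum J (f x)) \<rho>) \<longlongrightarrow> form (plate_sum J \<mu>) \<rho>) G" if J: "J \<in> {Ip, In}" for J \<rho>
  proof -
    have JI: "J \<subseteq> I" using J by auto
    \<comment> \<open>\<open>weak_limit\<close> is about filters of measures, so the filter of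
      indices is pushed forward to the plate sums.\<close>
    let ?H = "filtermap (\<lambda>x. plate_sum J (f x)) G"
    have H: "?H \<noteq> bot" using G(1) by (simp add: filtermap_bot_iff)
    have Hb: "eventually (\<lambda>\<sigma>. \<sigma> \<in> Ep \<and> form \<sigma> \<sigma> \<le> b) ?H" using plate_sum_b[OF J] by (simp add: eventually_filtermap)
    have Hl: "((\<lambda>\<sigma>. \<sigma> \<phi>) \<longlongrightarrow> plate_sum J \<mu> \<phi>) ?H" if "\<phi> \<in> cc_functions" for \<phi>
      using plim[OF JI that] by (simp add: filterlim_filtermap)
    show "plate_sum J \<mu> \<in> Ep" by (rule weak_limit_aux(1)[OF H Hb plate_sum_pm[OF mu JI]]) (rule Hl)
    assume rho: "\<rho> \<in> Ep"
    have "((\<lambda>\<sigma>. form \<sigma> \<rho>) \<longlongrightarrow> form (plate_sum J \<mu>) \<rho>) ?H" by (rule weak_limit[OF H Hb plate_sum_pm[OF mu JI] _ rho]) (rule Hl)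
    then show "((\<lambda>x. form (plate_sum J (f x)) \<rho>) \<longlongrightarrow> form (plate_sum J \<mu>) \<rho>) G" by (simp add: filterlim_filtermap)
  qed
  let ?p = "plate_sum Ip \<mu>" and ?n = "plate_sum In \<mu>"
  have E: "?p \<in> Ep" "?n \<in> Ep" using wl(1) by auto
  have "positive_integral (\<mu> i) (\<lambda>x. ereal (g i x)) = ereal (a i)" if i: "i \<in> I" for i
  proof (rule antisym)
    show "positive_integral (\<mu> i) (\<lambda>x. ereal (g i x)) \<le> ereal (a i)"
    proof (rule positive_integral_le)
      fix \<phi> :: "'a \<Rightarrow> real" assume phi: "\<phi> \<in> cc_functions" "\<And>x. ereal (\<phi> x) \<le> ereal (g i x)"
      have "eventually (\<lambda>x. f x i \<phi> \<le> a i) G"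
        using Gadm
      proof eventually_elim
        case (elim x)
        then show ?case using positive_integral_gt(1)[OF phi, of "f x i"] i by (simp add: adm_iff)
      qed
      then have "\<mu> i \<phi> \<le> a i" by (rule tendsto_upperbound[OF lim[OF i phi(1)] _ G(1)])
      then show "ereal (\<mu> i \<phi>) \<le> ereal (a i)" by simp
    qed
    obtain J where J: "J \<in> {Ip, In}" "i \<in> J" using i by auto
    then have JI: "J \<subseteq> I" by auto
    show "ereal (a i) \<le> positive_integral (\<mu> i) (\<lambda>x. ereal (g i x))"
    proof (rule ereal_le_epsilon2)
      fix \<delta> :: real assume d: "0 < \<delta>"
      obtain \<xi> where xi: "\<xi> \<in> cc_functions" "\<And>x. 0 \<le> \<xi> x" "\<And>x. \<xi> x \<le> 1"
        "\<And>\<nu>. \<nu> \<in> Ep \<Longrightarrow> \<nu> \<in> positive_measures_on (A i) \<Longrightarrow> (\<not> compact (UNIV :: 'a set) \<Longrightarrow> form \<nu> \<nu> \<le> b) \<Longrightarrow>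
          positive_integral \<nu> (\<lambda>x. ereal (g i x)) \<le> ereal (\<nu> (\<lambda>x. g i x * \<xi> x)) + ereal \<delta>"
        by (rule no_mass_escapes[OF i d b0]) blast
      have g0: "0 < g i x" for x using weight[OF i] by blast
      note gx = cc_mult[OF weight[OF i, THEN conjunct1] xi(1)]
      have "eventually (\<lambda>x. a i - \<delta> \<le> f x i (\<lambda>y. g i y * \<xi> y)) G"
        using Gadm plate_sum_b[OF J(1)]
      proof eventually_elim
        case (elim x)
        note ge = plate_sum_ge[OF adm_cm[OF elim(1)] JI J(2)] and pm = cm_pm[OF adm_cm[OF elim(1)] i]
        have JE: "plate_sum J (f x) \<in> Ep" and Jb: "form (plate_sum J (f x)) (plate_sum J (f x)) \<le> b" using elim(2) by auto
        \<comment> \<open>A single plate inherits the energy bound of its plate sum only for a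
          nonnegative kernel; this is why \<open>no_mass_escapes\<close> asks for the bound on
          noncompact spaces alone.\<close>
        have "form (f x i) (f x i) \<le> b" if "\<not> compact (UNIV :: 'a set)"
          using form_mono[OF kernel_nonneg[OF that] JE pm ge] Jb by simp
        from xi(4)[OF Ep_le[OF JE pm ge] cm_on[OF adm_cm[OF elim(1)] i] this]
        have "ereal (a i) \<le> ereal (f x i (\<lambda>y. g i y * \<xi> y)) + ereal \<delta>"
          using elim(1) i by (simp add: adm_iff)
        then show ?case by simp
      qed
      then have "a i - \<delta> \<le> \<mu> i (\<lambda>y. g i y * \<xi> y)" by (rule tendsto_lowerbound[OF lim[OF i gx] _ G(1)])
      moreover have "ereal (\<mu> i (\<lambda>y. g i y * \<xi> y)) \<le> positive_integral (\<mu> i) (\<lambda>x. ereal (g i x))"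
      proof (rule positive_integral_gt(1)[OF gx])
        show "ereal (g i x * \<xi> x) \<le> ereal (g i x)" for x
          using mult_left_mono[OF xi(3)[of x] less_imp_le[OF g0[of x]]] by simp
      qed
      ultimately have "ereal (a i - \<delta>) \<le> positive_integral (\<mu> i) (\<lambda>x. ereal (g i x))"
        by (meson ereal_less_eq(3) order_trans)
      then have "ereal (a i - \<delta>) + ereal \<delta> \<le> positive_integral (\<mu> i) (\<lambda>x. ereal (g i x)) + ereal \<delta>"
        by (rule add_right_mono)
      then show "ereal (a i) \<le> positive_integral (\<mu> i) (\<lambda>x. ereal (g i x)) + ereal \<delta>" by simp
    qed
  qed
  then have adm: "\<mu> \<in> adm" using mu E by (simp add: adm_iff)
  have "qdist ?p ?n \<le> w + \<epsilon>" if e: "0 < \<epsilon>" for \<epsilon>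
  proof -
    \<comment> \<open>\<open>?L x\<close> is twice the inner product of \<open>R (f x)\<close> and
      \<open>R \<mu>\<close> minus the energy of \<open>R \<mu>\<close>. It lies below
      \<open>nrm (f x)\<close>, since the distance of the two resultants is nonnegative, and being
      affine in the plate sums of \<open>f x\<close> it converges to the energy of
      \<open>R \<mu>\<close>.\<close>
    let ?L = "\<lambda>x. 2 * (form (plate_sum Ip (f x)) ?p - form (plate_sum Ip (f x)) ?n - form (plate_sum In (f x)) ?p + form (plate_sum In (f x)) ?n) - qdist ?p ?n"
    have "(?L \<longlongrightarrow> 2 * (form ?p ?p - form ?p ?n - form ?n ?p + form ?n ?n) - qdist ?p ?n) G"
      by (intro tendsto_intros wl(2) E) auto
    moreover have "2 * (form ?p ?p - form ?p ?n - form ?n ?p + form ?n ?n) - qdist ?p ?n = qdist ?p ?n"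
      by (simp add: qdist_def form_sym[of ?n ?p])
    ultimately have L: "(?L \<longlongrightarrow> qdist ?p ?n) G" by (simp only:)
    have "eventually (\<lambda>x. ?L x \<le> w + \<epsilon>) G"
      using Gadm Gw[OF e]
    proof eventually_elim
      case (elim x)
      let ?q = "plate_sum Ip (f x)" and ?m = "plate_sum In (f x)"
      note Ex = adm_Ep[OF elim(1)]
      have c1: "radon_comb 1 ?q 1 ?n \<in> Ep" "radon_comb 1 ?p 1 ?m \<in> Ep" using E Ex by (simp_all add: Ep_comb)
      have "0 \<le> qdist (radon_comb 1 ?q 1 ?n) (radon_comb 1 ?p 1 ?m)" by (rule energy_diff(3)[OF c1])
      also have "\<dots> = qdist ?q ?m - ?L x"
        using E Ex c1 by (simp add: qdist_def form_comb_square form_comb_left form_comb_right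
          form_sym[of ?p ?q] form_sym[of ?n ?p] form_sym[of ?n ?m] form_sym[of ?p ?m] form_sym[of ?n ?q] form_sym[of ?m ?q])
      finally show ?case using elim(2) nrm_eq[OF elim(1)] by simp
    qed
    then show ?thesis by (rule tendsto_upperbound[OF L _ G(1)])
  qed
  then have "nrm \<mu> \<le> w" unfolding nrm_eq[OF adm] by (rule field_le_epsilon)
  then show ?thesis using adm w_le[OF adm] by (simp add: minimizers_iff)
qed

end

section \<open>Exhaustion by compact condensers\<close>

lemma admissible_measures_mono:
  assumes "subcondenser Ip In K A"
  shows "admissible_measures \<kappa> Ip In K a g \<subseteq> admissible_measures \<kappa> Ip In A a g"
proof -
  have "condenser_measures Ip In K \<subseteq> condenser_measures Ip In A"
    unfolding condenser_measures_def using assms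
    by (intro PiE_mono) (auto simp: subcondenser_def positive_measures_on_def)
  then show ?thesis by (auto simp: admissible_measures_def condenser_finite_energy_def)
qed

lemma transp_subcondenser: "transp (subcondenser Ip In)"
  by (rule transpI) (auto simp: subcondenser_def)

context condenser_problem
begin

text \<open>Compact plates satisfy the growth and size conditions by themselves. Shrinking a plate
  raises the infimum of the weight and lowers the supremum of the kernel, so \<open>bound\<close>
  persists.\<close>

lemma sub_problem:
  assumes K: "compact_condenser Ip In K" and sub: "subcondenser Ip In K A"
  shows "condenser_problem \<kappa> Ip In K a g"
proof unfold_locales
  have KA: "K i \<subseteq> A i" if "i \<in> I" for i using sub that by (simp add: subcondenser_def)
  show "condenser Ip In K" using K by (simp add: compact_condenser_def)
  show "continuous_on UNIV (g i) \<and> (\<forall>x. 0 < g i x)" "0 < a i" if "i \<in> I" for i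
    using weight[OF that] mass[OF that] by auto
  have cK: "compact (K i)" if "i \<in> I" for i using K that by (simp add: compact_condenser_def)
  then show "compact (K i) \<or> interior_capacity \<kappa> (K i) < \<infinity>" if "i \<in> I" for i using that by blast
  show "(SUP x\<in>K i. ereal (g i x)) < \<infinity> \<or>
     (\<exists>r>1. \<exists>\<omega>\<in>finite_energy \<kappa>. nearly_everywhere \<kappa> (K i)
        (\<lambda>x. potential_defined \<kappa> x \<omega> \<and> ereal (g i x powr r) \<le> potential \<kappa> x \<omega>))" if i: "i \<in> I" for i
  proof -
    have "compact (g i ` K i)"
      using weight[OF i] by (intro compact_continuous_image[OF _ cK[OF i]]) (auto intro: continuous_on_subset)
    then obtain B where B: "\<forall>y\<in>g i ` K i. norm y \<le> B" using compact_imp_bounded bounded_iff by metis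
    have "(SUP x\<in>K i. ereal (g i x)) \<le> ereal B" using B by (intro SUP_least) (auto simp: abs_le_iff)
    then show ?thesis by auto
  qed
  show "In = {} \<or>
    ((\<Sum>\<^sub>\<infinity>i\<in>I. ereal (a i) * (1 / (INF x\<in>K i. ereal (g i x)))) < \<infinity> \<and>
     (SUP p\<in>(\<Union>i\<in>Ip. K i) \<times> (\<Union>j\<in>In. K j). \<kappa> p) < \<infinity>)"
  proof (cases "In = {}")
    case False
    let ?f = "\<lambda>A i. ereal (a i) * (1 / (INF x\<in>A i. ereal (g i x)))"
    have g0: "0 \<le> (INF x\<in>B. ereal (g i x))" if "i \<in> I" for i B
      using weight[OF that] by (intro INF_greatest) (auto intro: less_imp_le)
    have f0: "0 \<le> ?f B i" if "i \<in> I" for B i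
      using g0[OF that] mass[OF that] by (intro ereal_0_le_mult) (auto simp: zero_le_divide_ereal)
    have le: "?f K i \<le> ?f A i" if i: "i \<in> I" for i
    proof -
      have "(INF x\<in>A i. ereal (g i x)) \<le> (INF x\<in>K i. ereal (g i x))" using KA[OF i] by (rule INF_superset_mono) simp
      then have "1 / (INF x\<in>K i. ereal (g i x)) \<le> 1 / (INF x\<in>A i. ereal (g i x))"
        unfolding divide_ereal_def using g0[OF i] by (simp add: ereal_inverse_antimono)
      then show ?thesis using mass[OF i] by (intro ereal_mult_left_mono) auto
    qed
    have summable: "?f B summable_on I" for B by (rule nonneg_summable_on_complete) (rule f0)
    have "(\<Sum>\<^sub>\<infinity>i\<in>I. ?f K i) \<le> (\<Sum>\<^sub>\<infinity>i\<in>I. ?f A i)"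
      using summable[of K] summable[of A] le by (rule infsum_mono)
    moreover have "(SUP p\<in>(\<Union>i\<in>Ip. K i) \<times> (\<Union>j\<in>In. K j). \<kappa> p) \<le> (SUP p\<in>(\<Union>i\<in>Ip. A i) \<times> (\<Union>j\<in>In. A j). \<kappa> p)"
    proof (rule SUP_subset_mono)
      show "(\<Union>i\<in>Ip. K i) \<times> (\<Union>j\<in>In. K j) \<subseteq> (\<Union>i\<in>Ip. A i) \<times> (\<Union>j\<in>In. A j)"
        by (intro Sigma_mono UN_mono subset_refl) (auto intro: subsetD[OF KA])
    qed simp
    ultimately show ?thesis using bound False by (meson le_less_trans)
  qed simp
qed

text \<open>The direct method with a minimizing sequence. Interpreted for a compact sub-condenser,
  it yields the minimizers among which the net is chosen.\<close>

lemma ex_minimizer: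
  assumes "adm \<noteq> {}"
  shows "minimizers \<kappa> Ip In A a g \<noteq> {}"
proof -
  have "\<exists>\<mu>. \<mu> \<in> adm \<and> nrm \<mu> < w + inverse (real (Suc n))" for n
    by (rule near_w[OF assms, of "inverse (real (Suc n))"]) auto
  then obtain f where f: "\<And>n. f n \<in> adm \<and> nrm (f n) < w + inverse (real (Suc n))" by metis
  have adm: "eventually (\<lambda>n. f n \<in> adm) sequentially" using f by simp
  have near: "eventually (\<lambda>n. nrm (f n) \<le> w + \<epsilon>) sequentially" if e: "0 < \<epsilon>" for \<epsilon>
  proof -
    obtain N where N: "inverse (real (Suc N)) < \<epsilon>" using reals_Archimedean[OF e] by blast
    have "nrm (f n) \<le> w + \<epsilon>" if "N \<le> n" for n
    proof -
      have "inverse (real (Suc n)) \<le> inverse (real (Suc N))" using that by (intro le_imp_inverse_le) auto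
      then show ?thesis using f[of n] N by linarith
    qed
    then show ?thesis by (rule eventually_sequentiallyI)
  qed
  obtain \<mu> where "cluster_point (condenser_vague_topology Ip In A) f sequentially \<mu>"
    by (rule ex_cluster_point[OF sequentially_bot adm])
  from cluster_minimizer[OF sequentially_bot adm near this] show ?thesis by blast
qed

abbreviation CS :: "(nat \<Rightarrow> 'a set) set" where "CS \<equiv> compact_subcondensers \<kappa> Ip In A a g"

lemma CS_iff:
  "K \<in> CS \<longleftrightarrow> K \<in> extensional I \<and> compact_condenser Ip In K \<and> subcondenser Ip In K A
     \<and> admissible_measures \<kappa> Ip In K a g \<noteq> {}"
  using condenser_problem.capacity_pos_iff[OF sub_problem] by (auto simp: compact_subcondensers_def)

text \<open>Cut \<open>\<mu> i\<close> off so far out that renormalizing costs a factor at most \<open>1 + d\<close>, uniformly in the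
  possibly infinitely many \<open>i\<close>, and that nothing changes on a compact set \<open>Q\<close> carrying almost all of the
  mutual energy of the two parts.\<close>

lemma approximation_noncompact:
  assumes nc: "\<not> compact (UNIV :: 'a set)" and mu: "\<mu> \<in> adm" and e: "0 < \<epsilon>"
  shows "\<exists>K\<in>CS. \<exists>\<nu>\<in>admissible_measures \<kappa> Ip In K a g. nrm \<nu> \<le> nrm \<mu> + \<epsilon>"
proof -
  note nn = kernel_nonneg[OF nc]
  note cm = adm_cm[OF mu]
  let ?s = "plate_sum Ip \<mu>" and ?t = "plate_sum In \<mu>"
  note E = adm_Ep[OF mu]
  define S where "S = form ?s ?s + form ?t ?t"
  have S0: "0 \<le> S" using form_nonneg[OF E(1)] form_nonneg[OF E(2)] by (simp add: S_def)
  then have S1: "0 < S + 1" by simp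
  \<comment> \<open>From \<open>(1 + d)\<^sup>2 \<le> 1 + 3 * d\<close> and
    \<open>d * (S + 1) \<le> \<epsilon> / 6\<close>: rescaling raises the two energies by at most
    \<open>\<epsilon> / 2\<close> in total.\<close>
  define d where "d = min 1 (\<epsilon> / (6 * (S + 1)))"
  have d: "0 < d" "d \<le> 1" using e S0 by (auto simp: d_def)
  have dS: "(1 + d)\<^sup>2 * S \<le> S + \<epsilon> / 2"
  proof -
    have "d * d \<le> d * 1" using d by (intro mult_left_mono) auto
    then have "(1 + d)\<^sup>2 \<le> 1 + 3 * d" by (simp add: power2_eq_square algebra_simps)
    then have "(1 + d)\<^sup>2 * S \<le> (1 + 3 * d) * S" using S0 by (rule mult_right_mono)
    also have "\<dots> = S + 3 * (d * S)" by (simp add: algebra_simps)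
    also have "d * S \<le> \<epsilon> / (6 * (S + 1)) * (S + 1)" using S0 d(1) e by (intro mult_mono) (auto simp: d_def)
    also have "\<dots> = \<epsilon> / 6" using S1
      by (metis less_irrefl nonzero_mult_divide_mult_cancel_right times_divide_eq_left)
    finally show ?thesis by simp
  qed
  \<comment> \<open>\<open>\<epsilon> / 4\<close> for each order of the two factors, so the mixed
    energies account for the other \<open>\<epsilon> / 2\<close>.\<close>
  have lower: "\<exists>\<phi>\<in>cc_functions. (\<forall>z. 0 \<le> \<phi> z) \<and> (\<forall>z. ereal (\<phi> z) \<le> \<kappa> z)
      \<and> real_of_ereal (mutual \<rho> \<pi>) - \<epsilon> / 4 \<le> tensor_measure \<rho> \<pi> \<phi>"
    if r: "\<rho> \<in> Ep" "\<pi> \<in> Ep" for \<rho> \<pi>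
  proof -
    have "ereal (real_of_ereal (mutual \<rho> \<pi>) - \<epsilon> / 4) < ereal (real_of_ereal (mutual \<rho> \<pi>))" using e by simp
    also have "\<dots> = positive_integral (tensor_measure \<rho> \<pi>) \<kappa>" using mutual_real[OF r] by (simp add: mutual_def)
    finally obtain \<phi> where phi: "\<phi> \<in> cc_functions" "\<And>x. ereal (\<phi> x) \<le> \<kappa> x"
      "ereal (real_of_ereal (mutual \<rho> \<pi>) - \<epsilon> / 4) < ereal (tensor_measure \<rho> \<pi> \<phi>)"
      by (rule positive_integral_less) blast
    let ?\<phi> = "\<lambda>z. max (\<phi> z) 0"
    have cc: "?\<phi> \<in> cc_functions" by (rule cc_max[OF phi(1) cc_zero])
    have "tensor_measure \<rho> \<pi> \<phi> \<le> tensor_measure \<rho> \<pi> ?\<phi>"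
      by (rule pm_mono[OF tpm[OF Ep_pm[OF r(1)] Ep_pm[OF r(2)]] phi(1) cc]) simp
    moreover have "ereal (?\<phi> z) \<le> \<kappa> z" for z using phi(2)[of z] nn[of z] by (auto simp: max_def zero_ereal_def)
    ultimately show ?thesis using phi(3) cc by (intro bexI[of _ ?\<phi>]) auto
  qed
  obtain \<phi>1 where p1: "\<phi>1 \<in> cc_functions" "\<forall>z. 0 \<le> \<phi>1 z" "\<forall>z. ereal (\<phi>1 z) \<le> \<kappa> z"
    "real_of_ereal (mutual ?s ?t) - \<epsilon> / 4 \<le> tensor_measure ?s ?t \<phi>1" using lower[OF E] by blast
  obtain \<phi>2 where p2: "\<phi>2 \<in> cc_functions" "\<forall>z. 0 \<le> \<phi>2 z" "\<forall>z. ereal (\<phi>2 z) \<le> \<kappa> z"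
    "real_of_ereal (mutual ?t ?s) - \<epsilon> / 4 \<le> tensor_measure ?t ?s \<phi>2" using lower[OF E(2,1)] by blast
  let ?S1 = "closure {z. \<phi>1 z \<noteq> 0} \<union> closure {z. \<phi>2 z \<noteq> 0}"
  \<comment> \<open>Both projections of both supports: \<open>\<phi>1\<close> and
    \<open>\<phi>2\<close> vanish unless both coordinates lie in \<open>Q\<close>.\<close>
  define Q where "Q = fst ` ?S1 \<union> snd ` ?S1"
  have Q: "compact Q" unfolding Q_def
    by (intro compact_Un compact_continuous_image continuous_on_fst continuous_on_snd continuous_on_id cc_compact p1(1) p2(1))
  have outQ: "\<phi>1 (x, y) = 0 \<and> \<phi>2 (x, y) = 0" if "x \<notin> Q \<or> y \<notin> Q" for x y
  proof -
    have "(x, y) \<notin> ?S1" using that unfolding Q_def by force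
    then have "(x, y) \<notin> closure {z. \<phi>1 z \<noteq> 0}" "(x, y) \<notin> closure {z. \<phi>2 z \<noteq> 0}" by simp_all
    then show ?thesis using cc_outside[of "(x, y)" \<phi>1] cc_outside[of "(x, y)" \<phi>2] by blast
  qed
  have g0: "\<And>x. 0 < g i x" and gc: "continuous_on UNIV (g i)" if "i \<in> I" for i using weight[OF that] by auto
  have "\<forall>i\<in>I. \<exists>\<xi>. \<xi> \<in> cc_functions \<and> (\<forall>x. 0 \<le> \<xi> x) \<and> (\<forall>x. \<xi> x \<le> 1) \<and> (\<forall>x\<in>Q. \<xi> x = 1)
    \<and> a i / (1 + d) < \<mu> i (\<lambda>x. g i x * \<xi> x)"
  proof
    fix i assume i: "i \<in> I"
    have "ereal (a i / (1 + d)) < ereal (a i)" using mass[OF i] d by (simp add: field_simps)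
    also have "\<dots> = positive_integral (\<mu> i) (\<lambda>x. ereal (g i x))" using mu i by (simp add: adm_iff)
    finally obtain \<phi> where phi: "\<phi> \<in> cc_functions" "\<And>x. ereal (\<phi> x) \<le> ereal (g i x)" "ereal (a i / (1 + d)) < ereal (\<mu> i \<phi>)"
      by (rule positive_integral_less) blast
    from cc_cutoff[OF lc compact_Un[OF Q cc_compact[OF phi(1)]]]
    obtain \<xi> where xi[rule_format]: "\<xi> \<in> cc_functions" "\<forall>x. 0 \<le> \<xi> x" "\<forall>x. \<xi> x \<le> 1"
      "\<forall>x\<in>Q \<union> closure {x. \<phi> x \<noteq> 0}. \<xi> x = 1" by meson
    have "\<phi> x \<le> g i x * \<xi> x" for x
    proof (cases "x \<in> closure {x. \<phi> x \<noteq> 0}")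
      case True
      then show ?thesis using xi(4)[of x] phi(2)[of x] by simp
    next
      case False
      then show ?thesis using cc_outside[of x \<phi>] xi(2)[of x] g0[OF i, of x] by simp
    qed
    then have "\<mu> i \<phi> \<le> \<mu> i (\<lambda>x. g i x * \<xi> x)" by (rule pm_mono[OF cm_pm[OF cm i] phi(1) cc_mult[OF gc[OF i] xi(1)]])
    then show "\<exists>\<xi>. \<xi> \<in> cc_functions \<and> (\<forall>x. 0 \<le> \<xi> x) \<and> (\<forall>x. \<xi> x \<le> 1) \<and> (\<forall>x\<in>Q. \<xi> x = 1)
      \<and> a i / (1 + d) < \<mu> i (\<lambda>x. g i x * \<xi> x)" using xi phi(3) by (intro exI[of _ \<xi>]) auto
  qed
  from bchoice[OF this] obtain \<xi> where xi': "\<forall>i\<in>I. \<xi> i \<in> cc_functions \<and> (\<forall>x. 0 \<le> \<xi> i x) \<and> (\<forall>x. \<xi> i x \<le> 1)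
    \<and> (\<forall>x\<in>Q. \<xi> i x = 1) \<and> a i / (1 + d) < \<mu> i (\<lambda>x. g i x * \<xi> i x)" ..
  have xi: "\<xi> i \<in> cc_functions" "0 \<le> \<xi> i x" "\<xi> i x \<le> 1" "x \<in> Q \<Longrightarrow> \<xi> i x = 1"
    "a i / (1 + d) < \<mu> i (\<lambda>x. g i x * \<xi> i x)" if "i \<in> I" for i x
    using bspec[OF xi' that] by simp_all
  note xc = cc_cont[OF xi(1)]
  define m where "m i = \<mu> i (\<lambda>x. g i x * \<xi> i x)" for i
  \<comment> \<open>The factor that restores the mass \<open>a i\<close> after the cutoff; it lies
    between 1 and \<open>1 + d\<close>.\<close>
  define c where "c i = a i / m i" for i
  have gx: "(\<lambda>x. g i x * \<xi> i x) \<in> cc_functions" if "i \<in> I" for i by (rule cc_mult[OF gc[OF that] xi(1)[OF that]])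
  have m: "0 < m i" "m i \<le> a i" "a i \<le> (1 + d) * m i" if i: "i \<in> I" for i
  proof -
    have "0 < a i / (1 + d)" using mass[OF i] d by simp
    then show "0 < m i" using xi(5)[OF i] by (simp add: m_def)
    have "ereal (m i) \<le> positive_integral (\<mu> i) (\<lambda>x. ereal (g i x))"
      unfolding m_def
    proof (rule positive_integral_gt(1)[OF gx[OF i]])
      show "ereal (g i x * \<xi> i x) \<le> ereal (g i x)" for x
        using mult_left_mono[OF xi(3)[OF i] less_imp_le[OF g0[OF i, of x]]] by simp
    qed
    then show "m i \<le> a i" using mu i by (simp add: adm_iff)
    show "a i \<le> (1 + d) * m i" using xi(5)[OF i] d by (simp add: m_def field_simps)
  qed
  have c: "1 \<le> c i" "c i \<le> 1 + d" if "i \<in> I" for i using m[OF that] by (simp_all add: c_def field_simps)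
  define \<nu> where "\<nu> = (\<lambda>i\<in>I. radon_comb (c i) (radon_density (\<xi> i) (\<mu> i)) 0 zero_measure)"
  define K where "K = (\<lambda>i\<in>I. A i \<inter> closure {x. \<xi> i x \<noteq> 0})"
  have KA: "subcondenser Ip In K A" by (simp add: subcondenser_def K_def)
  have Kc: "compact (K i)" if "i \<in> I" for i
    using that closed_Int_compact[OF closed_plate[OF that] cc_compact[OF xi(1)[OF that]]] by (simp only: K_def restrict_apply' if_True)
  have nu_apply: "\<nu> i \<phi> = c i * \<mu> i (\<lambda>x. \<xi> i x * \<phi> x)" if "i \<in> I" "\<phi> \<in> cc_functions" for i \<phi>
    using that by (simp add: \<nu>_def)
  have dens: "radon_density (\<xi> i) (\<mu> i) \<in> positive_measures_on (K i)" if i: "i \<in> I" for i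
  proof -
    have "radon_density (\<xi> i) (\<mu> i) \<in> positive_measures_on (A i \<inter> closure {x. \<xi> i x \<noteq> 0})"
      by (rule radon_density_on[OF lc closed_plate[OF i] cm_on[OF cm i] xc[OF i] xi(2)[OF i] closed_closure])
        (rule cc_outside[of _ "\<xi> i"])
    then show ?thesis using i by (simp only: K_def restrict_apply' if_True)
  qed
  have nu_on: "\<nu> i \<in> positive_measures_on (K i)" if i: "i \<in> I" for i
  proof -
    have "radon_comb (c i) (radon_density (\<xi> i) (\<mu> i)) 0 zero_measure \<in> positive_measures_on (K i)"
      using c(1)[OF i] compact_imp_closed[OF Kc[OF i]]
      by (intro radon_comb_on[OF lc] zero_measure_on[OF lc] dens[OF i]) auto
    then show ?thesis using i by (simp only: \<nu>_def restrict_apply' if_True)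
  qed
  \<comment> \<open>A condenser needs nonempty plates; an empty \<open>K i\<close> would leave no
    mass to rescale, contradicting \<open>0 < m i\<close>.\<close>
  have Kne: "K i \<noteq> {}" if i: "i \<in> I" for i
  proof
    assume "K i = {}"
    then have emp: "A i \<inter> closure {x. \<xi> i x \<noteq> 0} = {}" using i by (simp only: K_def restrict_apply' if_True)
    have "closure {x. g i x * \<xi> i x \<noteq> 0} \<subseteq> closure {x. \<xi> i x \<noteq> 0}" by (rule closure_mono) auto
    then have "closure {x. g i x * \<xi> i x \<noteq> 0} \<inter> A i = {}" using emp by blast
    then have "m i = 0" unfolding m_def by (rule pm_on_null[OF lc cm_on[OF cm i] gx[OF i]])
    then show False using m(1)[OF i] by simp
  qed
  have condK: "condenser Ip In K"
    unfolding condenser_def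
  proof (intro conjI ballI allI impI)
    show "Ip \<noteq> {}" "Ip \<inter> In = {}" using cond by (simp_all add: condenser_def)
    show "closed (K i)" "K i \<noteq> {}" if "i \<in> I" for i using Kc[OF that] Kne[OF that] by (auto intro: compact_imp_closed)
    show "finite {i \<in> I. K i \<inter> C \<noteq> {}}" if "compact C" for C
    proof (rule finite_subset)
      show "finite {i \<in> I. A i \<inter> C \<noteq> {}}" using cond that by (simp add: condenser_def)
      show "{i \<in> I. K i \<inter> C \<noteq> {}} \<subseteq> {i \<in> I. A i \<inter> C \<noteq> {}}" using KA unfolding subcondenser_def by blast
    qed
    show "K i \<inter> K j = {}" if "i \<in> Ip" "j \<in> In" for i j
    proof -
      have "K i \<subseteq> A i" "K j \<subseteq> A j" using KA that by (simp_all add: subcondenser_def)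
      then show ?thesis using plates_disjoint[OF that] by blast
    qed
  qed
  have ccK: "compact_condenser Ip In K" using condK Kc by (simp add: compact_condenser_def)
  interpret K: condenser_problem \<kappa> Ip In K a g by (rule sub_problem[OF ccK KA])
  have nuK: "\<nu> \<in> condenser_measures Ip In K"
    unfolding condenser_measures_def by (rule PiE_I) (simp_all add: nu_on, simp add: \<nu>_def)
  moreover have "condenser_measures Ip In K \<subseteq> cm"
    unfolding condenser_measures_def
    by (rule PiE_mono) (use KA in \<open>auto simp: subcondenser_def positive_measures_on_def\<close>)
  ultimately have nucm: "\<nu> \<in> cm" by blast
  have xmu: "(\<lambda>x. \<xi> i x * \<phi> x) \<in> cc_functions" if "i \<in> I" "\<phi> \<in> cc_functions" for i \<phi>
    by (rule cc_mult[OF xc[OF that(1)] that(2)])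
  \<comment> \<open>The cutoff removes mass and the rescaling multiplies by at most
    \<open>1 + d\<close>, so the new plate sum lies below \<open>1 + d\<close> times the old one and
    \<open>\<kappa> \<ge> 0\<close> compares the energies.\<close>
  have plate_sum_up: "plate_sum J \<nu> \<in> Ep" "form (plate_sum J \<nu>) (plate_sum J \<nu>) \<le> (1 + d)\<^sup>2 * form (plate_sum J \<mu>) (plate_sum J \<mu>)"
    if J: "J \<subseteq> I" and EJ: "plate_sum J \<mu> \<in> Ep" for J
  proof -
    let ?R = "radon_comb (1 + d) (plate_sum J \<mu>) 0 zero_measure"
    have R: "?R \<in> Ep" using d by (intro Ep_comb EJ zero_Ep) auto
    have le: "measure_le (plate_sum J \<nu>) ?R"
      unfolding measure_le_def
    proof (intro ballI impI)
      fix \<phi> :: "'a \<Rightarrow> real" assume phi: "\<phi> \<in> cc_functions" "\<forall>x. 0 \<le> \<phi> x"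
      note pa = plate_sum_apply[OF _ J phi(1) finite_meets[OF phi(1)] subset_refl]
      have "plate_sum J \<nu> \<phi> \<le> (\<Sum>i\<in>J \<inter> meets \<phi>. (1 + d) * \<mu> i \<phi>)"
        unfolding pa[OF nucm]
      proof (rule sum_mono)
        fix i assume "i \<in> J \<inter> meets \<phi>"
        then have i: "i \<in> I" using J by auto
        have "\<xi> i x * \<phi> x \<le> \<phi> x" for x using mult_right_mono[OF xi(3)[OF i], of "\<phi> x"] phi(2) by simp
        then have "\<mu> i (\<lambda>x. \<xi> i x * \<phi> x) \<le> \<mu> i \<phi>" by (rule pm_mono[OF cm_pm[OF cm i] xmu[OF i phi(1)] phi(1)])
        moreover have "0 \<le> \<mu> i (\<lambda>x. \<xi> i x * \<phi> x)"
          by (rule pm_nonneg[OF cm_pm[OF cm i] xmu[OF i phi(1)]]) (simp add: xi(2)[OF i] phi(2))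
        ultimately have "c i * \<mu> i (\<lambda>x. \<xi> i x * \<phi> x) \<le> (1 + d) * \<mu> i \<phi>"
          using c[OF i] d by (intro mult_mono) auto
        then show "\<nu> i \<phi> \<le> (1 + d) * \<mu> i \<phi>" using nu_apply[OF i phi(1)] by simp
      qed
      also have "\<dots> = ?R \<phi>" using phi(1) pa[OF cm] by (simp add: sum_distrib_left)
      finally show "plate_sum J \<nu> \<phi> \<le> ?R \<phi>" .
    qed
    note pm = plate_sum_pm[OF nucm J]
    show "plate_sum J \<nu> \<in> Ep" by (rule Ep_le[OF R pm le])
    show "form (plate_sum J \<nu>) (plate_sum J \<nu>) \<le> (1 + d)\<^sup>2 * form (plate_sum J \<mu>) (plate_sum J \<mu>)"
      using form_mono[OF nn R pm le] form_comb_square[OF EJ zero_Ep, of "1 + d" 0] d by simp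
  qed
  \<comment> \<open>On \<open>Q\<close> all cutoffs equal 1 and all factors are at least 1, so there
    the new measures dominate the old ones.\<close>
  have plate_sum_low: "plate_sum J \<mu> f \<le> plate_sum J \<nu> f"
    if J: "J \<subseteq> I" and f: "f \<in> cc_functions" "\<And>x. 0 \<le> f x" "\<And>x. x \<notin> Q \<Longrightarrow> f x = 0" for J f
  proof -
    note pa = plate_sum_apply[OF _ J f(1) finite_meets[OF f(1)] subset_refl]
    show ?thesis
      unfolding pa[OF nucm] pa[OF cm]
    proof (rule sum_mono)
      fix i assume "i \<in> J \<inter> meets f"
      then have i: "i \<in> I" using J by auto
      have "\<xi> i x * f x = f x" for x using xi(4)[OF i] f(3)[of x] by (cases "x \<in> Q") simp_all
      then have "(\<lambda>x. \<xi> i x * f x) = f" by (rule ext)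
      then have "\<nu> i f = c i * \<mu> i f" using nu_apply[OF i f(1)] by simp
      moreover have "1 * \<mu> i f \<le> c i * \<mu> i f" using c(1)[OF i] pm_nonneg[OF cm_pm[OF cm i] f(1,2)] by (rule mult_right_mono)
      ultimately show "\<mu> i f \<le> \<nu> i f" by simp
    qed
  qed
  \<comment> \<open>Mixed energies enter \<open>nrm\<close> with a minus sign and therefore need
    lower bounds. As \<open>\<phi>\<close> is 0 off \<open>Q \<times> Q\<close>, the inner and then
    the outer plate sum may be replaced by the larger new one.\<close>
  have mutual_low: "real_of_ereal (mutual (plate_sum J \<mu>) (plate_sum L \<mu>)) - \<epsilon> / 4 \<le> real_of_ereal (mutual (plate_sum J \<nu>) (plate_sum L \<nu>))"
    if JL: "J \<subseteq> I" "L \<subseteq> I" and EJ: "plate_sum J \<nu> \<in> Ep" "plate_sum L \<nu> \<in> Ep"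
      and p: "\<phi> \<in> cc_functions" "\<forall>z. 0 \<le> \<phi> z" "\<forall>z. ereal (\<phi> z) \<le> \<kappa> z"
      "real_of_ereal (mutual (plate_sum J \<mu>) (plate_sum L \<mu>)) - \<epsilon> / 4 \<le> tensor_measure (plate_sum J \<mu>) (plate_sum L \<mu>) \<phi>"
      "\<And>x y. x \<notin> Q \<or> y \<notin> Q \<Longrightarrow> \<phi> (x, y) = 0" for J L \<phi>
  proof -
    note pmu = plate_sum_pm[OF cm JL(1)] plate_sum_pm[OF cm JL(2)] and pnu = plate_sum_pm[OF nucm JL(1)] plate_sum_pm[OF nucm JL(2)]
    note sl = tensor_slice_cc[OF p(1)] and inn = tensor_inner_cc[OF lc p(1)]
    have "plate_sum L \<mu> (\<lambda>y. \<phi> (x, y)) \<le> plate_sum L \<nu> (\<lambda>y. \<phi> (x, y))" for x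
      by (rule plate_sum_low[OF JL(2) sl]) (use p(2,5) in auto)
    then have "plate_sum J \<mu> (\<lambda>x. plate_sum L \<mu> (\<lambda>y. \<phi> (x, y))) \<le> plate_sum J \<mu> (\<lambda>x. plate_sum L \<nu> (\<lambda>y. \<phi> (x, y)))"
      by (rule pm_mono[OF pmu(1) inn[OF pmu(2)] inn[OF pnu(2)]])
    also have "\<dots> \<le> plate_sum J \<nu> (\<lambda>x. plate_sum L \<nu> (\<lambda>y. \<phi> (x, y)))"
    proof (rule plate_sum_low[OF JL(1) inn[OF pnu(2)]])
      show "0 \<le> plate_sum L \<nu> (\<lambda>y. \<phi> (x, y))" for x by (rule pm_nonneg[OF pnu(2) sl]) (use p(2) in simp)
      show "plate_sum L \<nu> (\<lambda>y. \<phi> (x, y)) = 0" if "x \<notin> Q" for x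
        using p(5) that rm_zero[OF pm_rm[OF pnu(2)]] by simp
    qed
    finally have "tensor_measure (plate_sum J \<mu>) (plate_sum L \<mu>) \<phi> \<le> tensor_measure (plate_sum J \<nu>) (plate_sum L \<nu>) \<phi>"
      using p(1) by (simp add: tensor_apply)
    moreover have "ereal (tensor_measure (plate_sum J \<nu>) (plate_sum L \<nu>) \<phi>) \<le> mutual (plate_sum J \<nu>) (plate_sum L \<nu>)"
      unfolding mutual_def by (rule positive_integral_gt(1)[OF p(1) p(3)[rule_format]])
    then have "tensor_measure (plate_sum J \<nu>) (plate_sum L \<nu>) \<phi> \<le> real_of_ereal (mutual (plate_sum J \<nu>) (plate_sum L \<nu>))"
      using mutual_real[OF EJ] by (metis ereal_less_eq(3))
    ultimately show ?thesis using p(4) by linarith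
  qed
  have EN: "plate_sum Ip \<nu> \<in> Ep" "plate_sum In \<nu> \<in> Ep" using plate_sum_up(1) E by auto
  have "positive_integral (\<nu> i) (\<lambda>x. ereal (g i x)) = ereal (a i)" if i: "i \<in> I" for i
  proof -
    have "positive_integral (\<nu> i) (\<lambda>x. ereal (g i x)) = ereal (c i) * positive_integral (radon_density (\<xi> i) (\<mu> i)) (\<lambda>x. ereal (g i x))
        + ereal 0 * positive_integral (zero_measure :: 'a functional) (\<lambda>x. ereal (g i x))"
      using i c(1)[OF i] g0[OF i]
      by (simp only: \<nu>_def restrict_apply' if_True, intro positive_integral_comb[OF pm_on_pm[OF dens[OF i]] zero_measure_pm _ _ cc_zero])
        (auto intro: less_imp_le)
    also have "\<dots> = ereal (c i * m i)"
      using positive_integral_radon_density[OF lc cm_pm[OF cm i] xi(1)[OF i] xi(2)[OF i] gc[OF i] less_imp_le[OF g0[OF i]]]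
      by (simp add: m_def zero_ereal_def[symmetric])
    also have "c i * m i = a i" using m(1)[OF i] by (simp add: c_def)
    finally show ?thesis .
  qed
  then have nuadm: "\<nu> \<in> admissible_measures \<kappa> Ip In K a g" using nuK EN by (simp add: K.adm_iff)
  have low1: "real_of_ereal (mutual ?s ?t) - \<epsilon> / 4 \<le> real_of_ereal (mutual (plate_sum Ip \<nu>) (plate_sum In \<nu>))"
    by (rule mutual_low[OF _ _ EN p1]) (use outQ in auto)
  have low2: "real_of_ereal (mutual ?t ?s) - \<epsilon> / 4 \<le> real_of_ereal (mutual (plate_sum In \<nu>) (plate_sum Ip \<nu>))"
    by (rule mutual_low[OF _ _ EN(2,1) p2]) (use outQ in auto)
  have form2: "2 * form \<sigma> \<tau> = real_of_ereal (mutual \<sigma> \<tau>) + real_of_ereal (mutual \<tau> \<sigma>)" for \<sigma> \<tau>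
    by (simp add: form_def)
  have "2 * form ?s ?t - \<epsilon> / 2 \<le> 2 * form (plate_sum Ip \<nu>) (plate_sum In \<nu>)"
    unfolding form2 using add_mono[OF low1 low2] by simp
  moreover have "form (plate_sum Ip \<nu>) (plate_sum Ip \<nu>) + form (plate_sum In \<nu>) (plate_sum In \<nu>) \<le> (1 + d)\<^sup>2 * S"
    using plate_sum_up(2)[OF Un_upper1 E(1)] plate_sum_up(2)[OF Un_upper2 E(2)] by (simp add: S_def distrib_left)
  ultimately have "nrm \<nu> \<le> nrm \<mu> + \<epsilon>"
    using dS K.nrm_eq[OF nuadm] nrm_eq[OF mu] by (simp add: qdist_def S_def)
  moreover have "K \<in> CS" using ccK KA nuadm by (auto simp: CS_iff) (simp add: K_def)
  ultimately show ?thesis using nuadm by blast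
qed

text \<open>On a compact space the plates are compact already, and the condenser itself, restricted
  to its index set, is a member of the family; cutting off is reserved for the noncompact case with
  \<open>\<kappa> \<ge> 0\<close>.\<close>

lemma approximation:
  assumes mu: "\<mu> \<in> adm" and e: "0 < \<epsilon>"
  shows "\<exists>K\<in>CS. \<exists>\<nu>\<in>admissible_measures \<kappa> Ip In K a g. nrm \<nu> \<le> nrm \<mu> + \<epsilon>"
proof (cases "compact (UNIV :: 'a set)")
  case True
  let ?K = "restrict A I"
  have "compact (A i)" if "i \<in> I" for i
    using compact_Int_closed[OF True closed_plate[OF that]] by simp
  then have "compact_condenser Ip In ?K"
    using cond by (simp add: compact_condenser_def condenser_def cong: conj_cong)
  moreover have "condenser_measures Ip In ?K = cm" unfolding condenser_measures_def by (intro PiE_cong) simp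
  then have "admissible_measures \<kappa> Ip In ?K a g = adm"
    by (simp add: admissible_measures_def condenser_finite_energy_def)
  moreover have "subcondenser Ip In ?K A" by (simp add: subcondenser_def)
  ultimately have "?K \<in> CS" "\<mu> \<in> admissible_measures \<kappa> Ip In ?K a g" using mu by (auto simp: CS_iff)
  then show ?thesis using e by (intro bexI[of _ ?K] bexI[of _ \<mu>]) auto
qed (rule approximation_noncompact[OF _ mu e])

text \<open>Uniting two compact condensers plate by plate keeps all plates inside those of
  \<open>A\<close>, and positive capacity persists because the measures admissible for
  \<open>K\<close> remain admissible.\<close>

lemma CS_directed:
  assumes ne: "adm \<noteq> {}"
  shows "directed_upwards CS (subcondenser Ip In)"
  unfolding directed_upwards_def
proof (intro conjI ballI)
  show "CS \<noteq> {}" using ne approximation[of _ 1] by fastforce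
  fix K L assume KL: "K \<in> CS" "L \<in> CS"
  let ?M = "\<lambda>i\<in>I. K i \<union> L i"
  have k: "compact_condenser Ip In K" "subcondenser Ip In K A" "admissible_measures \<kappa> Ip In K a g \<noteq> {}"
    and l: "compact_condenser Ip In L" "subcondenser Ip In L A" using KL by (auto simp: CS_iff)
  have sub: "subcondenser Ip In K ?M" "subcondenser Ip In L ?M" "subcondenser Ip In ?M A"
    using k(2) l(2) by (auto simp: subcondenser_def)
  have MA: "?M i \<subseteq> A i" if "i \<in> I" for i using sub(3) that unfolding subcondenser_def by blast
  have "condenser Ip In ?M"
    unfolding condenser_def
  proof (intro conjI ballI allI impI)
    show "Ip \<noteq> {}" "Ip \<inter> In = {}" using cond by (simp_all add: condenser_def)
    show "closed (?M i)" "?M i \<noteq> {}" if "i \<in> I" for i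
      using that k(1) l(1) by (auto simp: compact_condenser_def condenser_def intro!: closed_Un)
    show "finite {i \<in> I. ?M i \<inter> C \<noteq> {}}" if "compact C" for C
    proof (rule finite_subset)
      show "finite {i \<in> I. A i \<inter> C \<noteq> {}}" using cond that by (simp add: condenser_def)
      show "{i \<in> I. ?M i \<inter> C \<noteq> {}} \<subseteq> {i \<in> I. A i \<inter> C \<noteq> {}}" using MA by blast
    qed
    show "?M i \<inter> ?M j = {}" if "i \<in> Ip" "j \<in> In" for i j
      using MA[of i] MA[of j] plates_disjoint[OF that] that by blast
  qed
  then have "compact_condenser Ip In ?M" using k(1) l(1) by (auto simp: compact_condenser_def intro!: compact_Un)
  moreover have "admissible_measures \<kappa> Ip In K a g \<subseteq> admissible_measures \<kappa> Ip In ?M a g"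
    by (rule admissible_measures_mono[OF sub(1)])
  then have "admissible_measures \<kappa> Ip In ?M a g \<noteq> {}" using k(3) by blast
  ultimately have "?M \<in> CS" using sub(3) unfolding CS_iff by simp
  then show "\<exists>M\<in>CS. subcondenser Ip In K M \<and> subcondenser Ip In L M" using sub(1,2) by blast
qed

lemma CS_minimizers_ne: "K \<in> CS \<Longrightarrow> minimizers \<kappa> Ip In K a g \<noteq> {}"
  using condenser_problem.ex_minimizer[OF sub_problem] by (auto simp: CS_iff)

section \<open>The net of minimizers on compact condensers\<close>

context
  fixes \<Lambda>
  assumes ne: "adm \<noteq> {}" and Lam: "\<And>K. K \<in> CS \<Longrightarrow> \<Lambda> K \<in> minimizers \<kappa> Ip In K a g"
begin

lemma tails_nonbot: "tails_filter CS (subcondenser Ip In) \<noteq> bot"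
  by (rule tails_filter_nonbot[OF CS_directed[OF ne] transp_subcondenser])

lemma eventually_adm: "eventually (\<lambda>K. \<Lambda> K \<in> adm) (tails_filter CS (subcondenser Ip In))"
proof -
  have "\<Lambda> K \<in> adm" if K: "K \<in> CS" for K
    using Lam[OF K] admissible_measures_mono[of Ip In K A \<kappa> a g] K by (auto simp: CS_iff minimizers_def)
  moreover have "CS \<noteq> {}" using CS_directed[OF ne] by (simp add: directed_upwards_def)
  ultimately show ?thesis unfolding eventually_tails_filter[OF CS_directed[OF ne] transp_subcondenser] by blast
qed

text \<open>A nearly minimal measure can be moved to some compact \<open>K0\<close>. It stays
  admissible for every larger \<open>K\<close>, so it bounds the minimal energy of \<open>K\<close>,
  which \<open>\<Lambda> K\<close> attains.\<close>

lemma eventually_near: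
  assumes e: "0 < \<epsilon>"
  shows "eventually (\<lambda>K. nrm (\<Lambda> K) \<le> w + \<epsilon>) (tails_filter CS (subcondenser Ip In))"
proof -
  obtain \<mu> where mu: "\<mu> \<in> adm" "nrm \<mu> < w + \<epsilon> / 2" by (rule near_w[OF ne, of "\<epsilon> / 2"]) (use e in auto)
  obtain K0 \<nu> where K0: "K0 \<in> CS" "\<nu> \<in> admissible_measures \<kappa> Ip In K0 a g" "nrm \<nu> \<le> nrm \<mu> + \<epsilon> / 2"
    using approximation[OF mu(1), of "\<epsilon> / 2"] e by auto
  have "nrm (\<Lambda> K) \<le> w + \<epsilon>" if K: "K \<in> CS" "subcondenser Ip In K0 K" for K
  proof -
    interpret K: condenser_problem \<kappa> Ip In K a g by (rule sub_problem) (use K(1) in \<open>auto simp: CS_iff\<close>)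
    have "\<nu> \<in> admissible_measures \<kappa> Ip In K a g" using admissible_measures_mono[OF K(2)] K0(2) by blast
    then have "K.w \<le> nrm \<nu>" by (rule K.w_le)
    moreover have "nrm (\<Lambda> K) = K.w" using Lam[OF K(1)] by (simp add: K.minimizers_iff)
    ultimately show ?thesis using K0(3) mu(2) by linarith
  qed
  then show ?thesis
    unfolding eventually_tails_filter[OF CS_directed[OF ne] transp_subcondenser] using K0(1) by blast
qed

lemma minimizer_net_converges:
  assumes lam: "lam \<in> minimizers \<kappa> Ip In A a g"
  shows "((\<lambda>K. (condenser_dist \<kappa> Ip In (\<Lambda> K) lam)\<^sup>2) \<longlongrightarrow> 0) (tails_filter CS (subcondenser Ip In))"
proof (rule tendstoI)
  fix e :: real assume "0 < e"
  \<comment> \<open>\<open>dist_le\<close> doubles the excess over \<open>w\<close>, so the squared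
    distance is at most \<open>e / 2 < e\<close>.\<close>
  then have "0 < e / 4" by simp
  from eventually_near[OF this] eventually_adm
  show "eventually (\<lambda>K. dist ((condenser_dist \<kappa> Ip In (\<Lambda> K) lam)\<^sup>2) 0 < e) (tails_filter CS (subcondenser Ip In))"
  proof eventually_elim
    case (elim K)
    then show ?case using dist_le[OF elim(2) lam] \<open>0 < e\<close> by (simp add: dist_real_def)
  qed
qed

end

end

theorem theorem5p2:
  fixes \<kappa> :: "('a::t2_space) kernel"
    and Ip In :: "nat set"
    and A :: "nat \<Rightarrow> 'a set"
    and a :: "nat \<Rightarrow> real"
    and g :: "nat \<Rightarrow> 'a \<Rightarrow> real"
  assumes "locally_compact_space (euclidean :: 'a topology)"
    and "consistent_kernel \<kappa>"
    and "condenser Ip In A"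
    and "\<And>i. i \<in> Ip \<union> In \<Longrightarrow> continuous_on UNIV (g i) \<and> (\<forall>x. 0 < g i x)"
    and "\<And>i. i \<in> Ip \<union> In \<Longrightarrow> 0 < a i"
    and "0 < condenser_capacity \<kappa> Ip In A a g"
    and "In = {} \<or>
         ((\<Sum>\<^sub>\<infinity>i\<in>Ip \<union> In. ereal (a i) * (1 / (INF x\<in>A i. ereal (g i x)))) < \<infinity> \<and>
          (SUP p\<in>(\<Union>i\<in>Ip. A i) \<times> (\<Union>j\<in>In. A j). \<kappa> p) < \<infinity>)"
    and "\<And>i. i \<in> Ip \<union> In \<Longrightarrow>
           (SUP x\<in>A i. ereal (g i x)) < \<infinity> \<or>
           (\<exists>r>1. \<exists>\<omega>\<in>finite_energy \<kappa>. nearly_everywhere \<kappa> (A i)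
              (\<lambda>x. potential_defined \<kappa> x \<omega> \<and> ereal (g i x powr r) \<le> potential \<kappa> x \<omega>))"
    and "\<And>i. i \<in> Ip \<union> In \<Longrightarrow> compact (A i) \<or> interior_capacity \<kappa> (A i) < \<infinity>"
  shows "directed_upwards (compact_subcondensers \<kappa> Ip In A a g) (subcondenser Ip In) \<and>
    (\<forall>K\<in>compact_subcondensers \<kappa> Ip In A a g. minimizers \<kappa> Ip In K a g \<noteq> {}) \<and>
    (\<forall>\<Lambda>. (\<forall>K\<in>compact_subcondensers \<kappa> Ip In A a g. \<Lambda> K \<in> minimizers \<kappa> Ip In K a g) \<longrightarrow>
       (\<exists>\<mu>. cluster_point (condenser_vague_topology Ip In A) \<Lambda>
              (tails_filter (compact_subcondensers \<kappa> Ip In A a g) (subcondenser Ip In)) \<mu>) \<and>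
       (\<forall>\<mu>. cluster_point (condenser_vague_topology Ip In A) \<Lambda>
              (tails_filter (compact_subcondensers \<kappa> Ip In A a g) (subcondenser Ip In)) \<mu> \<longrightarrow>
            \<mu> \<in> minimizers \<kappa> Ip In A a g) \<and>
       (\<forall>lam\<in>minimizers \<kappa> Ip In A a g.
          ((\<lambda>K. (condenser_dist \<kappa> Ip In (\<Lambda> K) lam)\<^sup>2) \<longlongrightarrow> 0)
            (tails_filter (compact_subcondensers \<kappa> Ip In A a g) (subcondenser Ip In))))"
proof -
  interpret condenser_problem \<kappa> Ip In A a g
    by unfold_locales (use assms in \<open>auto simp: consistent_kernel_def\<close>)
  have ne: "adm \<noteq> {}" using assms(6) capacity_pos_iff by simp
  have net: "(\<exists>\<mu>. cluster_point (condenser_vague_topology Ip In A) \<Lambda> (tails_filter CS (subcondenser Ip In)) \<mu>) \<and>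
      (\<forall>\<mu>. cluster_point (condenser_vague_topology Ip In A) \<Lambda> (tails_filter CS (subcondenser Ip In)) \<mu> \<longrightarrow>
         \<mu> \<in> minimizers \<kappa> Ip In A a g) \<and>
      (\<forall>lam\<in>minimizers \<kappa> Ip In A a g.
         ((\<lambda>K. (condenser_dist \<kappa> Ip In (\<Lambda> K) lam)\<^sup>2) \<longlongrightarrow> 0) (tails_filter CS (subcondenser Ip In)))"
    if Lam: "\<And>K. K \<in> CS \<Longrightarrow> \<Lambda> K \<in> minimizers \<kappa> Ip In K a g" for \<Lambda>
  proof (intro conjI allI impI ballI)
    show "\<exists>\<mu>. cluster_point (condenser_vague_topology Ip In A) \<Lambda> (tails_filter CS (subcondenser Ip In)) \<mu>"
      using ex_cluster_point[OF tails_nonbot[OF ne Lam] eventually_adm[OF ne Lam]] by blast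
    show "\<mu> \<in> minimizers \<kappa> Ip In A a g"
      if "cluster_point (condenser_vague_topology Ip In A) \<Lambda> (tails_filter CS (subcondenser Ip In)) \<mu>" for \<mu>
      by (rule cluster_minimizer[OF tails_nonbot[OF ne Lam] eventually_adm[OF ne Lam] eventually_near[OF ne Lam] that])
    show "((\<lambda>K. (condenser_dist \<kappa> Ip In (\<Lambda> K) lam)\<^sup>2) \<longlongrightarrow> 0) (tails_filter CS (subcondenser Ip In))"
      if "lam \<in> minimizers \<kappa> Ip In A a g" for lam
      by (rule minimizer_net_converges[OF ne Lam that])
  qed
  show ?thesis using CS_directed[OF ne] CS_minimizers_ne net by blast
qed

end
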